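(* Let $1<m<n$ be integers, let $\Omega\subset\mathbb{C}^n$ be a smoothly bounded strongly $m$-pseudoconvex domain and let $\phi\in Lip_{2\alpha}(\bar\Omega)$, $0<\alpha\le\frac12$. Then the upper envelope $$h_m(z)=\sup\{v(z): v\in SH_m(\Omega)\cap C(\bar\Omega),\ v|_{\partial\Omega}\le\phi\}$$ is $m$-subharmonic in $\Omega$, and it belongs to $Lip_\alpha(\bar\Omega)$.
   Context: Notation: $d=\partial+\bar\partial$, $d^c=i(\bar\partial-\partial)$, $\beta=dd^c\|z\|^2$ is the standard Kähler form on $\mathbb{C}^n$. $m$-subharmonic functions: a function $u\in C^2(\Omega)$ is $m$-subharmonic ($m$-sh) if $(dd^cu)^k\wedge\beta^{n-k}\ge0$ at every point of $\Omega$ for $1\le k\le m$. A subharmonic function $u$ in $\Omega$ is $m$-sh if for all $C^2$-smooth $m$-sh functions $v_1,\dots,v_{m-1}$ one has $dd^cu\wedge dd^cv_1\wedge\dots\wedge dd^cv_{m-1}\wedge\beta^{n-m}\ge0$ in the weak sense of currents. $SH_m(\Omega)$ is the set of $m$-sh functions in $\Omega$. A defining function of $\Omega$ is a function $\rho$, $C^2$ in a neighborhood of $\bar\Omega$, with $\rho<0$ on $\Omega$, $\rho=0$ and $d\rho\ne0$ on $\partial\Omega$. $\Omega$ is strongly $m$-pseudoconvex if it has a defining function $\rho$ with $(dd^c\rho)^k\wedge\beta^{n-k}\ge\sigma\beta^n$ in $\bar\Omega$ for every $1\le k\le m$ and some $\sigma>0$. For $0<\alpha\le1$, $Lip_\alpha(\bar\Omega)=\{v\in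 C(\bar\Omega):\|v\|_\alpha<+\infty\}$, where $\|v\|_\alpha=\sup_{\bar\Omega}|v|+\sup\{|v(z)-v(w)|/|z-w|^\alpha: z\ne w,\ z,w\in\bar\Omega\}$ (for $\alpha=1$ these are the Lipschitz functions). *)

theory Defs
  imports "HOL-Analysis.Analysis" "HOL-Combinatorics.Permutations"
begin

text \<open>
  The space of \<open>n\<close> complex variables is \<^typ>\<open>complex^'n\<close> with \<open>n = CARD('n)\<close>.  Differential forms
  have complex coefficients and are alternating real-multilinear maps on tangent vectors; a
  \<open>2\<close>-form at a point is a function of two vectors, a form of degree \<open>p\<close> a function of
  the vectors \<open>v 0, \<dots>, v (p - 1)\<close>.
\<close>

subsection \<open>Functions of class \<open>C\<^sup>k\<close>\<close>

text \<open>Meant for open \<open>S\<close> in a finite-dimensional space, where continuity of all iterated directional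
  derivatives is continuity of the iterated derivatives.\<close>

primrec Ck_on :: "nat \<Rightarrow> ('a::real_normed_vector \<Rightarrow> real) \<Rightarrow> 'a set \<Rightarrow> bool" where
  "Ck_on 0 f S \<longleftrightarrow> continuous_on S f"
| "Ck_on (Suc k) f S \<longleftrightarrow>
     (\<forall>x\<in>S. f differentiable (at x)) \<and> (\<forall>v. Ck_on k (\<lambda>x. frechet_derivative f (at x) v) S)"

definition test_function :: "('a::real_normed_vector) set \<Rightarrow> ('a \<Rightarrow> real) \<Rightarrow> bool" where
  "test_function S \<theta> \<longleftrightarrow>
     (\<forall>k. Ck_on k \<theta> UNIV) \<and> compact (closure {x. \<theta> x \<noteq> 0}) \<and> closure {x. \<theta> x \<noteq> 0} \<subseteq> S"

subsection \<open>The operators \<open>\<partial>\<close>, \<open>\<partial>\<close>-bar and \<open>dd\<^sup>c\<close>\<close>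

text \<open>The complex linear and antilinear parts of the differential, \<open>\<partial>u + \<partial>\<close>-bar\<open> u = du\<close>.\<close>

definition del :: "(complex^'n \<Rightarrow> real) \<Rightarrow> complex^'n \<Rightarrow> complex^'n \<Rightarrow> complex" where
  "del u z v = (of_real (frechet_derivative u (at z) v)
                 - \<i> * of_real (frechet_derivative u (at z) (\<i> *s v))) / 2"

definition delbar :: "(complex^'n \<Rightarrow> real) \<Rightarrow> complex^'n \<Rightarrow> complex^'n \<Rightarrow> complex" where
  "delbar u z v = (of_real (frechet_derivative u (at z) v)
                    + \<i> * of_real (frechet_derivative u (at z) (\<i> *s v))) / 2"

definition dc :: "(complex^'n \<Rightarrow> real) \<Rightarrow> complex^'n \<Rightarrow> complex^'n \<Rightarrow> complex" where
  "dc u z v = \<i> * (delbar u z v - del u z v)"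

definition ext_d1 :: "('a \<Rightarrow> 'a \<Rightarrow> complex) \<Rightarrow> 'a::real_normed_vector \<Rightarrow> 'a \<Rightarrow> 'a \<Rightarrow> complex" where
  "ext_d1 \<eta> z v w = frechet_derivative (\<lambda>x. \<eta> x w) (at z) v - frechet_derivative (\<lambda>x. \<eta> x v) (at z) w"

definition ddc :: "(complex^'n \<Rightarrow> real) \<Rightarrow> complex^'n \<Rightarrow> complex^'n \<Rightarrow> complex^'n \<Rightarrow> complex" where
  "ddc u = ext_d1 (dc u)"

definition kaehler :: "complex^'n \<Rightarrow> complex^'n \<Rightarrow> complex^'n \<Rightarrow> complex" where
  "kaehler = ddc (\<lambda>z. (norm z)\<^sup>2)"

subsection \<open>Exterior products and positivity in top degree\<close>

text \<open>The exterior product of a list of \<open>k\<close> two-forms, normalised so that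
  \<open>(a \<and> b)(v, w) = a v * b w - a w * b v\<close> for one-forms: the factor is \<open>1 / (2!)\<^sup>k\<close>.\<close>

definition wedge2 :: "('a \<Rightarrow> 'a \<Rightarrow> complex) list \<Rightarrow> (nat \<Rightarrow> 'a) \<Rightarrow> complex" where
  "wedge2 \<omega>s v = (\<Sum>\<pi> | \<pi> permutes {..<2 * length \<omega>s}.
      of_int (sign \<pi>) * (\<Prod>i<length \<omega>s. (\<omega>s ! i) (v (\<pi> (2 * i))) (v (\<pi> (2 * i + 1)))))
    / 2 ^ length \<omega>s"

text \<open>The real frame \<open>e\<^sub>1, i e\<^sub>1, e\<^sub>2, i e\<^sub>2, \<dots>\<close>, for some enumeration of the index type.  Another
  enumeration gives the same orientation, since it permutes the pairs \<open>(e\<^sub>j, i e\<^sub>j)\<close>.\<close>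

definition std_frame :: "nat \<Rightarrow> complex^'n" where
  "std_frame k = axis (from_nat_into UNIV (k div 2)) (if even k then 1 else \<i>)"

text \<open>The coefficient of a form of degree \<open>2n\<close> with respect to Lebesgue measure
  \<open>dx\<^sub>1 \<and> dy\<^sub>1 \<and> \<dots> \<and> dx\<^sub>n \<and> dy\<^sub>n\<close>.\<close>

definition top_coeff :: "((nat \<Rightarrow> complex^'n) \<Rightarrow> complex) \<Rightarrow> complex" where
  "top_coeff T = T std_frame"

definition top_ge ::
    "((nat \<Rightarrow> complex^'n) \<Rightarrow> complex) \<Rightarrow> ((nat \<Rightarrow> complex^'n) \<Rightarrow> complex) \<Rightarrow> bool" where
  "top_ge T S \<longleftrightarrow> top_coeff T - top_coeff S \<in> \<real>\<^sub>\<ge>\<^sub>0"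

definition hessian_form ::
    "nat \<Rightarrow> (complex^'n \<Rightarrow> real) \<Rightarrow> complex^'n \<Rightarrow> (nat \<Rightarrow> complex^'n) \<Rightarrow> complex" where
  "hessian_form k u z = wedge2 (replicate k (ddc u z) @ replicate (CARD('n) - k) (kaehler z))"

subsection \<open>\<open>m\<close>-subharmonic functions\<close>

text \<open>Upper semicontinuous functions with values in \<open>[-\<infinity>, \<infinity>)\<close>, not identically \<open>-\<infinity>\<close> on any
  component, that satisfy the sub-mean value inequality on closed balls.  The right-hand side of
  the inequality is the integral of the positive part minus that of the negative part
  (\<^const>\<open>e2ennreal\<close> truncates at \<open>0\<close>), and the former is finite by semicontinuity.\<close>

definition subharmonic_on :: "'a::euclidean_space set \<Rightarrow> ('a \<Rightarrow> ereal) \<Rightarrow> bool" where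
  "subharmonic_on S u \<longleftrightarrow>
     (\<forall>x\<in>S. u x \<noteq> \<infinity>) \<and>
     (\<forall>C\<in>components S. \<exists>x\<in>C. u x \<noteq> -\<infinity>) \<and>
     (\<forall>x\<in>S. \<forall>c>u x. \<forall>\<^sub>F y in at x within S. u y < c) \<and>
     (\<forall>a r. 0 < r \<and> cball a r \<subseteq> S \<longrightarrow>
        u a * ereal (measure lborel (cball a r))
          \<le> enn2ereal (\<integral>\<^sup>+x\<in>cball a r. e2ennreal (u x) \<partial>lborel)
            - enn2ereal (\<integral>\<^sup>+x\<in>cball a r. e2ennreal (- u x) \<partial>lborel))"

definition C2_msh :: "nat \<Rightarrow> (complex^'n) set \<Rightarrow> (complex^'n \<Rightarrow> real) \<Rightarrow> bool" where
  "C2_msh m S u \<longleftrightarrow>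
     Ck_on 2 u S \<and> (\<forall>k\<in>{1..m}. \<forall>z\<in>S. top_ge (hessian_form k u z) (\<lambda>_. 0))"

text \<open>For \<open>v\<^sub>1, \<dots>, v\<^sub>k\<close> of class \<open>C\<^sup>2\<close> the form \<open>T = dd\<^sup>c v\<^sub>1 \<and> \<dots> \<and> dd\<^sup>c v\<^sub>k \<and> \<beta>\<^sup>n\<^sup>-\<^sup>k\<^sup>-\<^sup>1\<close> is continuous and closed
  as a current, and \<open>dd\<^sup>c u \<and> T\<close> denotes the current \<open>dd\<^sup>c(u T)\<close>, which acts on a test function \<open>\<theta>\<close> as
  the integral of \<open>u dd\<^sup>c \<theta> \<and> T\<close>.  A subharmonic \<open>u\<close> is locally integrable, so the integral exists.\<close>

definition weakly_positive ::
    "(complex^'n) set \<Rightarrow> (complex^'n \<Rightarrow> ereal) \<Rightarrow> (complex^'n \<Rightarrow> real) list \<Rightarrow> bool" where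
  "weakly_positive S u vs \<longleftrightarrow>
     (\<forall>\<theta>. test_function S \<theta> \<and> (\<forall>z. 0 \<le> \<theta> z) \<longrightarrow>
        (LINT z:S|lborel. real_of_ereal (u z) *\<^sub>R
           top_coeff (wedge2 (ddc \<theta> z # map (\<lambda>v. ddc v z) vs
                               @ replicate (CARD('n) - Suc (length vs)) (kaehler z))))
          \<in> \<real>\<^sub>\<ge>\<^sub>0)"

definition SH :: "nat \<Rightarrow> (complex^'n) set \<Rightarrow> (complex^'n \<Rightarrow> ereal) set" where
  "SH m S = {u. subharmonic_on S u \<and>
     (\<forall>vs. length vs = m - 1 \<and> (\<forall>v\<in>set vs. C2_msh m S v) \<longrightarrow> weakly_positive S u vs)}"

subsection \<open>Strongly \<open>m\<close>-pseudoconvex domains\<close>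

definition defining_function :: "(complex^'n) set \<Rightarrow> (complex^'n \<Rightarrow> real) \<Rightarrow> bool" where
  "defining_function S \<rho> \<longleftrightarrow>
     (\<exists>U. open U \<and> closure S \<subseteq> U \<and> Ck_on 2 \<rho> U) \<and>
     (\<forall>z\<in>S. \<rho> z < 0) \<and>
     (\<forall>z\<in>frontier S. \<rho> z = 0 \<and> frechet_derivative \<rho> (at z) \<noteq> (\<lambda>_. 0))"

definition strongly_m_pseudoconvex :: "nat \<Rightarrow> (complex^'n) set \<Rightarrow> bool" where
  "strongly_m_pseudoconvex m S \<longleftrightarrow>
     (\<exists>\<rho> \<sigma>. defining_function S \<rho> \<and> \<sigma> > 0 \<and>
        (\<forall>k\<in>{1..m}. \<forall>z\<in>closure S.
           top_ge (hessian_form k \<rho> z)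
                  (\<lambda>v. of_real \<sigma> * wedge2 (replicate CARD('n) (kaehler z)) v)))"

subsection \<open>Hoelder classes and the upper envelope\<close>

definition lip_norm :: "real \<Rightarrow> 'a::real_normed_vector set \<Rightarrow> ('a \<Rightarrow> real) \<Rightarrow> ennreal" where
  "lip_norm \<alpha> S v =
     (SUP z\<in>S. ennreal \<bar>v z\<bar>) +
     (SUP (z, w)\<in>{(z, w). z \<in> S \<and> w \<in> S \<and> z \<noteq> w}. ennreal (\<bar>v z - v w\<bar> / norm (z - w) powr \<alpha>))"

definition Lip :: "real \<Rightarrow> 'a::real_normed_vector set \<Rightarrow> ('a \<Rightarrow> real) set" where
  "Lip \<alpha> S = {v. continuous_on S v \<and> lip_norm \<alpha> S v < \<infinity>}"

text \<open>The supremum is taken in \<^typ>\<open>ereal\<close>, so that its finiteness is part of what has to be proved.\<close>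

definition envelope ::
    "nat \<Rightarrow> (complex^'n) set \<Rightarrow> (complex^'n \<Rightarrow> real) \<Rightarrow> complex^'n \<Rightarrow> ereal" where
  "envelope m S \<phi> z =
     (SUP v\<in>{v. (\<lambda>x. ereal (v x)) \<in> SH m S \<and> continuous_on (closure S) v
                 \<and> (\<forall>x\<in>frontier S. v x \<le> \<phi> x)}. ereal (v z))"

end

theory Submission
  imports Defs "HOL-Computational_Algebra.Fundamental_Theorem_Algebra" "Jordan_Normal_Form.Determinant"
begin

text \<open>
  The envelope is the largest member of a class of weakly \<open>m\<close>-subharmonic functions below \<open>\<phi>\<close> on the
  boundary, and the proof is the classical one: barriers give its boundary values with a rate, and
  a translation argument of Walsh carries that rate from the boundary into the interior.

  \<^bold>\<open>Barriers.\<close> Strong \<open>m\<close>-pseudoconvexity leaves room to subtract: \<open>dd\<^sup>c\<rho> - \<delta>\<beta>\<close> is still in the cone of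
  \<open>m\<close>-positive Hermitian matrices (lemma \<open>pseudoconvex_shift\<close>), so \<open>g(z) = \<rho>(z) / \<delta> - \<bar>z - \<xi>\<bar>\<^sup>2\<close> is negative and
  \<open>m\<close>-subharmonic, and so is \<open>-(-g)\<^sup>\<alpha>\<close>, because \<open>t \<mapsto> -(-t)\<^sup>\<alpha>\<close> is convex and increasing on the negative
  axis.  On the boundary it equals \<open>-\<bar>z - \<xi>\<bar>\<^sup>2\<^sup>\<alpha>\<close>, which compensates the modulus of continuity
  of \<open>\<phi>\<close>; inside it is \<open>\<alpha>\<close>-Hoelder uniformly in \<open>\<xi>\<close> (lemma \<open>barrier_family\<close>).  This loss from
  \<open>2\<alpha>\<close> to \<open>\<alpha>\<close> is the one in the theorem.

  \<^bold>\<open>Walsh's argument.\<close> Every competitor \<open>v\<close> lies below the reflected barriers, by the maximum principle.  For a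
  vector \<open>\<tau>\<close> the function \<open>max (v(z + \<tau>) - c) (V z)\<close>, extended by the
  supremum \<open>V\<close> of the lower barriers to where \<open>v(z + \<tau>)\<close> is undefined, is again a competitor as soon as
  \<open>c > C\<bar>\<tau>\<bar>\<^sup>\<alpha>\<close>.  Hence \<open>v(z + \<tau>) - c\<close> is at most the envelope at \<open>z\<close>, which is the Hoelder estimate.

  \<^bold>\<open>Weak positivity.\<close> The argument uses that the class is closed under maxima, translations, gluing and
  continuous suprema.  To have this, a continuous function is tested only against the
  constant-coefficient operators \<open>dd\<^sup>c\<theta> \<and> B\<^sub>1 \<and> \<dots> \<and> B\<^sub>m\<^sub>-\<^sub>1 \<and> \<beta>\<^sup>n\<^sup>-\<^sup>m\<close> with matrices \<open>B\<^sub>i\<close> in the cone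
  (predicate \<open>msub\<close>).  This local condition survives mollification, which makes the function smooth and
  pointwise positive (lemma \<open>smoothing\<close>), and for smooth functions all closure properties are
  computations with Hessians.  It is equivalent to the definition with arbitrary \<open>C\<^sup>2\<close>
  functions \<open>v\<^sub>i\<close> (theorems \<open>SH_msub\<close> and \<open>msub_SH\<close>): in one direction take quadratic polynomials
  \<open>v\<^sub>i\<close>; in the other, integrate by parts (theorem \<open>ibp\<close>) after smoothing and use pointwise positivity
  of mixed products.

  \<^bold>\<open>Mixed products.\<close> That \<open>B\<^sub>1 \<and> \<dots> \<and> B\<^sub>m \<and> \<beta>\<^sup>n\<^sup>-\<^sup>m \<ge> 0\<close> when each \<open>B\<^sub>i\<close> is \<open>m\<close>-positive is Garding's inequality
  for hyperbolic polynomials (theorems \<open>garding_pos\<close>, \<open>garding_nonneg\<close>, \<open>mixed_nonneg\<close>), applied to the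
  polarised determinant.  Hyperbolicity of the determinant in the direction of the identity is the
  reality of the eigenvalues of a Hermitian matrix.
\<close>

text \<open>The symbols denote components of vectors and the inner product of Euclidean spaces throughout.\<close>
no_notation Matrix.vec_index (infixl "$" 100)
no_notation Matrix.scalar_prod (infix "\<bullet>" 70)

text \<open>This rule would undo the factorisation of logarithmic derivatives into a value and a sum over roots.\<close>
lemmas [simp del] = Ring_Hom.mult_hom.hom_sum_mset

section \<open>Symmetric multilinear forms and their complexification\<close>

definition sym_form :: "nat \<Rightarrow> ('v::real_vector list \<Rightarrow> real) \<Rightarrow> bool" where
  "sym_form m P \<longleftrightarrow>
     (\<forall>a b x y zs. Suc (length zs) = m \<longrightarrow>
        P ((a *\<^sub>R x + b *\<^sub>R y) # zs) = a * P (x # zs) + b * P (y # zs)) \<and>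
     (\<forall>xs ys. length xs = m \<longrightarrow> mset xs = mset ys \<longrightarrow> P xs = P ys)"

lemma sym_form_lin:
  "sym_form m P \<Longrightarrow> Suc (length zs) = m \<Longrightarrow>
     P ((a *\<^sub>R x + b *\<^sub>R y) # zs) = a * P (x # zs) + b * P (y # zs)"
  unfolding sym_form_def by blast

lemma sym_form_perm: "sym_form m P \<Longrightarrow> length xs = m \<Longrightarrow> mset xs = mset ys \<Longrightarrow> P xs = P ys"
  unfolding sym_form_def by blast

lemma sym_form_Cons:
  assumes "sym_form (Suc m) P" shows "sym_form m (\<lambda>xs. P (b # xs))"
  unfolding sym_form_def
proof (intro conjI allI impI)
  fix c d :: real and x y :: 'a and zs :: "'a list" assume l: "Suc (length zs) = m"
  have "P (b # (c *\<^sub>R x + d *\<^sub>R y) # zs) = P ((c *\<^sub>R x + d *\<^sub>R y) # b # zs)"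
    using l by (intro sym_form_perm[OF assms]) auto
  also have "\<dots> = c * P (x # b # zs) + d * P (y # b # zs)"
    using l by (intro sym_form_lin[OF assms]) auto
  also have "P (x # b # zs) = P (b # x # zs)" using l by (intro sym_form_perm[OF assms]) auto
  also have "P (y # b # zs) = P (b # y # zs)" using l by (intro sym_form_perm[OF assms]) auto
  finally show "P (b # (c *\<^sub>R x + d *\<^sub>R y) # zs) = c * P (b # x # zs) + d * P (b # y # zs)" .
next
  fix xs ys :: "'a list" assume "length xs = m" "mset xs = mset ys"
  then show "P (b # xs) = P (b # ys)" by (intro sym_form_perm[OF assms]) auto
qed

lemma sym_form_append:
  assumes "sym_form (length bs + m) P" shows "sym_form m (\<lambda>xs. P (bs @ xs))"
  using assms
proof (induction bs arbitrary: P)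
  case (Cons b bs)
  then show ?case using Cons.IH[OF sym_form_Cons[of "length bs + m" P b]] by simp
qed simp

fun ev :: "(real \<Rightarrow> 'c::comm_ring_1) \<Rightarrow> nat \<Rightarrow> ('v list \<Rightarrow> real) \<Rightarrow> ('c \<times> 'v) list \<Rightarrow> 'c" where
  "ev h 0 P L = h (P [])"
| "ev h (Suc m) P L = (\<Sum>(c, x)\<leftarrow>L. c * ev h m (\<lambda>xs. P (x # xs)) L)"

text \<open>Ring embeddings of the reals into the scalars over which a real form is extended: the reals themselves or the
  complex numbers.\<close>
definition emb :: "(real \<Rightarrow> 'c::comm_ring_1) \<Rightarrow> bool" where
  "emb h \<longleftrightarrow> h 1 = 1 \<and> (\<forall>a b. h (a + b) = h a + h b) \<and> (\<forall>a b. h (a * b) = h a * h b)"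

lemma emb_of_real: "emb (of_real :: real \<Rightarrow> complex)" and emb_id: "emb (\<lambda>x::real. x)"
  by (auto simp: emb_def)

lemma ev_lin:
  assumes "emb h" shows
  "ev h m (\<lambda>xs. a * P xs + b * Q xs) L = h a * ev h m P L + h b * ev h m Q L"
proof (induction m arbitrary: P Q)
  case 0 then show ?case using assms by (simp add: emb_def)
next
  case (Suc m)
  have *: "(\<Sum>(c, x)\<leftarrow>K. c * ev h m (\<lambda>xs. a * P (x # xs) + b * Q (x # xs)) L)
     = h a * (\<Sum>(c, x)\<leftarrow>K. c * ev h m (\<lambda>xs. P (x # xs)) L)
       + h b * (\<Sum>(c, x)\<leftarrow>K. c * ev h m (\<lambda>xs. Q (x # xs)) L)" for K
  proof (induction K)
    case (Cons d K)
    show ?case using Cons by (cases d) (simp add: Suc algebra_simps)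
  qed simp
  show ?case using * by simp
qed

lemma ev_cong:
  assumes "\<And>xs. length xs = m \<Longrightarrow> P xs = Q xs" shows "ev h m P L = ev h m Q L"
  using assms
proof (induction m arbitrary: P Q)
  case (Suc m)
  have "ev h m (\<lambda>xs. P (x # xs)) L = ev h m (\<lambda>xs. Q (x # xs)) L" for x
    using Suc.prems by (intro Suc.IH) auto
  then show ?case by simp
qed simp

lemma ev_perm:
  assumes "mset L = mset L'" shows "ev h m P L = ev h m P L'"
proof (induction m arbitrary: P)
  case (Suc m)
  have "sum_list (map f L) = sum_list (map f L')" for f :: "_ \<Rightarrow> 'a"
    using assms by (metis mset_map sum_mset_sum_list)
  then show ?case using Suc by simp
qed simp

text \<open>Expanding only real combinations of equal directions is what symmetry and real multilinearity allow; complex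
  coefficients stay outside.\<close>
lemma ev_merge:
  assumes "emb h" "sym_form m P"
  shows "ev h m P ((c * h a, x) # (c * h b, y) # L) = ev h m P ((c, a *\<^sub>R x + b *\<^sub>R y) # L)"
  using assms(2)
proof (induction m arbitrary: P)
  case (Suc m)
  have IH: "ev h m (\<lambda>xs. P (z # xs)) ((c * h a, x) # (c * h b, y) # L)
          = ev h m (\<lambda>xs. P (z # xs)) ((c, a *\<^sub>R x + b *\<^sub>R y) # L)" for z
    by (rule Suc.IH[OF sym_form_Cons[OF Suc.prems]])
  have "ev h m (\<lambda>xs. P ((a *\<^sub>R x + b *\<^sub>R y) # xs)) K
      = ev h m (\<lambda>xs. a * P (x # xs) + b * P (y # xs)) K" for K
    by (rule ev_cong) (use sym_form_lin[OF Suc.prems] in auto)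
  then have lin: "ev h m (\<lambda>xs. P ((a *\<^sub>R x + b *\<^sub>R y) # xs)) K
      = h a * ev h m (\<lambda>xs. P (x # xs)) K + h b * ev h m (\<lambda>xs. P (y # xs)) K" for K
    using ev_lin[OF assms(1)] by simp
  show ?case by (simp add: IH lin algebra_simps)
qed simp

lemma ev_scale:
  "ev h m P (map (\<lambda>(c, x). (d * c, x)) L) = d ^ m * ev h m P L"
proof (induction m arbitrary: P)
  case (Suc m)
  have "(\<Sum>(c, x)\<leftarrow>map (\<lambda>(c, x). (d * c, x)) K. c * (d ^ m * ev h m (\<lambda>xs. P (x # xs)) L))
     = d ^ Suc m * (\<Sum>(c, x)\<leftarrow>K. c * ev h m (\<lambda>xs. P (x # xs)) L)" for K
  proof (induction K)
    case (Cons e K) then show ?case by (cases e) (simp add: algebra_simps)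
  qed simp
  then show ?case by (simp add: Suc)
qed simp

lemma ev_drop0: "ev h m P ((0, x) # L) = ev h m P L"
  by (induction m arbitrary: P) auto

lemma ev_single:
  assumes "emb h"
  shows "ev h m P [(h c, x)] = h (c ^ m * P (replicate m x))"
  using assms
proof (induction m arbitrary: P)
  case 0 then show ?case by (simp add: emb_def)
next
  case (Suc m)
  then show ?case by (simp add: emb_def flip: mult.assoc)
qed

lemma ev_cnj:
  "cnj (ev of_real m P L) = ev of_real m P (map (\<lambda>(c, x). (cnj c, x)) L)"
proof (induction m arbitrary: P)
  case (Suc m)
  have "cnj (\<Sum>(c, x)\<leftarrow>K. c * ev of_real m (\<lambda>xs. P (x # xs)) L)
    = (\<Sum>(c, x)\<leftarrow>map (\<lambda>(c, x). (cnj c, x)) K. c * ev of_real m (\<lambda>xs. P (x # xs)) (map (\<lambda>(c, x). (cnj c, x)) L))" for K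
  proof (induction K)
    case (Cons e K) then show ?case by (cases e) (simp add: Suc)
  qed simp
  then show ?case by simp
qed simp

text \<open>The binomial expansion in one distinguished direction. It turns statements about the form into statements
  about a polynomial in \<open>s\<close>.\<close>
lemma ev_head:
  assumes "emb h" "sym_form m P"
  shows "ev h m P ((s, b) # L)
     = (\<Sum>k\<le>m. of_nat (m choose k) * s ^ k * ev h (m - k) (\<lambda>xs. P (replicate k b @ xs)) L)"
  using assms(2)
proof (induction m arbitrary: P)
  case 0 then show ?case by simp
next
  case (Suc m)
  let ?g = "\<lambda>k. ev h (Suc m - k) (\<lambda>xs. P (replicate k b @ xs)) L"
  have IH: "ev h m (\<lambda>xs. P (x # xs)) ((s, b) # L)
    = (\<Sum>k\<le>m. of_nat (m choose k) * s ^ k * ev h (m - k) (\<lambda>xs. P (x # replicate k b @ xs)) L)" for x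
    by (rule Suc.IH[OF sym_form_Cons[OF Suc.prems]])
  have swap: "ev h (m - k) (\<lambda>xs. P (x # replicate k b @ xs)) L
     = ev h (m - k) (\<lambda>xs. P (replicate k b @ x # xs)) L" if "k \<le> m" for k x
    using that by (intro ev_cong sym_form_perm[OF Suc.prems]) auto
  have "ev h (Suc m) P ((s, b) # L)
     = s * (\<Sum>k\<le>m. of_nat (m choose k) * s ^ k * ?g (Suc k))
     + (\<Sum>(c, x)\<leftarrow>L. c * (\<Sum>k\<le>m. of_nat (m choose k) * s ^ k * ev h (m - k) (\<lambda>xs. P (replicate k b @ x # xs)) L))"
    by (simp add: IH swap)
  also have "(\<Sum>(c, x)\<leftarrow>K. c * (\<Sum>k\<le>m. of_nat (m choose k) * s ^ k * ev h (m - k) (\<lambda>xs. P (replicate k b @ x # xs)) L))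
      = (\<Sum>k\<le>m. of_nat (m choose k) * s ^ k * (\<Sum>(c, x)\<leftarrow>K. c * ev h (m - k) (\<lambda>xs. P (replicate k b @ x # xs)) L))" for K
  proof (induction K)
    case (Cons e K) then show ?case
      by (cases e) (simp add: sum.distrib sum_distrib_left algebra_simps)
  qed simp
  also have "(\<Sum>k\<le>m. of_nat (m choose k) * s ^ k * (\<Sum>(c, x)\<leftarrow>L. c * ev h (m - k) (\<lambda>xs. P (replicate k b @ x # xs)) L))
      = (\<Sum>k\<le>m. of_nat (m choose k) * s ^ k * ?g k)"
    by (intro sum.cong refl) (simp add: Suc_diff_le)
  also have "s * (\<Sum>k\<le>m. of_nat (m choose k) * s ^ k * ?g (Suc k))
     = (\<Sum>k\<le>m. of_nat (m choose k) * s ^ Suc k * ?g (Suc k))"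
    by (simp add: sum_distrib_left algebra_simps)
  also have "\<dots> + (\<Sum>k\<le>m. of_nat (m choose k) * s ^ k * ?g k)
     = (\<Sum>k\<le>Suc m. of_nat (Suc m choose k) * s ^ k * ?g k)"
  proof -
    have a: "(\<Sum>k\<le>m. of_nat (m choose k) * s ^ k * ?g k)
       = ?g 0 + (\<Sum>k\<le>m. of_nat (m choose Suc k) * s ^ Suc k * ?g (Suc k))"
      using sum.atMost_Suc_shift[of "\<lambda>k. of_nat (m choose k) * s ^ k * ?g k" m]
      by (simp add: binomial_eq_0)
    show ?thesis
      unfolding a sum.atMost_Suc_shift[of _ m]
      by (simp add: sum.distrib[symmetric] algebra_simps)
  qed
  finally show ?case .
qed

lemma ev_two:
  assumes "emb h" "sym_form m P"
  shows "ev h m P [(s, b), (h c, x)]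
     = (\<Sum>k\<le>m. of_nat (m choose k) * s ^ k * h (c ^ (m - k) * P (replicate k b @ replicate (m - k) x)))"
  unfolding ev_head[OF assms] ev_single[OF assms(1)] by simp

lemma sym_form_two:
  assumes "sym_form m P"
  shows "P (replicate m (c *\<^sub>R x + s *\<^sub>R b))
     = (\<Sum>k\<le>m. of_nat (m choose k) * s ^ k * c ^ (m - k) * P (replicate k b @ replicate (m - k) x))"
proof -
  have "P (replicate m (c *\<^sub>R x + s *\<^sub>R b)) = P (replicate m (s *\<^sub>R b + c *\<^sub>R x))" by (simp add: add.commute)
  also have "\<dots> = ev (\<lambda>x. x) m P [(1, s *\<^sub>R b + c *\<^sub>R x)]"
    using ev_single[OF emb_id, of m P 1 "s *\<^sub>R b + c *\<^sub>R x"] by simp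
  also have "\<dots> = ev (\<lambda>x. x) m P [(s, b), (c, x)]"
    using ev_merge[OF emb_id assms, of 1 s b c x "[]"] by simp
  finally show ?thesis using ev_two[OF emb_id assms, of s b c x] by (simp add: mult.assoc)
qed

lemma continuous_ev:
  assumes "\<And>c x. (c, x) \<in> set L \<Longrightarrow> continuous_on A c"
  shows "continuous_on A (\<lambda>t::real. ev (of_real::real\<Rightarrow>complex) m P (map (\<lambda>(c, x). (c t, x)) L))"
proof (induction m arbitrary: P)
  case 0 then show ?case by simp
next
  case (Suc m)
  have "continuous_on A (\<lambda>t. \<Sum>(c, x)\<leftarrow>map (\<lambda>(c, x). (c t, x)) K.
      c * ev (of_real::real\<Rightarrow>complex) m (\<lambda>xs. P (x # xs)) (map (\<lambda>(c, x). (c t, x)) L))"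
    if "set K \<subseteq> set L" for K
    using that
  proof (induction K)
    case (Cons e K)
    obtain c x where e: "e = (c, x)" by force
    show ?case using Cons assms[of c x] Suc[of "\<lambda>xs. P (x # xs)"] e
      by (auto intro!: continuous_intros)
  qed simp
  then show ?case by simp
qed

section \<open>Hyperbolic forms and the Garding cone\<close>

lemma norm_poly_ge:
  fixes p :: "complex poly"
  assumes "p \<noteq> 0" "\<And>x. poly p x = 0 \<Longrightarrow> \<epsilon> \<le> cmod (s - x)" "0 \<le> \<epsilon>"
  shows "cmod (lead_coeff p) * \<epsilon> ^ degree p \<le> cmod (poly p s)"
proof -
  obtain A where A: "size A = degree p" "p = Polynomial.smult (lead_coeff p) (\<Prod>x\<in>#A. [:-x, 1:])"
    using alg_closed_imp_factorization[OF assms(1)] by blast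
  have roots: "poly p x = 0" if "x \<in># A" for x
    by (subst A(2)) (use that in \<open>auto simp: poly_prod_mset prod_mset_zero_iff image_iff\<close>)
  have "\<epsilon> ^ size B \<le> cmod (\<Prod>x\<in>#B. s - x)" if "\<And>x. x \<in># B \<Longrightarrow> \<epsilon> \<le> cmod (s - x)" for B
    using that
  proof (induction B)
    case (add x B)
    then have "\<epsilon> \<le> cmod (s - x)" "\<epsilon> ^ size B \<le> cmod (\<Prod>x\<in>#B. s - x)" by auto
    then show ?case using assms(3) by (simp add: norm_mult mult_mono)
  qed simp
  from this[of A] have "\<epsilon> ^ degree p \<le> cmod (\<Prod>x\<in>#A. s - x)" using A(1) assms(2)[OF roots] by simp
  moreover have "poly p s = lead_coeff p * (\<Prod>x\<in>#A. s - x)"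
    by (subst A(2)) (simp add: poly_prod_mset image_mset.compositionality o_def)
  ultimately show ?thesis by (simp add: norm_mult mult_left_mono)
qed

text \<open>Continuity of roots: if no root of the perturbed polynomial were near \<open>s0\<close>, its value at
  \<open>s0\<close> would stay bounded below by \<open>norm_poly_ge\<close>, while it tends to \<open>0\<close>.
  The leading coefficient is constant, so no root can escape to infinity.\<close>
lemma root_near:
  fixes c :: "nat \<Rightarrow> real \<Rightarrow> complex"
  assumes cont: "\<And>k. k \<le> m \<Longrightarrow> continuous_on A (c k)"
    and lead: "\<And>t. t \<in> A \<Longrightarrow> c m t = C" "C \<noteq> 0"
    and t0: "t0 \<in> A" "(\<Sum>k\<le>m. c k t0 * s0 ^ k) = 0" and "0 < \<epsilon>"
  shows "\<exists>\<delta>>0. \<forall>t\<in>A. \<bar>t - t0\<bar> < \<delta> \<longrightarrow> (\<exists>s. cmod (s0 - s) < \<epsilon> \<and> (\<Sum>k\<le>m. c k t * s ^ k) = 0)"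
proof -
  have "continuous_on A (\<lambda>t. \<Sum>k\<le>m. c k t * s0 ^ k)"
    by (intro continuous_intros cont) auto
  moreover have "0 < cmod C * \<epsilon> ^ m" using lead \<open>0 < \<epsilon>\<close> by simp
  ultimately obtain \<delta> where d: "\<delta> > 0"
    "\<And>t. t \<in> A \<Longrightarrow> dist t t0 < \<delta> \<Longrightarrow> dist (\<Sum>k\<le>m. c k t * s0 ^ k) (\<Sum>k\<le>m. c k t0 * s0 ^ k) < cmod C * \<epsilon> ^ m"
    using t0(1) unfolding continuous_on_iff by meson
  have "\<exists>s. cmod (s0 - s) < \<epsilon> \<and> (\<Sum>k\<le>m. c k t * s ^ k) = 0" if t: "t \<in> A" "\<bar>t - t0\<bar> < \<delta>" for t
  proof (rule ccontr)
    assume *: "\<not> ?thesis"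
    define p where "p = (\<Sum>k\<le>m. monom (c k t) k)"
    have ev: "poly p s = (\<Sum>k\<le>m. c k t * s ^ k)" for s by (simp add: p_def poly_sum poly_monom)
    have cf: "coeff p j = (if j \<le> m then c j t else 0)" for j
      unfolding p_def by (simp add: coeff_sum)
    have deg: "degree p = m"
      using lead t(1) cf by (intro antisym degree_le le_degree) auto
    have "p \<noteq> 0" using cf[of m] lead t(1) by auto
    have "cmod C * \<epsilon> ^ m \<le> cmod (poly p s0)"
    proof -
      have "\<epsilon> \<le> cmod (s0 - x)" if "poly p x = 0" for x
        using * that unfolding ev by (meson not_le)
      with norm_poly_ge[OF \<open>p \<noteq> 0\<close>, of \<epsilon> s0] show ?thesis
        using \<open>0 < \<epsilon>\<close> lead t(1) by (simp add: deg cf)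
    qed
    then show False using d(2)[OF t(1)] t(2) t0(2) by (simp add: ev dist_norm)
  qed
  with d(1) show ?thesis by blast
qed

text \<open>Garding hyperbolicity of the polynomial \<open>x \<mapsto> P(x, \<dots>, x)\<close> with respect to
  \<open>e\<close>: its restriction to every line in the direction \<open>e\<close> has only real roots.\<close>
definition hyp :: "nat \<Rightarrow> ('v::real_vector list \<Rightarrow> real) \<Rightarrow> 'v \<Rightarrow> bool" where
  "hyp m P e \<longleftrightarrow> 0 < P (replicate m e) \<and>
     (\<forall>x t. ev of_real m P [(t, e), (1, x)] = (0::complex) \<longrightarrow> Im t = 0)"

text \<open>The open Garding cone, described by the signs of the coefficients of \<open>t \<mapsto> P(x + t e, \<dots>, x
  + t e)\<close>: they are all positive exactly when all roots are negative.\<close>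
definition Gam :: "nat \<Rightarrow> ('v::real_vector list \<Rightarrow> real) \<Rightarrow> 'v \<Rightarrow> 'v set" where
  "Gam m P e = {x. \<forall>k\<le>m. 0 < P (replicate k x @ replicate (m - k) e)}"

text \<open>Move \<open>s b + x\<close> to \<open>s b + \<i> e\<close> along \<open>s b + \<i> \<theta> e + (1 - \<theta>)
  x\<close>. For \<open>\<theta> > 0\<close> there is no real root \<open>s\<close>, since \<open>P\<close> is
  hyperbolic in the direction \<open>e\<close>; so by continuity of roots the existence of a root in the upper
  half plane persists from \<open>\<theta> = 0\<close> to \<open>\<theta> = 1\<close>. But the roots at
  \<open>\<theta> = 1\<close> are \<open>\<i> / \<tau>\<close> with \<open>\<tau> < 0\<close>, because
  \<open>b\<close> is in the cone. Roots in the lower half plane are excluded by conjugation.\<close>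
lemma hyp_wrt_cone:
  assumes P: "sym_form m P" and h: "hyp m P e" and b: "b \<in> Gam m P e"
  shows "hyp m P b"
proof -
  have Pb: "0 < P (replicate m b)" using b by (auto simp: Gam_def dest: spec[of _ m])
  have key: False if x: "ev of_real m P [(t, b), (1, x)] = (0::complex)" and Im: "Im t > 0" for x t
  proof -
    define R :: "real \<Rightarrow> complex \<Rightarrow> complex" where
      "R = (\<lambda>\<theta> s. ev of_real m P [(s, b), (\<i> * of_real \<theta>, e), (of_real (1 - \<theta>), x)])"
    define c :: "nat \<Rightarrow> real \<Rightarrow> complex" where
      "c k \<theta> = of_nat (m choose k) * ev of_real (m - k) (\<lambda>xs. P (replicate k b @ xs))
          [(\<i> * of_real \<theta>, e), (of_real (1 - \<theta>), x)]" for k \<theta>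
    have R_eq: "R \<theta> s = (\<Sum>k\<le>m. c k \<theta> * s ^ k)" for \<theta> s
      unfolding R_def c_def ev_head[OF emb_of_real P] by (simp add: mult_ac)
    have c_cont: "continuous_on {0..1} (c k)" for k
    proof -
      have "continuous_on {0..1} (\<lambda>\<theta>. ev of_real (m - k) (\<lambda>xs. P (replicate k b @ xs))
        (map (\<lambda>(c, x). (c \<theta>, x)) [(\<lambda>\<theta>. \<i> * of_real \<theta>, e), (\<lambda>\<theta>. of_real (1 - \<theta>), x)]))"
        by (rule continuous_ev) (auto intro!: continuous_intros)
      then show ?thesis unfolding c_def by (auto intro!: continuous_on_mult)
    qed
    have c_m: "c m \<theta> = of_real (P (replicate m b))" for \<theta> by (simp add: c_def)
    have nonreal: "R \<theta> (of_real r) \<noteq> 0" if "\<theta> > 0" for \<theta> r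
    proof
      assume "R \<theta> (of_real r) = 0"
      moreover have "R \<theta> (of_real r) = ev of_real m P [(1 * of_real r, b), (1 * of_real (1 - \<theta>), x), (\<i> * of_real \<theta>, e)]"
        unfolding R_def by (intro ev_perm) auto
      moreover have "\<dots> = ev of_real m P [(1, r *\<^sub>R b + (1 - \<theta>) *\<^sub>R x), (\<i> * of_real \<theta>, e)]"
        by (rule ev_merge[OF emb_of_real P])
      moreover have "\<dots> = ev of_real m P [(\<i> * of_real \<theta>, e), (1, r *\<^sub>R b + (1 - \<theta>) *\<^sub>R x)]"
        by (intro ev_perm) auto
      ultimately have "Im (\<i> * of_real \<theta>) = 0" using h unfolding hyp_def by metis
      then show False using that by simp
    qed
    define \<Theta> where "\<Theta> = {\<theta>\<in>{0..1}. \<exists>s. Im s > 0 \<and> R \<theta> s = 0}"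
    have zero: "0 \<in> \<Theta>"
    proof -
      have "R 0 t = ev of_real m P ((0, e) # [(t, b), (1, x)])"
        unfolding R_def by (intro ev_perm) auto
      then show ?thesis using x Im by (auto simp: \<Theta>_def ev_drop0)
    qed
    have one: "1 \<notin> \<Theta>"
    proof
      assume "1 \<in> \<Theta>"
      then obtain s where s: "Im s > 0" "R 1 s = 0" by (auto simp: \<Theta>_def)
      then have s0: "s \<noteq> 0" by auto
      have "R 1 s = ev of_real m P ((0, x) # [(s, b), (\<i>, e)])"
        unfolding R_def by (intro ev_perm) auto
      then have z: "ev of_real m P [(s, b), (\<i>, e)] = 0" using s by (simp add: ev_drop0)
      have "ev of_real m P [(\<i> / s, e), (1, b)] = ev of_real m P [(1, b), (\<i> / s, e)]"
        by (intro ev_perm) auto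
      also have "\<dots> = ev of_real m P (map (\<lambda>(c, x). (1 / s * c, x)) [(s, b), (\<i>, e)])"
        using s0 by simp
      also have "\<dots> = 0" unfolding ev_scale z by simp
      finally have z': "ev of_real m P [(\<i> / s, e), (1, b)] = 0" .
      then have "Im (\<i> / s) = 0" using h unfolding hyp_def by blast
      then obtain \<tau> where tau: "\<i> / s = of_real \<tau>" by (metis complex_eq_iff Im_complex_of_real Re_complex_of_real)
      have "\<tau> < 0"
      proof (rule ccontr)
        assume "\<not> \<tau> < 0"
        have sw: "P (replicate k e @ replicate (m - k) b) > 0" if "k \<le> m" for k
        proof -
          have "P (replicate k e @ replicate (m - k) b) = P (replicate (m - k) b @ replicate (m - (m - k)) e)"
            using that by (intro sym_form_perm[OF P]) auto
          moreover have "0 < P (replicate (m - k) b @ replicate (m - (m - k)) e)"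
            using b diff_le_self[of m k] unfolding Gam_def by blast
          ultimately show ?thesis by simp
        qed
        have "ev of_real m P [(\<i> / s, e), (1, b)]
          = of_real (\<Sum>k\<le>m. of_nat (m choose k) * \<tau> ^ k * (1 ^ (m - k) * P (replicate k e @ replicate (m - k) b)))"
          using ev_two[OF emb_of_real P, of "of_real \<tau>" e 1 b] by (simp add: tau)
        moreover have "0 < (\<Sum>k\<le>m. of_nat (m choose k) * \<tau> ^ k * (1 ^ (m - k) * P (replicate k e @ replicate (m - k) b)))"
        proof (rule sum_pos2[of _ 0])
          show "0 < real (m choose 0) * \<tau> ^ 0 * (1 ^ (m - 0) * P (replicate 0 e @ replicate (m - 0) b))"
            using sw[of 0] by simp
        qed (use sw \<open>\<not> \<tau> < 0\<close> in \<open>auto intro!: mult_nonneg_nonneg less_imp_le[OF sw]\<close>)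
        ultimately show False using z' by (simp del: of_real_sum)
      qed
      moreover have "\<i> = s * of_real \<tau>" using tau s0 by (simp add: field_simps)
      then have "Im \<i> = Im (s * of_real \<tau>)" by simp
      then have "Im s * \<tau> = 1" by simp
      ultimately show False using s(1) by (smt (verit) mult_pos_neg)
    qed
    have opn: "\<exists>\<delta>>0. \<forall>\<theta>\<in>{0..1}. \<bar>\<theta> - \<theta>0\<bar> < \<delta> \<longrightarrow> \<theta> \<in> \<Theta>" if th0: "\<theta>0 \<in> \<Theta>" for \<theta>0
    proof -
      obtain s0 where s0: "Im s0 > 0" "R \<theta>0 s0 = 0" using th0 by (auto simp: \<Theta>_def)
      have t0: "\<theta>0 \<in> {0..1}" using th0 by (auto simp: \<Theta>_def)
      obtain \<delta> where d: "\<delta> > 0" "\<forall>t\<in>{0..1}. \<bar>t - \<theta>0\<bar> < \<delta> \<longrightarrow> (\<exists>s. cmod (s0 - s) < Im s0 \<and> (\<Sum>k\<le>m. c k t * s ^ k) = 0)"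
        using root_near[of m "{0..1}" c "of_real (P (replicate m b))" \<theta>0 s0 "Im s0"] c_cont c_m t0 s0 Pb
        by (auto simp: R_eq)
      have "\<theta> \<in> \<Theta>" if th: "\<theta> \<in> {0..1}" "\<bar>\<theta> - \<theta>0\<bar> < \<delta>" for \<theta>
      proof -
        obtain s where s: "cmod (s0 - s) < Im s0" "R \<theta> s = 0" using d(2) th by (auto simp: R_eq)
        have "\<bar>Im (s0 - s)\<bar> < Im s0" using s(1) abs_Im_le_cmod[of "s0 - s"] by linarith
        then have "Im s > 0" by auto
        then show ?thesis using th s(2) by (auto simp: \<Theta>_def)
      qed
      then show ?thesis using d(1) by blast
    qed
    have cls: "closed \<Theta>"
    proof -
      obtain M where M: "\<And>\<theta> k. \<theta> \<in> {0..1} \<Longrightarrow> k \<le> m \<Longrightarrow> cmod (c k \<theta>) \<le> M"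
      proof -
        have "\<exists>M. \<forall>\<theta>\<in>{0..1}. cmod (c k \<theta>) \<le> M" for k
          using compact_continuous_image[OF c_cont compact_Icc, of k]
          by (auto dest!: compact_imp_bounded simp: bounded_iff)
        then obtain Mf where "\<And>k \<theta>. \<theta> \<in> {0..1} \<Longrightarrow> cmod (c k \<theta>) \<le> Mf k" by metis
        then have "cmod (c k \<theta>) \<le> Max (Mf ` {..m})" if "\<theta> \<in> {0..1}" "k \<le> m" for k \<theta>
          using that by (intro order_trans[OF _ Max_ge[of _ "Mf k"]]) auto
        then show ?thesis using that by blast
      qed
      define B where "B = max 1 (real m * M / P (replicate m b))"
      have bnd: "cmod s \<le> B" if th: "\<theta> \<in> {0..1}" and z: "R \<theta> s = 0" for \<theta> s
      proof (rule ccontr)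
        assume "\<not> cmod s \<le> B"
        then have s1: "cmod s > 1" and s2: "cmod s > real m * M / P (replicate m b)" by (auto simp: B_def)
        have m0: "m \<noteq> 0"
        proof
          assume "m = 0"
          then have "R \<theta> s = of_real (P [])" by (simp add: R_def)
          then show False using z Pb \<open>m = 0\<close> by simp
        qed
        have "(\<Sum>k\<le>m. c k \<theta> * s ^ k) = (\<Sum>k<m. c k \<theta> * s ^ k) + c m \<theta> * s ^ m"
          by (simp only: lessThan_Suc_atMost[symmetric] sum.lessThan_Suc)
        then have eq: "of_real (P (replicate m b)) * s ^ m = - (\<Sum>k<m. c k \<theta> * s ^ k)"
          using z c_m[of \<theta>] unfolding R_eq by (metis add.commute add_eq_0_iff)
        have "P (replicate m b) * cmod s ^ m = cmod (of_real (P (replicate m b)) * s ^ m)"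
          using Pb by (simp add: norm_mult norm_power)
        also have "\<dots> \<le> (\<Sum>k<m. cmod (c k \<theta> * s ^ k))" unfolding eq norm_minus_cancel by (rule norm_sum)
        also have "\<dots> \<le> (\<Sum>k<m. M * cmod s ^ (m - 1))"
        proof (rule sum_mono)
          fix k assume "k \<in> {..<m}"
          then have "cmod s ^ k \<le> cmod s ^ (m - 1)" using s1 by (intro power_increasing) auto
          moreover have "cmod (c k \<theta>) \<le> M" using M[OF th, of k] \<open>k \<in> {..<m}\<close> by simp
          moreover have "0 \<le> M" using \<open>cmod (c k \<theta>) \<le> M\<close> norm_ge_zero[of "c k \<theta>"] by linarith
          ultimately show "cmod (c k \<theta> * s ^ k) \<le> M * cmod s ^ (m - 1)"
            unfolding norm_mult norm_power by (intro mult_mono) auto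
        qed
        also have "\<dots> = real m * M * cmod s ^ (m - 1)" by simp
        finally have "P (replicate m b) * cmod s ^ m \<le> real m * M * cmod s ^ (m - 1)" .
        moreover have "cmod s ^ m = cmod s * cmod s ^ (m - 1)" using m0 by (cases m) auto
        moreover have "cmod s ^ (m - 1) > 0" using s1 by (intro zero_less_power) linarith
        ultimately have "(P (replicate m b) * cmod s) * cmod s ^ (m - 1) \<le> (real m * M) * cmod s ^ (m - 1)"
          by (simp add: mult.assoc)
        then have "P (replicate m b) * cmod s \<le> real m * M"
          using \<open>cmod s ^ (m - 1) > 0\<close> by (simp only: mult_le_cancel_right_pos)
        moreover have "real m * M < cmod s * P (replicate m b)"
          using s2 Pb by (simp add: pos_divide_less_eq)
        ultimately show False by (simp add: mult.commute)
      qed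
      define K where "K = {(\<theta>, s). \<theta> \<in> {0..1} \<and> s \<in> cball 0 B \<and> Im s \<ge> 0 \<and> R \<theta> s = 0}"
      have contR: "continuous_on ({0..1} \<times> cball 0 B) (\<lambda>p. R (fst p) (snd p))"
        unfolding R_eq
        by (intro continuous_intros continuous_on_compose2[OF c_cont]) auto
      have "K = (({0..1} \<times> cball 0 B) \<inter> (\<lambda>p. R (fst p) (snd p)) -` {0}) \<inter> (snd -` {s. Im s \<ge> 0})"
        unfolding K_def by auto
      moreover have "closed (({0..1} \<times> cball 0 B) \<inter> (\<lambda>p. R (fst p) (snd p)) -` {0})"
        by (rule continuous_closed_preimage[OF contR]) (auto intro: closed_Times)
      moreover have "closed ((snd :: real \<times> complex \<Rightarrow> complex) -` {s. Im s \<ge> 0})"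
        by (rule closed_vimage_snd) (auto simp: closed_halfspace_Im_ge)
      ultimately have "closed K" by (simp add: closed_Int)
      moreover have "bounded K"
        by (rule bounded_subset[of "{0..1} \<times> cball 0 B"]) (auto simp: K_def intro: bounded_Times)
      ultimately have "compact K" by (simp add: compact_eq_bounded_closed)
      then have "compact (fst ` K)" by (intro compact_continuous_image continuous_intros)
      then have "closed (insert 0 (fst ` K))" by (simp add: compact_imp_closed)
      moreover have "insert 0 (fst ` K) = \<Theta>"
      proof (intro equalityI subsetI)
        fix \<theta> assume "\<theta> \<in> insert 0 (fst ` K)"
        then show "\<theta> \<in> \<Theta>"
        proof
          assume "\<theta> \<in> fst ` K"
          then obtain s where s: "\<theta> \<in> {0..1}" "Im s \<ge> 0" "R \<theta> s = 0" by (auto simp: K_def)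
          show ?thesis
          proof (cases "\<theta> = 0")
            case False
            then have "Im s \<noteq> 0" using s nonreal[of \<theta> "Re s"] by (auto simp: complex_is_Real_iff of_real_Re)
            then show ?thesis using s by (auto simp: \<Theta>_def intro!: exI[of _ s])
          qed (use zero in simp)
        qed (use zero in simp)
      next
        fix \<theta> assume "\<theta> \<in> \<Theta>"
        then obtain s where "\<theta> \<in> {0..1}" "Im s > 0" "R \<theta> s = 0" by (auto simp: \<Theta>_def)
        then have "(\<theta>, s) \<in> K" using bnd by (auto simp: K_def)
        then show "\<theta> \<in> insert 0 (fst ` K)" by force
      qed
      ultimately show ?thesis by simp
    qed
    have ne: "\<Theta> \<noteq> {}" using zero by blast
    have bd: "bdd_above \<Theta>" by (rule bdd_aboveI[of _ 1]) (simp add: \<Theta>_def)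
    have S: "Sup \<Theta> \<in> \<Theta>" using closed_contains_Sup[OF ne bd cls] .
    then have "Sup \<Theta> < 1" using one by (metis (no_types, lifting) \<Theta>_def atLeastAtMost_iff less_eq_real_def mem_Collect_eq)
    obtain \<delta> where d: "\<delta> > 0" "\<forall>\<theta>\<in>{0..1}. \<bar>\<theta> - Sup \<Theta>\<bar> < \<delta> \<longrightarrow> \<theta> \<in> \<Theta>" using opn[OF S] by blast
    define \<theta> where "\<theta> = min 1 (Sup \<Theta> + \<delta> / 2)"
    have "Sup \<Theta> \<ge> 0" using zero bd cSup_upper by blast
    have "\<theta> \<in> \<Theta>" using d \<open>Sup \<Theta> < 1\<close> \<open>Sup \<Theta> \<ge> 0\<close> by (auto simp: \<theta>_def min_def)
    then have "\<theta> \<le> Sup \<Theta>" using bd cSup_upper by blast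
    then show False using d(1) \<open>Sup \<Theta> < 1\<close> by (auto simp: \<theta>_def min_def split: if_splits)
  qed
  show ?thesis unfolding hyp_def
  proof (intro conjI allI impI Pb)
    fix x and t :: complex assume z: "ev of_real m P [(t, b), (1, x)] = 0"
    then have z2: "ev of_real m P [(cnj t, b), (1, x)] = 0"
      using ev_cnj[of m P "[(t, b), (1, x)]"] by simp
    show "Im t = 0" using key[OF z] key[OF z2] by (cases "Im t" "0::real" rule: linorder_cases) auto
  qed
qed

section \<open>The Garding inequality\<close>

lemma coeff_prod_neg_roots:
  fixes B :: "complex multiset"
  assumes "\<And>x. x \<in># B \<Longrightarrow> \<exists>r<0. x = of_real r"
  shows "(\<forall>j\<le>size B. \<exists>c>0. coeff (\<Prod>x\<in>#B. [:-x, 1:]) j = of_real c)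
       \<and> (\<forall>j>size B. coeff (\<Prod>x\<in>#B. [:-x, 1:]) j = 0)"
  using assms
proof (induction B)
  case empty
  have "\<exists>c>0. (1::complex) = of_real c" by (rule exI[of _ 1]) auto
  then show ?case by auto
next
  case (add x B)
  define p where "p = (\<Prod>x\<in>#B. [:-x, 1:])"
  obtain r where r: "r < 0" "x = of_real r" using add.prems by auto
  have IH: "\<And>j. j \<le> size B \<Longrightarrow> \<exists>c>0. coeff p j = of_real c" "\<And>j. j > size B \<Longrightarrow> coeff p j = 0"
    using add by (auto simp: p_def)
  have cf: "coeff ([:-x, 1:] * p) j = (if j = 0 then 0 else coeff p (j - 1)) - x * coeff p j" for j
    by (cases j) auto
  have "\<exists>c>0. coeff ([:-x, 1:] * p) j = of_real c" if j: "j \<le> Suc (size B)" for j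
  proof -
    obtain u where u: "u \<ge> 0" "- (x * coeff p j) = of_real u" "j \<le> size B \<Longrightarrow> u > 0"
    proof (cases "j \<le> size B")
      case True
      then obtain c where "c > 0" "coeff p j = of_real c" using IH by auto
      then show ?thesis using r that[of "- r * c"] by (auto simp: mult_neg_pos less_imp_le)
    next
      case False
      then show ?thesis using IH(2)[of j] that[of 0] by auto
    qed
    obtain w where w: "w \<ge> 0" "(if j = 0 then 0 else coeff p (j - 1)) = of_real w" "j \<noteq> 0 \<Longrightarrow> w > 0"
    proof (cases "j = 0")
      case True then show ?thesis using that[of 0] by auto
    next
      case False
      from j have "j - 1 \<le> size B" by linarith
      then obtain c where "c > 0" "coeff p (j - 1) = of_real c" using IH(1) by blast
      then show ?thesis using False that[of c] by auto
    qed
    have "u + w > 0" using u w by (cases "j = 0") auto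
    moreover have "coeff ([:-x, 1:] * p) j = of_real (u + w)"
      unfolding cf w(2) diff_conv_add_uminus u(2) by simp
    ultimately show ?thesis by blast
  qed
  moreover have "coeff ([:-x, 1:] * p) j = 0" if "j > Suc (size B)" for j
    unfolding cf using that IH(2)[of j] IH(2)[of "j - 1"] by auto
  ultimately show ?case by (simp add: p_def)
qed

text \<open>A hyperbolic form restricted to a line is a real polynomial that splits into real linear factors; the multiset
  \<open>A\<close> collects its roots.\<close>
lemma hyp_poly:
  assumes P: "sym_form m P" and h: "hyp m P b"
  obtains p :: "complex poly" and A where
    "\<And>t. poly p t = ev of_real m P [(t, b), (1, y)]"
    "\<And>k. k \<le> m \<Longrightarrow> coeff p k = of_real (real (m choose k) * P (replicate k b @ replicate (m - k) y))"
    "\<And>k. k > m \<Longrightarrow> coeff p k = 0"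
    "size A = m" "p = Polynomial.smult (of_real (P (replicate m b))) (\<Prod>x\<in>#A. [:-x, 1:])"
    "\<And>x. x \<in># A \<Longrightarrow> poly p x = 0 \<and> x = of_real (Re x)"
proof -
  let ?c = "\<lambda>k. of_real (real (m choose k) * P (replicate k b @ replicate (m - k) y)) :: complex"
  define p where "p = (\<Sum>k\<le>m. monom (?c k) k)"
  have ev: "poly p t = ev of_real m P [(t, b), (1, y)]" for t
    using ev_two[OF emb_of_real P, of t b 1 y] by (simp add: p_def poly_sum poly_monom mult_ac)
  have cf: "coeff p j = (if j \<le> m then ?c j else 0)" for j
    unfolding p_def by (simp add: coeff_sum)
  have Pb: "P (replicate m b) > 0" using h by (simp add: hyp_def)
  have deg: "degree p = m"
    using Pb cf by (intro antisym degree_le le_degree) auto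
  have p0: "p \<noteq> 0" using cf[of m] Pb by auto
  obtain A where A: "size A = degree p" "p = Polynomial.smult (lead_coeff p) (\<Prod>x\<in>#A. [:-x, 1:])"
    using alg_closed_imp_factorization[OF p0] by blast
  have roots: "poly p x = 0" if "x \<in># A" for x
    by (subst A(2)) (use that in \<open>auto simp: poly_prod_mset prod_mset_zero_iff image_iff\<close>)
  have "x = of_real (Re x)" if "x \<in># A" for x
    using roots[OF that] h unfolding ev hyp_def by (metis complex_eq_iff Im_complex_of_real Re_complex_of_real)
  then have real: "\<And>x. x \<in># A \<Longrightarrow> poly p x = 0 \<and> x = of_real (Re x)" using roots by blast
  have lead: "lead_coeff p = of_real (P (replicate m b))" using cf[of m] deg by simp
  show ?thesis
  proof (intro that[of p A] ev)
    show "coeff p k = of_real (real (m choose k) * P (replicate k b @ replicate (m - k) y))" if "k \<le> m" for k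
      using cf[of k] that by simp
    show "p = Polynomial.smult (of_real (P (replicate m b))) (\<Prod>x\<in>#A. [:-x, 1:])" using A(2) unfolding lead .
    show "size A = m" using A(1) deg by simp
    show "coeff p k = 0" if "k > m" for k using cf[of k] that by simp
  qed (use real in auto)
qed

text \<open>If all coefficients are nonnegative the roots are at most \<open>0\<close>, and a nonzero constant term
  excludes the root \<open>0\<close>.\<close>
lemma Gam_of_nonneg:
  assumes P: "sym_form m P" and h: "hyp m P b"
    and nn: "\<And>k. k \<le> m \<Longrightarrow> 0 \<le> P (replicate k y @ replicate (m - k) b)" and ny: "P (replicate m y) \<noteq> 0"
  shows "y \<in> Gam m P b"
proof -
  obtain p A where p: "\<And>t. poly p t = ev of_real m P [(t, b), (1, y)]"
    "\<And>k. k \<le> m \<Longrightarrow> coeff p k = of_real (real (m choose k) * P (replicate k b @ replicate (m - k) y))"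
    "\<And>k. k > m \<Longrightarrow> coeff p k = 0"
    "size A = m" "p = Polynomial.smult (of_real (P (replicate m b))) (\<Prod>x\<in>#A. [:-x, 1:])"
    "\<And>x. x \<in># A \<Longrightarrow> poly p x = 0 \<and> x = of_real (Re x)"
    by (rule hyp_poly[OF P h, where y = y], rule that)
  have Pb: "P (replicate m b) > 0" using h by (simp add: hyp_def)
  have sw: "P (replicate k b @ replicate (m - k) y) = P (replicate (m - k) y @ replicate k b)"
    if "k \<le> m" for k
    using that by (intro sym_form_perm[OF P]) auto
  have nn': "0 \<le> P (replicate (m - k) y @ replicate k b)" if "k \<le> m" for k
    using nn[of "m - k"] that by simp
  have "\<exists>r<0. x = of_real r" if "x \<in># A" for x
  proof (intro exI conjI)
    show x: "x = of_real (Re x)" using p(6) that by blast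
    show "Re x < 0"
    proof (rule ccontr)
      assume "\<not> Re x < 0"
      then have "0 < (\<Sum>k\<le>m. real (m choose k) * (Re x) ^ k * (1 ^ (m - k) * P (replicate k b @ replicate (m - k) y)))"
        using nn[of m] ny
        by (intro sum_pos2[of _ 0]) (auto simp: sw intro!: mult_nonneg_nonneg nn')
      moreover have "ev of_real m P [(x, b), (1, y)]
         = of_real (\<Sum>k\<le>m. real (m choose k) * (Re x) ^ k * (1 ^ (m - k) * P (replicate k b @ replicate (m - k) y)))"
        using ev_two[OF emb_of_real P, of x b 1 y] by (subst (asm) (2) x) simp
      ultimately show False using p(1)[of x] p(6)[OF that] by (simp del: of_real_sum)
    qed
  qed
  then have pos: "\<forall>j\<le>m. \<exists>c>0. coeff (\<Prod>x\<in>#A. [:-x, 1:]) j = of_real c"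
    using coeff_prod_neg_roots[of A] p(4) by auto
  show ?thesis unfolding Gam_def
  proof (intro CollectI allI impI)
    fix k assume k: "k \<le> m"
    obtain c where c: "c > 0" "coeff (\<Prod>x\<in>#A. [:-x, 1:]) (m - k) = of_real c" using pos by (meson diff_le_self)
    have "coeff p (m - k) = of_real (P (replicate m b) * c)" by (subst p(5)) (simp add: c)
    then have "real (m choose (m - k)) * P (replicate (m - k) b @ replicate (m - (m - k)) y) = P (replicate m b) * c"
      using p(2)[of "m - k"] by (metis diff_le_self of_real_eq_iff)
    moreover have "P (replicate m b) * c > 0" using Pb c by simp
    ultimately have "P (replicate (m - k) b @ replicate (m - (m - k)) y) > 0"
      by (metis of_nat_0_le_iff zero_less_mult_pos less_eq_real_def mult_eq_0_iff less_irrefl)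
    moreover have "P (replicate (m - k) b @ replicate (m - (m - k)) y) = P (replicate k y @ replicate (m - k) b)"
      using k by (intro sym_form_perm[OF P]) auto
    ultimately show "0 < P (replicate k y @ replicate (m - k) b)" by simp
  qed
qed

lemma sym_form_two_mixed:
  assumes P: "sym_form m P" and k: "k \<le> m"
  shows "P (replicate k (c *\<^sub>R x + s *\<^sub>R y) @ replicate (m - k) b)
   = (\<Sum>j\<le>k. of_nat (k choose j) * s ^ j * c ^ (k - j) * P (replicate j y @ replicate (k - j) x @ replicate (m - k) b))"
proof -
  have sf: "sym_form k (\<lambda>xs. P (replicate (m - k) b @ xs))"
    by (rule sym_form_append) (use P k in simp)
  have "P (replicate k (c *\<^sub>R x + s *\<^sub>R y) @ replicate (m - k) b) = P (replicate (m - k) b @ replicate k (c *\<^sub>R x + s *\<^sub>R y))"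
    using k by (intro sym_form_perm[OF P]) auto
  moreover have "P (replicate (m - k) b @ replicate j y @ replicate (k - j) x) = P (replicate j y @ replicate (k - j) x @ replicate (m - k) b)"
    if "j \<le> k" for j
    using k that by (intro sym_form_perm[OF P]) auto
  ultimately show ?thesis using sym_form_two[OF sf, of c x s y] by simp
qed

text \<open>The cone is the connected component of the base point in the nonvanishing set: along a segment on which
  \<open>P\<close> does not vanish, membership is open, and closed by \<open>Gam_of_nonneg\<close>.\<close>
lemma Gam_segment:
  assumes P: "sym_form m P" and h: "hyp m P b" and y0: "y0 \<in> Gam m P b"
    and nz: "\<And>\<theta>. \<theta> \<in> {0..1} \<Longrightarrow> P (replicate m ((1 - \<theta>) *\<^sub>R y0 + \<theta> *\<^sub>R y1)) \<noteq> 0"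
  shows "y1 \<in> Gam m P b"
proof -
  define f where "f k \<theta> = P (replicate k ((1 - \<theta>) *\<^sub>R y0 + \<theta> *\<^sub>R y1) @ replicate (m - k) b)" for k \<theta>
  have cont: "continuous_on {0..1} (f k)" if "k \<le> m" for k
    unfolding f_def sym_form_two_mixed[OF P that] by (intro continuous_intros)
  define T where "T = {\<theta>\<in>{0..1}. \<forall>k\<le>m. 0 < f k \<theta>}"
  have T_eq: "T = {\<theta>\<in>{0..1}. \<forall>k\<le>m. 0 \<le> f k \<theta>}"
  proof -
    have "\<forall>k\<le>m. 0 < f k \<theta>" if "\<theta> \<in> {0..1}" "\<forall>k\<le>m. 0 \<le> f k \<theta>" for \<theta>
      using Gam_of_nonneg[OF P h, of "(1 - \<theta>) *\<^sub>R y0 + \<theta> *\<^sub>R y1"] nz that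
      by (auto simp: f_def Gam_def)
    then show ?thesis unfolding T_def by (auto intro: less_imp_le)
  qed
  have "openin (top_of_set {0..1}) T"
  proof -
    have "T = (\<Inter>k\<in>{..m}. {0..1} \<inter> f k -` {0<..})" unfolding T_def by auto
    also have "openin (top_of_set {0..1}) \<dots>"
      by (intro openin_Inter) (auto intro!: continuous_openin_preimage_gen cont)
    finally show ?thesis .
  qed
  moreover have "closedin (top_of_set {0..1}) T"
  proof -
    have "T = (\<Inter>k\<in>{..m}. {0..1} \<inter> f k -` {0..})" unfolding T_eq by auto
    also have "closedin (top_of_set {0..1}) \<dots>"
      by (intro closedin_Inter) (auto intro!: continuous_closedin_preimage cont)
    finally show ?thesis .
  qed
  moreover have "0 \<in> T" using y0 by (auto simp: T_def f_def Gam_def)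
  moreover have "connected {0..1::real}" by simp
  ultimately have "T = {0..1}" unfolding connected_clopen by blast
  then have "1 \<in> T" by simp
  then show ?thesis by (auto simp: T_def f_def Gam_def)
qed

lemma Gam_nz_e:
  assumes P: "sym_form m P" and x: "x \<in> Gam m P e" and t: "\<theta> \<in> {0..1}"
  shows "P (replicate m ((1 - \<theta>) *\<^sub>R x + \<theta> *\<^sub>R e)) > 0"
proof -
  have sw: "P (replicate k e @ replicate (m - k) x) = P (replicate (m - k) x @ replicate k e)"
    if "k \<le> m" for k
    using that by (intro sym_form_perm[OF P]) auto
  have g: "0 < P (replicate (m - k) x @ replicate k e)" if "k \<le> m" for k
  proof -
    have "0 < P (replicate (m - k) x @ replicate (m - (m - k)) e)"
      using x diff_le_self[of m k] unfolding Gam_def by blast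
    then show ?thesis using that by simp
  qed
  show ?thesis
  proof (cases "\<theta> = 1")
    case True then show ?thesis using g[of m] by simp
  next
    case False
    then show ?thesis unfolding sym_form_two[OF P]
      using t g[of 0] by (intro sum_pos2[of _ 0]) (auto simp: sw g intro!: mult_nonneg_nonneg less_imp_le[OF g] mult_pos_pos g)
  qed
qed

lemma Gam_self: "hyp m P b \<Longrightarrow> b \<in> Gam m P b"
  by (auto simp: Gam_def hyp_def simp flip: replicate_add)

lemma Gam_change_base:
  assumes P: "sym_form m P" and h: "hyp m P e" and b: "b \<in> Gam m P e" and x: "x \<in> Gam m P e"
  shows "x \<in> Gam m P b"
proof -
  have hb: "hyp m P b" by (rule hyp_wrt_cone[OF P h b])
  have "e \<in> Gam m P b"
    by (rule Gam_segment[OF P hb Gam_self[OF hb]]) (use Gam_nz_e[OF P b] in force)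
  then show ?thesis
  proof (rule Gam_segment[OF P hb])
    fix \<theta> :: real assume "\<theta> \<in> {0..1}"
    then show "P (replicate m ((1 - \<theta>) *\<^sub>R e + \<theta> *\<^sub>R x)) \<noteq> 0"
      using Gam_nz_e[OF P x, of "1 - \<theta>"] by (simp add: add.commute)
  qed
qed

lemma poly_pderiv_prod:
  fixes B :: "complex multiset"
  assumes "\<And>x. x \<in># B \<Longrightarrow> t \<noteq> x"
  shows "poly (pderiv (\<Prod>x\<in>#B. [:-x, 1:])) t = poly (\<Prod>x\<in>#B. [:-x, 1:]) t * (\<Sum>x\<in>#B. 1 / (t - x))"
  using assms
proof (induction B)
  case (add x B)
  define p where "p = (\<Prod>x\<in>#B. [:-x, 1:])"
  define S where "S = (\<Sum>x\<in>#B. 1 / (t - x))"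
  have tx: "t - x \<noteq> 0" using add.prems by auto
  have IH: "poly (pderiv p) t = poly p t * S" using add by (auto simp: p_def S_def)
  have "poly (pderiv ([:-x, 1:] * p)) t = poly p t + (t - x) * poly (pderiv p) t"
    unfolding pderiv_mult poly_add poly_mult by (simp add: pderiv_pCons)
  also have "\<dots> = (t - x) * poly p t * (1 / (t - x) + S)"
    using tx by (simp add: IH distrib_left)
  also have "(t - x) * poly p t = poly ([:-x, 1:] * p) t" unfolding poly_mult by simp
  finally show ?case by (simp only: p_def S_def image_mset_add_mset prod_mset.add_mset sum_mset.add_mset)
qed simp

lemma pderiv_sum': "pderiv (\<Sum>i\<in>I. f i) = (\<Sum>i\<in>I. pderiv (f i :: complex poly))"
  by (induction I rule: infinite_finite_induct) (auto simp: pderiv_add)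

text \<open>Differentiating in the direction \<open>b\<close> preserves real-rootedness. Off the real axis the logarithmic
  derivative \<open>\<Sum> 1 / (t - x)\<close> over real roots has nonzero imaginary part, so the derivative
  cannot vanish there.\<close>
lemma hyp_derivative:
  assumes P: "sym_form (Suc m) P" and h: "hyp (Suc m) P b"
  shows "hyp m (\<lambda>xs. P (b # xs)) b"
  unfolding hyp_def
proof (intro conjI allI impI)
  show "0 < P (b # replicate m b)" using h by (simp add: hyp_def)
  fix y and t :: complex assume z: "ev of_real m (\<lambda>xs. P (b # xs)) [(t, b), (1, y)] = 0"
  obtain p A where p: "\<And>t. poly p t = ev of_real (Suc m) P [(t, b), (1, y)]"
    "\<And>k. k \<le> Suc m \<Longrightarrow> coeff p k = of_real (real (Suc m choose k) * P (replicate k b @ replicate (Suc m - k) y))"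
    "\<And>k. k > Suc m \<Longrightarrow> coeff p k = 0"
    "size A = Suc m" "p = Polynomial.smult (of_real (P (replicate (Suc m) b))) (\<Prod>x\<in>#A. [:-x, 1:])"
    "\<And>x. x \<in># A \<Longrightarrow> poly p x = 0 \<and> x = of_real (Re x)"
    by (rule hyp_poly[OF P h, where y = y], rule that)
  show "Im t = 0"
  proof (rule ccontr)
    assume im: "Im t \<noteq> 0"
    have "poly p t \<noteq> 0" using h im unfolding p(1) hyp_def by blast
    have "t \<noteq> x" if "x \<in># A" for x using p(6)[OF that] im by (metis Im_complex_of_real)
    then have "poly (pderiv p) t = poly p t * (\<Sum>x\<in>#A. 1 / (t - x))"
      using poly_pderiv_prod[of A t] by (subst (1 2) p(5)) (simp add: pderiv_smult)
    moreover have "Im (\<Sum>x\<in>#A. 1 / (t - x)) \<noteq> 0"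
    proof -
      have "Im (\<Sum>x\<in>#B. 1 / (t - x)) = - Im t * (\<Sum>x\<in>#B. 1 / (cmod (t - x))\<^sup>2)
          \<and> (\<Sum>x\<in>#B. 1 / (cmod (t - x))\<^sup>2) \<ge> 0 \<and> (B \<noteq> {#} \<longrightarrow> (\<Sum>x\<in>#B. 1 / (cmod (t - x))\<^sup>2) > 0)"
        if "B \<subseteq># A" for B
        using that
      proof (induction B)
        case (add x B)
        then have "x \<in># A" by (meson insert_subset_eq_iff)
        then have x: "Im x = 0" "t \<noteq> x" using p(6)[of x] im by (metis Im_complex_of_real)+
        have B: "B \<subseteq># A" using add.prems by (meson mset_subset_eq_insertD subset_mset.less_imp_le)
        define a where "a = 1 / (cmod (t - x))\<^sup>2"
        define S where "S = (\<Sum>x\<in>#B. 1 / (cmod (t - x))\<^sup>2)"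
        have "Im (1 / (t - x)) = - Im t * a"
          using x by (simp add: Im_divide cmod_power2 a_def)
        moreover have "a > 0" using x by (simp add: a_def)
        moreover have "Im (\<Sum>x\<in>#B. 1 / (t - x)) = - Im t * S" "S \<ge> 0" using add.IH[OF B] by (auto simp: S_def)
        ultimately have "Im (1 / (t - x) + (\<Sum>x\<in>#B. 1 / (t - x))) = - Im t * (a + S)" "a + S > 0"
          by (simp_all add: distrib_left)
        then show ?case by (simp add: a_def S_def)
      qed simp
      from this[of A] show ?thesis using p(4) im by auto
    qed
    ultimately have "poly (pderiv p) t \<noteq> 0" using \<open>poly p t \<noteq> 0\<close> by auto
    moreover have "poly (pderiv p) t = of_nat (Suc m) * ev of_real m (\<lambda>xs. P (b # xs)) [(t, b), (1, y)]"
    proof -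
      have "p = (\<Sum>k\<le>Suc m. monom (coeff p k) k)"
        using p(3) by (intro poly_eqI) (auto simp: coeff_sum not_le)
      then have "poly (pderiv p) t = poly (pderiv (\<Sum>k\<le>Suc m. monom (coeff p k) k)) t" by simp
      also have "\<dots> = (\<Sum>k\<le>Suc m. of_nat k * coeff p k * t ^ (k - 1))"
        by (simp add: pderiv_sum' pderiv_monom poly_sum poly_monom del: sum.atMost_Suc)
      also have "\<dots> = (\<Sum>k\<le>m. of_nat (Suc k) * coeff p (Suc k) * t ^ k)"
        by (simp add: sum.atMost_Suc_shift del: sum.atMost_Suc of_nat_Suc)
      also have "\<dots> = (\<Sum>k\<le>m. of_nat (Suc m) * (of_nat (m choose k) * t ^ k * of_real (1 ^ (m - k) * P (b # replicate k b @ replicate (m - k) y))))"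
      proof (intro sum.cong refl)
        fix k assume "k \<in> {..m}"
        then have "coeff p (Suc k) = of_real (real (Suc m choose Suc k) * P (b # replicate k b @ replicate (m - k) y))"
          using p(2)[of "Suc k"] by simp
        moreover have "(of_nat (Suc k) :: complex) * of_nat (Suc m choose Suc k) = of_nat (Suc m) * of_nat (m choose k)"
          using Suc_times_binomial_eq[of m k] by (metis mult.commute of_nat_mult)
        ultimately show "of_nat (Suc k) * coeff p (Suc k) * t ^ k =
          of_nat (Suc m) * (of_nat (m choose k) * t ^ k * of_real (1 ^ (m - k) * P (b # replicate k b @ replicate (m - k) y)))"
          by (simp del: of_nat_Suc binomial_Suc_Suc add: mult.assoc[symmetric])
      qed
      also have "\<dots> = of_nat (Suc m) * ev of_real m (\<lambda>xs. P (b # xs)) [(t, b), (1, y)]"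
        using ev_two[OF emb_of_real sym_form_Cons[OF P, of b], of t b 1 y] by (simp add: sum_distrib_left)
      finally show ?thesis .
    qed
    ultimately show False using z by simp
  qed
qed

text \<open>Induction on the degree. For \<open>b\<close> in the cone the form stays hyperbolic with respect to
  \<open>b\<close> by \<open>hyp_wrt_cone\<close>, the other directions stay in the cone taken from
  \<open>b\<close>, and \<open>P(b, \<cdot>, \<dots>)\<close> is hyperbolic of one degree less with a cone that
  contains the old one.\<close>
theorem garding_pos:
  assumes "sym_form m P" "hyp m P e" "length bs = m" "set bs \<subseteq> Gam m P e"
  shows "P bs > 0"
  using assms
proof (induction bs arbitrary: m P e)
  case Nil then show ?case by (simp add: hyp_def)
next
  case (Cons b bs)
  obtain k where m: "m = Suc k" "length bs = k" using Cons.prems(3) by (cases m) auto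
  have hb: "hyp m P b" using hyp_wrt_cone[OF Cons.prems(1,2)] Cons.prems(4) by auto
  have "set bs \<subseteq> Gam k (\<lambda>xs. P (b # xs)) b"
  proof
    fix x assume "x \<in> set bs"
    then have x: "x \<in> Gam (Suc k) P b"
      using Gam_change_base[OF Cons.prems(1,2), of b x] Cons.prems(4) m by auto
    show "x \<in> Gam k (\<lambda>xs. P (b # xs)) b" unfolding Gam_def
    proof (intro CollectI allI impI)
      fix j assume j: "j \<le> k"
      have "P (b # replicate j x @ replicate (k - j) b) = P (replicate j x @ replicate (Suc k - j) b)"
        using j m by (intro sym_form_perm[OF Cons.prems(1)]) (auto simp: Suc_diff_le)
      then show "0 < P (b # replicate j x @ replicate (k - j) b)" using x j by (simp add: Gam_def)
    qed
  qed
  then show ?case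
    using Cons.IH[of k "\<lambda>xs. P (b # xs)" b] hyp_derivative[of k P b] hb sym_form_Cons[of k P b] Cons.prems(1) m by auto
qed

text \<open>The closed variant, with weak inequalities. It is the closure of the open cone because adding
  \<open>\<epsilon> e\<close> makes all coefficients positive.\<close>
definition Gamc :: "nat \<Rightarrow> ('v::real_vector list \<Rightarrow> real) \<Rightarrow> 'v \<Rightarrow> 'v set" where
  "Gamc m P e = {x. \<forall>k\<le>m. 0 \<le> P (replicate k x @ replicate (m - k) e)}"

lemma continuous_form_shift:
  assumes "sym_form (length bs) P"
  shows "continuous_on UNIV (\<lambda>\<epsilon>. P (map (\<lambda>b. b + \<epsilon> *\<^sub>R e) bs))"
  using assms
proof (induction bs arbitrary: P)
  case (Cons b bs)
  have "P ((b + \<epsilon> *\<^sub>R e) # map (\<lambda>b. b + \<epsilon> *\<^sub>R e) bs)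
     = P (b # map (\<lambda>b. b + \<epsilon> *\<^sub>R e) bs) + \<epsilon> * P (e # map (\<lambda>b. b + \<epsilon> *\<^sub>R e) bs)" for \<epsilon>
    using sym_form_lin[OF Cons.prems, of "map (\<lambda>b. b + \<epsilon> *\<^sub>R e) bs" 1 b \<epsilon> e] by simp
  moreover have "continuous_on UNIV (\<lambda>\<epsilon>. P (x # map (\<lambda>b. b + \<epsilon> *\<^sub>R e) bs))" for x
    using Cons.IH[of "\<lambda>xs. P (x # xs)"] sym_form_Cons[of "length bs" P x] Cons.prems by simp
  ultimately show ?case by (auto intro!: continuous_intros)
qed simp

theorem garding_nonneg:
  assumes P: "sym_form m P" and h: "hyp m P e" and l: "length bs = m" and bs: "set bs \<subseteq> Gamc m P e"
  shows "P bs \<ge> 0"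
proof -
  have e: "P (replicate m e) > 0" using h by (simp add: hyp_def)
  have "b + \<epsilon> *\<^sub>R e \<in> Gam m P e" if b: "b \<in> set bs" and "\<epsilon> > 0" for b \<epsilon>
    unfolding Gam_def
  proof (intro CollectI allI impI)
    fix k assume k: "k \<le> m"
    have sw: "P (replicate j e @ replicate (k - j) b @ replicate (m - k) e) = P (replicate (k - j) b @ replicate (m - (k - j)) e)"
      if "j \<le> k" for j
    proof -
      have "m - (k - j) = j + (m - k)" using k that by simp
      then have "replicate (m - (k - j)) e = replicate j e @ replicate (m - k) e"
        by (simp only: replicate_add)
      then show ?thesis using that k
        by (simp only:) (intro sym_form_perm[OF P], auto)
    qed
    have nn: "0 \<le> P (replicate (k - j) b @ replicate (m - (k - j)) e)" for j
    proof -
      have "k - j \<le> m" using k by simp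
      then show ?thesis using b bs unfolding Gamc_def by blast
    qed
    define F where "F j = P (replicate j e @ replicate (k - j) b @ replicate (m - k) e)" for j
    have F: "0 \<le> F j" if "j \<le> k" for j using sw[OF that] nn[of j] by (simp add: F_def)
    have Fk: "F k > 0" using e k by (simp add: F_def flip: replicate_add)
    have "0 < (\<Sum>j\<le>k. of_nat (k choose j) * \<epsilon> ^ j * 1 ^ (k - j) * F j)"
      by (rule sum_pos2[of _ k]) (use \<open>\<epsilon> > 0\<close> F Fk in \<open>auto intro!: mult_nonneg_nonneg\<close>)
    then show "0 < P (replicate k (b + \<epsilon> *\<^sub>R e) @ replicate (m - k) e)"
      using sym_form_two_mixed[OF P k, of 1 b \<epsilon> e e] by (simp add: F_def)
  qed
  then have pos: "P (map (\<lambda>b. b + \<epsilon> *\<^sub>R e) bs) > 0" if "\<epsilon> > 0" for \<epsilon>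
    using garding_pos[OF P h, of "map (\<lambda>b. b + \<epsilon> *\<^sub>R e) bs"] l that by auto
  define f where "f \<epsilon> = P (map (\<lambda>b. b + \<epsilon> *\<^sub>R e) bs)" for \<epsilon>
  have "continuous_on UNIV f" using continuous_form_shift[of bs P e] P l unfolding f_def by blast
  then have "isCont f 0" by (simp add: continuous_on_eq_continuous_at)
  then have "(f \<longlongrightarrow> f 0) (at_right 0)" unfolding isCont_def filterlim_at_split by blast
  moreover have "eventually (\<lambda>\<epsilon>. 0 \<le> f \<epsilon>) (at_right 0)"
    using pos by (auto simp: eventually_at_filter less_imp_le f_def)
  ultimately have "0 \<le> f 0"
    by (rule tendsto_lowerbound) simp
  then show ?thesis by (simp add: f_def)
qed

section \<open>Exterior products as alternating sums\<close>

abbreviation tr :: "nat \<Rightarrow> nat \<Rightarrow> nat \<Rightarrow> nat" where "tr \<equiv> Transposition.transpose"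

text \<open>The alternating sum behind \<^const>\<open>wedge2\<close>, for bilinear forms that need not be alternating. It
  is the more flexible object: \<^const>\<open>wedge2\<close> of antisymmetrisations reduces to it without
  denominators (lemma \<open>wedge2_skew\<close>).\<close>
definition asum :: "('a \<Rightarrow> 'a \<Rightarrow> 'c::comm_ring_1) list \<Rightarrow> (nat \<Rightarrow> 'a) \<Rightarrow> 'c" where
  "asum \<eta>s v = (\<Sum>\<pi> | \<pi> permutes {..<2 * length \<eta>s}.
      of_int (sign \<pi>) * (\<Prod>i<length \<eta>s. (\<eta>s ! i) (v (\<pi> (2 * i))) (v (\<pi> (2 * i + 1)))))"

lemma wedge2_eq_asum: "wedge2 \<omega>s v = asum \<omega>s v / 2 ^ length \<omega>s"
  by (simp add: wedge2_def asum_def)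

lemma sum_perm_sign:
  fixes F :: "(nat \<Rightarrow> nat) \<Rightarrow> 'c::comm_ring_1"
  assumes "\<rho> permutes {..<N}"
  shows "(\<Sum>\<pi> | \<pi> permutes {..<N}. of_int (sign \<pi>) * F \<pi>)
    = of_int (sign \<rho>) * (\<Sum>\<pi> | \<pi> permutes {..<N}. of_int (sign \<pi>) * F (\<pi> \<circ> \<rho>))"
proof -
  have "(\<Sum>\<pi> | \<pi> permutes {..<N}. of_int (sign \<pi>) * F \<pi>)
      = (\<Sum>\<pi> | \<pi> permutes {..<N}. of_int (sign (\<pi> \<circ> \<rho>)) * F (\<pi> \<circ> \<rho>))"
    by (rule sum_permutations_compose_right[OF assms])
  also have "\<dots> = (\<Sum>\<pi> | \<pi> permutes {..<N}. of_int (sign \<rho>) * (of_int (sign \<pi>) * F (\<pi> \<circ> \<rho>)))"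
  proof (rule sum.cong[OF refl])
    fix \<pi> assume "\<pi> \<in> {\<pi>. \<pi> permutes {..<N}}"
    then have "sign (\<pi> \<circ> \<rho>) = sign \<pi> * sign \<rho>"
      using assms by (intro sign_compose permutes_imp_permutation[of "{..<N}"]) auto
    then show "of_int (sign (\<pi> \<circ> \<rho>)) * F (\<pi> \<circ> \<rho>) = of_int (sign \<rho>) * (of_int (sign \<pi>) * F (\<pi> \<circ> \<rho>))"
      by (simp add: mult_ac)
  qed
  finally show ?thesis by (simp add: sum_distrib_left)
qed

lemma sum_perm_sign_left:
  fixes F :: "(nat \<Rightarrow> nat) \<Rightarrow> 'c::comm_ring_1"
  assumes "\<rho> permutes {..<N}"
  shows "(\<Sum>\<pi> | \<pi> permutes {..<N}. of_int (sign \<pi>) * F \<pi>)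
    = of_int (sign \<rho>) * (\<Sum>\<pi> | \<pi> permutes {..<N}. of_int (sign \<pi>) * F (\<rho> \<circ> \<pi>))"
proof -
  have "(\<Sum>\<pi> | \<pi> permutes {..<N}. of_int (sign \<pi>) * F \<pi>)
      = (\<Sum>\<pi> | \<pi> permutes {..<N}. of_int (sign (\<rho> \<circ> \<pi>)) * F (\<rho> \<circ> \<pi>))"
    by (rule sum.reindex_bij_witness[of _ "\<lambda>\<pi>. \<rho> \<circ> \<pi>" "\<lambda>\<pi>. inv_into UNIV \<rho> \<circ> \<pi>"])
      (use assms in \<open>auto simp: permutes_compose permutes_inv permutes_inv_o o_assoc\<close>)
  also have "\<dots> = (\<Sum>\<pi> | \<pi> permutes {..<N}. of_int (sign \<rho>) * (of_int (sign \<pi>) * F (\<rho> \<circ> \<pi>)))"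
  proof (rule sum.cong[OF refl])
    fix \<pi> assume "\<pi> \<in> {\<pi>. \<pi> permutes {..<N}}"
    then have "sign (\<rho> \<circ> \<pi>) = sign \<rho> * sign \<pi>"
      using assms by (intro sign_compose permutes_imp_permutation[of "{..<N}"]) auto
    then show "of_int (sign (\<rho> \<circ> \<pi>)) * F (\<rho> \<circ> \<pi>) = of_int (sign \<rho>) * (of_int (sign \<pi>) * F (\<rho> \<circ> \<pi>))"
      by (simp add: mult_ac)
  qed
  finally show ?thesis by (simp add: sum_distrib_left)
qed

text \<open>The terms cancel in pairs under the transposition of \<open>a\<close> and \<open>b\<close>.\<close>
lemma sum_perm_odd:
  fixes F :: "(nat \<Rightarrow> nat) \<Rightarrow> 'c::{idom, ring_char_0}"
  assumes "a < N" "b < N" "a \<noteq> b" "\<And>\<pi>. \<pi> permutes {..<N} \<Longrightarrow> F (\<pi> \<circ> tr a b) = F \<pi>"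
  shows "(\<Sum>\<pi> | \<pi> permutes {..<N}. of_int (sign \<pi>) * F \<pi>) = 0"
proof -
  have "tr a b permutes {..<N}" using assms by (intro permutes_swap_id) auto
  from sum_perm_sign[OF this, of F] have "(\<Sum>\<pi> | \<pi> permutes {..<N}. of_int (sign \<pi>) * F \<pi>)
     = - (\<Sum>\<pi> | \<pi> permutes {..<N}. of_int (sign \<pi>) * F \<pi>)"
    using assms by (simp add: sign_swap_id)
  then show ?thesis by (simp only: eq_neg_iff_add_eq_0 flip: mult_2) simp
qed

lemma asum_Cons:
  "asum (\<eta> # \<eta>s) v = (\<Sum>\<pi> | \<pi> permutes {..<2 * Suc (length \<eta>s)}.
      of_int (sign \<pi>) * (\<eta> (v (\<pi> 0)) (v (\<pi> 1)) *
       (\<Prod>i<length \<eta>s. (\<eta>s ! i) (v (\<pi> (2 * i + 2))) (v (\<pi> (2 * i + 3))))))"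
  unfolding asum_def by (simp add: prod.lessThan_Suc_shift numeral_eq_Suc del: prod.lessThan_Suc)

lemma asum_lin:
  "asum ((\<lambda>x y. a * \<eta> x y + b * \<zeta> x y) # L) v = a * asum (\<eta> # L) v + b * asum (\<zeta> # L) v"
  unfolding asum_Cons by (simp add: sum_distrib_left sum.distrib[symmetric] algebra_simps)

lemma asum_flip:
  fixes \<eta> :: "'a \<Rightarrow> 'a \<Rightarrow> 'c::comm_ring_1"
  shows "asum ((\<lambda>x y. \<eta> y x) # L) v = - asum (\<eta> # L) v"
proof -
  let ?F = "\<lambda>\<pi>. \<eta> (v (\<pi> 0)) (v (\<pi> 1)) * (\<Prod>i<length L. (L ! i) (v (\<pi> (2 * i + 2))) (v (\<pi> (2 * i + 3))))"
  have t: "tr 0 1 permutes {..<2 * Suc (length L)}" by (intro permutes_swap_id) auto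
  have "asum (\<eta> # L) v = of_int (sign (tr 0 1)) * (\<Sum>\<pi> | \<pi> permutes {..<2 * Suc (length L)}. of_int (sign \<pi>) * ?F (\<pi> \<circ> tr 0 1))"
    unfolding asum_Cons by (rule sum_perm_sign[OF t])
  also have "(\<Sum>\<pi> | \<pi> permutes {..<2 * Suc (length L)}. of_int (sign \<pi>) * ?F (\<pi> \<circ> tr 0 1)) = asum ((\<lambda>x y. \<eta> y x) # L) v"
    unfolding asum_Cons by (intro sum.cong refl) (simp add: Transposition.transpose_def)
  finally show ?thesis by (simp add: sign_swap_id)
qed

text \<open>Exchanging two 2-forms permutes their two pairs of slots, which is an even permutation.\<close>
lemma asum_swap:
  assumes "a < length L" "b < length L" "a \<noteq> b"
  shows "asum (permute_list (tr a b) L) v = asum L v"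
proof -
  let ?n = "length L"
  define \<rho> where "\<rho> = tr (2 * a) (2 * b) \<circ> tr (2 * a + 1) (2 * b + 1)"
  have t: "tr a b permutes {..<?n}" using assms by (intro permutes_swap_id) auto
  have p: "tr (2 * a) (2 * b) permutes {..<2 * ?n}" "tr (2 * a + 1) (2 * b + 1) permutes {..<2 * ?n}"
    using assms by (auto intro!: permutes_swap_id)
  have rp: "\<rho> permutes {..<2 * ?n}" unfolding \<rho>_def using p by (intro permutes_compose)
  have "sign \<rho> = sign (tr (2 * a) (2 * b)) * sign (tr (2 * a + 1) (2 * b + 1))"
    unfolding \<rho>_def by (intro sign_compose permutation_swap_id)
  then have sr: "sign \<rho> = 1" using assms by (simp add: sign_swap_id)
  have r: "\<rho> (2 * i) = 2 * tr a b i" for i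
    by (auto simp: \<rho>_def Transposition.transpose_def)
  have r': "\<rho> (Suc (2 * i)) = Suc (2 * tr a b i)" for i
    by (auto simp: \<rho>_def Transposition.transpose_def)
  let ?F = "\<lambda>\<pi>. \<Prod>i<?n. (permute_list (tr a b) L ! i) (v (\<pi> (2 * i))) (v (\<pi> (2 * i + 1)))"
  let ?G = "\<lambda>\<pi>. \<Prod>i<?n. (L ! i) (v (\<pi> (2 * i))) (v (\<pi> (2 * i + 1)))"
  have FG: "?G \<pi> = ?F (\<pi> \<circ> \<rho>)" for \<pi>
  proof -
    have "?G \<pi> = (\<Prod>i<?n. (L ! tr a b i) (v (\<pi> (2 * tr a b i))) (v (\<pi> (2 * tr a b i + 1))))"
      using prod.permute[OF t, of "\<lambda>i. (L ! i) (v (\<pi> (2 * i))) (v (\<pi> (2 * i + 1)))"] by (simp add: o_def)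
    also have "\<dots> = ?F (\<pi> \<circ> \<rho>)"
      by (intro prod.cong refl) (simp add: permute_list_nth[OF t] r r')
    finally show ?thesis .
  qed
  have "asum L v = (\<Sum>\<pi> | \<pi> permutes {..<2 * ?n}. of_int (sign \<pi>) * ?F (\<pi> \<circ> \<rho>))"
    unfolding asum_def FG ..
  also have "\<dots> = (\<Sum>\<pi> | \<pi> permutes {..<2 * ?n}. of_int (sign \<pi>) * ?F \<pi>)"
    using sum_perm_sign[OF rp, of ?F] sr by simp
  also have "\<dots> = asum (permute_list (tr a b) L) v" unfolding asum_def by simp
  finally show ?thesis by simp
qed

lemma asum_mset:
  fixes xs ys :: "('a \<Rightarrow> 'a \<Rightarrow> 'c::comm_ring_1) list"
  assumes "mset xs = mset ys" shows "asum xs v = asum ys v"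
proof -
  obtain p where p: "p permutes {..<length ys}" "permute_list p ys = xs"
    using mset_eq_permutation[OF assms] .
  have "asum (permute_list p zs) v = asum zs v" if "length zs = length ys" for zs :: "('a \<Rightarrow> 'a \<Rightarrow> 'c) list"
    using p(1) finite_lessThan that
  proof (induction p arbitrary: zs rule: permutes_induct)
    case id
    then show ?case by simp
  next
    case (swap a b p)
    have "permute_list (tr a b \<circ> p) zs = permute_list p (permute_list (tr a b) zs)"
      using swap.hyps(4) swap.prems by (intro permute_list_compose) simp
    then have "asum (permute_list (tr a b \<circ> p) zs) v = asum (permute_list p (permute_list (tr a b) zs)) v"
      by simp
    also have "\<dots> = asum (permute_list (tr a b) zs) v" using swap.IH swap.prems by simp
    also have "\<dots> = asum zs v" using swap.hyps swap.prems by (intro asum_swap) auto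
    finally show ?case .
  qed
  from this[of ys] p(2) show ?thesis by simp
qed

lemma asum_map_head:
  assumes "\<And>\<eta> L. asum (g \<eta> # L) v = c * asum (\<eta> # L) v"
  shows "asum (map g \<eta>s @ L) v = c ^ length \<eta>s * asum (\<eta>s @ L) v"
proof (induction \<eta>s arbitrary: L)
  case (Cons \<eta> \<eta>s)
  have "asum (g \<eta> # (map g \<eta>s @ L)) v = c * asum (\<eta> # (map g \<eta>s @ L)) v" by (rule assms)
  also have "asum (\<eta> # (map g \<eta>s @ L)) v = asum (map g \<eta>s @ (\<eta> # L)) v" by (intro asum_mset) auto
  also have "\<dots> = c ^ length \<eta>s * asum (\<eta>s @ (\<eta> # L)) v" by (rule Cons.IH)
  also have "asum (\<eta>s @ (\<eta> # L)) v = asum ((\<eta> # \<eta>s) @ L) v" by (intro asum_mset) auto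
  finally show ?case by (simp add: mult.assoc)
qed simp

definition skew :: "('a \<Rightarrow> 'a \<Rightarrow> 'c::comm_ring_1) \<Rightarrow> 'a \<Rightarrow> 'a \<Rightarrow> 'c" where
  "skew \<eta> = (\<lambda>x y. \<eta> x y - \<eta> y x)"

lemma asum_skew: "asum (skew \<eta> # L) v = 2 * asum (\<eta> # L) v"
proof -
  have "skew \<eta> = (\<lambda>x y. 1 * \<eta> x y + (-1) * \<eta> y x)"
    by (auto simp: skew_def fun_eq_iff)
  then have "asum (skew \<eta> # L) v = 1 * asum (\<eta> # L) v + (-1) * asum ((\<lambda>x y. \<eta> y x) # L) v"
    using asum_lin[of 1 \<eta> "-1" "\<lambda>x y. \<eta> y x" L v] by simp
  then show ?thesis using asum_flip[of \<eta> L v] by simp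
qed

lemma wedge2_skew: "wedge2 (map skew \<eta>s) v = asum \<eta>s v"
  using asum_map_head[of skew v 2 \<eta>s "[]", OF asum_skew] by (simp add: wedge2_eq_asum)

lemma asum_neg_flip:
  fixes \<eta>s :: "('a \<Rightarrow> 'a \<Rightarrow> 'c::comm_ring_1) list"
  shows "asum (map (\<lambda>\<eta> x y. - \<eta> y x) \<eta>s) v = asum \<eta>s v"
proof -
  have "asum ((\<lambda>x y. - \<eta> y x) # L) v = 1 * asum (\<eta> # L) v" for \<eta> :: "'a \<Rightarrow> 'a \<Rightarrow> 'c" and L
    using asum_lin[of "-1" "\<lambda>x y. \<eta> y x" 0 "\<lambda>_ _. 0" L v] asum_flip[of \<eta> L v] by simp
  from asum_map_head[of "\<lambda>\<eta> x y. - \<eta> y x" v 1 \<eta>s "[]", OF this] show ?thesis by simp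
qed

lemma asum_hom:
  fixes \<eta>s :: "('a \<Rightarrow> 'a \<Rightarrow> 'c::comm_ring_1) list"
  assumes "\<And>a b. h (a + b) = h a + h b" "\<And>a b. h (a * b) = h a * h b" "h 0 = 0" "h 1 = 1" "\<And>k. h (of_int k) = of_int k"
  shows "h (asum \<eta>s v) = asum (map (\<lambda>\<eta> x y. h (\<eta> x y)) \<eta>s) v"
proof -
  have s: "h (sum f A) = (\<Sum>x\<in>A. h (f x))" for f :: "(nat \<Rightarrow> nat) \<Rightarrow> 'c" and A
    using assms by (induction A rule: infinite_finite_induct) auto
  have p: "h (prod f A) = (\<Prod>x\<in>A. h (f x))" for f :: "nat \<Rightarrow> 'c" and A
    using assms by (induction A rule: infinite_finite_induct) auto
  show ?thesis unfolding asum_def by (simp add: s p assms(2,5))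
qed

text \<open>A wedge of decomposable forms with a repeated one-form factor vanishes.\<close>
lemma asum_decomp_repeat:
  fixes a b :: "nat \<Rightarrow> 'a \<Rightarrow> 'c::{idom, ring_char_0}"
  assumes kl: "k < n" "l < n" "k \<noteq> l" and eq: "a k = a l"
  shows "asum (map (\<lambda>i x y. a i x * b i y) [0..<n]) v = 0"
proof -
  have "(\<Sum>\<pi> | \<pi> permutes {..<2 * n}. of_int (sign \<pi>) * ((\<Prod>i<n. a i (v (\<pi> (2 * i)))) * (\<Prod>i<n. b i (v (\<pi> (2 * i + 1)))))) = 0"
  proof (rule sum_perm_odd[of "2 * k" _ "2 * l"])
    fix \<pi> :: "nat \<Rightarrow> nat"
    have t: "tr k l permutes {..<n}" using kl by (intro permutes_swap_id) auto
    have r: "tr (2 * k) (2 * l) (2 * i) = 2 * tr k l i" for i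
      by (auto simp: Transposition.transpose_def)
    have r': "tr (2 * k) (2 * l) (2 * i + 1) = 2 * i + 1" for i
      by (auto simp: Transposition.transpose_def) presburger+
    have "(\<Prod>i<n. a i (v (\<pi> (2 * tr k l i)))) = (\<Prod>i<n. a (tr k l i) (v (\<pi> (2 * tr k l i))))"
      using eq by (intro prod.cong refl) (auto simp: Transposition.transpose_def)
    also have "\<dots> = (\<Prod>i<n. a i (v (\<pi> (2 * i))))"
      using prod.permute[OF t, of "\<lambda>i. a i (v (\<pi> (2 * i)))"] by (simp add: o_def)
    finally show "(\<Prod>i<n. a i (v ((\<pi> \<circ> tr (2 * k) (2 * l)) (2 * i)))) * (\<Prod>i<n. b i (v ((\<pi> \<circ> tr (2 * k) (2 * l)) (2 * i + 1))))
       = (\<Prod>i<n. a i (v (\<pi> (2 * i)))) * (\<Prod>i<n. b i (v (\<pi> (2 * i + 1))))"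
      unfolding o_def r r' by simp
  qed (use kl in auto)
  then show ?thesis unfolding asum_def by (simp add: prod.distrib)
qed

lemma prod_pairs: "(\<Prod>i<2 * n. g i) = (\<Prod>i<n. g (2 * i) * g (2 * i + 1 :: nat) :: 'c::comm_monoid_mult)"
  by (induction n) (simp_all add: mult_ac)

text \<open>For decomposable forms the alternating sum is the Leibniz formula with rows arranged in pairs.\<close>
lemma asum_decomp_det:
  fixes a b :: "nat \<Rightarrow> 'a \<Rightarrow> 'c::comm_ring_1"
  shows "asum (map (\<lambda>i x y. a i x * b i y) [0..<n]) v
    = Determinant.det (Matrix.mat (2 * n) (2 * n) (\<lambda>(p, q). if even p then a (p div 2) (v q) else b (p div 2) (v q)))"
proof -
  have "Determinant.det (Matrix.mat (2 * n) (2 * n) (\<lambda>(p, q). if even p then a (p div 2) (v q) else b (p div 2) (v q)))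
    = (\<Sum>\<pi> | \<pi> permutes {0..<2 * n}. of_int (sign \<pi>) * (\<Prod>i = 0..<2 * n. if even i then a (i div 2) (v (\<pi> i)) else b (i div 2) (v (\<pi> i))))"
    unfolding Determinant.det_def
    by (auto intro!: sum.cong prod.cong arg_cong2[of _ _ _ _ "(*)"] simp: permutes_in_image)
  also have "\<dots> = (\<Sum>\<pi> | \<pi> permutes {..<2 * n}. of_int (sign \<pi>) * (\<Prod>i<n. a i (v (\<pi> (2 * i))) * b i (v (\<pi> (2 * i + 1)))))"
    unfolding lessThan_atLeast0[symmetric] prod_pairs by simp
  finally show ?thesis by (simp add: asum_def)
qed

lemma det_zero_left_kernel:
  fixes M :: "nat \<Rightarrow> nat \<Rightarrow> 'c::field"
  assumes "Determinant.det (Matrix.mat N N (\<lambda>(p, q). M p q)) = 0"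
  obtains x where "\<exists>p<N. x p \<noteq> 0" "\<And>q. q < N \<Longrightarrow> (\<Sum>p<N. x p * M p q) = 0"
proof -
  let ?A = "Matrix.mat N N (\<lambda>(p, q). M p q)"
  have "Determinant.det (transpose_mat ?A) = 0" using assms det_transpose[of ?A N] by simp
  then obtain w where w: "w \<in> carrier_vec N" "w \<noteq> 0\<^sub>v N" "transpose_mat ?A *\<^sub>v w = 0\<^sub>v N"
    using det_0_iff_vec_prod_zero_field[of "transpose_mat ?A" N] by auto
  show ?thesis
  proof (rule that[of "vec_index w"])
    show "\<exists>p<N. vec_index w p \<noteq> 0"
    proof (rule ccontr)
      assume "\<not> ?thesis"
      then have "w = 0\<^sub>v N" using w(1) by (intro eq_vecI) auto
      then show False using w(2) by simp
    qed
    fix q assume q: "q < N"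
    have "vec_index (transpose_mat ?A *\<^sub>v w) q = (\<Sum>p = 0..<N. M p q * vec_index w p)"
      using q w(1) by (simp add: scalar_prod_def)
    then show "(\<Sum>p<N. vec_index w p * M p q) = 0"
      using w(3) q by (simp add: lessThan_atLeast0 mult.commute)
  qed
qed

lemma det_2x2: "Determinant.det (Matrix.mat 2 2 (\<lambda>(p, q). C p q)) = C 0 0 * C 1 1 - C 0 1 * (C 1 0 :: 'c::comm_ring_1)"
proof -
  have eq: "{0..<2::nat} = {0, 1}" by auto
  have ne: "id \<noteq> tr 0 1" by (auto simp: fun_eq_iff Transposition.transpose_def intro!: exI[of _ 0])
  have "{p. p permutes {0, 1::nat}} = {id, tr 0 1}"
    using permutes_doubleton_iff[of _ "0::nat" 1] by auto
  then show ?thesis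
    unfolding Determinant.det_def using ne by (simp add: eq sign_swap_id Transposition.transpose_def)
qed

lemma det_pair_blocks:
  fixes C :: "nat \<Rightarrow> nat \<Rightarrow> 'c::idom"
  shows "Determinant.det (Matrix.mat (2 * n) (2 * n) (\<lambda>(p, q). if p div 2 = q div 2 then C (p mod 2) (q mod 2) else 0))
    = (C 0 0 * C 1 1 - C 0 1 * C 1 0) ^ n"
proof (induction n)
  case 0 then show ?case by (simp add: Determinant.det_def)
next
  case (Suc n)
  let ?M = "\<lambda>n. Matrix.mat (2 * n) (2 * n) (\<lambda>(p, q). if p div 2 = q div 2 then C (p mod 2) (q mod 2) else 0)"
  let ?B = "Matrix.mat 2 2 (\<lambda>(p, q). C p q)"
  have "?M (Suc n) = four_block_mat (?M n) (0\<^sub>m (2 * n) 2) (0\<^sub>m 2 (2 * n)) ?B"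
  proof (rule eq_matI)
    fix i j assume "i < dim_row (four_block_mat (?M n) (0\<^sub>m (2 * n) 2) (0\<^sub>m 2 (2 * n)) ?B)"
      "j < dim_col (four_block_mat (?M n) (0\<^sub>m (2 * n) 2) (0\<^sub>m 2 (2 * n)) ?B)"
    then have ij: "i < 2 * n + 2" "j < 2 * n + 2" by simp_all
    have sm: "k div 2 = n" "k mod 2 = k - 2 * n" if "k < 2 * n + 2" "\<not> k < 2 * n" for k
      using that by presburger+
    have sm2: "k div 2 \<noteq> n" "n \<noteq> k div 2" if "k < 2 * n" for k using that by presburger+
    show "?M (Suc n) $$ (i, j) = four_block_mat (?M n) (0\<^sub>m (2 * n) 2) (0\<^sub>m 2 (2 * n)) ?B $$ (i, j)"
      using ij by (cases "i < 2 * n"; cases "j < 2 * n") (simp_all add: sm sm2)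
  qed simp_all
  then have "Determinant.det (?M (Suc n)) = Determinant.det (?M n) * Determinant.det ?B"
    using det_four_block_mat_upper_right_zero[of "?M n" "2 * n" "0\<^sub>m (2 * n) 2" 2 "0\<^sub>m 2 (2 * n)" ?B] by simp
  then show ?case using Suc by (simp add: det_2x2)
qed

section \<open>The polarised determinant of Hermitian matrices\<close>

definition smul :: "complex \<Rightarrow> complex^'n^'n \<Rightarrow> complex^'n^'n" where
  "smul c A = (\<chi> j k. c * A $ j $ k)"
text \<open>Conjugate transpose.\<close>
definition ctr :: "complex^'n^'n \<Rightarrow> complex^'n^'n" where
  "ctr A = (\<chi> j k. cnj (A $ k $ j))"
definition idm :: "complex^'n^'n" where "idm = (\<chi> j k. if j = k then 1 else 0)"
text \<open>The sesquilinear form of a Hermitian matrix. Its antisymmetrisation is the real (1,1)-form \<open>dd\<^sup>c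
  u\<close> when \<open>A\<close> is the complex Hessian of \<open>u\<close>.\<close>
definition eta :: "complex^'n^'n \<Rightarrow> complex^'n \<Rightarrow> complex^'n \<Rightarrow> complex" where
  "eta A v w = (\<Sum>j\<in>UNIV. \<Sum>k\<in>UNIV. 2 * \<i> * A $ j $ k * v $ j * cnj (w $ k))"
text \<open>The coefficient of \<open>A\<^sub>1 \<and> \<dots> \<and> A\<^sub>n\<close> with respect to Lebesgue measure,
  which is the polarised determinant up to a positive factor.\<close>
definition Qf :: "(complex^'n^'n) list \<Rightarrow> complex" where
  "Qf As = asum (map eta As) std_frame"
definition bco :: "complex^'n^'n \<Rightarrow> 'n \<Rightarrow> complex^'n \<Rightarrow> complex" where
  "bco B i y = (\<Sum>k\<in>UNIV. 2 * \<i> * B $ i $ k * cnj (y $ k))"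
abbreviation \<iota> :: "nat \<Rightarrow> 'n::finite" where "\<iota> \<equiv> from_nat_into UNIV"

lemma eta_lin: "eta (smul c A + smul d B) = (\<lambda>v w. c * eta A v w + d * eta B v w)"
  by (simp add: eta_def smul_def fun_eq_iff sum_distrib_left sum.distrib[symmetric] algebra_simps)

lemma Qf_lin: "Qf ((smul c A + smul d B) # L) = c * Qf (A # L) + d * Qf (B # L)"
  by (simp add: Qf_def eta_lin asum_lin)

lemma Qf_mset: "mset As = mset Bs \<Longrightarrow> Qf As = Qf Bs"
  unfolding Qf_def by (intro asum_mset) (metis mset_map)

lemma cnj_eta: "cnj (eta A v w) = - eta (ctr A) w v"
proof -
  have "cnj (eta A v w) = (\<Sum>j\<in>UNIV. \<Sum>k\<in>UNIV. - (2 * \<i> * cnj (A $ j $ k) * w $ k * cnj (v $ j)))"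
    by (simp add: eta_def mult_ac)
  also have "\<dots> = (\<Sum>k\<in>UNIV. \<Sum>j\<in>UNIV. - (2 * \<i> * cnj (A $ j $ k) * w $ k * cnj (v $ j)))"
    by (rule sum.swap)
  also have "\<dots> = - eta (ctr A) w v" by (simp add: eta_def ctr_def sum_negf)
  finally show ?thesis .
qed

lemma cnj_Qf: "cnj (Qf As) = Qf (map ctr As)"
proof -
  have "cnj (Qf As) = asum (map (\<lambda>\<eta> x y. cnj (\<eta> x y)) (map eta As)) std_frame"
    unfolding Qf_def by (rule asum_hom) auto
  also have "map (\<lambda>\<eta> x y. cnj (\<eta> x y)) (map eta As) = map (\<lambda>\<eta> x y. - \<eta> y x) (map eta (map ctr As))"
    by (simp add: cnj_eta o_def)
  also have "asum \<dots> std_frame = Qf (map ctr As)" unfolding asum_neg_flip Qf_def ..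
  finally show ?thesis .
qed

lemma eta_decomp: "eta B x y = (\<Sum>i\<in>UNIV. x $ i * bco B i y)"
  by (simp add: eta_def bco_def sum_distrib_left mult_ac)

lemma asum_power_expand:
  fixes a b :: "'i::finite \<Rightarrow> 'a \<Rightarrow> 'c::comm_ring_1"
  shows "asum (replicate n (\<lambda>x y. \<Sum>i\<in>UNIV. a i x * b i y)) v
    = (\<Sum>f\<in>{..<n} \<rightarrow>\<^sub>E UNIV. asum (map (\<lambda>k x y. a (f k) x * b (f k) y) [0..<n]) v)"
proof -
  have "asum (replicate n (\<lambda>x y. \<Sum>i\<in>UNIV. a i x * b i y)) v
    = (\<Sum>\<pi> | \<pi> permutes {..<2 * n}. of_int (sign \<pi>) * (\<Prod>k<n. \<Sum>i\<in>UNIV. a i (v (\<pi> (2 * k))) * b i (v (\<pi> (2 * k + 1)))))"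
    unfolding asum_def by simp
  also have "\<dots> = (\<Sum>\<pi> | \<pi> permutes {..<2 * n}. \<Sum>f\<in>{..<n} \<rightarrow>\<^sub>E UNIV. of_int (sign \<pi>) * (\<Prod>k<n. a (f k) (v (\<pi> (2 * k))) * b (f k) (v (\<pi> (2 * k + 1)))))"
    by (subst prod_sum_PiE) (auto simp: sum_distrib_left)
  also have "\<dots> = (\<Sum>f\<in>{..<n} \<rightarrow>\<^sub>E UNIV. \<Sum>\<pi> | \<pi> permutes {..<2 * n}. of_int (sign \<pi>) * (\<Prod>k<n. a (f k) (v (\<pi> (2 * k))) * b (f k) (v (\<pi> (2 * k + 1)))))"
    by (rule sum.swap)
  finally show ?thesis unfolding asum_def by simp
qed

lemma iota_bij: "bij_betw (\<iota> :: nat \<Rightarrow> 'n::finite) {..<CARD('n)} UNIV"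
  by (rule bij_betw_from_nat_into_finite) simp

lemma iota_eq: "i < CARD('n) \<Longrightarrow> j < CARD('n) \<Longrightarrow> (\<iota> i :: 'n::finite) = \<iota> j \<longleftrightarrow> i = j"
  using iota_bij[where ?'n = 'n] by (auto simp: bij_betw_def dest: inj_onD)

text \<open>The determinant in real coordinates of the one-forms \<open>dz\<^sub>i\<close> and \<open>2 \<i>
  \<Sum>\<^sub>k B\<^sub>i\<^sub>k d\<close>-bar\<open> z\<^sub>k\<close>. It is a positive multiple of
  \<open>det B\<close>.\<close>
definition Dt :: "complex^'n^'n \<Rightarrow> complex" where
  "Dt B = Determinant.det (Matrix.mat (2 * CARD('n)) (2 * CARD('n))
     (\<lambda>(p, q). if even p then std_frame q $ (\<iota> (p div 2) :: 'n) else bco B (\<iota> (p div 2)) (std_frame q)))"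

text \<open>Expanding the power, only the terms in which every \<open>dz\<^sub>i\<close> occurs once survive; each such
  term gives the same determinant, since reordering pairs of rows is even. The factor \<open>N\<close> counts
  them.\<close>
lemma Qf_power: "\<exists>N>0. \<forall>B::complex^'n^'n. Qf (replicate CARD('n) B) = of_nat N * Dt B"
proof -
  let ?n = "CARD('n)"
  let ?I = "{f \<in> {..<?n} \<rightarrow>\<^sub>E (UNIV::'n set). inj_on f {..<?n}}"
  have fin: "finite ({..<?n} \<rightarrow>\<^sub>E (UNIV::'n set))" by (intro finite_PiE) auto
  have mem: "restrict \<iota> {..<?n} \<in> ?I"
    using iota_bij[where ?'n = 'n] by (auto simp: bij_betw_def inj_on_def)
  have "finite ?I" using fin by (rule rev_finite_subset) auto
  then have N: "card ?I > 0" unfolding card_gt_0_iff using mem by blast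
  have "Qf (replicate ?n B) = of_nat (card ?I) * Dt B" for B :: "complex^'n^'n"
  proof -
    let ?g = "\<lambda>i x y. x $ i * bco B i y"
    have eB: "eta B = (\<lambda>x y. \<Sum>i\<in>UNIV. x $ i * bco B i y)" by (simp add: fun_eq_iff eta_decomp)
    have "Qf (replicate ?n B) = (\<Sum>f\<in>{..<?n} \<rightarrow>\<^sub>E UNIV. asum (map (\<lambda>k. ?g (f k)) [0..<?n]) std_frame)"
      unfolding Qf_def map_replicate eB asum_power_expand ..
    also have "\<dots> = (\<Sum>f\<in>?I. asum (map (\<lambda>k. ?g (f k)) [0..<?n]) std_frame)"
    proof (intro sum.mono_neutral_right fin ballI)
      fix f :: "nat \<Rightarrow> 'n" assume "f \<in> ({..<?n} \<rightarrow>\<^sub>E UNIV) - ?I"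
      then obtain k l where "k < ?n" "l < ?n" "k \<noteq> l" "f k = f l" by (auto simp: inj_on_def)
      then show "asum (map (\<lambda>k. ?g (f k)) [0..<?n]) std_frame = 0"
        using asum_decomp_repeat[of k ?n l "\<lambda>k x. x $ f k" "\<lambda>k y. bco B (f k) y" std_frame] by simp
    qed auto
    also have "\<dots> = (\<Sum>f\<in>?I. Dt B)"
    proof (rule sum.cong[OF refl])
      have m: "mset (map (\<lambda>k. ?g (f k)) [0..<?n]) = image_mset ?g (mset_set UNIV)"
        if "bij_betw f {..<?n} UNIV" for f
      proof -
        have "mset (map (\<lambda>k. ?g (f k)) [0..<?n]) = image_mset ?g (image_mset f (mset_set {..<?n}))"
          by (simp add: image_mset.compositionality o_def lessThan_atLeast0)
        also have "image_mset f (mset_set {..<?n}) = mset_set UNIV"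
          using that by (simp add: image_mset_mset_set bij_betw_def)
        finally show ?thesis .
      qed
      fix f assume f: "f \<in> ?I"
      then have inj: "inj_on f {..<?n}" by simp
      have "card (f ` {..<?n}) = card (UNIV :: 'n set)" using card_image[OF inj] by simp
      then have "f ` {..<?n} = UNIV" by (intro card_subset_eq) auto
      then have bf: "bij_betw f {..<?n} UNIV" using inj by (simp add: bij_betw_def)
      have "asum (map (\<lambda>k. ?g (f k)) [0..<?n]) std_frame = asum (map (\<lambda>k. ?g (\<iota> k)) [0..<?n]) std_frame"
        by (intro asum_mset) (simp only: m[OF bf] m[OF iota_bij])
      also have "\<dots> = Dt B"
        using asum_decomp_det[of "\<lambda>k x. x $ \<iota> k" "\<lambda>k y. bco B (\<iota> k) y" ?n std_frame] by (simp add: Dt_def)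
      finally show "asum (map (\<lambda>k. ?g (f k)) [0..<?n]) std_frame = Dt B" .
    qed
    finally show ?thesis by simp
  qed
  with N show ?thesis by blast
qed

lemma std_frame_nth: "std_frame q $ i = (if i = \<iota> (q div 2) then (if even q then 1 else \<i>) else 0)"
  by (simp add: std_frame_def axis_def)

lemma bco_frame: "bco B i (std_frame q) = 2 * \<i> * B $ i $ \<iota> (q div 2) * (if even q then 1 else - \<i>)"
proof -
  have "bco B i (std_frame q) = (\<Sum>k\<in>UNIV. if k = \<iota> (q div 2) then 2 * \<i> * B $ i $ k * (if even q then 1 else - \<i>) else 0)"
    unfolding bco_def by (intro sum.cong refl) (simp add: std_frame_nth)
  then show ?thesis by simp
qed

lemma sum_pairs: "(\<Sum>i<2 * n. g i) = (\<Sum>i<n. g (2 * i) + g (2 * i + 1 :: nat) :: 'c::comm_monoid_add)"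
  by (induction n) (simp_all add: add_ac)

text \<open>A linear relation among the rows has a part in the \<open>dz\<^sub>i\<close> and a part in their conjugates.
  The two types are linearly independent, so the second part is a left null vector of \<open>B\<close>.\<close>
lemma Dt_zero_kernel:
  fixes B :: "complex^'n^'n"
  assumes "Dt B = 0"
  obtains y :: "complex^'n" where "y \<noteq> 0" "\<And>j. (\<Sum>i\<in>UNIV. y $ i * B $ i $ j) = 0"
proof -
  let ?n = "CARD('n)"
  obtain x where x: "\<exists>p<2 * ?n. x p \<noteq> 0"
    "\<And>q. q < 2 * ?n \<Longrightarrow> (\<Sum>p<2 * ?n. x p * (if even p then std_frame q $ (\<iota> (p div 2) :: 'n) else bco B (\<iota> (p div 2)) (std_frame q))) = 0"
    using det_zero_left_kernel[OF assms[unfolded Dt_def]] by blast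
  define S where "S j = (\<Sum>i<?n. x (2 * i + 1) * (2 * \<i> * B $ \<iota> i $ \<iota> j))" for j
  have eq: "x (2 * j) * (if even q then 1 else \<i>) + S j * (if even q then 1 else - \<i>) = 0"
    if "j < ?n" "q = 2 * j \<or> q = 2 * j + 1" for j q
  proof -
    have q: "q < 2 * ?n" "q div 2 = j" using that by auto
    have "0 = (\<Sum>i<?n. x (2 * i) * std_frame q $ (\<iota> i :: 'n) + x (2 * i + 1) * bco B (\<iota> i) (std_frame q))"
      using x(2)[OF q(1)] unfolding sum_pairs by simp
    also have "\<dots> = (\<Sum>i<?n. if i = j then x (2 * j) * (if even q then 1 else \<i>) else 0) + (\<Sum>i<?n. x (2 * i + 1) * bco B (\<iota> i) (std_frame q))"
      unfolding sum.distrib using that q by (intro arg_cong2[of _ _ _ _ "(+)"] sum.cong refl) (auto simp: std_frame_nth iota_eq)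
    also have "(\<Sum>i<?n. x (2 * i + 1) * bco B (\<iota> i) (std_frame q)) = S j * (if even q then 1 else - \<i>)"
      unfolding S_def sum_distrib_right bco_frame q(2) by (simp add: mult_ac)
    finally show ?thesis using that by simp
  qed
  have zero: "x (2 * j) = 0" "S j = 0" if "j < ?n" for j
  proof -
    have a: "x (2 * j) + S j = 0" using eq[OF that, of "2 * j"] by simp
    have "\<i> * (x (2 * j) - S j) = 0" using eq[OF that, of "2 * j + 1"] by (simp add: algebra_simps)
    then have b: "x (2 * j) = S j" by simp
    show "x (2 * j) = 0" "S j = 0" using a b by (auto simp flip: mult_2)
  qed
  define y :: "complex^'n" where "y = (\<chi> i. x (2 * inv_into {..<?n} \<iota> i + 1))"
  have y: "y $ \<iota> i = x (2 * i + 1)" if "i < ?n" for i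
    using that iota_bij[where ?'n = 'n] by (simp add: y_def bij_betw_def inv_into_f_f)
  have surj: "\<exists>j<?n. k = \<iota> j" for k :: 'n
    using iota_bij[where ?'n = 'n] by (auto simp: bij_betw_def image_iff set_eq_iff)
  show ?thesis
  proof (rule that[of y])
    show "y \<noteq> 0"
    proof
      assume "y = 0"
      then have "x (2 * i + 1) = 0" if "i < ?n" for i using y[OF that] by simp
      moreover obtain p where p: "p < 2 * ?n" "x p \<noteq> 0" using x(1) by blast
      moreover have "p div 2 < ?n" using p by simp
      ultimately show False using zero(1)[of "p div 2"] p(2) odd_two_times_div_two_succ[of p]
        by (cases "even p") (simp, force)
    qed
    fix k :: 'n
    obtain j where j: "j < ?n" "k = \<iota> j" using surj by blast
    have "(\<Sum>i\<in>UNIV. y $ i * B $ i $ k) = (\<Sum>i<?n. y $ \<iota> i * B $ \<iota> i $ k)"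
      by (rule sum.reindex_bij_betw[OF iota_bij, symmetric])
    also have "2 * \<i> * \<dots> = S j"
      unfolding S_def sum_distrib_left j(2) by (intro sum.cong refl) (simp add: y mult_ac)
    finally show "(\<Sum>i\<in>UNIV. y $ i * B $ i $ k) = 0" using zero(2)[OF j(1)] by simp
  qed
qed

lemma Dt_idm: "Dt (idm :: complex^'n^'n) = 4 ^ CARD('n)"
proof -
  let ?n = "CARD('n)"
  define C :: "nat \<Rightarrow> nat \<Rightarrow> complex" where
    "C p q = (if p = 0 then (if q = 0 then 1 else \<i>) else 2 * \<i> * (if q = 0 then 1 else - \<i>))" for p q
  have "Dt (idm :: complex^'n^'n) = Determinant.det (Matrix.mat (2 * ?n) (2 * ?n) (\<lambda>(p, q). if p div 2 = q div 2 then C (p mod 2) (q mod 2) else 0))"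
    unfolding Dt_def
  proof (intro arg_cong[where f = Determinant.det] cong_mat refl, clarify)
    fix p q assume "p < 2 * ?n" "q < 2 * ?n"
    then have "p div 2 < ?n" "q div 2 < ?n" by auto
    then have i: "(\<iota> (p div 2) :: 'n) = \<iota> (q div 2) \<longleftrightarrow> p div 2 = q div 2" by (rule iota_eq)
    show "(if even p then std_frame q $ (\<iota> (p div 2) :: 'n) else bco (idm :: complex^'n^'n) (\<iota> (p div 2)) (std_frame q))
       = (if p div 2 = q div 2 then C (p mod 2) (q mod 2) else 0)"
      unfolding bco_frame std_frame_nth
      by (cases "even p"; cases "even q") (simp_all add: C_def idm_def i mod2_eq_if)
  qed
  also have "\<dots> = 4 ^ ?n" unfolding det_pair_blocks by (simp add: C_def)
  finally show ?thesis .
qed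

lemma Qf_idm_pos: "\<exists>c>0. Qf (replicate CARD('n) (idm :: complex^'n^'n)) = of_real c"
proof -
  obtain N where N: "N > 0" "\<forall>B::complex^'n^'n. Qf (replicate CARD('n) B) = of_nat N * Dt B" using Qf_power by blast
  have "Qf (replicate CARD('n) (idm :: complex^'n^'n)) = of_real (real N * 4 ^ CARD('n))"
    using N(2) by (simp add: Dt_idm)
  moreover have "real N * 4 ^ CARD('n) > 0" using N(1) by simp
  ultimately show ?thesis by blast
qed

text \<open>A matrix with a nonvanishing Hermitian form has no left null vector.\<close>
lemma Qf_nonzero:
  fixes B :: "complex^'n^'n"
  assumes "\<And>y. y \<noteq> 0 \<Longrightarrow> (\<Sum>i\<in>UNIV. \<Sum>j\<in>UNIV. y $ i * B $ i $ j * cnj (y $ j)) \<noteq> 0"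
  shows "Qf (replicate CARD('n) B) \<noteq> 0"
proof
  assume "Qf (replicate CARD('n) B) = 0"
  then have D: "Dt B = 0" using Qf_power[where ?'n = 'n] by auto
  obtain y :: "complex^'n" where y: "y \<noteq> 0" "\<And>j. (\<Sum>i\<in>UNIV. y $ i * B $ i $ j) = 0"
    by (rule Dt_zero_kernel[OF D], rule that)
  have "(\<Sum>i\<in>UNIV. \<Sum>j\<in>UNIV. y $ i * B $ i $ j * cnj (y $ j)) = (\<Sum>j\<in>UNIV. \<Sum>i\<in>UNIV. y $ i * B $ i $ j * cnj (y $ j))"
    by (rule sum.swap)
  also have "\<dots> = 0" using y(2) by (simp flip: sum_distrib_right)
  finally show False using assms[OF y(1)] by blast
qed

section \<open>Positivity of mixed products\<close>

definition herm :: "complex^'n^'n \<Rightarrow> complex^'n^'n" where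
  "herm B = (\<chi> j k. (B $ j $ k + cnj (B $ k $ j)) / 2)"
definition qform :: "complex^'n^'n \<Rightarrow> complex^'n \<Rightarrow> complex" where
  "qform A y = (\<Sum>i\<in>UNIV. \<Sum>j\<in>UNIV. y $ i * A $ i $ j * cnj (y $ j))"
text \<open>Composing with the Hermitian part makes the form real on all matrices, so that it is a symmetric real form on
  a real vector space, as the theory of hyperbolic forms requires.\<close>
definition Pn :: "(complex^'n^'n) list \<Rightarrow> real" where "Pn Bs = Re (Qf (map herm Bs))"

lemmas cvec_eq_iff = Finite_Cartesian_Product.vec_eq_iff

lemma entry_scaleR: "(a *\<^sub>R A) $ i $ j = of_real a * (A $ i $ j :: complex)"
  unfolding vector_scaleR_component by (rule scaleR_conv_of_real)

lemma ctr_herm: "ctr (herm B) = herm B"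
  by (simp add: ctr_def herm_def cvec_eq_iff add.commute)

lemma herm_of_ctr: assumes "ctr A = A" shows "herm A = A"
proof -
  have "cnj (A $ k $ j) = A $ j $ k" for j k
    using arg_cong[OF assms, of "\<lambda>X. X $ j $ k"] by (simp add: ctr_def)
  then show ?thesis by (simp add: herm_def cvec_eq_iff)
qed

lemma ctr_idm [simp]: "ctr idm = idm" by (auto simp: ctr_def idm_def cvec_eq_iff)

lemma ctr_lin: "ctr (a *\<^sub>R A + b *\<^sub>R B) = a *\<^sub>R ctr A + b *\<^sub>R ctr B"
  by (simp add: ctr_def cvec_eq_iff entry_scaleR)

lemma herm_lin: "herm (a *\<^sub>R x + b *\<^sub>R y) = smul (of_real a) (herm x) + smul (of_real b) (herm y)"
  by (simp add: herm_def smul_def cvec_eq_iff scaleR_conv_of_real[where 'a=complex] add_divide_distrib algebra_simps)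

lemma map_herm: "(\<And>B. B \<in> set Bs \<Longrightarrow> ctr B = B) \<Longrightarrow> map herm Bs = Bs"
  by (induction Bs) (auto simp: herm_of_ctr)

lemma Qf_herm: "Qf (map herm Bs) = of_real (Pn Bs)"
proof -
  have "cnj (Qf (map herm Bs)) = Qf (map herm Bs)" by (simp add: cnj_Qf o_def ctr_herm)
  then have "Im (cnj (Qf (map herm Bs))) = Im (Qf (map herm Bs))" by simp
  then have "Im (Qf (map herm Bs)) = 0" by simp
  then show ?thesis by (simp add: Pn_def complex_eq_iff)
qed

lemma sym_form_Pn: "sym_form k Pn"
  unfolding sym_form_def
proof (intro conjI allI impI)
  fix a b :: real and x y :: "complex^'n^'n" and zs
  show "Pn ((a *\<^sub>R x + b *\<^sub>R y) # zs) = a * Pn (x # zs) + b * Pn (y # zs)"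
    by (simp add: Pn_def herm_lin Qf_lin)
next
  fix xs ys :: "(complex^'n^'n) list" assume "mset xs = mset ys"
  then show "Pn xs = Pn ys" unfolding Pn_def by (metis Qf_mset mset_map)
qed

lemma sym_form_Pn_app: "sym_form k (\<lambda>xs. Pn (Ms @ xs))"
  by (rule sym_form_append[OF sym_form_Pn])

lemma ev_Pn:
  "ev of_real k (\<lambda>xs. Pn (Ms @ xs)) [(t, e), (1, x)]
    = Qf (map herm Ms @ replicate k (smul t (herm e) + smul 1 (herm x)))"
proof (induction k arbitrary: Ms)
  case 0 then show ?case by (simp add: Qf_herm)
next
  case (Suc k)
  let ?Y = "smul t (herm e) + smul 1 (herm x)"
  have IH: "ev of_real k (\<lambda>xs. Pn (Ms @ z # xs)) [(t, e), (1, x)] = Qf (herm z # map herm Ms @ replicate k ?Y)" for z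
    using Suc[of "Ms @ [z]"] Qf_mset[of "herm z # map herm Ms @ replicate k ?Y" "map herm Ms @ herm z # replicate k ?Y"]
    by simp
  have "Qf (map herm Ms @ replicate (Suc k) ?Y) = Qf (?Y # map herm Ms @ replicate k ?Y)"
    by (rule Qf_mset) simp
  then show ?case by (simp add: IH Qf_lin)
qed

lemma qform_lin: "qform (a *\<^sub>R A + b *\<^sub>R B) y = of_real a * qform A y + of_real b * qform B y"
  by (simp add: qform_def sum_distrib_left sum.distrib[symmetric] scaleR_conv_of_real[where 'a=complex] algebra_simps)

lemma qform_smul: "qform (smul s A + smul t B) y = s * qform A y + t * qform B y"
  by (simp add: qform_def smul_def sum_distrib_left sum.distrib[symmetric] algebra_simps)

lemma qform_idm: "qform idm y = of_real (\<Sum>i\<in>UNIV. (cmod (y $ i))\<^sup>2)"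
proof -
  have "qform idm y = (\<Sum>i\<in>UNIV. \<Sum>j\<in>UNIV. if j = i then y $ i * cnj (y $ i) else 0)"
    unfolding qform_def by (intro sum.cong refl) (auto simp: idm_def)
  then show ?thesis by (simp add: complex_norm_square del: of_real_power)
qed

lemma qform_real: assumes "ctr A = A" shows "Im (qform A y) = 0"
proof -
  have c: "cnj (A $ k $ j) = A $ j $ k" for j k
    using arg_cong[OF assms, of "\<lambda>X. X $ j $ k"] by (simp add: ctr_def)
  have "cnj (qform A y) = (\<Sum>i\<in>UNIV. \<Sum>j\<in>UNIV. y $ j * A $ j $ i * cnj (y $ i))"
    unfolding qform_def by (simp add: c mult_ac)
  also have "\<dots> = qform A y" unfolding qform_def by (rule sum.swap)
  finally have "Im (cnj (qform A y)) = Im (qform A y)" by simp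
  then show ?thesis by simp
qed

lemma norm2_pos: "(y::complex^'n) \<noteq> 0 \<Longrightarrow> 0 < (\<Sum>i\<in>UNIV. (cmod (y $ i))\<^sup>2)"
proof -
  assume "y \<noteq> 0"
  then obtain i where "y $ i \<noteq> 0" by (auto simp: cvec_eq_iff)
  then show ?thesis by (intro sum_pos2[of _ i]) auto
qed

text \<open>Reality of the eigenvalues of a Hermitian matrix: for non-real \<open>t\<close> the form of \<open>t I +
  A\<close> has imaginary part \<open>Im t \<bar>y\<bar>\<^sup>2\<close> and hence does not vanish, so the
  determinant is nonzero by \<open>Qf_nonzero\<close>.\<close>
lemma hyp_Pn: "hyp CARD('n) Pn (idm :: complex^'n^'n)"
  unfolding hyp_def
proof (intro conjI allI impI)
  obtain c where c: "c > 0" "Qf (replicate CARD('n) (idm :: complex^'n^'n)) = of_real c" using Qf_idm_pos by blast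
  then show "0 < Pn (replicate CARD('n) (idm :: complex^'n^'n))"
    by (simp add: Pn_def herm_of_ctr)
  fix x :: "complex^'n^'n" and t :: complex
  assume "ev of_real CARD('n) Pn [(t, idm), (1, x)] = 0"
  then have z: "Qf (replicate CARD('n) (smul t idm + smul 1 (herm x))) = 0"
    using ev_Pn[of "CARD('n)" "[]" t idm x] by (simp add: herm_of_ctr)
  show "Im t = 0"
  proof (rule ccontr)
    assume im: "Im t \<noteq> 0"
    have "Qf (replicate CARD('n) (smul t idm + smul 1 (herm x))) \<noteq> 0"
    proof (rule Qf_nonzero, fold qform_def)
      fix y :: "complex^'n" assume y: "y \<noteq> 0"
      have "Im (qform (smul t idm + smul 1 (herm x)) y) = Im t * (\<Sum>i\<in>UNIV. (cmod (y $ i))\<^sup>2)"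
        unfolding qform_smul qform_idm using qform_real[OF ctr_herm, of x y] by simp
      then have "Im (qform (smul t idm + smul 1 (herm x)) y) \<noteq> 0" using im norm2_pos[OF y] by simp
      then show "qform (smul t idm + smul 1 (herm x)) y \<noteq> 0" by (intro notI) simp
    qed
    then show False using z by blast
  qed
qed

text \<open>Iterated derivatives in the direction \<open>e\<close>: the elementary symmetric functions of the eigenvalues
  are hyperbolic because the determinant is.\<close>
lemma hyp_append:
  assumes "sym_form (j + m) P" "hyp (j + m) P e" shows "hyp m (\<lambda>xs. P (replicate j e @ xs)) e"
  using assms
proof (induction j arbitrary: P)
  case (Suc j)
  have "hyp m (\<lambda>xs. P (e # replicate j e @ xs)) e"
    using Suc.IH[of "\<lambda>xs. P (e # xs)"] sym_form_Cons[of "j + m" P e] hyp_derivative[of "j + m" P e] Suc.prems by simp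
  then show ?case by simp
qed simp

text \<open>The coefficient of \<open>A\<^sup>k \<and> \<beta>\<^sup>n\<^sup>-\<^sup>k\<close>, a positive multiple of the
  \<open>k\<close>-th elementary symmetric function of the eigenvalues.\<close>
definition sig :: "nat \<Rightarrow> complex^'n^'n \<Rightarrow> real" where
  "sig k A = Re (Qf (replicate k A @ replicate (CARD('n) - k) idm))"
text \<open>The cone of \<open>m\<close>-positive Hermitian matrices: \<open>C\<^sup>2\<close> functions are
  \<open>m\<close>-subharmonic exactly when their complex Hessians belong to it.\<close>
definition Gm :: "nat \<Rightarrow> (complex^'n^'n) set" where
  "Gm m = {A. ctr A = A \<and> (\<forall>k\<in>{1..m}. 0 \<le> sig k A)}"

lemma sig_Pn:
  fixes A :: "complex^'n^'n"
  assumes "ctr A = A" shows "sig k A = Pn (replicate (CARD('n) - k) idm @ replicate k A)"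
proof -
  have "Qf (replicate k A @ replicate (CARD('n) - k) idm) = Qf (replicate (CARD('n) - k) idm @ replicate k A)"
    by (rule Qf_mset) simp
  then show ?thesis using assms by (simp add: sig_def Pn_def herm_of_ctr)
qed

lemma Pn_idm_pos: "0 < Pn (replicate CARD('n) (idm :: complex^'n^'n))"
  using hyp_Pn unfolding hyp_def by blast

lemma sig_0: "sig 0 (A :: complex^'n^'n) = Pn (replicate CARD('n) (idm :: complex^'n^'n))"
  by (simp add: sig_def Pn_def herm_of_ctr)

text \<open>Garding's inequality for the derivative of the determinant of order \<open>n - m\<close> in the direction of
  the identity, whose closed cone is \<^const>\<open>Gm\<close>.\<close>
theorem mixed_nonneg:
  fixes Bs :: "(complex^'n^'n) list"
  assumes "length Bs = m" "m \<le> CARD('n)" "set Bs \<subseteq> Gm m"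
  shows "0 \<le> Re (Qf (Bs @ replicate (CARD('n) - m) idm))"
proof -
  let ?P = "\<lambda>xs. Pn (replicate (CARD('n) - m) (idm :: complex^'n^'n) @ xs) :: real"
  have cB: "ctr B = B" if "B \<in> set Bs" for B using assms(3) that by (auto simp: Gm_def)
  have "set Bs \<subseteq> Gamc m ?P idm"
  proof
    fix B assume B: "B \<in> set Bs"
    show "B \<in> Gamc m ?P idm" unfolding Gamc_def
    proof (intro CollectI allI impI)
      fix k assume k: "k \<le> m"
      have "0 \<le> sig k B" using B assms(3) k Pn_idm_pos[where ?'n = 'n] by (cases "k = 0") (auto simp: Gm_def sig_0)
      also have "sig k B = Pn (replicate (CARD('n) - k) idm @ replicate k B)" by (rule sig_Pn[OF cB[OF B]])
      also have "\<dots> = Pn (replicate (CARD('n) - m) idm @ replicate k B @ replicate (m - k) idm)"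
      proof -
        have "replicate (CARD('n) - k) (idm :: complex^'n^'n) = replicate (CARD('n) - m) idm @ replicate (m - k) idm"
          using k assms(2) by (simp flip: replicate_add)
        then show ?thesis by (intro sym_form_perm[OF sym_form_Pn refl]) simp
      qed
      finally show "0 \<le> ?P (replicate k B @ replicate (m - k) idm)" .
    qed
  qed
  moreover have "hyp m ?P idm"
    by (rule hyp_append[OF sym_form_Pn]) (use hyp_Pn[where ?'n = 'n] assms(2) in simp)
  ultimately have "0 \<le> ?P Bs" using garding_nonneg[OF sym_form_Pn_app] assms(1) by blast
  also have "?P Bs = Re (Qf (replicate (CARD('n) - m) idm @ Bs))"
    using map_herm[of Bs] cB by (simp add: Pn_def herm_of_ctr)
  also have "Qf (replicate (CARD('n) - m) idm @ Bs) = Qf (Bs @ replicate (CARD('n) - m) idm)"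
    by (rule Qf_mset) simp
  finally show ?thesis .
qed

text \<open>The segment from the identity to \<open>A + \<epsilon> I\<close> consists of positive definite matrices, so
  the determinant does not vanish on it and \<open>Gam_segment\<close> puts \<open>A + \<epsilon> I\<close> in
  the open cone; then \<open>\<epsilon>\<close> tends to \<open>0\<close>.\<close>
lemma psd_Gm:
  fixes A :: "complex^'n^'n"
  assumes c: "ctr A = A" and psd: "\<And>y. 0 \<le> Re (qform A y)" and m: "m \<le> CARD('n)"
  shows "A \<in> Gm m"
proof -
  let ?n = "CARD('n)"
  have G: "A + \<epsilon> *\<^sub>R idm \<in> Gam ?n Pn idm" if eps: "\<epsilon> > 0" for \<epsilon>
  proof (rule Gam_segment[OF sym_form_Pn hyp_Pn Gam_self[OF hyp_Pn]])
    fix \<theta> :: real assume t: "\<theta> \<in> {0..1}"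
    let ?X = "(1 - \<theta>) *\<^sub>R idm + \<theta> *\<^sub>R (A + \<epsilon> *\<^sub>R idm)"
    have X: "?X = (1 - \<theta> + \<theta> * \<epsilon>) *\<^sub>R idm + \<theta> *\<^sub>R A" by (simp add: algebra_simps)
    have cX: "ctr ?X = ?X" unfolding X ctr_lin c by simp
    have "Qf (replicate ?n ?X) \<noteq> 0"
    proof (rule Qf_nonzero, fold qform_def)
      fix y :: "complex^'n" assume y: "y \<noteq> 0"
      have "1 - \<theta> + \<theta> * \<epsilon> > 0" using t eps by (cases "\<theta> = 1") (auto intro!: add_pos_nonneg)
      then have "0 < (1 - \<theta> + \<theta> * \<epsilon>) * (\<Sum>i\<in>UNIV. (cmod (y $ i))\<^sup>2)" using norm2_pos[OF y] by simp
      moreover have "0 \<le> \<theta> * Re (qform A y)" using t psd[of y] by simp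
      ultimately have "0 < Re (qform ?X y)" unfolding X qform_lin qform_idm by simp
      then show "qform ?X y \<noteq> 0" by (intro notI) simp
    qed
    then show "Pn (replicate ?n ?X) \<noteq> 0"
      using Qf_herm[of "replicate ?n ?X"] cX by (simp add: herm_of_ctr)
  qed
  have "0 \<le> sig k A" if k: "k \<le> ?n" for k
  proof -
    define f where "f \<epsilon> = Pn (replicate (?n - k) idm @ map (\<lambda>b. b + \<epsilon> *\<^sub>R idm) (replicate k A))" for \<epsilon>
    have "continuous_on UNIV f"
      unfolding f_def using continuous_form_shift[OF sym_form_Pn_app] by blast
    then have "isCont f 0" by (simp add: continuous_on_eq_continuous_at)
    then have "(f \<longlongrightarrow> f 0) (at_right 0)" unfolding isCont_def filterlim_at_split by blast
    moreover have "0 \<le> f \<epsilon>" if "\<epsilon> > 0" for \<epsilon>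
    proof -
      have "0 < Pn (replicate k (A + \<epsilon> *\<^sub>R idm) @ replicate (?n - k) idm)"
        using G[OF that] k unfolding Gam_def by blast
      also have "\<dots> = f \<epsilon>" unfolding f_def by (intro sym_form_perm[OF sym_form_Pn refl]) simp
      finally show ?thesis by simp
    qed
    then have "eventually (\<lambda>\<epsilon>. 0 \<le> f \<epsilon>) (at_right 0)" by (auto simp: eventually_at_filter)
    ultimately have "0 \<le> f 0" by (rule tendsto_lowerbound) simp
    also have "f 0 = sig k A" unfolding f_def sig_Pn[OF c] by simp
    finally show ?thesis .
  qed
  then show ?thesis using c m by (auto simp: Gm_def)
qed

lemma idm_Gm: "m \<le> CARD('n) \<Longrightarrow> (idm :: complex^'n^'n) \<in> Gm m"
  by (rule psd_Gm) (auto simp: qform_idm intro!: sum_nonneg)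

text \<open>These matrices come from \<open>du \<and> d\<^sup>cu\<close>, the second-order term in the chain rule for
  \<open>dd\<^sup>c\<close>.\<close>
lemma rank1_Gm:
  fixes w :: "complex^'n"
  assumes "m \<le> CARD('n)" shows "(\<chi> j k. w $ j * cnj (w $ k)) \<in> Gm m"
proof (rule psd_Gm)
  show "ctr (\<chi> j k. w $ j * cnj (w $ k)) = (\<chi> j k. w $ j * cnj (w $ k))" by (simp add: ctr_def mult.commute)
  fix y :: "complex^'n"
  have "qform (\<chi> j k. w $ j * cnj (w $ k)) y = (\<Sum>i\<in>UNIV. y $ i * w $ i) * cnj (\<Sum>j\<in>UNIV. y $ j * w $ j)"
    by (simp add: qform_def sum_product mult_ac)
  also have "\<dots> = of_real ((cmod (\<Sum>i\<in>UNIV. y $ i * w $ i))\<^sup>2)" by (rule complex_norm_square[symmetric])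
  finally show "0 \<le> Re (qform (\<chi> j k. w $ j * cnj (w $ k)) y)" by simp
qed (rule assms)

text \<open>Quantitative openness of the cone: \<open>sig k (A - \<delta> I)\<close> is a binomial sum whose first term is
  at least \<open>\<sigma>\<close> and whose other terms are at most \<open>\<delta> M\<close> times a binomial
  coefficient; their number is bounded by \<open>2\<^sup>m\<close>.\<close>
lemma Gm_shift:
  fixes A :: "complex^'n^'n"
  assumes c: "ctr A = A" and lo: "\<And>k. k \<in> {1..m} \<Longrightarrow> \<sigma> \<le> sig k A" and hi: "\<And>k. k \<le> m \<Longrightarrow> \<bar>sig k A\<bar> \<le> M"
    and d: "0 < \<delta>" "\<delta> \<le> 1" "\<delta> * (2 ^ m * M) \<le> \<sigma>" and m: "m \<le> CARD('n)"
  shows "A - \<delta> *\<^sub>R idm \<in> Gm m"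
proof -
  have X: "A - \<delta> *\<^sub>R idm = 1 *\<^sub>R A + (- \<delta>) *\<^sub>R idm" by simp
  have cX: "ctr (A - \<delta> *\<^sub>R idm) = A - \<delta> *\<^sub>R idm" unfolding X ctr_lin c by simp
  have M0: "0 \<le> M" using hi[of 0] by simp
  have "0 \<le> sig k (A - \<delta> *\<^sub>R idm)" if k: "k \<in> {1..m}" for k
  proof -
    have s: "Pn (replicate (CARD('n) - k) idm @ replicate j idm @ replicate (k - j) A) = sig (k - j) A" if "j \<le> k" for j
    proof -
      have "CARD('n) - (k - j) = CARD('n) - k + j" using that k m by auto
      then have "replicate (CARD('n) - (k - j)) idm = replicate (CARD('n) - k) idm @ replicate j (idm :: complex^'n^'n)"
        by (simp only: replicate_add)
      then show ?thesis unfolding sig_Pn[OF c] by simp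
    qed
    have "sig k (A - \<delta> *\<^sub>R idm) = (\<Sum>j\<le>k. of_nat (k choose j) * (- \<delta>) ^ j * 1 ^ (k - j) * Pn (replicate (CARD('n) - k) idm @ replicate j idm @ replicate (k - j) A))"
      unfolding sig_Pn[OF cX] unfolding X by (rule sym_form_two[OF sym_form_Pn_app])
    also have "\<dots> = (\<Sum>j\<le>k. of_nat (k choose j) * (- \<delta>) ^ j * sig (k - j) A)"
      by (intro sum.cong refl) (simp add: s)
    also have "\<dots> = sig k A + (\<Sum>j\<in>{..k} - {0}. of_nat (k choose j) * (- \<delta>) ^ j * sig (k - j) A)"
      by (subst sum.remove[of _ 0]) auto
    also have "\<dots> \<ge> \<sigma> - \<delta> * (2 ^ m * M)"
    proof -
      have "\<bar>\<Sum>j\<in>{..k} - {0}. of_nat (k choose j) * (- \<delta>) ^ j * sig (k - j) A\<bar> \<le> (\<Sum>j\<in>{..k} - {0}. of_nat (k choose j) * (\<delta> * M))"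
      proof (rule order_trans[OF sum_abs], rule sum_mono)
        fix j assume j: "j \<in> {..k} - {0}"
        have "\<delta> ^ j \<le> \<delta> ^ 1" using d j by (intro power_decreasing) auto
        then have "\<delta> ^ j * \<bar>sig (k - j) A\<bar> \<le> \<delta> * M" using hi[of "k - j"] k d by (intro mult_mono) auto
        then show "\<bar>of_nat (k choose j) * (- \<delta>) ^ j * sig (k - j) A\<bar> \<le> of_nat (k choose j) * (\<delta> * M)"
          using d by (simp add: abs_mult power_abs mult_left_mono mult.assoc)
      qed
      also have "\<dots> \<le> (\<Sum>j\<le>k. of_nat (k choose j) * (\<delta> * M))"
        by (rule sum_mono2) (use d M0 in auto)
      also have "\<dots> = 2 ^ k * (\<delta> * M)"
        unfolding sum_distrib_right[symmetric] using choose_row_sum[of k] by (simp flip: of_nat_sum)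
      also have "\<dots> \<le> 2 ^ m * (\<delta> * M)" using k d M0 by (intro mult_right_mono power_increasing) auto
      finally show ?thesis using lo[OF k] by (simp add: mult_ac)
    qed
    also have "\<sigma> - \<delta> * (2 ^ m * M) \<ge> 0" using d by simp
    finally show ?thesis by simp
  qed
  then show ?thesis using cX by (auto simp: Gm_def)
qed

section \<open>The trace as a mixed product\<close>

lemma three_same_half:
  assumes "a div 2 = c div 2" "b div 2 = c div 2" shows "a = c \<or> b = c \<or> a = (b::nat)"
proof -
  have "a = 2 * (c div 2) + a mod 2" "b = 2 * (c div 2) + b mod 2" "c = 2 * (c div 2) + c mod 2"
    using assms mult_div_mod_eq[of 2 a] mult_div_mod_eq[of 2 b] by simp_all
  moreover have "a mod 2 = b mod 2 \<or> a mod 2 = c mod 2 \<or> b mod 2 = c mod 2"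
    unfolding mod2_eq_if by simp
  ultimately show ?thesis by metis
qed

lemma div2_less: "a < 2 * n \<Longrightarrow> a div 2 < (n::nat)"
  by linarith

lemma half_less: "a div 2 < n \<Longrightarrow> a < 2 * (n::nat)"
  by linarith

lemma pred2_split:
  assumes "p \<noteq> 0" "p \<noteq> 1" shows "p = 2 * ((p - 2) div 2) + 2 \<or> p = 2 * ((p - 2) div 2) + (3::nat)"
proof -
  obtain q where q: "p = q + 2" using assms by (metis One_nat_def add_2_eq_Suc' not0_implies_Suc)
  show ?thesis unfolding q by (cases "even q") (auto elim!: evenE oddE)
qed

lemma mult_if_aux: "c * (if P then 1 else 0) * u * v = (if P then c * u * v else (0::complex))"
  by simp

lemma idm_nth: "idm $ a $ b = (if a = b then 1 else 0)" by (simp add: idm_def)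

lemma eta_frame: "eta (A :: complex^'n^'n) (std_frame p) (std_frame q)
   = 2 * \<i> * A $ \<iota> (p div 2) $ \<iota> (q div 2) * (if even p then 1 else \<i>) * (if even q then 1 else - \<i>)"
proof -
  have "eta A (std_frame p) (std_frame q) = (\<Sum>i\<in>UNIV. if i = \<iota> (p div 2) then (if even p then 1 else \<i>) * bco A i (std_frame q) else 0)"
    unfolding eta_decomp by (intro sum.cong refl) (simp add: std_frame_nth)
  then show ?thesis by (simp add: bco_frame)
qed

lemma eta_frame_idm: "eta (idm :: complex^'n^'n) (std_frame p) (std_frame q)
   = (if (\<iota> (p div 2) :: 'n) = \<iota> (q div 2) then 2 * \<i> * (if even p then 1 else \<i>) * (if even q then 1 else - \<i>) else 0)"
  unfolding eta_frame idm_nth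
  by (rule mult_if_aux)

text \<open>With \<open>n - 1\<close> copies of \<open>\<beta>\<close> only the diagonal of \<open>A\<close> contributes,
  and by symmetry each diagonal entry contributes equally. This identifies \<open>dd\<^sup>cu \<and>
  \<beta>\<^sup>n\<^sup>-\<^sup>1\<close> with the Laplacian.\<close>
theorem Qf_trace:
  fixes A :: "complex^'n^'n"
  shows "of_nat CARD('n) * Qf (A # replicate (CARD('n) - 1) idm)
    = (\<Sum>j\<in>UNIV. A $ j $ j) * Qf (replicate CARD('n) (idm :: complex^'n^'n))"
proof -
  let ?n = "CARD('n)"
  obtain l where l: "?n = Suc l" using gr0_implies_Suc[OF zero_less_card_finite] by blast
  let ?E = "\<lambda>p q. eta (idm :: complex^'n^'n) (std_frame p) (std_frame q)"
  let ?R = "\<lambda>\<pi>. \<Prod>i<l. ?E (\<pi> (2 * i + 2)) (\<pi> (2 * i + 3))"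
  define c where "c j = (\<Sum>\<pi> | \<pi> permutes {..<2 * ?n}. of_int (sign \<pi>) * (if \<pi> 0 div 2 = j then ?E (\<pi> 0) (\<pi> 1) * ?R \<pi> else 0))" for j
  have dv: "p div 2 < ?n" if "p < 2 * ?n" for p using that by (rule div2_less)
  have pair: "\<pi> 0 div 2 = \<pi> 1 div 2" if \<pi>: "\<pi> permutes {..<2 * ?n}" and nz: "?R \<pi> \<noteq> 0" for \<pi>
  proof -
    have in\<pi>: "\<pi> p < 2 * ?n \<longleftrightarrow> p < 2 * ?n" for p using permutes_in_image[OF \<pi>, of p] by auto
    have sm: "\<pi> (2 * i + 2) div 2 = \<pi> (2 * i + 3) div 2" if i: "i < l" for i
    proof -
      have "?E (\<pi> (2 * i + 2)) (\<pi> (2 * i + 3)) \<noteq> 0" using nz i by (auto simp: prod_zero_iff)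
      then have e: "(\<iota> (\<pi> (2 * i + 2) div 2) :: 'n) = \<iota> (\<pi> (2 * i + 3) div 2)" unfolding eta_frame_idm by (auto split: if_splits)
      have h: "2 * i + 2 < 2 * ?n" "2 * i + 3 < 2 * ?n" using i l by simp_all
      have "\<pi> (2 * i + 2) div 2 < ?n" "\<pi> (2 * i + 3) div 2 < ?n"
        by (rule dv[OF in\<pi>[THEN iffD2, OF h(1)]], rule dv[OF in\<pi>[THEN iffD2, OF h(2)]])
      then show ?thesis using e iota_eq by blast
    qed
    show ?thesis
    proof (rule ccontr)
      assume ne: "\<pi> 0 div 2 \<noteq> \<pi> 1 div 2"
      define q where "q = (if even (\<pi> 0) then \<pi> 0 + 1 else \<pi> 0 - 1)"
      have q: "q div 2 = \<pi> 0 div 2" "q \<noteq> \<pi> 0" unfolding q_def by (auto elim!: evenE oddE)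
      have "\<pi> 0 < 2 * ?n" using in\<pi>[of 0] l by simp
      then have "q div 2 < ?n" using q(1) dv by simp
      then have "q < 2 * ?n" by (rule half_less)
      then have "q \<in> \<pi> ` {..<2 * ?n}" using permutes_image[OF \<pi>] by auto
      then obtain p where p: "p < 2 * ?n" "q = \<pi> p" by auto
      have "p \<noteq> 0" using p(2) q(2) by (cases "p = 0") simp_all
      have "p \<noteq> 1" using p(2) q(1) ne by (cases "p = 1") simp_all
      then obtain i where i: "p = 2 * i + 2 \<or> p = 2 * i + 3" "i < l"
      proof -
        have "p = 2 * ((p - 2) div 2) + 2 \<or> p = 2 * ((p - 2) div 2) + 3" using \<open>p \<noteq> 0\<close> \<open>p \<noteq> 1\<close> by (rule pred2_split)
        moreover have "(p - 2) div 2 < l" using p(1) l \<open>p \<noteq> 0\<close> \<open>p \<noteq> 1\<close> by auto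
        ultimately show ?thesis using that by blast
      qed
      have three: "\<pi> (2 * i + 2) div 2 = \<pi> 0 div 2" "\<pi> (2 * i + 3) div 2 = \<pi> 0 div 2"
        using i(1) sm[OF i(2)] p(2) q(1) by auto
      have inj: "\<pi> a = \<pi> b \<longleftrightarrow> a = b" for a b using permutes_inj[OF \<pi>] by (auto dest: injD)
      have "\<pi> (2 * i + 2) \<noteq> \<pi> 0" "\<pi> (2 * i + 3) \<noteq> \<pi> 0" "\<pi> (2 * i + 2) \<noteq> \<pi> (2 * i + 3)"
        by (simp_all add: inj)
      then show False using three_same_half[OF three] by blast
    qed
  qed
  have c_eq: "c j = c k" if jk: "j < ?n" "k < ?n" for j k
  proof (cases "j = k")
    case False
    define \<rho> where "\<rho> = tr (2 * j) (2 * k) \<circ> tr (2 * j + 1) (2 * k + 1)"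
    have p: "tr (2 * j) (2 * k) permutes {..<2 * ?n}" "tr (2 * j + 1) (2 * k + 1) permutes {..<2 * ?n}"
      using jk by (auto intro!: permutes_swap_id)
    have tp: "tr j k permutes {..<?n}" using jk by (intro permutes_swap_id) auto
    have rp: "\<rho> permutes {..<2 * ?n}" unfolding \<rho>_def using p by (intro permutes_compose)
    have "sign \<rho> = sign (tr (2 * j) (2 * k)) * sign (tr (2 * j + 1) (2 * k + 1))"
      unfolding \<rho>_def by (intro sign_compose permutation_swap_id)
    then have sr: "sign \<rho> = 1" using False by (simp add: sign_swap_id)
    have r1: "\<rho> (2 * i) = 2 * tr j k i" for i
      by (auto simp: \<rho>_def Transposition.transpose_def)
    have r2: "\<rho> (2 * i + 1) = 2 * tr j k i + 1" for i
      by (auto simp: \<rho>_def Transposition.transpose_def)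
    have r: "\<rho> x div 2 = tr j k (x div 2) \<and> (even (\<rho> x) \<longleftrightarrow> even x)" for x
    proof (cases "even x")
      case True then show ?thesis using r1[of "x div 2"] by auto
    next
      case False
      then have e: "2 * (x div 2) + 1 = x" by presburger
      have "\<rho> x = 2 * tr j k (x div 2) + 1" using r2[of "x div 2"] unfolding e .
      then show ?thesis using False by simp
    qed
    have E\<rho>: "?E (\<rho> x) (\<rho> y) = ?E x y" if "x < 2 * ?n" "y < 2 * ?n" for x y
    proof -
      have "\<rho> x < 2 * ?n" "\<rho> y < 2 * ?n" using permutes_in_image[OF rp] that by auto
      then have "(\<iota> (\<rho> x div 2) :: 'n) = \<iota> (\<rho> y div 2) \<longleftrightarrow> \<rho> x div 2 = \<rho> y div 2"
        "(\<iota> (x div 2) :: 'n) = \<iota> (y div 2) \<longleftrightarrow> x div 2 = y div 2"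
        using that by (auto intro!: iota_eq dv)
      moreover have "\<rho> x div 2 = \<rho> y div 2 \<longleftrightarrow> x div 2 = y div 2" using r[of x] r[of y] inj_eq[OF permutes_inj[OF tp]] by simp
      ultimately show ?thesis unfolding eta_frame_idm using r[of x] r[of y] by simp
    qed
    have "c j = (\<Sum>\<pi> | \<pi> permutes {..<2 * ?n}. of_int (sign \<pi>) * (if (\<rho> \<circ> \<pi>) 0 div 2 = j then ?E ((\<rho> \<circ> \<pi>) 0) ((\<rho> \<circ> \<pi>) 1) * ?R (\<rho> \<circ> \<pi>) else 0))"
      unfolding c_def by (subst sum_perm_sign_left[OF rp]) (simp add: sr)
    also have "\<dots> = c k"
      unfolding c_def
    proof (intro sum.cong refl arg_cong2[of _ _ _ _ "(*)"])
      fix \<pi> assume "\<pi> \<in> {\<pi>. \<pi> permutes {..<2 * ?n}}"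
      then have in\<pi>: "\<pi> p < 2 * ?n \<longleftrightarrow> p < 2 * ?n" for p using permutes_in_image[of \<pi> "{..<2 * ?n}" p] by auto
      have h: "0 < 2 * ?n" "1 < 2 * ?n" "\<And>i. i < l \<Longrightarrow> 2 * i + 2 < 2 * ?n" "\<And>i. i < l \<Longrightarrow> 2 * i + 3 < 2 * ?n"
        using l by simp_all
      have "?E ((\<rho> \<circ> \<pi>) 0) ((\<rho> \<circ> \<pi>) 1) = ?E (\<pi> 0) (\<pi> 1)"
        unfolding o_def by (rule E\<rho>[OF in\<pi>[THEN iffD2, OF h(1)] in\<pi>[THEN iffD2, OF h(2)]])
      moreover have "?R (\<rho> \<circ> \<pi>) = ?R \<pi>"
        unfolding o_def by (intro prod.cong refl E\<rho> in\<pi>[THEN iffD2] h) simp_all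
      moreover have "(\<rho> \<circ> \<pi>) 0 div 2 = j \<longleftrightarrow> \<pi> 0 div 2 = k"
        using r[of "\<pi> 0"] by (auto simp: Transposition.transpose_def split: if_splits)
      ultimately show "(if (\<rho> \<circ> \<pi>) 0 div 2 = j then ?E ((\<rho> \<circ> \<pi>) 0) ((\<rho> \<circ> \<pi>) 1) * ?R (\<rho> \<circ> \<pi>) else 0)
        = (if \<pi> 0 div 2 = k then ?E (\<pi> 0) (\<pi> 1) * ?R \<pi> else 0)" by simp
    qed
    finally show ?thesis .
  qed simp
  have main: "Qf (B # replicate l idm) = (\<Sum>j<?n. B $ \<iota> j $ \<iota> j * c j)" for B :: "complex^'n^'n"
  proof -
    have "Qf (B # replicate l idm) = (\<Sum>\<pi> | \<pi> permutes {..<2 * ?n}. of_int (sign \<pi>) * (eta B (std_frame (\<pi> 0)) (std_frame (\<pi> 1)) * ?R \<pi>))"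
      unfolding Qf_def by (simp add: asum_Cons l del: replicate.simps)
    also have "\<dots> = (\<Sum>\<pi> | \<pi> permutes {..<2 * ?n}. \<Sum>j<?n. B $ \<iota> j $ \<iota> j * (of_int (sign \<pi>) * (if \<pi> 0 div 2 = j then ?E (\<pi> 0) (\<pi> 1) * ?R \<pi> else 0)))"
    proof (rule sum.cong[OF refl])
      fix \<pi> assume "\<pi> \<in> {\<pi>. \<pi> permutes {..<2 * ?n}}"
      then have \<pi>: "\<pi> permutes {..<2 * ?n}" by simp
      have lt: "\<pi> 0 div 2 < ?n" using permutes_in_image[OF \<pi>, of 0] l by (intro dv) simp
      have "(\<Sum>j<?n. B $ \<iota> j $ \<iota> j * (of_int (sign \<pi>) * (if \<pi> 0 div 2 = j then ?E (\<pi> 0) (\<pi> 1) * ?R \<pi> else 0)))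
         = (\<Sum>j<?n. if j = \<pi> 0 div 2 then B $ \<iota> (\<pi> 0 div 2) $ \<iota> (\<pi> 0 div 2) * (of_int (sign \<pi>) * (?E (\<pi> 0) (\<pi> 1) * ?R \<pi>)) else 0)"
        by (intro sum.cong refl) auto
      also have "\<dots> = B $ \<iota> (\<pi> 0 div 2) $ \<iota> (\<pi> 0 div 2) * (of_int (sign \<pi>) * (?E (\<pi> 0) (\<pi> 1) * ?R \<pi>))"
        using lt by simp
      also have "\<dots> = of_int (sign \<pi>) * (eta B (std_frame (\<pi> 0)) (std_frame (\<pi> 1)) * ?R \<pi>)"
      proof (cases "?R \<pi> = 0")
        case False
        then show ?thesis using pair[OF \<pi> False] by (simp add: eta_frame idm_def)
      qed simp
      finally show "of_int (sign \<pi>) * (eta B (std_frame (\<pi> 0)) (std_frame (\<pi> 1)) * ?R \<pi>) =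
        (\<Sum>j<?n. B $ \<iota> j $ \<iota> j * (of_int (sign \<pi>) * (if \<pi> 0 div 2 = j then ?E (\<pi> 0) (\<pi> 1) * ?R \<pi> else 0)))" ..
    qed
    also have "\<dots> = (\<Sum>j<?n. \<Sum>\<pi> | \<pi> permutes {..<2 * ?n}. B $ \<iota> j $ \<iota> j * (of_int (sign \<pi>) * (if \<pi> 0 div 2 = j then ?E (\<pi> 0) (\<pi> 1) * ?R \<pi> else 0)))"
      by (rule sum.swap)
    finally show ?thesis unfolding c_def by (simp add: sum_distrib_left)
  qed
  have c0: "c j = c 0" if "j \<in> {..<?n}" for j using c_eq[of j 0] that l by simp
  have diag: "Qf (B # replicate l idm) = (\<Sum>j\<in>UNIV. B $ j $ j) * c 0" for B :: "complex^'n^'n"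
  proof -
    have "Qf (B # replicate l idm) = (\<Sum>j<?n. B $ \<iota> j $ \<iota> j * c 0)"
      unfolding main by (intro sum.cong refl arg_cong2[of _ _ _ _ "(*)"] c0)
    also have "\<dots> = (\<Sum>j<?n. B $ \<iota> j $ \<iota> j) * c 0" by (rule sum_distrib_right[symmetric])
    also have "(\<Sum>j<?n. B $ \<iota> j $ \<iota> j) = (\<Sum>j\<in>UNIV. B $ j $ j)"
      by (rule sum.reindex_bij_betw[OF iota_bij])
    finally show ?thesis .
  qed
  have a: "Qf (replicate ?n (idm :: complex^'n^'n)) = of_nat ?n * c 0"
    using diag[of idm] by (simp add: l idm_nth)
  have "Qf (A # replicate (?n - 1) idm) = (\<Sum>j\<in>UNIV. A $ j $ j) * c 0"
    using diag[of A] by (simp add: l)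
  then show ?thesis unfolding a by (simp add: mult_ac)
qed

section \<open>Calculus of iterated directional derivatives\<close>

definition dd :: "'a::real_normed_vector \<Rightarrow> ('a \<Rightarrow> real) \<Rightarrow> 'a \<Rightarrow> real" where
  "dd v f = (\<lambda>x. frechet_derivative f (at x) v)"

lemma Ck_Suc: "Ck_on (Suc k) f S \<longleftrightarrow> (\<forall>x\<in>S. f differentiable (at x)) \<and> (\<forall>v. Ck_on k (dd v f) S)"
  by (simp add: dd_def)

lemmas [simp del] = Ck_on.simps(2)

lemma dd_eq: assumes "(f has_derivative f') (at x)" shows "dd v f x = f' v"
  unfolding dd_def using fun_cong[OF frechet_derivative_at[OF assms], of v] by simp

lemma has_derivative_dd: "f differentiable (at x) \<Longrightarrow> (f has_derivative (\<lambda>v. dd v f x)) (at x)"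
  unfolding dd_def by (simp add: frechet_derivative_works)

lemma differentiable_cong_open:
  assumes "open S" "x \<in> S" "\<And>y. y \<in> S \<Longrightarrow> f y = g y" "f differentiable (at x)"
  shows "g differentiable (at x)"
proof -
  obtain f' where "(f has_derivative f') (at x)" using assms(4) unfolding differentiable_def by blast
  then have "(g has_derivative f') (at x)"
    by (rule has_derivative_transform_within_open[OF _ assms(1,2,3)])
  then show ?thesis unfolding differentiable_def by blast
qed

lemma dd_cong_open:
  assumes "open S" "x \<in> S" "\<And>y. y \<in> S \<Longrightarrow> f y = g y" shows "dd v f x = dd v g x"
proof -
  have "(f has_derivative f') (at x) \<longleftrightarrow> (g has_derivative f') (at x)" for f'
    using has_derivative_transform_within_open[OF _ assms(1,2), of f f' UNIV g] assms(3)
      has_derivative_transform_within_open[OF _ assms(1,2), of g f' UNIV f] by auto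
  then show ?thesis unfolding dd_def frechet_derivative_def by simp
qed

lemma Ck_cong:
  assumes "open S" shows "(\<And>x. x \<in> S \<Longrightarrow> f x = g x) \<Longrightarrow> Ck_on k f S \<Longrightarrow> Ck_on k g S"
proof (induction k arbitrary: f g)
  case 0 then show ?case by (simp cong: continuous_on_cong)
next
  case (Suc k)
  have "dd v f x = dd v g x" if "x \<in> S" for v x
    by (rule dd_cong_open[OF assms that]) (rule Suc.prems(1))
  then have "Ck_on k (dd v g) S" for v
    using Suc.IH[of "dd v f" "dd v g"] Suc.prems(2) unfolding Ck_Suc by blast
  moreover have "g differentiable (at x)" if "x \<in> S" for x
    using differentiable_cong_open[OF assms that, of f g] Suc.prems that unfolding Ck_Suc by blast
  ultimately show ?case unfolding Ck_Suc by blast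
qed

lemma Ck_subset: "Ck_on k f S \<Longrightarrow> T \<subseteq> S \<Longrightarrow> Ck_on k f T"
proof (induction k arbitrary: f)
  case 0 then show ?case by (auto intro: continuous_on_subset)
next
  case (Suc k) then show ?case unfolding Ck_Suc by blast
qed

lemma Ck_cont: "Ck_on k f S \<Longrightarrow> continuous_on S f"
proof (cases k)
  case (Suc j)
  assume "Ck_on k f S"
  then have "f differentiable (at x)" if "x \<in> S" for x using that unfolding Suc Ck_Suc by blast
  then show ?thesis
    by (intro continuous_at_imp_continuous_on ballI differentiable_imp_continuous_within) auto
qed simp

lemma Ck_Suc_imp: "Ck_on (Suc k) f S \<Longrightarrow> Ck_on k f S"
proof (induction k arbitrary: f)
  case 0 then show ?case using Ck_cont by auto
next
  case (Suc k) then show ?case unfolding Ck_Suc[of "Suc k"] Ck_Suc[of k] by blast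
qed

lemma Ck_le: "Ck_on k f S \<Longrightarrow> j \<le> k \<Longrightarrow> Ck_on j f S"
proof (induction "k - j" arbitrary: k)
  case (Suc n)
  then obtain k' where "k = Suc k'" by (cases k) auto
  moreover have "n = k' - j" "j \<le> k'" using Suc.hyps(2) calculation by arith+
  ultimately show ?case using Suc.hyps(1)[of k'] Suc.prems(1) Ck_Suc_imp[of k' f S] by blast
qed simp

lemma Ck_dd: "Ck_on (Suc k) f S \<Longrightarrow> Ck_on k (dd v f) S" unfolding Ck_Suc by blast
lemma Ck_diff: "Ck_on (Suc k) f S \<Longrightarrow> x \<in> S \<Longrightarrow> f differentiable (at x)" unfolding Ck_Suc by blast

lemma dd_const [simp]: "dd v (\<lambda>_. c) = (\<lambda>_. 0)"
  by (rule ext, rule dd_eq) (rule has_derivative_const)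

lemma Ck_const: "Ck_on k (\<lambda>_. c) S"
  by (induction k arbitrary: c) (auto simp: Ck_Suc)

lemma dd_add: "f differentiable (at x) \<Longrightarrow> g differentiable (at x) \<Longrightarrow> dd v (\<lambda>y. f y + g y) x = dd v f x + dd v g x"
  by (rule dd_eq[OF has_derivative_add[OF has_derivative_dd has_derivative_dd]])
lemma dd_cmult: "f differentiable (at x) \<Longrightarrow> dd v (\<lambda>y. c * f y) x = c * dd v f x"
  by (rule dd_eq[OF has_derivative_mult_right[OF has_derivative_dd]])
lemma dd_mult: "f differentiable (at x) \<Longrightarrow> g differentiable (at x) \<Longrightarrow> dd v (\<lambda>y. f y * g y) x = f x * dd v g x + dd v f x * g x"
  by (rule dd_eq[OF has_derivative_mult[OF has_derivative_dd has_derivative_dd]])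

lemma Ck_add:
  assumes "open S" shows "Ck_on k f S \<Longrightarrow> Ck_on k g S \<Longrightarrow> Ck_on k (\<lambda>x. f x + g x) S"
proof (induction k arbitrary: f g)
  case 0 then show ?case by (auto intro: continuous_intros)
next
  case (Suc k)
  have "Ck_on k (dd v (\<lambda>x. f x + g x)) S" for v
    by (rule Ck_cong[OF assms _ Suc.IH[OF Ck_dd[OF Suc.prems(1)] Ck_dd[OF Suc.prems(2)]]])
      (use Suc.prems in \<open>auto simp: dd_add Ck_diff\<close>)
  then show ?case using Suc.prems unfolding Ck_Suc by auto
qed

lemma Ck_mult:
  assumes "open S" shows "Ck_on k f S \<Longrightarrow> Ck_on k g S \<Longrightarrow> Ck_on k (\<lambda>x. f x * g x) S"
proof (induction k arbitrary: f g)
  case 0 then show ?case by (auto intro: continuous_intros)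
next
  case (Suc k)
  have "Ck_on k (\<lambda>x. f x * dd v g x + dd v f x * g x) S" for v
    by (intro Ck_add assms Suc.IH Ck_dd Suc.prems Ck_Suc_imp)
  then have "Ck_on k (dd v (\<lambda>x. f x * g x)) S" for v
    by (rule Ck_cong[OF assms, rotated]) (use Suc.prems in \<open>auto simp: dd_mult Ck_diff\<close>)
  then show ?case using Suc.prems unfolding Ck_Suc by (auto intro: differentiable_mult)
qed

lemma Ck_cmult: "open S \<Longrightarrow> Ck_on k f S \<Longrightarrow> Ck_on k (\<lambda>x. c * f x) S"
  by (intro Ck_mult Ck_const)

lemma Ck_diff_fun: "open S \<Longrightarrow> Ck_on k f S \<Longrightarrow> Ck_on k g S \<Longrightarrow> Ck_on k (\<lambda>x. f x - g x) S"
  using Ck_add[of S k f "\<lambda>x. (-1) * g x"] Ck_cmult[of S k g "-1"] by simp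

lemma Ck_prod: "open S \<Longrightarrow> (\<And>i. i \<in> I \<Longrightarrow> Ck_on k (f i) S) \<Longrightarrow> Ck_on k (\<lambda>x. \<Prod>i\<in>I. f i x) S"
  by (induction I rule: infinite_finite_induct) (auto intro: Ck_const Ck_mult)

lemma dd_linear: "bounded_linear f \<Longrightarrow> dd v f = (\<lambda>_. f v)"
  by (rule ext, rule dd_eq) (rule bounded_linear_imp_has_derivative)

lemma Ck_linear: "bounded_linear f \<Longrightarrow> Ck_on k f S"
proof (cases k)
  case 0
  assume "bounded_linear f" then show ?thesis unfolding 0 by (simp add: linear_continuous_on)
next
  case (Suc j)
  assume "bounded_linear f"
  then show ?thesis unfolding Suc Ck_Suc
    by (auto simp: dd_linear Ck_const intro: bounded_linear_imp_differentiable)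
qed

lemma dd_compose:
  assumes "g differentiable (at x)" "(F has_real_derivative F') (at (g x))"
  shows "dd v (\<lambda>y. F (g y)) x = F' * dd v g x" "(\<lambda>y. F (g y)) differentiable (at x)"
proof -
  have "((\<lambda>y. F (g y)) has_derivative (\<lambda>v. F' * dd v g x)) (at x)"
    using has_derivative_compose[OF has_derivative_dd[OF assms(1)] has_field_derivative_imp_has_derivative[OF assms(2)]] by simp
  then show "dd v (\<lambda>y. F (g y)) x = F' * dd v g x" "(\<lambda>y. F (g y)) differentiable (at x)"
    by (auto simp: dd_eq differentiable_def)
qed

lemma Ck_comp:
  assumes "open S" "g ` S \<subseteq> I"
  shows "(\<And>j t. j < k \<Longrightarrow> t \<in> I \<Longrightarrow> (F j has_real_derivative F (Suc j) t) (at t)) \<Longrightarrow> continuous_on I (F k) \<Longrightarrow>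
    Ck_on k g S \<Longrightarrow> Ck_on k (\<lambda>x. F 0 (g x)) S"
proof (induction k arbitrary: F)
  case 0 then show ?case using assms by (auto intro: continuous_on_compose2)
next
  case (Suc k)
  have IH: "Ck_on k (\<lambda>x. F (Suc 0) (g x)) S"
    by (rule Suc.IH[of "\<lambda>j. F (Suc j)"]) (use Suc.prems Ck_Suc_imp in auto)
  have d: "(F 0 has_real_derivative F (Suc 0) (g x)) (at (g x))" if "x \<in> S" for x
    using Suc.prems(1)[of 0 "g x"] assms(2) that by auto
  have cm: "Ck_on k (\<lambda>x. F (Suc 0) (g x) * dd v g x) S" for v
    by (intro Ck_mult assms(1) IH Ck_dd[OF Suc.prems(3)])
  have "Ck_on k (dd v (\<lambda>x. F 0 (g x))) S" for v
    by (rule Ck_cong[OF assms(1) _ cm[of v]])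
      (use dd_compose(1)[OF Ck_diff[OF Suc.prems(3)] d] in simp)
  then show ?case unfolding Ck_Suc using dd_compose(2)[OF Ck_diff[OF Suc.prems(3)] d] by blast
qed

lemma Ck_union:
  assumes "open A" "open B" shows "Ck_on k f A \<Longrightarrow> Ck_on k f B \<Longrightarrow> Ck_on k f (A \<union> B)"
proof (induction k arbitrary: f)
  case 0 then show ?case using assms by (simp add: continuous_on_open_Un)
next
  case (Suc k) then show ?case unfolding Ck_Suc by blast
qed

text \<open>A function supported in a closed subset of \<open>S\<close> is regular on the whole space, because it vanishes
  on the complementary open set.\<close>
lemma Ck_extend:
  assumes "open S" "closed K" "K \<subseteq> S" "\<And>x. x \<notin> K \<Longrightarrow> f x = 0" "Ck_on k f S"
  shows "Ck_on k f UNIV"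
proof -
  have "Ck_on k f (- K)"
    by (rule Ck_cong[OF _ _ Ck_const[of k 0]]) (use assms in auto)
  then have "Ck_on k f (S \<union> - K)" using assms by (intro Ck_union) auto
  moreover have "S \<union> - K = UNIV" using assms by auto
  ultimately show ?thesis by simp
qed

lemma dd_zero_off:
  assumes "closed K" "\<And>x. x \<notin> K \<Longrightarrow> f x = 0" "x \<notin> K" shows "dd v f x = 0"
  using dd_cong_open[of "- K" x f "\<lambda>_. 0" v] assms by auto

lemma dd_dir_lin:
  assumes "f differentiable (at x)"
  shows "dd (a *\<^sub>R v + b *\<^sub>R w) f x = a * dd v f x + b * dd w f x"
proof -
  have l: "linear (\<lambda>v. dd v f x)" using has_derivative_linear[OF has_derivative_dd[OF assms]] .
  show ?thesis
    using linear_add[OF l, of "a *\<^sub>R v" "b *\<^sub>R w"] linear_scale[OF l, of a v] linear_scale[OF l, of b w] by simp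
qed

lemma dd_affine:
  assumes "f differentiable (at (c - x))"
  shows "dd v (\<lambda>y. f (c - y)) x = - dd v f (c - x)" "(\<lambda>y. f (c - y)) differentiable (at x)"
proof -
  have "((\<lambda>y. c - y) has_derivative (\<lambda>v. - v)) (at x)" by (auto intro!: derivative_eq_intros)
  from has_derivative_compose[OF this has_derivative_dd[OF assms]]
  have h: "((\<lambda>y. f (c - y)) has_derivative (\<lambda>v. dd (- v) f (c - x))) (at x)" .
  have "dd (- v) f (c - x) = - dd v f (c - x)" using dd_dir_lin[OF assms, of "-1" v 0 v] by simp
  then show "dd v (\<lambda>y. f (c - y)) x = - dd v f (c - x)" using dd_eq[OF h] by simp
  show "(\<lambda>y. f (c - y)) differentiable (at x)" using h by (auto simp: differentiable_def)
qed

lemma Ck_affine: "Ck_on k f UNIV \<Longrightarrow> Ck_on k (\<lambda>y. f (c - y)) UNIV"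
proof (induction k arbitrary: f)
  case 0 then show ?case by (auto intro!: continuous_on_compose2[of UNIV f] continuous_intros)
next
  case (Suc k)
  have d: "f differentiable (at x)" for x using Suc.prems by (auto simp: Ck_Suc)
  have "Ck_on k (\<lambda>y. (-1) * dd v f (c - y)) UNIV" for v
    by (intro Ck_cmult Suc.IH Ck_dd[OF Suc.prems]) simp
  then have "Ck_on k (dd v (\<lambda>y. f (c - y))) UNIV" for v
    by (rule Ck_cong[OF open_UNIV, rotated]) (simp add: dd_affine d)
  then show ?case unfolding Ck_Suc using dd_affine(2)[OF d] by blast
qed

lemma dd_shift:
  assumes "f differentiable (at (x + c))"
  shows "dd v (\<lambda>y. f (y + c)) x = dd v f (x + c)" "(\<lambda>y. f (y + c)) differentiable (at x)"
proof -
  have "((\<lambda>y. y + c) has_derivative (\<lambda>v. v)) (at x)" by (auto intro!: derivative_eq_intros)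
  from has_derivative_compose[OF this has_derivative_dd[OF assms]]
  have h: "((\<lambda>y. f (y + c)) has_derivative (\<lambda>v. dd v f (x + c))) (at x)" .
  show "dd v (\<lambda>y. f (y + c)) x = dd v f (x + c)" using dd_eq[OF h] by simp
  show "(\<lambda>y. f (y + c)) differentiable (at x)" using h by (auto simp: differentiable_def)
qed

lemma Ck_shift: "Ck_on k f UNIV \<Longrightarrow> Ck_on k (\<lambda>y. f (y + c)) UNIV"
proof (induction k arbitrary: f)
  case 0 then show ?case by (auto intro!: continuous_on_compose2[of UNIV f] continuous_intros)
next
  case (Suc k)
  have d: "f differentiable (at x)" for x using Suc.prems by (auto simp: Ck_Suc)
  have "Ck_on k (\<lambda>y. dd v f (y + c)) UNIV" for v
    by (rule Suc.IH[OF Ck_dd[OF Suc.prems]])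
  then have "Ck_on k (dd v (\<lambda>y. f (y + c))) UNIV" for v
    by (rule Ck_cong[OF open_UNIV, rotated]) (simp add: dd_shift d)
  then show ?case unfolding Ck_Suc using dd_shift(2)[OF d] by blast
qed

lemma line_derivative:
  assumes "f differentiable (at (x + t *\<^sub>R v))"
  shows "((\<lambda>t. f (x + t *\<^sub>R v)) has_real_derivative dd v f (x + t *\<^sub>R v)) (at t)"
proof -
  have "((\<lambda>t. x + t *\<^sub>R v) has_derivative (\<lambda>h. h *\<^sub>R v)) (at t)" by (auto intro!: derivative_eq_intros)
  from has_derivative_compose[OF this has_derivative_dd[OF assms]]
  have "((\<lambda>t. f (x + t *\<^sub>R v)) has_derivative (\<lambda>h. dd (h *\<^sub>R v) f (x + t *\<^sub>R v))) (at t)" .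
  moreover have "dd (h *\<^sub>R v) f (x + t *\<^sub>R v) = dd v f (x + t *\<^sub>R v) * h" for h
    using dd_dir_lin[OF assms, of h v 0 v] by simp
  ultimately show ?thesis unfolding has_field_derivative_def by simp
qed

text \<open>The mean value theorem applied twice.\<close>
lemma second_difference:
  assumes f: "Ck_on 2 f S" and s: "0 < s" and sub: "\<And>a b. 0 \<le> a \<Longrightarrow> a \<le> s \<Longrightarrow> 0 \<le> b \<Longrightarrow> b \<le> s \<Longrightarrow> x + a *\<^sub>R v + b *\<^sub>R w \<in> S"
  shows "\<exists>a b. 0 < a \<and> a < s \<and> 0 < b \<and> b < s \<and>
    f (x + s *\<^sub>R v + s *\<^sub>R w) - f (x + s *\<^sub>R v) - f (x + s *\<^sub>R w) + f x = s\<^sup>2 * dd w (dd v f) (x + a *\<^sub>R v + b *\<^sub>R w)"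
proof -
  have f2: "Ck_on (Suc (Suc 0)) f S" using f by (simp add: numeral_2_eq_2)
  have d1: "f differentiable (at y)" if "y \<in> S" for y using f2 that by (rule Ck_diff)
  have d2: "dd v f differentiable (at y)" if "y \<in> S" for y using Ck_dd[OF f2] that by (rule Ck_diff)
  have D1: "((\<lambda>t. f ((x + s *\<^sub>R w) + t *\<^sub>R v) - f (x + t *\<^sub>R v)) has_real_derivative
      dd v f ((x + s *\<^sub>R w) + t *\<^sub>R v) - dd v f (x + t *\<^sub>R v)) (at t)" if "0 \<le> t" "t \<le> s" for t
  proof (intro DERIV_diff line_derivative d1)
    show "x + s *\<^sub>R w + t *\<^sub>R v \<in> S" using sub[of t s] that s by (simp add: add_ac)
    show "x + t *\<^sub>R v \<in> S" using sub[of t 0] that s by simp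
  qed
  obtain a where a: "0 < a" "a < s" "(f ((x + s *\<^sub>R w) + s *\<^sub>R v) - f (x + s *\<^sub>R v)) - (f ((x + s *\<^sub>R w) + 0 *\<^sub>R v) - f (x + 0 *\<^sub>R v))
     = (s - 0) * (dd v f ((x + s *\<^sub>R w) + a *\<^sub>R v) - dd v f (x + a *\<^sub>R v))"
    using MVT2[OF s D1] by blast
  have D2: "((\<lambda>t. dd v f ((x + a *\<^sub>R v) + t *\<^sub>R w)) has_real_derivative dd w (dd v f) ((x + a *\<^sub>R v) + t *\<^sub>R w)) (at t)"
    if "0 \<le> t" "t \<le> s" for t
    by (intro line_derivative d2 sub) (use a that in auto)
  obtain b where b: "0 < b" "b < s" "dd v f ((x + a *\<^sub>R v) + s *\<^sub>R w) - dd v f ((x + a *\<^sub>R v) + 0 *\<^sub>R w) = (s - 0) * dd w (dd v f) ((x + a *\<^sub>R v) + b *\<^sub>R w)"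
    using MVT2[OF s D2] by blast
  have "f (x + s *\<^sub>R v + s *\<^sub>R w) - f (x + s *\<^sub>R v) - f (x + s *\<^sub>R w) + f x
     = s * (dd v f (x + a *\<^sub>R v + s *\<^sub>R w) - dd v f (x + a *\<^sub>R v))"
    using a(3) by (simp add: add_ac)
  also have "\<dots> = s * (s * dd w (dd v f) (x + a *\<^sub>R v + b *\<^sub>R w))" using b(3) by simp
  finally show ?thesis using a b by (intro exI[of _ a] exI[of _ b]) (simp add: power2_eq_square)
qed

text \<open>The second difference quotient is symmetric in the two directions, and by \<open>second_difference\<close> it
  is close to each of the two mixed derivatives.\<close>
lemma dd_commute:
  fixes x :: "'a::real_normed_vector"
  assumes f: "Ck_on 2 f S" and S: "open S" "x \<in> S"
  shows "dd v (dd w f) x = dd w (dd v f) x"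
proof (rule ccontr)
  assume ne: "dd v (dd w f) x \<noteq> dd w (dd v f) x"
  define e where "e = \<bar>dd v (dd w f) x - dd w (dd v f) x\<bar> / 2"
  have e: "e > 0" using ne by (simp add: e_def)
  have f2: "Ck_on (Suc (Suc 0)) f S" using f by (simp add: numeral_2_eq_2)
  have c: "continuous_on S (dd p (dd q f))" for p q
    using Ck_cont[OF Ck_dd[OF Ck_dd[OF f2]]] .
  have nh: "\<exists>r>0. \<forall>y. dist y x < r \<longrightarrow> y \<in> S \<and> \<bar>dd p (dd q f) y - dd p (dd q f) x\<bar> < e" for p q
  proof -
    obtain r1 where r1: "r1 > 0" "ball x r1 \<subseteq> S" using S open_contains_ball by blast
    obtain r2 where r2: "r2 > 0" "\<And>y. y \<in> S \<Longrightarrow> dist y x < r2 \<Longrightarrow> dist (dd p (dd q f) y) (dd p (dd q f) x) < e"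
      using c[of p q] S(2) e unfolding continuous_on_iff by blast
    have "y \<in> S \<and> \<bar>dd p (dd q f) y - dd p (dd q f) x\<bar> < e" if "dist y x < min r1 r2" for y
      using that r1 r2(2)[of y] by (auto simp: subset_iff dist_commute dist_real_def)
    then show ?thesis using r1(1) r2(1) by (intro exI[of _ "min r1 r2"]) auto
  qed
  obtain r1 where r1: "r1 > 0" "\<And>y. dist y x < r1 \<Longrightarrow> y \<in> S \<and> \<bar>dd v (dd w f) y - dd v (dd w f) x\<bar> < e" using nh by blast
  obtain r2 where r2: "r2 > 0" "\<And>y. dist y x < r2 \<Longrightarrow> y \<in> S \<and> \<bar>dd w (dd v f) y - dd w (dd v f) x\<bar> < e" using nh by blast
  define N where "N = norm v + norm w + 1"
  define s where "s = min r1 r2 / (2 * N)"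
  have nn: "N > 0" by (simp add: N_def add_nonneg_pos)
  have s: "s > 0" using r1 r2 nn by (simp add: s_def)
  have sm: "s * N = min r1 r2 / 2" using nn by (simp add: s_def)
  have near: "dist (x + a *\<^sub>R v + b *\<^sub>R w) x < min r1 r2" if "0 \<le> a" "a \<le> s" "0 \<le> b" "b \<le> s" for a b
  proof -
    have "dist (x + a *\<^sub>R v + b *\<^sub>R w) x = norm (a *\<^sub>R v + b *\<^sub>R w)" by (simp add: dist_norm add.assoc)
    also have "\<dots> \<le> a * norm v + b * norm w" using that by (intro order_trans[OF norm_triangle_ineq]) simp
    also have "\<dots> \<le> s * norm v + s * norm w" using that by (intro add_mono mult_right_mono) auto
    also have "\<dots> < s * N" using s by (simp add: N_def algebra_simps)
    also have "\<dots> < min r1 r2" unfolding sm using r1 r2 by auto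
    finally show ?thesis .
  qed
  have near': "dist (x + a *\<^sub>R w + b *\<^sub>R v) x < min r1 r2" if "0 \<le> a" "a \<le> s" "0 \<le> b" "b \<le> s" for a b
    using near[of b a] that by (simp add: add_ac)
  obtain a b where ab: "0 < a" "a < s" "0 < b" "b < s"
    "f (x + s *\<^sub>R v + s *\<^sub>R w) - f (x + s *\<^sub>R v) - f (x + s *\<^sub>R w) + f x = s\<^sup>2 * dd w (dd v f) (x + a *\<^sub>R v + b *\<^sub>R w)"
    using second_difference[OF f s, of x v w] near r1(2) by force
  obtain a' b' where ab': "0 < a'" "a' < s" "0 < b'" "b' < s"
    "f (x + s *\<^sub>R w + s *\<^sub>R v) - f (x + s *\<^sub>R w) - f (x + s *\<^sub>R v) + f x = s\<^sup>2 * dd v (dd w f) (x + a' *\<^sub>R w + b' *\<^sub>R v)"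
    using second_difference[OF f s, of x w v] near' r1(2) by force
  have "f (x + s *\<^sub>R w + s *\<^sub>R v) = f (x + s *\<^sub>R v + s *\<^sub>R w)" by (simp add: add_ac)
  then have "s\<^sup>2 * dd v (dd w f) (x + a' *\<^sub>R w + b' *\<^sub>R v) = s\<^sup>2 * dd w (dd v f) (x + a *\<^sub>R v + b *\<^sub>R w)"
    using ab(5) ab'(5) by linarith
  then have eq: "dd v (dd w f) (x + a' *\<^sub>R w + b' *\<^sub>R v) = dd w (dd v f) (x + a *\<^sub>R v + b *\<^sub>R w)" using s by simp
  have "\<bar>dd v (dd w f) (x + a' *\<^sub>R w + b' *\<^sub>R v) - dd v (dd w f) x\<bar> < e" using r1(2) near'[of a' b'] ab' by auto
  moreover have "\<bar>dd w (dd v f) (x + a *\<^sub>R v + b *\<^sub>R w) - dd w (dd v f) x\<bar> < e" using r2(2) near[of a b] ab by auto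
  moreover have "2 * e = \<bar>dd v (dd w f) x - dd w (dd v f) x\<bar>" by (simp add: e_def)
  ultimately show False unfolding eq by arith
qed

section \<open>A smooth bump function\<close>

lemma poly_exp_lim: "((\<lambda>x. poly q x * exp (- x)) \<longlongrightarrow> 0) (at_top :: real filter)"
proof -
  have "((\<lambda>x. \<Sum>i\<le>degree q. coeff q i * (x ^ i / exp x)) \<longlongrightarrow> (\<Sum>i\<le>degree q. coeff q i * 0)) at_top"
    by (intro tendsto_intros tendsto_power_div_exp_0)
  moreover have "(\<Sum>i\<le>degree q. coeff q i * (x ^ i / exp x)) = poly q x * exp (- x)" for x
    by (simp add: poly_altdef sum_distrib_right exp_minus divide_inverse mult.assoc)
  ultimately show ?thesis by simp
qed

primrec bp :: "nat \<Rightarrow> real poly" where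
  "bp 0 = 1"
| "bp (Suc j) = [:0, 0, 1:] * (bp j - pderiv (bp j))"

text \<open>The functions \<open>p(1/t) exp(-1/t)\<close> on the positive axis that arise as derivatives of
  \<open>exp(-1/t)\<close>, extended by zero; the polynomials are generated by the recursion for the derivative.\<close>
definition bE :: "nat \<Rightarrow> real \<Rightarrow> real" where
  "bE j t = (if t > 0 then poly (bp j) (1 / t) * exp (- (1 / t)) else 0)"

lemma bE_deriv: "(bE j has_real_derivative bE (Suc j) t) (at t)"
proof (cases t "0::real" rule: linorder_cases)
  case less
  have "((\<lambda>_. 0) has_real_derivative 0) (at t)" by simp
  then have "(bE j has_real_derivative 0) (at t)"
    by (rule has_field_derivative_transform_within_open[of _ _ _ "{..<0}"]) (use less in \<open>auto simp: bE_def\<close>)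
  then show ?thesis using less by (simp add: bE_def)
next
  case greater
  have "((\<lambda>t. poly (bp j) (1 / t) * exp (- (1 / t))) has_real_derivative
     (poly (pderiv (bp j)) (1 / t) * (- (1 / t\<^sup>2))) * exp (- (1 / t)) + poly (bp j) (1 / t) * (exp (- (1 / t)) * (1 / t\<^sup>2))) (at t)"
    using greater
    by (auto intro!: derivative_eq_intros DERIV_chain2[of "poly (bp j)"] poly_DERIV simp: power2_eq_square divide_inverse mult_ac)
  moreover have "(poly (pderiv (bp j)) (1 / t) * (- (1 / t\<^sup>2))) * exp (- (1 / t)) + poly (bp j) (1 / t) * (exp (- (1 / t)) * (1 / t\<^sup>2)) = bE (Suc j) t"
    using greater by (simp add: bE_def power2_eq_square algebra_simps)
  ultimately have "((\<lambda>t. poly (bp j) (1 / t) * exp (- (1 / t))) has_real_derivative bE (Suc j) t) (at t)" by simp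
  then show ?thesis
    by (rule has_field_derivative_transform_within_open[of _ _ _ "{0<..}"]) (use greater in \<open>auto simp: bE_def\<close>)
next
  case equal
  have "((\<lambda>h. bE j h / h) \<longlongrightarrow> 0) (at_right 0)"
  proof -
    have "((\<lambda>x. poly ([:0, 1:] * bp j) (inverse x) * exp (- (inverse x))) \<longlongrightarrow> 0) (at_right (0::real))"
      by (rule filterlim_compose[OF poly_exp_lim filterlim_inverse_at_top_right])
    then show ?thesis
      by (rule Lim_transform_eventually) (auto simp: eventually_at_filter bE_def divide_inverse mult_ac)
  qed
  moreover have "((\<lambda>h. bE j h / h) \<longlongrightarrow> 0) (at_left 0)"
    by (rule Lim_transform_eventually[of "\<lambda>_. 0"]) (auto simp: eventually_at_filter bE_def)
  ultimately have "((\<lambda>h. bE j h / h) \<longlongrightarrow> 0) (at 0)" by (simp add: filterlim_at_split)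
  then show ?thesis unfolding equal by (simp add: DERIV_def bE_def)
qed

definition bump :: "real \<Rightarrow> 'a::euclidean_space \<Rightarrow> real" where
  "bump \<epsilon> x = bE 0 (\<epsilon>\<^sup>2 - x \<bullet> x)"

lemma dd_inner_self: "dd v (\<lambda>x::'a::real_inner. x \<bullet> x) = (\<lambda>x. 2 * (x \<bullet> v))"
proof
  fix x :: 'a
  have "((\<lambda>x. x \<bullet> x) has_derivative (\<lambda>v. x \<bullet> v + v \<bullet> x)) (at x)" by (auto intro!: derivative_eq_intros)
  from dd_eq[OF this, of v] show "dd v (\<lambda>x. x \<bullet> x) x = 2 * (x \<bullet> v)" by (simp add: inner_commute)
qed

lemma Ck_inner_self: "Ck_on k (\<lambda>x::'a::real_inner. x \<bullet> x) S"
proof (cases k)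
  case 0 then show ?thesis by (auto intro!: continuous_intros)
next
  case (Suc j)
  have "Ck_on j (\<lambda>x. 2 * (x \<bullet> v)) S" for v :: 'a
    by (intro Ck_linear bounded_linear_intros)
  moreover have "(\<lambda>x::'a. x \<bullet> x) differentiable (at x)" for x by (auto intro!: derivative_intros)
  ultimately show ?thesis unfolding Suc Ck_Suc dd_inner_self by blast
qed

lemma Ck_bump: "Ck_on k (bump \<epsilon>) UNIV"
proof -
  have "Ck_on k (\<lambda>x::'a. bE 0 (\<epsilon>\<^sup>2 - x \<bullet> x)) UNIV"
    by (rule Ck_comp[of UNIV _ UNIV k bE])
      (auto intro: bE_deriv Ck_diff_fun Ck_const Ck_inner_self DERIV_continuous_on)
  then show ?thesis unfolding bump_def[abs_def] .
qed

lemma bump_nonneg: "0 \<le> bump \<epsilon> x" by (simp add: bump_def bE_def)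

lemma bump_pos: "norm x < \<epsilon> \<Longrightarrow> 0 < bump \<epsilon> x"
proof -
  assume "norm x < \<epsilon>"
  then have "(norm x)\<^sup>2 < \<epsilon>\<^sup>2" by (intro power_strict_mono) auto
  then show ?thesis by (simp add: bump_def bE_def power2_norm_eq_inner)
qed

lemma bump_zero: "0 < \<epsilon> \<Longrightarrow> \<epsilon> \<le> norm x \<Longrightarrow> bump \<epsilon> x = 0"
proof -
  assume "0 < \<epsilon>" "\<epsilon> \<le> norm x"
  then have "\<epsilon>\<^sup>2 \<le> (norm x)\<^sup>2" by (intro power_mono) auto
  then show ?thesis by (simp add: bump_def bE_def power2_norm_eq_inner)
qed

section \<open>Integration by parts and convolution\<close>

definition csupp :: "('a::real_normed_vector \<Rightarrow> real) \<Rightarrow> bool" where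
  "csupp f \<longleftrightarrow> (\<exists>B. \<forall>x. B < norm x \<longrightarrow> f x = 0)"

lemma csupp_bounded: "bounded K \<Longrightarrow> (\<And>x. x \<notin> K \<Longrightarrow> f x = 0) \<Longrightarrow> csupp f"
  unfolding csupp_def bounded_iff by (metis not_le)

lemma cbox_supp:
  fixes f :: "'a::euclidean_space \<Rightarrow> real"
  assumes "bounded K" "\<And>x. x \<notin> K \<Longrightarrow> f x = 0"
  obtains a where "\<And>x. x \<notin> cbox (-a) a \<Longrightarrow> f x = 0"
proof -
  obtain a where "K \<subseteq> cbox (-a) a" using bounded_subset_cbox_symmetric[OF assms(1)] .
  then show ?thesis using assms(2) that by blast
qed

lemma cc_int:
  fixes f :: "'a::euclidean_space \<Rightarrow> real"
  assumes "continuous_on (cbox a b) f" "\<And>x. x \<notin> cbox a b \<Longrightarrow> f x = 0"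
  shows "integrable lborel f" "integral\<^sup>L lborel f = integral (cbox a b) f"
proof -
  have e: "f = (\<lambda>x. indicator (cbox a b) x *\<^sub>R f x)" using assms(2) by (auto simp: fun_eq_iff indicator_def)
  have i: "integrable lborel (\<lambda>x. indicator (cbox a b) x *\<^sub>R f x)"
    by (rule borel_integrable_compact[OF compact_cbox assms(1)])
  then show "integrable lborel f" using e by simp
  have "set_integrable lborel (cbox a b) f" using i by (simp add: set_integrable_def)
  then have "(LINT x:cbox a b|lborel. f x) = integral (cbox a b) f" by (rule set_borel_integral_eq_integral)
  then show "integral\<^sup>L lborel f = integral (cbox a b) f" unfolding set_lebesgue_integral_def using e by simp
qed

lemma cc_integrable:
  fixes f :: "'a::euclidean_space \<Rightarrow> real"
  assumes "continuous_on UNIV f" "csupp f" shows "integrable lborel f"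
proof -
  obtain B where B: "\<And>x. B < norm x \<Longrightarrow> f x = 0" using assms(2) by (auto simp: csupp_def)
  have "bounded (cball (0::'a) B)" by simp
  then obtain a where "\<And>x. x \<notin> cbox (-a) a \<Longrightarrow> f x = 0"
    by (rule cbox_supp[of "cball 0 B" f]) (use B in auto)
  then show ?thesis using cc_int(1)[of "-a" a f] continuous_on_subset[OF assms(1)] by blast
qed

lemma lborel_int_shift:
  fixes f :: "'a::euclidean_space \<Rightarrow> real"
  assumes "f \<in> borel_measurable borel"
  shows "integral\<^sup>L lborel (\<lambda>x. f (c + x)) = integral\<^sup>L lborel f"
proof -
  have "integral\<^sup>L lborel f = integral\<^sup>L (distr lborel borel ((+) c)) f" by (simp add: lborel_distr_plus)
  also have "\<dots> = integral\<^sup>L lborel (\<lambda>x. f (c + x))" by (rule integral_distr) (use assms in auto)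
  finally show ?thesis ..
qed

text \<open>The integral of a translate is constant, and it can be differentiated under the integral sign.\<close>
lemma int_dd_zero:
  fixes f :: "'a::euclidean_space \<Rightarrow> real"
  assumes f: "Ck_on 1 f UNIV" and s: "csupp f"
  shows "integral\<^sup>L lborel (dd v f) = 0" "integrable lborel (dd v f)"
proof -
  obtain B where B: "\<And>x. B < norm x \<Longrightarrow> f x = 0" using s by (auto simp: csupp_def)
  have f1: "Ck_on (Suc 0) f UNIV" using f by simp
  have d: "f differentiable (at x)" for x using Ck_diff[OF f1] by simp
  have cf: "continuous_on UNIV f" and cd: "continuous_on UNIV (dd v f)"
    using Ck_cont[OF f] Ck_cont[OF Ck_dd[OF f1]] by auto
  obtain a where a: "cball (0::'a) (B + norm v) \<subseteq> cbox (-a) a" using bounded_subset_cbox_symmetric[OF bounded_cball] .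
  have off: "f (x + t *\<^sub>R v) = 0" if "x \<notin> cbox (-a) a" "\<bar>t\<bar> \<le> 1" for x t
  proof (rule B)
    have "x \<notin> cball 0 (B + norm v)" using a that(1) by blast
    then have "norm x > B + norm v" by simp
    moreover have "norm x \<le> norm (x + t *\<^sub>R v) + norm (t *\<^sub>R v)" using norm_triangle_ineq4[of "x + t *\<^sub>R v" "t *\<^sub>R v"] by simp
    moreover have "norm (t *\<^sub>R v) \<le> norm v" using that(2) by (simp add: mult_left_le_one_le)
    ultimately show "B < norm (x + t *\<^sub>R v)" by linarith
  qed
  have offd: "dd v f x = 0" if "x \<notin> cbox (-a) a" for x
    using dd_zero_off[of "cbox (-a) a" f x v] off[of _ 0] that by (simp add: closed_cbox)
  define g where "g t = integral (cbox (-a) a) (\<lambda>x. f (x + t *\<^sub>R v))" for t :: real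
  have ct: "continuous_on UNIV (\<lambda>x. f (x + t *\<^sub>R v))" for t
    by (rule continuous_on_compose2[OF cf]) (auto intro!: continuous_intros)
  have gc: "g t = integral\<^sup>L lborel f" if "t \<in> {-1<..<1}" for t
  proof -
    have "integral\<^sup>L lborel (\<lambda>x. f (x + t *\<^sub>R v)) = g t" unfolding g_def
      by (rule cc_int(2)) (use off that in \<open>auto intro: continuous_on_subset[OF ct]\<close>)
    moreover have "integral\<^sup>L lborel (\<lambda>x. f (t *\<^sub>R v + x)) = integral\<^sup>L lborel f"
      by (rule lborel_int_shift) (rule borel_measurable_continuous_onI[OF cf])
    ultimately show ?thesis by (simp add: add.commute)
  qed
  have "(g has_vector_derivative integral (cbox (-a) a) (\<lambda>x. dd v f (x + 0 *\<^sub>R v))) (at 0 within UNIV)"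
    unfolding g_def
  proof (rule leibniz_rule_vector_derivative[where U = UNIV])
    show "((\<lambda>t. f (x + t *\<^sub>R v)) has_vector_derivative dd v f (x + t *\<^sub>R v)) (at t within UNIV)" for t :: real and x
      using line_derivative[OF d, where x = x and t = t and v = v] by (simp add: has_real_derivative_iff_has_vector_derivative)
    show "(\<lambda>x. f (x + t *\<^sub>R v)) integrable_on cbox (-a) a" for t :: real
      by (rule integrable_continuous[OF continuous_on_subset[OF ct]]) simp
    show "continuous_on (UNIV \<times> cbox (-a) a) (\<lambda>(t, x). dd v f (x + t *\<^sub>R v))"
      unfolding split_beta by (rule continuous_on_compose2[OF cd]) (auto intro!: continuous_intros)
  qed auto
  moreover have "(g has_vector_derivative 0) (at 0)"
    by (rule has_vector_derivative_transform_within_open[of "\<lambda>_. integral\<^sup>L lborel f" _ _ "{-1<..<1}"]) (use gc in auto)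
  ultimately have "integral (cbox (-a) a) (dd v f) = 0" using vector_derivative_unique_at by fastforce
  then show "integral\<^sup>L lborel (dd v f) = 0" "integrable lborel (dd v f)"
    using cc_int[of "-a" a "dd v f"] offd continuous_on_subset[OF cd] by auto
qed

lemma int_by_parts:
  fixes f g :: "'a::euclidean_space \<Rightarrow> real"
  assumes "open S" "closed K" "bounded K" "K \<subseteq> S" "Ck_on 1 f S" "Ck_on 1 g S" "\<And>x. x \<notin> K \<Longrightarrow> g x = 0"
  shows "integral\<^sup>L lborel (\<lambda>x. f x * dd v g x) = - integral\<^sup>L lborel (\<lambda>x. dd v f x * g x)"
    "integrable lborel (\<lambda>x. f x * dd v g x)" "integrable lborel (\<lambda>x. dd v f x * g x)"
proof -
  have f1: "Ck_on (Suc 0) f S" and g1: "Ck_on (Suc 0) g S" using assms by simp_all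
  have z: "dd v g x = 0" if "x \<notin> K" for x by (rule dd_zero_off[OF assms(2,7) that])
  have ext: "integrable lborel h" if "continuous_on S h" "\<And>x. x \<notin> K \<Longrightarrow> h x = 0" for h :: "'a \<Rightarrow> real"
  proof (rule cc_integrable)
    have "Ck_on 0 h UNIV" by (rule Ck_extend[OF assms(1,2,4) that(2)]) (use that in simp_all)
    then show "continuous_on UNIV h" by simp
    show "csupp h" by (rule csupp_bounded[OF assms(3) that(2)])
  qed
  show i1: "integrable lborel (\<lambda>x. f x * dd v g x)"
    by (rule ext) (use z Ck_cont[OF assms(5)] Ck_cont[OF Ck_dd[OF g1]] in \<open>auto intro!: continuous_intros\<close>)
  show i2: "integrable lborel (\<lambda>x. dd v f x * g x)"
    by (rule ext) (use assms(7) Ck_cont[OF assms(6)] Ck_cont[OF Ck_dd[OF f1]] in \<open>auto intro!: continuous_intros\<close>)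
  have P: "Ck_on 1 (\<lambda>x. f x * g x) UNIV"
    by (rule Ck_extend[OF assms(1,2,4)]) (use assms in \<open>auto intro!: Ck_mult\<close>)
  have pt: "dd v (\<lambda>x. f x * g x) x = f x * dd v g x + dd v f x * g x" for x
  proof (cases "x \<in> S")
    case True then show ?thesis by (intro dd_mult Ck_diff[OF f1] Ck_diff[OF g1])
  next
    case False
    then have "x \<notin> K" using assms by blast
    then show ?thesis using dd_zero_off[of K "\<lambda>x. f x * g x" x v] z assms by simp
  qed
  have e: "dd v (\<lambda>x. f x * g x) = (\<lambda>x. f x * dd v g x + dd v f x * g x)" by (intro HOL.ext pt)
  have "csupp (\<lambda>x. f x * g x)" by (rule csupp_bounded[OF assms(3)]) (simp add: assms(7))
  from int_dd_zero(1)[OF P this, of v] have "integral\<^sup>L lborel (\<lambda>x. f x * dd v g x + dd v f x * g x) = 0"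
    unfolding e .
  then show "integral\<^sup>L lborel (\<lambda>x. f x * dd v g x) = - integral\<^sup>L lborel (\<lambda>x. dd v f x * g x)"
    using i1 i2 by simp
qed

section \<open>Mollification\<close>

definition conv :: "('a::euclidean_space \<Rightarrow> real) \<Rightarrow> ('a \<Rightarrow> real) \<Rightarrow> 'a \<Rightarrow> real" where
  "conv u k x = integral\<^sup>L lborel (\<lambda>y. u y * k (x - y))"

text \<open>All derivatives fall on the kernel, so \<open>u\<close> need only be continuous.\<close>
lemma conv_derivative:
  fixes u :: "'a::euclidean_space \<Rightarrow> real"
  assumes u: "continuous_on UNIV u" "csupp u" and k: "Ck_on 1 k UNIV"
  shows "conv u k differentiable (at x)" "dd v (conv u k) x = conv u (dd v k) x"
proof -
  obtain B where B: "\<And>x. B < norm x \<Longrightarrow> u x = 0" using u(2) by (auto simp: csupp_def)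
  obtain a where a: "cball (0::'a) B \<subseteq> cbox (-a) a" using bounded_subset_cbox_symmetric[OF bounded_cball] .
  have off: "u y = 0" if "y \<notin> cbox (-a) a" for y using a that by (intro B) (auto simp: subset_iff not_le)
  have k1: "Ck_on (Suc 0) k UNIV" using k by simp
  have d: "k differentiable (at x)" for x using Ck_diff[OF k1] by simp
  have ck: "continuous_on UNIV k" and cd: "continuous_on UNIV (dd v k)" for v
    using Ck_cont[OF k] Ck_cont[OF Ck_dd[OF k1]] by auto
  have eq: "conv u h x = integral (cbox (-a) a) (\<lambda>y. u y * h (x - y))" if "continuous_on UNIV h" for h x
    unfolding conv_def
    by (rule cc_int(2)) (use off in \<open>auto intro!: continuous_intros continuous_on_subset[OF u(1)] continuous_on_compose2[OF that]\<close>)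
  define fx where "fx x y = u y *\<^sub>R Blinfun (\<lambda>v. dd v k (x - y))" for x y
  have bl: "bounded_linear (\<lambda>v. dd v k z)" for z by (rule has_derivative_bounded_linear[OF has_derivative_dd[OF d]])
  have fxa: "blinfun_apply (fx x y) v = u y * dd v k (x - y)" for x y v
    unfolding fx_def by (simp add: bounded_linear_Blinfun_apply[OF bl] scaleR_blinfun.rep_eq)
  have contfx: "continuous_on UNIV (\<lambda>p. fx (fst p) (snd p))"
    unfolding fx_def
    by (intro continuous_on_scaleR continuous_on_blinfun_componentwise)
      (auto simp: bounded_linear_Blinfun_apply[OF bl] intro!: continuous_intros continuous_on_compose2[OF u(1)] continuous_on_compose2[OF cd])
  have D: "((\<lambda>x. integral (cbox (-a) a) (\<lambda>y. u y * k (x - y))) has_derivative integral (cbox (-a) a) (fx x)) (at x within UNIV)"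
  proof (rule leibniz_rule)
    fix x y :: 'a
    have "((\<lambda>x. x - y) has_derivative (\<lambda>v. v)) (at x)" by (auto intro!: derivative_eq_intros)
    from has_derivative_compose[OF this has_derivative_dd[OF d]]
    have "((\<lambda>x. k (x - y)) has_derivative (\<lambda>v. dd v k (x - y))) (at x)" .
    then have "((\<lambda>x. u y * k (x - y)) has_derivative (\<lambda>v. u y * dd v k (x - y))) (at x)"
      by (rule has_derivative_mult_right)
    then show "((\<lambda>x. u y * k (x - y)) has_derivative blinfun_apply (fx x y)) (at x within UNIV)"
      by (simp add: fxa[abs_def] has_derivative_eq_rhs)
    show "(\<lambda>y. u y * k (x - y)) integrable_on cbox (-a) a"
      by (rule integrable_continuous) (auto intro!: continuous_intros continuous_on_subset[OF u(1)] continuous_on_compose2[OF ck])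
  next
    show "continuous_on (UNIV \<times> cbox (- a) a) (\<lambda>(x, y). fx x y)"
      unfolding split_beta by (rule continuous_on_subset[OF contfx]) simp
  qed auto
  have cfx: "fx x integrable_on cbox (-a) a"
    by (rule integrable_continuous, rule continuous_on_compose2[OF contfx, of _ "\<lambda>y. (x, y)", simplified]) (auto intro!: continuous_intros)
  have e: "conv u k = (\<lambda>x. integral (cbox (-a) a) (\<lambda>y. u y * k (x - y)))" using eq[OF ck] by (simp add: fun_eq_iff)
  show "conv u k differentiable (at x)" unfolding e differentiable_def using D by blast
  have "dd v (conv u k) x = blinfun_apply (integral (cbox (-a) a) (fx x)) v" unfolding e by (rule dd_eq[OF D])
  also have "\<dots> = integral (cbox (-a) a) (\<lambda>y. u y * dd v k (x - y))"
    unfolding blinfun_apply_integral[OF cfx] fxa ..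
  finally show "dd v (conv u k) x = conv u (dd v k) x" using eq[OF cd] by simp
qed

lemma Ck_conv:
  fixes u :: "'a::euclidean_space \<Rightarrow> real"
  assumes u: "continuous_on UNIV u" "csupp u" shows "(\<And>j. Ck_on j k UNIV) \<Longrightarrow> Ck_on j (conv u k) UNIV"
proof (induction j arbitrary: k)
  case 0
  have "continuous_on UNIV (conv u k)"
    by (intro continuous_at_imp_continuous_on ballI differentiable_imp_continuous_within conv_derivative(1)[OF u 0])
  then show ?case by simp
next
  case (Suc j)
  have "dd v (conv u k) = conv u (dd v k)" for v by (rule ext) (rule conv_derivative(2)[OF u Suc.prems])
  moreover have "Ck_on j (conv u (dd v k)) UNIV" for v
    by (rule Suc.IH) (rule Ck_dd[OF Suc.prems])
  ultimately show ?case unfolding Ck_Suc using conv_derivative(1)[OF u Suc.prems] by auto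
qed

definition moll :: "real \<Rightarrow> 'a::euclidean_space \<Rightarrow> real" where
  "moll \<epsilon> x = bump \<epsilon> x / integral\<^sup>L lborel (bump \<epsilon> :: 'a \<Rightarrow> real)"

lemma bump_int_pos:
  assumes "0 < \<epsilon>" shows "0 < integral\<^sup>L lborel (bump \<epsilon> :: 'a::euclidean_space \<Rightarrow> real)" "integrable lborel (bump \<epsilon> :: 'a \<Rightarrow> real)"
proof -
  have c: "continuous_on UNIV (bump \<epsilon> :: 'a \<Rightarrow> real)" using Ck_bump[of 0 \<epsilon>] by simp
  have cs: "csupp (bump \<epsilon> :: 'a \<Rightarrow> real)"
    by (rule csupp_bounded[of "cball 0 \<epsilon>"]) (auto intro!: bump_zero[OF assms])
  show i: "integrable lborel (bump \<epsilon> :: 'a \<Rightarrow> real)" by (rule cc_integrable[OF c cs])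
  have "integral\<^sup>L lborel (bump \<epsilon> :: 'a \<Rightarrow> real) \<noteq> 0"
  proof
    assume "integral\<^sup>L lborel (bump \<epsilon> :: 'a \<Rightarrow> real) = 0"
    then have "AE x in lborel. bump \<epsilon> (x::'a) = 0"
      using integral_nonneg_eq_0_iff_AE[OF i] bump_nonneg by auto
    then have "AE x in lborel. (x::'a) \<notin> ball 0 \<epsilon>"
      by (rule AE_mp) (auto intro!: AE_I2 dest: bump_pos)
    then have "emeasure lborel (ball (0::'a) \<epsilon>) = 0"
      by (subst AE_iff_measurable[symmetric, where P = "\<lambda>x. x \<notin> ball 0 \<epsilon>"]) auto
    then show False using emeasure_lborel_ball_finite content_ball_pos[OF assms, of "0::'a"]
      by (simp add: measure_def)
  qed
  moreover have "integral\<^sup>L lborel (bump \<epsilon> :: 'a \<Rightarrow> real) \<ge> 0" by (intro integral_nonneg_AE AE_I2 bump_nonneg)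
  ultimately show "0 < integral\<^sup>L lborel (bump \<epsilon> :: 'a \<Rightarrow> real)" by linarith
qed

lemma Ck_moll: "Ck_on k (moll \<epsilon>) UNIV"
  unfolding moll_def[abs_def] using Ck_cmult[OF open_UNIV Ck_bump, of k "1 / integral\<^sup>L lborel (bump \<epsilon>)" \<epsilon>] by simp

lemma moll_nonneg: "0 < \<epsilon> \<Longrightarrow> 0 \<le> moll \<epsilon> x"
  unfolding moll_def using bump_int_pos(1)[of \<epsilon>, where ?'a = 'a] bump_nonneg[of \<epsilon> x] by simp

lemma moll_zero: "0 < \<epsilon> \<Longrightarrow> x \<notin> cball 0 \<epsilon> \<Longrightarrow> moll \<epsilon> x = 0"
  unfolding moll_def using bump_zero[of \<epsilon> x] by simp

lemma moll_zero': "0 < \<epsilon> \<Longrightarrow> y \<notin> cball x \<epsilon> \<Longrightarrow> moll \<epsilon> (x - y) = 0"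
  by (rule moll_zero) (auto simp: dist_norm norm_minus_commute)

lemma moll_shift_cont: "continuous_on A (\<lambda>y. moll \<epsilon> (x - y))"
  using Ck_cont[OF Ck_affine[OF Ck_moll, of 0 \<epsilon> x]] continuous_on_subset by blast

lemma moll_int:
  assumes "0 < \<epsilon>"
  shows "integral\<^sup>L lborel (\<lambda>y::'a::euclidean_space. moll \<epsilon> (x - y)) = 1" "integrable lborel (\<lambda>y. moll \<epsilon> (x - y))"
proof -
  have sym: "moll \<epsilon> (x - y) = moll \<epsilon> (- x + y)" for y :: 'a
    by (simp add: moll_def bump_def algebra_simps inner_commute)
  have m: "(moll \<epsilon> :: 'a \<Rightarrow> real) \<in> borel_measurable borel"
    using Ck_cont[OF Ck_moll[of 0 \<epsilon>]] by (rule borel_measurable_continuous_onI)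
  have "integral\<^sup>L lborel (\<lambda>y::'a. moll \<epsilon> (x - y)) = integral\<^sup>L lborel (moll \<epsilon> :: 'a \<Rightarrow> real)"
    unfolding sym by (rule lborel_int_shift[OF m])
  also have "\<dots> = 1" unfolding moll_def using bump_int_pos[OF assms, where ?'a = 'a] by simp
  finally show "integral\<^sup>L lborel (\<lambda>y::'a. moll \<epsilon> (x - y)) = 1" .
  show "integrable lborel (\<lambda>y. moll \<epsilon> (x - y))"
    by (rule cc_integrable[OF moll_shift_cont csupp_bounded[of "cball x \<epsilon>"]]) (use moll_zero'[OF assms] in auto)
qed

lemma conv_moll_close:
  fixes g :: "'a::euclidean_space \<Rightarrow> real"
  assumes "0 < \<epsilon>" and c: "continuous_on (cball x \<epsilon>) g" and e: "\<And>y. y \<in> cball x \<epsilon> \<Longrightarrow> \<bar>g y - g x\<bar> \<le> e"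
  shows "\<bar>conv g (moll \<epsilon>) x - g x\<bar> \<le> e" "integrable lborel (\<lambda>y. g y * moll \<epsilon> (x - y))"
proof -
  have i: "integrable lborel (\<lambda>y. h y * moll \<epsilon> (x - y))" if "continuous_on (cball x \<epsilon>) h" for h
  proof -
    have "integrable lborel (\<lambda>y. indicator (cball x \<epsilon>) y *\<^sub>R (h y * moll \<epsilon> (x - y)))"
      by (rule borel_integrable_compact) (auto intro!: continuous_intros that moll_shift_cont)
    moreover have "(\<lambda>y. indicator (cball x \<epsilon>) y *\<^sub>R (h y * moll \<epsilon> (x - y))) = (\<lambda>y. h y * moll \<epsilon> (x - y))"
      using moll_zero'[OF assms(1)] by (auto simp: fun_eq_iff indicator_def)
    ultimately show ?thesis by simp
  qed
  show ii: "integrable lborel (\<lambda>y. g y * moll \<epsilon> (x - y))" by (rule i[OF c])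
  have "conv g (moll \<epsilon>) x - g x = integral\<^sup>L lborel (\<lambda>y. g y * moll \<epsilon> (x - y)) - integral\<^sup>L lborel (\<lambda>y. g x * moll \<epsilon> (x - y))"
  proof -
    have "integral\<^sup>L lborel (\<lambda>y. g x * moll \<epsilon> (x - y)) = g x * integral\<^sup>L lborel (\<lambda>y. moll \<epsilon> (x - y))"
      by (rule integral_mult_right_zero)
    then show ?thesis unfolding conv_def moll_int(1)[OF assms(1)] by (simp only: mult_1_right)
  qed
  also have "\<dots> = integral\<^sup>L lborel (\<lambda>y. g y * moll \<epsilon> (x - y) - g x * moll \<epsilon> (x - y))"
    by (intro Bochner_Integration.integral_diff[symmetric] i c continuous_on_const)
  finally have eq: "conv g (moll \<epsilon>) x - g x = integral\<^sup>L lborel (\<lambda>y. g y * moll \<epsilon> (x - y) - g x * moll \<epsilon> (x - y))" .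
  have "\<bar>\<dots>\<bar> \<le> integral\<^sup>L lborel (\<lambda>y. \<bar>g y * moll \<epsilon> (x - y) - g x * moll \<epsilon> (x - y)\<bar>)"
    by (rule integral_abs_bound)
  also have "\<dots> \<le> integral\<^sup>L lborel (\<lambda>y. e * moll \<epsilon> (x - y))"
  proof (rule integral_mono)
    show "integrable lborel (\<lambda>y. \<bar>g y * moll \<epsilon> (x - y) - g x * moll \<epsilon> (x - y)\<bar>)"
      by (intro integrable_abs Bochner_Integration.integrable_diff i c continuous_on_const)
    show "integrable lborel (\<lambda>y. e * moll \<epsilon> (x - y))" by (intro i continuous_on_const)
    fix y
    have "\<bar>g y * moll \<epsilon> (x - y) - g x * moll \<epsilon> (x - y)\<bar> = \<bar>g y - g x\<bar> * moll \<epsilon> (x - y)"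
      using moll_nonneg[OF assms(1), of "x - y"] by (simp add: left_diff_distrib[symmetric] abs_mult)
    also have "\<dots> \<le> e * moll \<epsilon> (x - y)"
      using e[of y] moll_zero'[OF assms(1), of y x] moll_nonneg[OF assms(1), of "x - y"]
      by (cases "y \<in> cball x \<epsilon>") (auto intro!: mult_right_mono)
    finally show "\<bar>g y * moll \<epsilon> (x - y) - g x * moll \<epsilon> (x - y)\<bar> \<le> e * moll \<epsilon> (x - y)" .
  qed
  also have "\<dots> = e" unfolding integral_mult_right_zero moll_int(1)[OF assms(1)] by simp
  finally show "\<bar>conv g (moll \<epsilon>) x - g x\<bar> \<le> e" unfolding eq .
qed

lemma compact_nbhd:
  fixes K :: "'a::euclidean_space set"
  assumes "compact K" "open S" "K \<subseteq> S"
  obtains r L where "r > 0" "compact L" "L \<subseteq> S" "\<And>x. x \<in> K \<Longrightarrow> cball x r \<subseteq> L"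
proof (cases "K = {}")
  case True then show ?thesis using that[of 1 "{}"] by auto
next
  case False
  obtain e where e: "e > 0" "{x. infdist x K \<le> e} \<subseteq> S" using compact_in_open_separated[OF False assms] by blast
  show ?thesis
  proof (rule that[of e "{x. infdist x K \<le> e}"])
    show "compact {x. infdist x K \<le> e}" by (rule compact_infdist_le[OF False assms(1) e(1)])
    fix x assume "x \<in> K"
    then show "cball x e \<subseteq> {x. infdist x K \<le> e}"
      by (auto simp: dist_commute intro!: order_trans[OF infdist_le])
  qed (use e in auto)
qed

lemma conv_moll_uniform:
  fixes g :: "'a::euclidean_space \<Rightarrow> real"
  assumes "compact K" "open S" "K \<subseteq> S" "continuous_on S g" "e > 0"
  shows "\<exists>\<epsilon>0>0. \<forall>\<epsilon>. 0 < \<epsilon> \<and> \<epsilon> < \<epsilon>0 \<longrightarrow> (\<forall>x\<in>K. cball x \<epsilon> \<subseteq> S \<and> \<bar>conv g (moll \<epsilon>) x - g x\<bar> \<le> e)"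
proof -
  obtain r L where L: "r > 0" "compact L" "L \<subseteq> S" "\<And>x. x \<in> K \<Longrightarrow> cball x r \<subseteq> L" using compact_nbhd[OF assms(1-3)] by blast
  have "uniformly_continuous_on L g" by (rule compact_uniformly_continuous[OF continuous_on_subset[OF assms(4) L(3)] L(2)])
  then obtain d where d: "d > 0" "\<And>x y. x \<in> L \<Longrightarrow> y \<in> L \<Longrightarrow> dist y x < d \<Longrightarrow> dist (g y) (g x) < e"
    unfolding uniformly_continuous_on_def using assms(5) by meson
  show ?thesis
  proof (intro exI[of _ "min r d"] conjI allI impI ballI)
    show "min r d > 0" using L(1) d(1) by simp
    fix \<epsilon> x assume eps: "0 < \<epsilon> \<and> \<epsilon> < min r d" and x: "x \<in> K"
    have sub: "cball x \<epsilon> \<subseteq> L" using L(4)[OF x] eps by (auto simp: subset_iff)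
    then show "cball x \<epsilon> \<subseteq> S" using L(3) by blast
    show "\<bar>conv g (moll \<epsilon>) x - g x\<bar> \<le> e"
    proof (rule conv_moll_close)
      show "continuous_on (cball x \<epsilon>) g" using continuous_on_subset[OF assms(4)] sub L(3) by blast
      fix y assume y: "y \<in> cball x \<epsilon>"
      have "x \<in> L" using sub eps by (auto simp: subset_iff)
      then have "dist (g y) (g x) < e" using d(2)[of x y] y sub eps by (auto simp: dist_commute)
      then show "\<bar>g y - g x\<bar> \<le> e" by (simp add: dist_real_def)
    qed (use eps in simp)
  qed
qed

lemma cutoff:
  fixes K :: "'a::euclidean_space set"
  assumes "compact K" "open S" "K \<subseteq> S"
  obtains \<kappa> L r where "continuous_on UNIV \<kappa>" "compact L" "L \<subseteq> S" "\<And>x. x \<notin> L \<Longrightarrow> \<kappa> x = (0::real)"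
    "r > 0" "\<And>x y. x \<in> K \<Longrightarrow> y \<in> cball x r \<Longrightarrow> \<kappa> y = 1" "\<And>x. x \<in> K \<Longrightarrow> cball x r \<subseteq> S"
proof (cases "K = {}")
  case True then show ?thesis using that[of "\<lambda>_. 0" "{}" 1] by auto
next
  case False
  obtain e where e: "e > 0" "{x. infdist x K \<le> e} \<subseteq> S" using compact_in_open_separated[OF False assms] by blast
  show ?thesis
  proof (rule that[of "\<lambda>x. max 0 (min 1 (2 - 2 * infdist x K / e))" "{x. infdist x K \<le> e}" "e / 2"])
    show "continuous_on UNIV (\<lambda>x. max 0 (min 1 (2 - 2 * infdist x K / e)))"
      using e(1) by (intro continuous_intros) auto
    show "compact {x. infdist x K \<le> e}" by (rule compact_infdist_le[OF False assms(1) e(1)])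
    show "max 0 (min 1 (2 - 2 * infdist x K / e)) = 0" if "x \<notin> {x. infdist x K \<le> e}" for x
      using that e(1) by (auto simp: field_simps max_def min_def)
    have i: "infdist y K \<le> e / 2" if "x \<in> K" "y \<in> cball x (e / 2)" for x y
      using infdist_le[OF that(1), of y] that(2) by (simp add: dist_commute)
    then show "max 0 (min 1 (2 - 2 * infdist y K / e)) = 1" if "x \<in> K" "y \<in> cball x (e / 2)" for x y
      using i[OF that] e(1) by (auto simp: field_simps max_def min_def)
    show "cball x (e / 2) \<subseteq> S" if "x \<in> K" for x using i[OF that] e by force
  qed (use e in auto)
qed

lemma test_moll:
  assumes "0 < \<epsilon>" "cball x \<epsilon> \<subseteq> S"
  shows "test_function S (\<lambda>y. moll \<epsilon> (x - y))"
proof -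
  have sub: "closure {y. moll \<epsilon> (x - y) \<noteq> 0} \<subseteq> cball x \<epsilon>"
    by (rule closure_minimal[OF _ closed_cball]) (use moll_zero'[OF assms(1)] in blast)
  then have "compact (closure {y. moll \<epsilon> (x - y) \<noteq> 0})"
    by (metis bounded_cball bounded_subset closed_closure compact_eq_bounded_closed)
  then show ?thesis unfolding test_function_def using Ck_affine[OF Ck_moll] sub assms by blast
qed

text \<open>A derivative of the kernel can be moved to a function that is differentiable near the point.\<close>
lemma conv_dd_moll:
  fixes g :: "'a::euclidean_space \<Rightarrow> real"
  assumes "0 < \<epsilon>" "open S" "cball x \<epsilon> \<subseteq> S" "Ck_on 1 g S" "Ck_on 1 k UNIV" "\<And>z. z \<notin> cball 0 \<epsilon> \<Longrightarrow> k z = 0"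
  shows "conv g (dd v k) x = conv (dd v g) k x"
proof -
  have k1: "Ck_on (Suc 0) k UNIV" using assms(5) by simp
  have d: "k differentiable (at z)" for z using Ck_diff[OF k1] by simp
  have a: "Ck_on 1 (\<lambda>y. k (x - y)) S" by (rule Ck_subset[OF Ck_affine[OF assms(5)]]) simp
  have b: "k (x - y) = 0" if "y \<notin> cball x \<epsilon>" for y
    by (rule assms(6)) (use that in \<open>simp add: dist_norm norm_minus_commute\<close>)
  have "integral\<^sup>L lborel (\<lambda>y. g y * dd v (\<lambda>y. k (x - y)) y) = - integral\<^sup>L lborel (\<lambda>y. dd v g y * k (x - y))"
    by (rule int_by_parts(1)[OF assms(2) closed_cball bounded_cball assms(3,4) a b])
  then show ?thesis unfolding conv_def by (simp add: dd_affine[OF d])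
qed

lemma conv_cong:
  assumes "\<And>y. y \<in> cball x \<epsilon> \<Longrightarrow> f y = g y" "\<And>z. z \<notin> cball 0 \<epsilon> \<Longrightarrow> k z = 0"
  shows "conv f k x = conv g k x"
  unfolding conv_def
proof (rule Bochner_Integration.integral_cong[OF refl])
  fix y show "f y * k (x - y) = g y * k (x - y)"
    using assms(1)[of y] assms(2)[of "x - y"] by (cases "y \<in> cball x \<epsilon>") (auto simp: dist_norm norm_minus_commute)
qed

section \<open>The complex Hessian\<close>

definition mJ :: "complex^'n \<Rightarrow> complex^'n" where "mJ v = \<i> *s v"

lemma mJ_add: "mJ (a + b) = mJ a + mJ b" by (simp add: mJ_def vector_add_ldistrib)
lemma mJ_scaleR: "mJ (r *\<^sub>R a) = r *\<^sub>R mJ a"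
  by (simp add: mJ_def cvec_eq_iff scaleR_conv_of_real[where 'a = complex])
lemma mJ_mJ: "mJ (mJ a) = - a"
  by (simp add: mJ_def cvec_eq_iff)
lemma dc_eq: "dc u z w = complex_of_real (- dd (mJ w) u z)"
  by (simp add: dc_def del_def delbar_def dd_def mJ_def field_simps)

lemma fd_of_real: "g differentiable (at z) \<Longrightarrow> frechet_derivative (\<lambda>x. complex_of_real (g x)) (at z) v = of_real (dd v g z)"
  using fun_cong[OF frechet_derivative_at[OF has_derivative_of_real[OF has_derivative_dd[of g z], where ?'a = complex]], of v] by simp

text \<open>A real bilinear form whose antisymmetrisation is \<open>dd\<^sup>cu\<close>; the coefficients of all wedge
  products below are polynomials in such second derivatives.\<close>
definition reta :: "(complex^'n \<Rightarrow> real) \<Rightarrow> complex^'n \<Rightarrow> complex^'n \<Rightarrow> complex^'n \<Rightarrow> real" where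
  "reta u z = (\<lambda>v w. - dd v (dd (mJ w) u) z)"

lemma ddc_eq:
  assumes "Ck_on 2 u S" "z \<in> S"
  shows "ddc u z = skew (\<lambda>v w. complex_of_real (reta u z v w))"
proof (intro HOL.ext)
  fix v w
  have u: "Ck_on (Suc (Suc 0)) u S" using assms(1) by (simp add: numeral_2_eq_2)
  have d: "(\<lambda>x. - dd (mJ w) u x) differentiable (at z)" for w
    using Ck_diff[OF Ck_dd[OF u] assms(2)] by (rule differentiable_minus)
  have m: "dd v (\<lambda>x. - dd (mJ w) u x) z = - dd v (dd (mJ w) u) z" for v w
    using dd_cmult[OF Ck_diff[OF Ck_dd[OF u] assms(2)], of v "-1" "mJ w"] by simp
  show "ddc u z v w = skew (\<lambda>v w. complex_of_real (reta u z v w)) v w"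
    unfolding ddc_def ext_d1_def dc_eq fd_of_real[OF d] m by (simp add: skew_def reta_def)
qed

text \<open>The matrix \<open>\<partial>\<^sup>2 / \<partial>z\<^sub>j \<partial>\<close>-bar\<open> z\<^sub>k\<close> of
  a real symmetric bilinear form in place of the real Hessian.\<close>
definition hm :: "(complex^'n \<Rightarrow> complex^'n \<Rightarrow> real) \<Rightarrow> complex^'n^'n" where
  "hm H = (\<chi> j k. (of_real (H (axis j 1) (axis k 1) + H (axis j \<i>) (axis k \<i>))
     + \<i> * of_real (H (axis j 1) (axis k \<i>) - H (axis j \<i>) (axis k 1))) / 4)"

definition hess :: "(complex^'n \<Rightarrow> real) \<Rightarrow> complex^'n \<Rightarrow> complex^'n^'n" where
  "hess u z = hm (\<lambda>a b. dd a (dd b u) z)"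

definition bil :: "(complex^'n \<Rightarrow> complex^'n \<Rightarrow> real) \<Rightarrow> bool" where
  "bil H \<longleftrightarrow> (\<forall>a b c r s. H (r *\<^sub>R a + s *\<^sub>R b) c = r * H a c + s * H b c) \<and> (\<forall>a b. H a b = H b a)"

lemma bil_sym: "bil H \<Longrightarrow> H a b = H b a" unfolding bil_def by blast
lemma bil_l: "bil H \<Longrightarrow> H (r *\<^sub>R a + s *\<^sub>R b) c = r * H a c + s * H b c" unfolding bil_def by blast
lemma bil_r: assumes "bil H" shows "H c (r *\<^sub>R a + s *\<^sub>R b) = r * H c a + s * H c b"
  using bil_l[OF assms, of r a s b c] bil_sym[OF assms, of c "r *\<^sub>R a + s *\<^sub>R b"] bil_sym[OF assms, of c a] bil_sym[OF assms, of c b]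
  by simp
lemma bil_minus: assumes "bil H" shows "H (- a) c = - H a c" "H c (- a) = - H c a"
  using bil_l[OF assms, of "-1" a 0 a c] bil_r[OF assms, of c "-1" a 0 a] by simp_all

text \<open>The Hermitian form of \<^const>\<open>hm\<close> without coordinates.\<close>
definition hf :: "(complex^'n \<Rightarrow> complex^'n \<Rightarrow> real) \<Rightarrow> complex^'n \<Rightarrow> complex^'n \<Rightarrow> complex" where
  "hf H v w = (of_real (H v w + H (mJ v) (mJ w)) + \<i> * of_real (H v (mJ w) - H (mJ v) w)) / 4"

lemma hf_add: assumes "bil H" shows "hf H (a + b) w = hf H a w + hf H b w"
  using bil_l[OF assms, of 1 a 1 b] bil_l[OF assms, of 1 "mJ a" 1 "mJ b"]
  by (simp add: hf_def mJ_add field_simps)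

lemma smult_decomp: "c *s v = Re c *\<^sub>R v + Im c *\<^sub>R mJ v"
proof -
  have "c * z = of_real (Re c) * z + of_real (Im c) * (\<i> * z)" for z
    by (subst complex_eq[of c]) (simp add: algebra_simps)
  then show ?thesis by (simp add: cvec_eq_iff mJ_def scaleR_conv_of_real[where 'a = complex])
qed

lemma hf_mJ: assumes "bil H" shows "hf H (mJ v) w = \<i> * hf H v w"
  by (simp add: hf_def mJ_mJ bil_minus[OF assms] field_simps)

lemma hf_scaleR: assumes "bil H" shows "hf H (r *\<^sub>R v) w = of_real r * hf H v w"
proof -
  have "H (r *\<^sub>R v) c = r * H v c" for v c using bil_l[OF assms, of r v 0 v c] by simp
  then show ?thesis by (simp add: hf_def mJ_scaleR field_simps)
qed

lemma hf_smult: assumes "bil H" shows "hf H (c *s v) w = c * hf H v w"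
  unfolding smult_decomp hf_add[OF assms] hf_scaleR[OF assms] hf_mJ[OF assms]
  by (simp add: complex_eq_iff algebra_simps)

lemma hf_cnj: assumes "bil H" shows "hf H w v = cnj (hf H v w)"
  using bil_sym[OF assms] by (simp add: hf_def field_simps)

lemma hf_sum: assumes "bil H" shows "hf H (\<Sum>i\<in>I. f i) w = (\<Sum>i\<in>I. hf H (f i) w)"
proof -
  have z: "hf H 0 w = 0" using hf_smult[OF assms, of 0 0 w] by simp
  show ?thesis by (induction I rule: infinite_finite_induct) (simp_all add: z hf_add[OF assms])
qed

lemma hf_expand_left: assumes "bil H" shows "hf H v w = (\<Sum>j\<in>UNIV. v $ j * hf H (axis j 1) w)"
proof -
  have "hf H v w = hf H (\<Sum>j\<in>UNIV. (v $ j) *s axis j 1) w" by (simp add: basis_expansion)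
  then show ?thesis by (simp add: hf_sum[OF assms] hf_smult[OF assms])
qed

lemma mJ_axis: "mJ (axis j c) = axis j (\<i> * c)"
  by (simp add: mJ_def cvec_eq_iff axis_def)

lemma hf_axis: "hf H (axis j 1) (axis k 1) = hm H $ j $ k"
  by (simp add: hf_def hm_def mJ_axis)

lemma hf_expand: assumes "bil H" shows "hf H v w = (\<Sum>j\<in>UNIV. \<Sum>k\<in>UNIV. hm H $ j $ k * v $ j * cnj (w $ k))"
proof -
  have "hf H (axis j 1) w = (\<Sum>k\<in>UNIV. hm H $ j $ k * cnj (w $ k))" for j
  proof -
    have "hf H (axis j 1) w = cnj (hf H w (axis j 1))" by (rule hf_cnj[OF assms])
    also have "\<dots> = (\<Sum>k\<in>UNIV. cnj (w $ k) * cnj (hf H (axis k 1) (axis j 1)))"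
      by (subst hf_expand_left[OF assms]) simp
    also have "\<dots> = (\<Sum>k\<in>UNIV. hm H $ j $ k * cnj (w $ k))"
    proof (intro sum.cong refl)
      fix k
      show "cnj (w $ k) * cnj (hf H (axis k 1) (axis j 1)) = hm H $ j $ k * cnj (w $ k)"
        using hf_cnj[OF assms, where w = "axis j 1" and v = "axis k 1"] by (simp add: hf_axis)
    qed
    finally show ?thesis .
  qed
  then show ?thesis by (subst hf_expand_left[OF assms]) (simp add: sum_distrib_left mult_ac)
qed

lemma ctr_hm: assumes "bil H" shows "ctr (hm H) = hm H"
proof -
  have "cnj (hm H $ k $ j) = hm H $ j $ k" for j k
    unfolding hf_axis[symmetric] by (rule hf_cnj[OF assms, symmetric])
  then show ?thesis by (simp add: ctr_def cvec_eq_iff)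
qed

lemma skew_eta_hm:
  assumes "bil H"
  shows "skew (eta (hm H)) = skew (\<lambda>v w. complex_of_real (- H v (mJ w)))"
proof (intro HOL.ext)
  fix v w
  have e: "eta (hm H) v w = 2 * \<i> * hf H v w" for v w
    by (simp add: eta_def hf_expand[OF assms] sum_distrib_left mult_ac)
  have "skew (eta (hm H)) v w = 2 * \<i> * (hf H v w - cnj (hf H v w))"
    unfolding skew_def e hf_cnj[OF assms, of w v] by (simp add: algebra_simps)
  also have "\<dots> = of_real (- (4 * Im (hf H v w)))" by (simp add: complex_eq_iff)
  also have "4 * Im (hf H v w) = H v (mJ w) - H (mJ v) w" by (simp add: hf_def)
  also have "H (mJ v) w = H w (mJ v)" by (rule bil_sym[OF assms])
  finally show "skew (eta (hm H)) v w = skew (\<lambda>v w. complex_of_real (- H v (mJ w))) v w"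
    by (simp add: skew_def)
qed

lemma bil_hess:
  assumes "Ck_on 2 u S" "open S" "z \<in> S" shows "bil (\<lambda>a b. dd a (dd b u) z)"
proof -
  have u: "Ck_on (Suc (Suc 0)) u S" using assms(1) by (simp add: numeral_2_eq_2)
  show ?thesis unfolding bil_def
    using dd_dir_lin[OF Ck_diff[OF Ck_dd[OF u] assms(3)]] dd_commute[OF assms] by blast
qed

lemma ctr_hess: "Ck_on 2 u S \<Longrightarrow> open S \<Longrightarrow> z \<in> S \<Longrightarrow> ctr (hess u z) = hess u z"
  unfolding hess_def by (rule ctr_hm[OF bil_hess])

lemma ddc_hess:
  assumes "Ck_on 2 u S" "open S" "z \<in> S" shows "ddc u z = skew (eta (hess u z))"
  unfolding ddc_eq[OF assms(1,3)] hess_def skew_eta_hm[OF bil_hess[OF assms]] reta_def by simp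

lemma wedge_Qf:
  assumes "\<And>u. u \<in> set us \<Longrightarrow> Ck_on 2 u S" "open S" "z \<in> S"
  shows "wedge2 (map (\<lambda>u. ddc u z) us) std_frame = Qf (map (\<lambda>u. hess u z) us)"
proof -
  have "map (\<lambda>u. ddc u z) us = map skew (map eta (map (\<lambda>u. hess u z) us))"
    using ddc_hess[OF assms(1) assms(2,3)] by simp
  then show ?thesis unfolding Qf_def by (simp only: wedge2_skew)
qed

lemma wedge_real:
  assumes "\<And>u. u \<in> set us \<Longrightarrow> Ck_on 2 u S" "z \<in> S"
  shows "wedge2 (map (\<lambda>u. ddc u z) us) v = of_real (asum (map (\<lambda>u. reta u z) us) v)"
proof -
  have "map (\<lambda>u. ddc u z) us = map skew (map (\<lambda>\<eta> x y. complex_of_real (\<eta> x y)) (map (\<lambda>u. reta u z) us))"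
    using ddc_eq[OF assms(1) assms(2)] by simp
  then have "wedge2 (map (\<lambda>u. ddc u z) us) v = asum (map (\<lambda>\<eta> x y. complex_of_real (\<eta> x y)) (map (\<lambda>u. reta u z) us)) v"
    by (simp only: wedge2_skew)
  also have "\<dots> = of_real (asum (map (\<lambda>u. reta u z) us) v)"
    by (rule asum_hom[symmetric]) auto
  finally show ?thesis .
qed

definition nsq :: "complex^'n \<Rightarrow> real" where "nsq z = (norm z)\<^sup>2"

lemma nsq_inner: "nsq = (\<lambda>z. z \<bullet> z)" by (simp add: nsq_def power2_norm_eq_inner fun_eq_iff)
lemma Ck_nsq: "Ck_on k nsq S" unfolding nsq_inner by (rule Ck_inner_self)
lemma kaehler_nsq: "kaehler = ddc nsq" unfolding kaehler_def nsq_def[abs_def] ..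

lemma dd_dd_nsq: "dd a (dd b nsq) z = 2 * (a \<bullet> b)"
proof -
  have "bounded_linear (\<lambda>x. 2 * (x \<bullet> b))" by (intro bounded_linear_intros)
  then show ?thesis unfolding nsq_inner dd_inner_self by (simp add: dd_linear)
qed

lemma hess_nsq: "hess nsq z = idm"
  by (auto simp: hess_def hm_def dd_dd_nsq idm_def cvec_eq_iff inner_axis_axis)

section \<open>Quadratic potentials and the complex structure\<close>

text \<open>The quadratic polynomial with complex Hessian \<open>B\<close> for a Hermitian matrix \<open>B\<close>.\<close>
definition qp :: "complex^'n^'n \<Rightarrow> complex^'n \<Rightarrow> real" where
  "qp B z = z \<bullet> (\<chi> j. \<Sum>k\<in>UNIV. cnj (B $ j $ k) * z $ k)"

lemma qp_deriv:
  fixes B :: "complex^'n^'n"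
  shows "Ck_on k (qp B) S"
    "dd a (dd b (qp B)) z = b \<bullet> (\<chi> j. \<Sum>k\<in>UNIV. cnj (B $ j $ k) * a $ k) + a \<bullet> (\<chi> j. \<Sum>k\<in>UNIV. cnj (B $ j $ k) * b $ k)"
proof -
  define M where "M z = (\<chi> j. \<Sum>k\<in>UNIV. cnj (B $ j $ k) * z $ k)" for z :: "complex^'n"
  have "linear M"
    by (rule linearI) (simp_all add: M_def cvec_eq_iff sum.distrib algebra_simps scaleR_sum_right)
  then have M: "bounded_linear M" by (simp add: linear_conv_bounded_linear)
  have d: "(qp B has_derivative (\<lambda>b. x \<bullet> M b + b \<bullet> M x)) (at x)" for x
    unfolding qp_def[abs_def] M_def[symmetric]
    by (auto intro!: derivative_eq_intros bounded_linear_imp_has_derivative[OF M])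
  have e: "dd b (qp B) = (\<lambda>x. x \<bullet> M b + b \<bullet> M x)" for b by (rule HOL.ext) (rule dd_eq[OF d])
  have l: "bounded_linear (\<lambda>x. x \<bullet> M b + b \<bullet> M x)" for b
    by (intro bounded_linear_add bounded_linear_inner_left bounded_linear_compose[OF bounded_linear_inner_right M])
  show "dd a (dd b (qp B)) z = b \<bullet> (\<chi> j. \<Sum>k\<in>UNIV. cnj (B $ j $ k) * a $ k) + a \<bullet> (\<chi> j. \<Sum>k\<in>UNIV. cnj (B $ j $ k) * b $ k)"
    unfolding e dd_linear[OF l] unfolding M_def by simp
  show "Ck_on k (qp B) S"
  proof (cases k)
    case 0
    have "qp B differentiable (at x)" for x using d by (auto simp: differentiable_def)
    then show ?thesis unfolding 0
      by (auto intro!: continuous_at_imp_continuous_on differentiable_imp_continuous_within)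
  next
    case (Suc j)
    then show ?thesis unfolding Suc Ck_Suc e using d by (auto simp: differentiable_def intro!: Ck_linear l)
  qed
qed

lemma hess_qp:
  fixes B :: "complex^'n^'n"
  assumes "ctr B = B" shows "hess (qp B) z = B"
proof -
  have c: "cnj (B $ k $ j) = B $ j $ k" for j k
    using arg_cong[OF assms, of "\<lambda>X. X $ j $ k"] by (simp add: ctr_def)
  have s: "axis j p \<bullet> (\<chi> i. \<Sum>l\<in>UNIV. cnj (B $ i $ l) * axis k q $ l) = Re (cnj p * (B $ k $ j * q))" for j k :: 'n and p q
  proof -
    have "(\<Sum>l\<in>UNIV. cnj (B $ j $ l) * axis k q $ l) = (\<Sum>l\<in>UNIV. if l = k then B $ k $ j * q else 0)"
      by (intro sum.cong refl) (auto simp: axis_def c)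
    then show ?thesis by (simp add: inner_axis' inner_complex_def)
  qed
  have "hess (qp B) z $ j $ k = B $ j $ k" for j k
    using c[of k j] unfolding hess_def hm_def qp_deriv(2) s
    by (auto simp: complex_eq_iff)
  then show ?thesis by (simp add: cvec_eq_iff)
qed

lemma frame_J: "mJ (std_frame k :: complex^'n) = (if even k then 1 else -1) *\<^sub>R std_frame (if even k then k + 1 else k - 1)"
proof -
  have "(k - 1) div 2 = k div 2" "even (k - 1)" if "odd k" using that by (auto elim!: oddE)
  then show ?thesis by (auto simp: cvec_eq_iff mJ_def std_frame_nth)
qed

definition bodd :: "('a::real_vector \<Rightarrow> 'a \<Rightarrow> real) \<Rightarrow> bool" where
  "bodd \<eta> \<longleftrightarrow> (\<forall>x y r s. \<eta> (r *\<^sub>R x) (s *\<^sub>R y) = r * s * \<eta> x y)"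

lemma prod_perm_all: assumes "\<pi> permutes {..<N::nat}" shows "(\<Prod>k<N. g (\<pi> k)) = (\<Prod>k<N. g k :: 'c::comm_monoid_mult)"
  using prod.permute[OF assms, of g] by (simp add: o_def)

text \<open>The complex structure permutes the standard frame up to signs, so it multiplies the alternating sum by a
  product of signs that does not depend on the forms. Testing with \<open>\<beta>\<^sup>n\<close> shows below
  that this factor is \<open>1\<close>.\<close>
lemma asum_J_factor:
  "\<exists>c. \<forall>\<eta>s. length \<eta>s = CARD('n) \<longrightarrow> (\<forall>\<eta>\<in>set \<eta>s. bodd \<eta>) \<longrightarrow>
     asum \<eta>s (\<lambda>k. mJ (std_frame k :: complex^'n)) = c * asum \<eta>s std_frame"
proof -
  let ?n = "CARD('n)"
  define \<kappa> where "\<kappa> k = (if k < 2 * ?n then (if even k then k + 1 else k - 1) else k)" for k :: nat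
  define s where "s k = (if even k then 1 else -1 :: real)" for k :: nat
  have kl: "\<kappa> k < 2 * ?n" if "k < 2 * ?n" for k
    using that by (auto simp: \<kappa>_def elim!: evenE oddE)
  have kk: "\<kappa> (\<kappa> k) = k" for k
  proof (cases "k < 2 * ?n")
    case True
    show ?thesis
    proof (cases "even k")
      case True
      then have "\<kappa> k = k + 1" using \<open>k < 2 * ?n\<close> by (simp add: \<kappa>_def)
      moreover have "k + 1 < 2 * ?n" using kl[OF \<open>k < 2 * ?n\<close>] calculation by simp
      ultimately show ?thesis using True by (simp add: \<kappa>_def[of "Suc k"])
    next
      case False
      then obtain j where j: "k = 2 * j + 1" by (rule oddE)
      then have "\<kappa> k = 2 * j" using \<open>k < 2 * ?n\<close> by (simp add: \<kappa>_def)
      then show ?thesis using j \<open>k < 2 * ?n\<close> by (simp add: \<kappa>_def[of "2 * j"])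
    qed
  next
    case False
    then show ?thesis by (simp add: \<kappa>_def)
  qed
  have koff: "\<kappa> k = k" if "k \<notin> {..<2 * ?n}" for k using that by (simp add: \<kappa>_def)
  have kp: "\<kappa> permutes {..<2 * ?n}"
    by (rule bij_imp_permutes[OF bij_betw_byWitness[where f' = \<kappa>] koff]) (auto simp: kk intro: kl)
  have J: "mJ (std_frame k :: complex^'n) = s k *\<^sub>R std_frame (\<kappa> k)" if "k < 2 * ?n" for k
    using that unfolding frame_J s_def \<kappa>_def by simp
  let ?c = "(\<Prod>k<2 * ?n. s k) * of_int (sign \<kappa>)"
  have "asum \<eta>s (\<lambda>k. mJ (std_frame k :: complex^'n)) = ?c * asum \<eta>s std_frame"
    if l: "length \<eta>s = ?n" and b: "\<forall>\<eta>\<in>set \<eta>s. bodd \<eta>" for \<eta>s :: "(complex^'n \<Rightarrow> complex^'n \<Rightarrow> real) list"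
  proof -
    let ?F = "\<lambda>\<pi>. \<Prod>i<?n. (\<eta>s ! i) (std_frame (\<pi> (2 * i))) (std_frame (\<pi> (2 * i + 1)))"
    have "asum \<eta>s (\<lambda>k. mJ (std_frame k :: complex^'n)) = (\<Sum>\<pi> | \<pi> permutes {..<2 * ?n}. (\<Prod>k<2 * ?n. s k) * (of_int (sign \<pi>) * ?F (\<kappa> \<circ> \<pi>)))"
      unfolding asum_def l
    proof (rule sum.cong[OF refl])
      fix \<pi> assume "\<pi> \<in> {\<pi>. \<pi> permutes {..<2 * ?n}}"
      then have \<pi>: "\<pi> permutes {..<2 * ?n}" by simp
      have in\<pi>: "\<pi> p < 2 * ?n \<longleftrightarrow> p < 2 * ?n" for p using permutes_in_image[OF \<pi>, of p] by auto
      have "(\<Prod>i<?n. (\<eta>s ! i) (mJ (std_frame (\<pi> (2 * i)))) (mJ (std_frame (\<pi> (2 * i + 1)))))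
        = (\<Prod>i<?n. (s (\<pi> (2 * i)) * s (\<pi> (2 * i + 1))) * (\<eta>s ! i) (std_frame (\<kappa> (\<pi> (2 * i)))) (std_frame (\<kappa> (\<pi> (2 * i + 1)))))"
      proof (rule prod.cong[OF refl])
        fix i assume i: "i \<in> {..<?n}"
        have "\<pi> (2 * i) < 2 * ?n" "\<pi> (2 * i + 1) < 2 * ?n" using i by (simp_all add: in\<pi>)
        moreover have "bodd (\<eta>s ! i)" using b l i by simp
        ultimately show "(\<eta>s ! i) (mJ (std_frame (\<pi> (2 * i)))) (mJ (std_frame (\<pi> (2 * i + 1)))) =
          (s (\<pi> (2 * i)) * s (\<pi> (2 * i + 1))) * (\<eta>s ! i) (std_frame (\<kappa> (\<pi> (2 * i)))) (std_frame (\<kappa> (\<pi> (2 * i + 1))))"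
          by (simp add: J bodd_def)
      qed
      also have "\<dots> = (\<Prod>k<2 * ?n. s (\<pi> k)) * ?F (\<kappa> \<circ> \<pi>)"
        unfolding prod.distrib prod_pairs[of "\<lambda>k. s (\<pi> k)"] by (simp add: prod.distrib)
      also have "(\<Prod>k<2 * ?n. s (\<pi> k)) = (\<Prod>k<2 * ?n. s k)" by (rule prod_perm_all[OF \<pi>])
      finally show "of_int (sign \<pi>) * (\<Prod>i<?n. (\<eta>s ! i) (mJ (std_frame (\<pi> (2 * i)))) (mJ (std_frame (\<pi> (2 * i + 1)))))
        = (\<Prod>k<2 * ?n. s k) * (of_int (sign \<pi>) * ?F (\<kappa> \<circ> \<pi>))" by (simp add: mult_ac)
    qed
    also have "\<dots> = (\<Prod>k<2 * ?n. s k) * (\<Sum>\<pi> | \<pi> permutes {..<2 * ?n}. of_int (sign \<pi>) * ?F (\<kappa> \<circ> \<pi>))"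
      by (simp add: sum_distrib_left)
    also have "(\<Sum>\<pi> | \<pi> permutes {..<2 * ?n}. of_int (sign \<pi>) * ?F (\<kappa> \<circ> \<pi>)) = of_int (sign \<kappa>) * asum \<eta>s std_frame"
      using sum_perm_sign_left[OF kp, of ?F] unfolding asum_def l by (simp add: sign_def)
    finally show ?thesis by simp
  qed
  then show ?thesis by blast
qed

lemma asum_nsq_pos: "0 < asum (replicate CARD('n) (reta nsq z)) (std_frame :: nat \<Rightarrow> complex^'n)"
proof -
  obtain c where c: "c > 0" "Qf (replicate CARD('n) (idm :: complex^'n^'n)) = of_real c" using Qf_idm_pos by blast
  have "wedge2 (map (\<lambda>u. ddc u z) (replicate CARD('n) nsq)) (std_frame :: nat \<Rightarrow> complex^'n) = of_real c"
  proof -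
    have "wedge2 (map (\<lambda>u. ddc u z) (replicate CARD('n) nsq)) (std_frame :: nat \<Rightarrow> complex^'n) = Qf (map (\<lambda>u. hess u z) (replicate CARD('n) nsq))"
      by (rule wedge_Qf[of _ UNIV]) (auto intro: Ck_nsq)
    then show ?thesis unfolding map_replicate hess_nsq c(2) .
  qed
  moreover have "wedge2 (map (\<lambda>u. ddc u z) (replicate CARD('n) nsq)) (std_frame :: nat \<Rightarrow> complex^'n)
      = of_real (asum (map (\<lambda>u. reta u z) (replicate CARD('n) nsq)) std_frame)"
    by (rule wedge_real[of _ UNIV]) (auto simp: Ck_nsq)
  ultimately show ?thesis using c(1) by simp
qed

lemma asum_J:
  assumes "length \<eta>s = CARD('n)" "\<And>\<eta>. \<eta> \<in> set \<eta>s \<Longrightarrow> bodd \<eta>"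
  shows "asum \<eta>s (\<lambda>k. mJ (std_frame k :: complex^'n)) = asum \<eta>s std_frame"
proof -
  obtain c where c: "\<And>\<eta>s. length \<eta>s = CARD('n) \<Longrightarrow> (\<forall>\<eta>\<in>set \<eta>s. bodd \<eta>) \<Longrightarrow>
     asum \<eta>s (\<lambda>k. mJ (std_frame k :: complex^'n)) = c * asum \<eta>s std_frame"
    using asum_J_factor by blast
  let ?r = "reta nsq (0 :: complex^'n)"
  have i: "mJ x \<bullet> mJ y = x \<bullet> y" for x y :: "complex^'n"
    by (simp add: mJ_def inner_vec_def inner_complex_def algebra_simps)
  have r: "?r x y = - 2 * (x \<bullet> mJ y)" for x y by (simp add: reta_def dd_dd_nsq)
  have inv: "?r (mJ x) (mJ y) = ?r x y" for x y unfolding r i ..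
  have bo: "bodd ?r" unfolding bodd_def r by (simp add: mJ_scaleR)
  have "asum (replicate CARD('n) ?r) (\<lambda>k. mJ (std_frame k :: complex^'n)) = asum (replicate CARD('n) ?r) std_frame"
    unfolding asum_def by (simp add: inv)
  moreover have "asum (replicate CARD('n) ?r) (\<lambda>k. mJ (std_frame k :: complex^'n)) = c * asum (replicate CARD('n) ?r) std_frame"
    by (rule c) (use bo in auto)
  ultimately have "c = 1" using asum_nsq_pos[of "0 :: complex^'n"] by simp
  then show ?thesis using c[OF assms(1)] assms(2) by simp
qed

lemma asum_pullback: "asum \<eta>s (\<lambda>k. f (v k)) = asum (map (\<lambda>\<eta> x y. \<eta> (f x) (f y)) \<eta>s) v"
  unfolding asum_def length_map
  by (intro sum.cong refl arg_cong2[of _ _ _ _ "(*)"] prod.cong) simp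

text \<open>Invariance under the complex structure turns \<open>df \<and> d\<^sup>cg \<and> T\<close> into \<open>dg
  \<and> d\<^sup>cf \<and> T\<close> for \<open>J\<close>-invariant \<open>T\<close>.\<close>
lemma asum_sym_grad:
  fixes \<xi> \<zeta> :: "complex^'n \<Rightarrow> real"
  assumes lin: "linear \<xi>" "linear \<zeta>" and l: "Suc (length L) = CARD('n)"
    and L: "\<And>\<eta>. \<eta> \<in> set L \<Longrightarrow> bodd \<eta>" "\<And>\<eta> x y. \<eta> \<in> set L \<Longrightarrow> \<eta> (mJ x) (mJ y) = - \<eta> y x"
  shows "asum ((\<lambda>x y. \<xi> x * \<zeta> (mJ y)) # L) std_frame = asum ((\<lambda>x y. \<zeta> x * \<xi> (mJ y)) # L) std_frame"
proof -
  define X0 where "X0 = (\<lambda>x y. 1 * (\<xi> x * \<zeta> (mJ y)) + (-1) * (\<zeta> x * \<xi> (mJ y)))"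
  have sc: "\<xi> (r *\<^sub>R x) = r * \<xi> x" "\<zeta> (r *\<^sub>R x) = r * \<zeta> x" for r x
    using lin by (simp_all add: linear_scale)
  have mi: "\<xi> (- x) = - \<xi> x" "\<zeta> (- x) = - \<zeta> x" for x using sc[of "-1" x] by simp_all
  have bo: "bodd X0" unfolding bodd_def X0_def by (simp add: sc mJ_scaleR algebra_simps)
  have "asum (X0 # L) std_frame = asum (X0 # L) (\<lambda>k. mJ (std_frame k))"
    by (rule asum_J[symmetric]) (use l L bo in auto)
  also have "\<dots> = asum (map (\<lambda>\<eta> x y. - \<eta> y x) ((\<lambda>x y. - X0 x y) # L)) std_frame"
  proof -
    have "asum (X0 # L) (\<lambda>k. mJ (std_frame k)) = asum (map (\<lambda>\<eta> x y. \<eta> (mJ x) (mJ y)) (X0 # L)) std_frame"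
      by (rule asum_pullback)
    moreover have "map (\<lambda>\<eta> x y. \<eta> (mJ x) (mJ y)) (X0 # L) = map (\<lambda>\<eta> x y. - \<eta> y x) ((\<lambda>x y. - X0 x y) # L)"
      using L(2) by (auto simp: X0_def fun_eq_iff mJ_mJ mi)
    ultimately show ?thesis by (simp only:)
  qed
  also have "\<dots> = asum ((\<lambda>x y. (-1) * X0 x y + 0 * X0 x y) # L) std_frame" unfolding asum_neg_flip by simp
  also have "\<dots> = - asum (X0 # L) std_frame" using asum_lin[of "-1" X0 0 X0 L std_frame] by simp
  finally have "asum (X0 # L) std_frame = 0" by simp
  moreover have "asum (X0 # L) std_frame = 1 * asum ((\<lambda>x y. \<xi> x * \<zeta> (mJ y)) # L) std_frame + (-1) * asum ((\<lambda>x y. \<zeta> x * \<xi> (mJ y)) # L) std_frame"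
    unfolding X0_def by (rule asum_lin)
  ultimately show ?thesis by simp
qed

section \<open>Integration by parts against a closed form\<close>

lemma Ck2D: "Ck_on 2 f S \<Longrightarrow> Ck_on (Suc (Suc 0)) f S"
  by (simp add: numeral_2_eq_2)

lemma dd_prod:
  assumes "finite I" "\<And>i. i \<in> I \<Longrightarrow> g i differentiable (at x)"
  shows "dd v (\<lambda>x. \<Prod>i\<in>I. g i x) x = (\<Sum>l\<in>I. dd v (g l) x * (\<Prod>i\<in>I - {l}. g i x))"
    "(\<lambda>x. \<Prod>i\<in>I. g i x) differentiable (at x)"
proof -
  have "dd v (\<lambda>x. \<Prod>i\<in>I. g i x) x = (\<Sum>l\<in>I. dd v (g l) x * (\<Prod>i\<in>I - {l}. g i x)) \<and> (\<lambda>x. \<Prod>i\<in>I. g i x) differentiable (at x)"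
    using assms
  proof (induction I rule: finite_induct)
    case (insert j I)
    have d: "g j differentiable (at x)" "(\<lambda>x. \<Prod>i\<in>I. g i x) differentiable (at x)" using insert by auto
    have "(\<Sum>l\<in>I. dd v (g l) x * (\<Prod>i\<in>insert j I - {l}. g i x)) = g j x * (\<Sum>l\<in>I. dd v (g l) x * (\<Prod>i\<in>I - {l}. g i x))"
      unfolding sum_distrib_left
    proof (intro sum.cong refl)
      fix l assume l: "l \<in> I"
      then have "insert j I - {l} = insert j (I - {l})" using insert.hyps by auto
      then show "dd v (g l) x * (\<Prod>i\<in>insert j I - {l}. g i x) = g j x * (dd v (g l) x * (\<Prod>i\<in>I - {l}. g i x))"
        using insert.hyps by simp
    qed
    moreover have "insert j I - {j} = I" using insert.hyps by auto
    moreover have "dd v (\<lambda>x. \<Prod>i\<in>I. g i x) x = (\<Sum>l\<in>I. dd v (g l) x * (\<Prod>i\<in>I - {l}. g i x))" using insert by auto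
    ultimately show ?case using insert.hyps dd_mult[OF d, of v] differentiable_mult[OF d] by simp
  qed simp
  then show "dd v (\<lambda>x. \<Prod>i\<in>I. g i x) x = (\<Sum>l\<in>I. dd v (g l) x * (\<Prod>i\<in>I - {l}. g i x))"
    "(\<lambda>x. \<Prod>i\<in>I. g i x) differentiable (at x)" by auto
qed

lemma int_by_parts_sym:
  fixes f g :: "'a::euclidean_space \<Rightarrow> real"
  assumes "open S" "closed K" "bounded K" "K \<subseteq> S" "Ck_on 1 f S" "Ck_on 1 g S"
    and "(\<forall>x. x \<notin> K \<longrightarrow> g x = 0) \<or> (\<forall>x. x \<notin> K \<longrightarrow> f x = 0)"
  shows "integral\<^sup>L lborel (\<lambda>x. f x * dd v g x) = - integral\<^sup>L lborel (\<lambda>x. dd v f x * g x)"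
    "integrable lborel (\<lambda>x. f x * dd v g x)" "integrable lborel (\<lambda>x. dd v f x * g x)"
proof -
  have "integral\<^sup>L lborel (\<lambda>x. f x * dd v g x) = - integral\<^sup>L lborel (\<lambda>x. dd v f x * g x) \<and>
    integrable lborel (\<lambda>x. f x * dd v g x) \<and> integrable lborel (\<lambda>x. dd v f x * g x)"
  proof (cases "\<forall>x. x \<notin> K \<longrightarrow> g x = 0")
    case True then show ?thesis using int_by_parts[OF assms(1-6), of v] by blast
  next
    case False
    then have "\<forall>x. x \<notin> K \<longrightarrow> f x = 0" using assms(7) by blast
    then show ?thesis using int_by_parts[OF assms(1-4,6,5), of v] by (simp add: mult.commute)
  qed
  then show "integral\<^sup>L lborel (\<lambda>x. f x * dd v g x) = - integral\<^sup>L lborel (\<lambda>x. dd v f x * g x)"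
    "integrable lborel (\<lambda>x. f x * dd v g x)" "integrable lborel (\<lambda>x. dd v f x * g x)" by auto
qed

definition Gpi :: "(complex^'n \<Rightarrow> real) list \<Rightarrow> (nat \<Rightarrow> nat) \<Rightarrow> complex^'n \<Rightarrow> real" where
  "Gpi vs \<pi> x = (\<Prod>i<length vs. reta (vs ! i) x (std_frame (\<pi> (2 * i + 2))) (std_frame (\<pi> (2 * i + 3))))"

lemma asum_reta_Cons:
  "asum (\<eta> # map (\<lambda>u. reta u x) vs) std_frame = (\<Sum>\<pi> | \<pi> permutes {..<2 * Suc (length vs)}.
      of_int (sign \<pi>) * (\<eta> (std_frame (\<pi> 0)) (std_frame (\<pi> 1)) * Gpi vs \<pi> x))"
  unfolding asum_Cons Gpi_def by simp

lemma Ck_reta: "open S \<Longrightarrow> Ck_on (Suc (Suc k)) u S \<Longrightarrow> Ck_on k (\<lambda>x. reta u x a b) S"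
proof -
  assume "open S" "Ck_on (Suc (Suc k)) u S"
  from Ck_cmult[OF this(1) Ck_dd[OF Ck_dd[OF this(2)]], of "-1" a "mJ b"]
  show ?thesis unfolding reta_def by simp
qed

lemma Ck_Gpi: "open S \<Longrightarrow> (\<And>u. u \<in> set vs \<Longrightarrow> Ck_on (Suc (Suc k)) u S) \<Longrightarrow> Ck_on k (Gpi vs \<pi>) S"
  unfolding Gpi_def[abs_def] by (intro Ck_prod Ck_reta) auto

text \<open>The form \<open>dd\<^sup>cv\<^sub>1 \<and> \<dots> \<and> dd\<^sup>cv\<^sub>k\<close> is closed: each term of
  its divergence contains a third derivative symmetric in two slots on which the sign alternates.\<close>
lemma Gpi_closed:
  fixes vs :: "(complex^'n \<Rightarrow> real) list"
  assumes vs: "\<And>u j. u \<in> set vs \<Longrightarrow> Ck_on j u UNIV"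
  shows "(\<Sum>\<pi> | \<pi> permutes {..<2 * Suc (length vs)}. of_int (sign \<pi>) * (h (\<pi> 1) * dd (std_frame (\<pi> 0)) (Gpi vs \<pi>) x)) = 0"
proof -
  let ?N = "2 * Suc (length vs)"
  let ?g = "\<lambda>\<pi> i x. reta (vs ! i) x (std_frame (\<pi> (2 * i + 2))) (std_frame (\<pi> (2 * i + 3)))"
  have c1: "Ck_on (Suc 0) (?g \<pi> i) UNIV" if "i < length vs" for \<pi> i
    by (rule Ck_reta) (use that vs in auto)
  have dG: "dd v (Gpi vs \<pi>) x = (\<Sum>l<length vs. dd v (?g \<pi> l) x * (\<Prod>i\<in>{..<length vs} - {l}. ?g \<pi> i x))" for v \<pi>
    unfolding Gpi_def[abs_def] by (rule dd_prod(1)) (use Ck_diff[OF c1] in auto)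
  have "(\<Sum>\<pi> | \<pi> permutes {..<?N}. of_int (sign \<pi>) * (h (\<pi> 1) * dd (std_frame (\<pi> 0)) (Gpi vs \<pi>) x))
    = (\<Sum>\<pi> | \<pi> permutes {..<?N}. \<Sum>l<length vs. of_int (sign \<pi>) * (h (\<pi> 1) * (dd (std_frame (\<pi> 0)) (?g \<pi> l) x * (\<Prod>i\<in>{..<length vs} - {l}. ?g \<pi> i x))))"
    unfolding dG by (simp add: sum_distrib_left)
  also have "\<dots> = (\<Sum>l<length vs. \<Sum>\<pi> | \<pi> permutes {..<?N}. of_int (sign \<pi>) * (h (\<pi> 1) * (dd (std_frame (\<pi> 0)) (?g \<pi> l) x * (\<Prod>i\<in>{..<length vs} - {l}. ?g \<pi> i x))))"
    by (rule sum.swap)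
  also have "\<dots> = 0"
  proof (rule sum.neutral, rule ballI)
    fix l assume l: "l \<in> {..<length vs}"
    let ?\<tau> = "tr 0 (2 * l + 2)"
    show "(\<Sum>\<pi> | \<pi> permutes {..<?N}. of_int (sign \<pi>) * (h (\<pi> 1) * (dd (std_frame (\<pi> 0)) (?g \<pi> l) x * (\<Prod>i\<in>{..<length vs} - {l}. ?g \<pi> i x)))) = 0"
    proof (rule sum_perm_odd[of 0 _ "2 * l + 2"])
      fix \<pi> :: "nat \<Rightarrow> nat"
      have t: "?\<tau> 0 = 2 * l + 2" "?\<tau> (2 * l + 2) = 0" "?\<tau> 1 = 1" "?\<tau> (2 * l + 3) = 2 * l + 3"
        by (simp_all add: Transposition.transpose_def)
      have ti: "?\<tau> (2 * i + 2) = 2 * i + 2" "?\<tau> (2 * i + 3) = 2 * i + 3" if "i \<noteq> l" for i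
      proof -
        have "even (2 * i + 3) \<noteq> even (2 * l + 2)" by simp
        then have "2 * i + 3 \<noteq> 2 * l + 2" by (rule contrapos_nn) (simp only:)
        then show "?\<tau> (2 * i + 2) = 2 * i + 2" "?\<tau> (2 * i + 3) = 2 * i + 3"
          using that by (simp_all add: Transposition.transpose_def)
      qed
      have P: "(\<Prod>i\<in>{..<length vs} - {l}. ?g (\<pi> \<circ> ?\<tau>) i x) = (\<Prod>i\<in>{..<length vs} - {l}. ?g \<pi> i x)"
      proof (rule prod.cong[OF refl])
        fix i assume "i \<in> {..<length vs} - {l}"
        then have ne: "i \<noteq> l" by blast
        show "?g (\<pi> \<circ> ?\<tau>) i x = ?g \<pi> i x" unfolding o_def ti[OF ne] by (rule refl)
      qed
      let ?w = "dd (mJ (std_frame (\<pi> (2 * l + 3)))) (vs ! l)"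
      have "Ck_on (Suc 2) (vs ! l) UNIV" by (rule vs) (use l in simp)
      then have w: "Ck_on 2 ?w UNIV" by (rule Ck_dd)
      then have w2: "Ck_on (Suc (Suc 0)) ?w UNIV" by (rule Ck2D)
      have w1: "dd a ?w differentiable (at x)" for a
        by (rule Ck_diff[OF Ck_dd[OF w2]]) (rule UNIV_I)
      have m: "dd b (\<lambda>x. - dd a ?w x) x = - dd b (dd a ?w) x" for a b
        using dd_cmult[OF w1, of b "-1" a] by simp
      have D: "dd (std_frame ((\<pi> \<circ> ?\<tau>) 0)) (?g (\<pi> \<circ> ?\<tau>) l) x = dd (std_frame (\<pi> 0)) (?g \<pi> l) x"
        unfolding reta_def o_def t m
        using dd_commute[OF w open_UNIV UNIV_I, where v = "std_frame (\<pi> 0)" and w = "std_frame (\<pi> (2 * l + 2))" and x = x]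
        by (simp only:)
      show "h ((\<pi> \<circ> ?\<tau>) 1) * (dd (std_frame ((\<pi> \<circ> ?\<tau>) 0)) (?g (\<pi> \<circ> ?\<tau>) l) x * (\<Prod>i\<in>{..<length vs} - {l}. ?g (\<pi> \<circ> ?\<tau>) i x)) =
        h (\<pi> 1) * (dd (std_frame (\<pi> 0)) (?g \<pi> l) x * (\<Prod>i\<in>{..<length vs} - {l}. ?g \<pi> i x))"
        unfolding P D by (simp only: t(3) o_def)
    qed (use l in auto)
  qed
  finally show ?thesis .
qed

text \<open>The coefficient of \<open>dd\<^sup>cu\<^sub>1 \<and> \<dots> \<and> dd\<^sup>cu\<^sub>n\<close>.\<close>
definition Fs :: "(complex^'n \<Rightarrow> real) list \<Rightarrow> complex^'n \<Rightarrow> real" where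
  "Fs us x = asum (map (\<lambda>u. reta u x) us) std_frame"

text \<open>The coefficient of \<open>df \<and> d\<^sup>cg \<and> dd\<^sup>cv\<^sub>1 \<and> \<dots>\<close>, up to sign.\<close>
definition Bs :: "(complex^'n \<Rightarrow> real) \<Rightarrow> (complex^'n \<Rightarrow> real) \<Rightarrow> (complex^'n \<Rightarrow> real) list \<Rightarrow> complex^'n \<Rightarrow> real" where
  "Bs f g vs x = asum ((\<lambda>a b. dd a f x * dd (mJ b) g x) # map (\<lambda>u. reta u x) vs) std_frame"

text \<open>One integration by parts. The third derivatives that appear cancel by \<open>Gpi_closed\<close>, for which the
  \<open>v\<^sub>i\<close> have to be smooth.\<close>
lemma ibp_half:
  fixes f g :: "complex^'n \<Rightarrow> real"
  assumes S: "open S" "closed K" "bounded K" "K \<subseteq> S" and f: "Ck_on 1 f S" and g: "Ck_on 2 g S"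
    and vs: "\<And>u j. u \<in> set vs \<Longrightarrow> Ck_on j u UNIV"
    and z: "(\<forall>x. x \<notin> K \<longrightarrow> g x = 0) \<or> (\<forall>x. x \<notin> K \<longrightarrow> f x = 0)"
  shows "integral\<^sup>L lborel (\<lambda>x. f x * Fs (g # vs) x) = integral\<^sup>L lborel (\<lambda>x. Bs f g vs x)"
proof -
  let ?P = "{\<pi>. \<pi> permutes {..<2 * Suc (length vs)}}"
  let ?e = "std_frame :: nat \<Rightarrow> complex^'n"
  have g2: "Ck_on (Suc (Suc 0)) g S" using g by (simp add: numeral_2_eq_2)
  have fP: "finite ?P" by (rule finite_permutations) simp
  have G1: "Ck_on 1 (Gpi vs \<pi>) UNIV" for \<pi> by (rule Ck_Gpi) (use vs in auto)
  have GS: "Ck_on 1 (Gpi vs \<pi>) S" for \<pi> by (rule Ck_subset[OF G1]) simp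
  have fG: "Ck_on 1 (\<lambda>x. f x * Gpi vs \<pi> x) S" for \<pi> by (rule Ck_mult[OF S(1) f GS])
  have gam: "Ck_on 1 (dd b g) S" for b using Ck_dd[OF g2] by simp
  have zz: "(\<forall>x. x \<notin> K \<longrightarrow> dd b g x = 0) \<or> (\<forall>x. x \<notin> K \<longrightarrow> f x * Gpi vs \<pi> x = 0)" for b \<pi>
    using z dd_zero_off[OF S(2), of g _ b] by auto
  note ibp = int_by_parts_sym[OF S fG gam zz]
  have "integral\<^sup>L lborel (\<lambda>x. f x * Fs (g # vs) x)
     = integral\<^sup>L lborel (\<lambda>x. \<Sum>\<pi>\<in>?P. - of_int (sign \<pi>) * ((f x * Gpi vs \<pi> x) * dd (?e (\<pi> 0)) (dd (mJ (?e (\<pi> 1))) g) x))"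
    unfolding Fs_def list.map asum_reta_Cons sum_distrib_left
    by (intro Bochner_Integration.integral_cong refl sum.cong) (simp add: reta_def mult_ac)
  also have "\<dots> = (\<Sum>\<pi>\<in>?P. - of_int (sign \<pi>) * integral\<^sup>L lborel (\<lambda>x. (f x * Gpi vs \<pi> x) * dd (?e (\<pi> 0)) (dd (mJ (?e (\<pi> 1))) g) x))"
    by (subst Bochner_Integration.integral_sum) (use ibp(2) in \<open>auto intro!: integrable_mult_right\<close>)
  also have "\<dots> = (\<Sum>\<pi>\<in>?P. of_int (sign \<pi>) * integral\<^sup>L lborel (\<lambda>x. dd (?e (\<pi> 0)) (\<lambda>x. f x * Gpi vs \<pi> x) x * dd (mJ (?e (\<pi> 1))) g x))"
    unfolding ibp(1) by simp
  also have "\<dots> = integral\<^sup>L lborel (\<lambda>x. \<Sum>\<pi>\<in>?P. of_int (sign \<pi>) * (dd (?e (\<pi> 0)) (\<lambda>x. f x * Gpi vs \<pi> x) x * dd (mJ (?e (\<pi> 1))) g x))"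
    by (subst Bochner_Integration.integral_sum) (use ibp(3) in \<open>auto intro!: integrable_mult_right\<close>)
  also have "\<dots> = integral\<^sup>L lborel (\<lambda>x. Bs f g vs x)"
  proof (rule Bochner_Integration.integral_cong[OF refl])
    fix x
    show "(\<Sum>\<pi>\<in>?P. of_int (sign \<pi>) * (dd (?e (\<pi> 0)) (\<lambda>x. f x * Gpi vs \<pi> x) x * dd (mJ (?e (\<pi> 1))) g x)) = Bs f g vs x"
    proof (cases "x \<in> S")
      case True
      have df: "f differentiable (at x)" using Ck_diff[of 0 f S x] f True by simp
      have dG: "Gpi vs \<pi> differentiable (at x)" for \<pi> using Ck_diff[of 0 "Gpi vs \<pi>" UNIV x] G1 by simp
      have "(\<Sum>\<pi>\<in>?P. of_int (sign \<pi>) * (dd (?e (\<pi> 0)) (\<lambda>x. f x * Gpi vs \<pi> x) x * dd (mJ (?e (\<pi> 1))) g x))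
        = (\<Sum>\<pi>\<in>?P. of_int (sign \<pi>) * (dd (?e (\<pi> 0)) f x * dd (mJ (?e (\<pi> 1))) g x * Gpi vs \<pi> x))
        + f x * (\<Sum>\<pi>\<in>?P. of_int (sign \<pi>) * (dd (mJ (?e (\<pi> 1))) g x * dd (?e (\<pi> 0)) (Gpi vs \<pi>) x))"
        unfolding dd_mult[OF df dG] by (simp add: sum_distrib_left sum.distrib[symmetric] algebra_simps)
      then show ?thesis unfolding Bs_def asum_reta_Cons
        using Gpi_closed[where h = "\<lambda>k. dd (mJ (?e k)) g x" and x = x and vs = vs, OF vs] by simp
    next
      case False
      then have xK: "x \<notin> K" using S by blast
      show ?thesis
      proof (cases "\<forall>x. x \<notin> K \<longrightarrow> g x = 0")
        case True
        then have "dd b g x = 0" for b using dd_zero_off[OF S(2) _ xK] by blast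
        then show ?thesis unfolding Bs_def asum_reta_Cons by simp
      next
        case False
        then have f0: "\<And>x. x \<notin> K \<Longrightarrow> f x = 0" using z by blast
        then have "dd b f x = 0" "dd b (\<lambda>x. f x * Gpi vs \<pi> x) x = 0" for b \<pi>
          using dd_zero_off[OF S(2) _ xK, of f] dd_zero_off[OF S(2) _ xK, of "\<lambda>x. f x * Gpi vs \<pi> x"] by auto
        then show ?thesis unfolding Bs_def asum_reta_Cons by simp
      qed
    qed
  qed
  finally show ?thesis .
qed

lemma Bs_sym:
  fixes f g :: "complex^'n \<Rightarrow> real"
  assumes "f differentiable (at x)" "g differentiable (at x)" "Suc (length vs) = CARD('n)"
    "\<And>u. u \<in> set vs \<Longrightarrow> Ck_on 2 u S" "open S" "x \<in> S"
  shows "Bs f g vs x = Bs g f vs x"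
  unfolding Bs_def
proof (rule asum_sym_grad)
  show "linear (\<lambda>a. dd a f x)" "linear (\<lambda>a. dd a g x)"
    using has_derivative_linear[OF has_derivative_dd] assms(1,2) by auto
  show "Suc (length (map (\<lambda>u. reta u x) vs)) = CARD('n)" using assms(3) by simp
  fix \<eta> assume "\<eta> \<in> set (map (\<lambda>u. reta u x) vs)"
  then obtain u where u: "u \<in> set vs" "\<eta> = reta u x" by auto
  have b: "bil (\<lambda>a b. dd a (dd b u) x)" by (rule bil_hess[OF assms(4)[OF u(1)] assms(5,6)])
  have l: "dd (r *\<^sub>R a) (dd c u) x = r * dd a (dd c u) x" "dd c (dd (r *\<^sub>R a) u) x = r * dd c (dd a u) x" for r a c
    using bil_l[OF b, of r a 0 a c] bil_r[OF b, of c r a 0 a] by simp_all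
  show "bodd \<eta>" unfolding bodd_def u(2) reta_def by (simp add: mJ_scaleR l)
  fix a c
  have "dd (mJ a) (dd (- c) u) x = - dd (mJ a) (dd c u) x" using l(2)[of "mJ a" "-1" c] by simp
  then show "\<eta> (mJ a) (mJ c) = - \<eta> c a"
    unfolding u(2) reta_def mJ_mJ using bil_sym[OF b, of "mJ a" c] by simp
qed

lemma ibp_smooth:
  fixes f g :: "complex^'n \<Rightarrow> real"
  assumes S: "open S" "closed K" "bounded K" "K \<subseteq> S" and f: "Ck_on 2 f S" and g: "Ck_on 2 g S"
    and vs: "\<And>u j. u \<in> set vs \<Longrightarrow> Ck_on j u UNIV" and l: "Suc (length vs) = CARD('n)"
    and z: "\<And>x. x \<notin> K \<Longrightarrow> g x = 0"
  shows "integral\<^sup>L lborel (\<lambda>x. f x * Fs (g # vs) x) = integral\<^sup>L lborel (\<lambda>x. g x * Fs (f # vs) x)"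
proof -
  have f1: "Ck_on 1 f S" using f by (rule Ck_le) simp
  have g1: "Ck_on 1 g S" using g by (rule Ck_le) simp
  have "integral\<^sup>L lborel (\<lambda>x. f x * Fs (g # vs) x) = integral\<^sup>L lborel (\<lambda>x. Bs f g vs x)"
    by (rule ibp_half[OF S f1 g vs]) (use z in auto)
  also have "\<dots> = integral\<^sup>L lborel (\<lambda>x. Bs g f vs x)"
  proof (rule Bochner_Integration.integral_cong[OF refl])
    fix x
    show "Bs f g vs x = Bs g f vs x"
    proof (cases "x \<in> S")
      case True
      have "f differentiable (at x)" "g differentiable (at x)"
        using Ck_diff[of 0 f S x] Ck_diff[of 0 g S x] f1 g1 True by simp_all
      then show ?thesis by (rule Bs_sym[OF _ _ l _ open_UNIV]) (use vs in auto)
    next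
      case False
      then have xK: "x \<notin> K" using S by blast
      have "dd b g x = 0" for b by (rule dd_zero_off[OF S(2) _ xK]) (rule z)
      then show ?thesis unfolding Bs_def asum_reta_Cons by simp
    qed
  qed
  also have "\<dots> = integral\<^sup>L lborel (\<lambda>x. g x * Fs (f # vs) x)"
    by (rule ibp_half[OF S g1 f vs, symmetric]) (use z in auto)
  finally show ?thesis .
qed

lemma Fs_mset: "mset us = mset ws \<Longrightarrow> Fs us x = Fs ws x"
  unfolding Fs_def by (intro asum_mset) (metis mset_map)

lemma Ck_Fs_cont:
  assumes "open S" "\<And>u. u \<in> set us \<Longrightarrow> Ck_on 2 u S" shows "continuous_on S (Fs us)"
proof -
  have "continuous_on S (\<lambda>x. reta u x a b)" if "u \<in> set us" for u a b
    using Ck_reta[OF assms(1), of 0 u] assms(2)[OF that] by (simp add: numeral_2_eq_2)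
  then have c: "continuous_on S (\<lambda>x. reta (us ! i) x a b)" if "i < length us" for i a b
    using nth_mem[OF that] by blast
  have F: "Fs us = (\<lambda>x. \<Sum>\<pi> | \<pi> permutes {..<2 * length us}. of_int (sign \<pi>) *
      (\<Prod>i<length us. reta (us ! i) x (std_frame (\<pi> (2 * i))) (std_frame (\<pi> (2 * i + 1)))))"
    unfolding Fs_def[abs_def] asum_def length_map
    by (intro HOL.ext sum.cong refl arg_cong2[of _ _ _ _ "(*)"] prod.cong) simp
  show ?thesis unfolding F
    by (intro continuous_on_sum continuous_on_mult continuous_on_const continuous_on_prod c) simp
qed

lemma Fs_zero: assumes "closed K" "\<And>x. x \<notin> K \<Longrightarrow> u x = 0" "x \<notin> K" shows "Fs (u # us) x = 0"
proof -
  have "dd a (dd b u) x = 0" for a b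
    using dd_zero_off[OF assms(1) dd_zero_off[OF assms(1,2)] assms(3)] .
  then show ?thesis unfolding Fs_def list.map asum_reta_Cons by (simp add: reta_def)
qed

lemma supp_integrable:
  fixes h :: "'a::euclidean_space \<Rightarrow> real"
  assumes "open S" "closed K" "bounded K" "K \<subseteq> S" "continuous_on S h" "\<And>x. x \<notin> K \<Longrightarrow> h x = 0"
  shows "integrable lborel h" "continuous_on UNIV h"
proof -
  have "Ck_on 0 h UNIV" by (rule Ck_extend[OF assms(1,2,4,6)]) (use assms(5) in simp_all)
  then show c: "continuous_on UNIV h" by simp
  show "integrable lborel h" by (rule cc_integrable[OF c csupp_bounded[OF assms(3,6)]])
qed

text \<open>Mollification of a cut-off of \<open>v\<close>. On \<open>K\<close> the cut-off is \<open>1\<close> at a fixed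
  scale, and second derivatives can be moved from the kernel to \<open>v\<close>.\<close>
lemma smooth_approx:
  fixes v :: "'a::euclidean_space \<Rightarrow> real"
  assumes K: "compact K" "open S" "K \<subseteq> S" and v: "Ck_on 2 v S"
  obtains w where "\<And>(i::nat) j. Ck_on j (w i) UNIV"
    "\<And>p q e. 0 < e \<Longrightarrow> \<exists>i0. \<forall>i\<ge>i0. \<forall>x\<in>K. \<bar>dd p (dd q (w i)) x - dd p (dd q v) x\<bar> \<le> e"
proof -
  obtain \<kappa> L r where k: "continuous_on UNIV \<kappa>" "compact L" "L \<subseteq> S" "\<And>x. x \<notin> L \<Longrightarrow> \<kappa> x = (0::real)"
    "r > 0" "\<And>x y. x \<in> K \<Longrightarrow> y \<in> cball x r \<Longrightarrow> \<kappa> y = 1" "\<And>x. x \<in> K \<Longrightarrow> cball x r \<subseteq> S"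
    using cutoff[OF K] by blast
  have v2: "Ck_on (Suc (Suc 0)) v S" using v by (simp add: numeral_2_eq_2)
  define u where "u y = \<kappa> y * v y" for y
  have u0: "u y = 0" if "y \<notin> L" for y using k(4)[OF that] by (simp add: u_def)
  have "continuous_on S u" unfolding u_def using Ck_cont[OF v] continuous_on_subset[OF k(1)] by (auto intro!: continuous_intros)
  then have cu: "continuous_on UNIV u"
    by (rule supp_integrable(2)[OF K(2) compact_imp_closed[OF k(2)] compact_imp_bounded[OF k(2)] k(3)]) (rule u0)
  have su: "csupp u" by (rule csupp_bounded[OF compact_imp_bounded[OF k(2)]]) (rule u0)
  have sm: "Ck_on j (conv u (moll \<epsilon>)) UNIV" for j \<epsilon> by (rule Ck_conv[OF cu su Ck_moll])
  have M: "dd p (dd q (conv u (moll \<epsilon>))) x = conv (dd p (dd q v)) (moll \<epsilon>) x" if x: "x \<in> K" and e: "0 < \<epsilon>" "\<epsilon> \<le> r" for p q x \<epsilon>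
  proof -
    have sub: "cball x \<epsilon> \<subseteq> S" using k(7)[OF x] e by (auto simp: subset_iff)
    have zq: "dd q (moll \<epsilon>) z = 0" if "z \<notin> cball 0 \<epsilon>" for z :: 'a and q
      by (rule dd_zero_off[OF closed_cball _ that]) (rule moll_zero[OF e(1)])
    have zpq: "dd p (dd q (moll \<epsilon>)) z = 0" if "z \<notin> cball 0 \<epsilon>" for z :: 'a and p q
      by (rule dd_zero_off[OF closed_cball _ that]) (rule zq)
    have m1: "Ck_on 1 (moll \<epsilon>) UNIV" and m1q: "Ck_on 1 (dd q (moll \<epsilon>)) UNIV" for q :: 'a
      using Ck_moll Ck_dd[OF Ck_moll] by auto
    have "dd q (conv u (moll \<epsilon>)) = conv u (dd q (moll \<epsilon>))"
      by (rule HOL.ext) (rule conv_derivative(2)[OF cu su m1])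
    then have "dd p (dd q (conv u (moll \<epsilon>))) x = conv u (dd p (dd q (moll \<epsilon>))) x"
      using conv_derivative(2)[OF cu su m1q] by simp
    also have "\<dots> = conv v (dd p (dd q (moll \<epsilon>))) x"
    proof (rule conv_cong[of x \<epsilon>])
      fix y assume "y \<in> cball x \<epsilon>"
      then have "y \<in> cball x r" using e by auto
      then show "u y = v y" using k(6)[OF x] by (simp add: u_def)
    qed (rule zpq)
    also have "\<dots> = conv (dd p v) (dd q (moll \<epsilon>)) x"
      by (rule conv_dd_moll[OF e(1) K(2) sub _ m1q zq]) (use Ck_Suc_imp[OF v2] in simp)
    also have "\<dots> = conv (dd q (dd p v)) (moll \<epsilon>) x"
      by (rule conv_dd_moll[OF e(1) K(2) sub _ m1 moll_zero[OF e(1)]]) (use Ck_dd[OF v2] in simp)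
    also have "\<dots> = conv (dd p (dd q v)) (moll \<epsilon>) x"
      by (rule conv_cong[of x \<epsilon>]) (use dd_commute[OF v K(2)] sub moll_zero[OF e(1)] in auto)
    finally show ?thesis .
  qed
  define \<epsilon> where "\<epsilon> i = r / (real i + 1)" for i :: nat
  have ep: "0 < \<epsilon> i" "\<epsilon> i \<le> r" for i using k(5) by (auto simp: \<epsilon>_def field_simps)
  have el: "\<epsilon> \<longlonglongrightarrow> 0" 
  proof -
    have "(\<lambda>i. r * (1 / (real i + 1))) \<longlonglongrightarrow> r * 0"
      using LIMSEQ_inverse_real_of_nat by (intro tendsto_mult_left) (simp add: inverse_eq_divide add.commute)
    then show ?thesis by (simp add: \<epsilon>_def[abs_def])
  qed
  show ?thesis
  proof (rule that[of "\<lambda>i. conv u (moll (\<epsilon> i))"])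
    show "Ck_on j (conv u (moll (\<epsilon> i))) UNIV" for i j by (rule sm)
    fix p q and e :: real assume e: "0 < e"
    have "continuous_on S (dd p (dd q v))" using Ck_cont[OF Ck_dd[OF Ck_dd[OF v2]]] .
    then obtain \<epsilon>0 where e0: "\<epsilon>0 > 0" "\<forall>\<epsilon>. 0 < \<epsilon> \<and> \<epsilon> < \<epsilon>0 \<longrightarrow> (\<forall>x\<in>K. cball x \<epsilon> \<subseteq> S \<and> \<bar>conv (dd p (dd q v)) (moll \<epsilon>) x - dd p (dd q v) x\<bar> \<le> e)"
      using conv_moll_uniform[OF K _ e] by blast
    have "eventually (\<lambda>i. \<epsilon> i < \<epsilon>0) sequentially" using el e0(1) by (rule order_tendstoD(2))
    then obtain i0 where "\<forall>i\<ge>i0. \<epsilon> i < \<epsilon>0" by (auto simp: eventually_sequentially)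
    then show "\<exists>i0. \<forall>i\<ge>i0. \<forall>x\<in>K. \<bar>dd p (dd q (conv u (moll (\<epsilon> i)))) x - dd p (dd q v) x\<bar> \<le> e"
      using e0(2) ep M by (intro exI[of _ i0]) auto
  qed
qed

lemma int_uniform_limit:
  fixes C :: "'a::euclidean_space \<Rightarrow> real"
  assumes S: "open S" "closed K" "bounded K" "K \<subseteq> S" and C: "continuous_on S C" "\<And>x. x \<notin> K \<Longrightarrow> C x = 0"
    and h: "\<And>i::nat. continuous_on S (h i)" "continuous_on S h0"
    and u: "\<And>e. 0 < e \<Longrightarrow> \<exists>i0. \<forall>i\<ge>i0. \<forall>x\<in>K. \<bar>h i x - h0 x\<bar> \<le> e"
  shows "(\<lambda>i. integral\<^sup>L lborel (\<lambda>x. C x * h i x)) \<longlonglongrightarrow> integral\<^sup>L lborel (\<lambda>x. C x * h0 x)"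
proof (rule LIMSEQ_I)
  fix e :: real assume e: "0 < e"
  have i: "integrable lborel (\<lambda>x. C x * g x)" if "continuous_on S g" for g
    by (rule supp_integrable[OF S]) (use C that in \<open>auto intro!: continuous_intros\<close>)
  have iC: "integrable lborel (\<lambda>x. \<bar>C x\<bar>)" by (rule supp_integrable[OF S]) (use C in \<open>auto intro!: continuous_intros\<close>)
  define I where "I = integral\<^sup>L lborel (\<lambda>x. \<bar>C x\<bar>)"
  have I0: "0 \<le> I" unfolding I_def by (intro integral_nonneg_AE AE_I2) simp
  define d where "d = e / (I + 1) / 2"
  have d: "0 < d" "d * I < e" using e I0 by (auto simp: d_def field_simps intro!: add_nonneg_pos)
  obtain i0 where i0: "\<forall>i\<ge>i0. \<forall>x\<in>K. \<bar>h i x - h0 x\<bar> \<le> d" using u[OF d(1)] by blast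
  show "\<exists>no. \<forall>n\<ge>no. norm (integral\<^sup>L lborel (\<lambda>x. C x * h n x) - integral\<^sup>L lborel (\<lambda>x. C x * h0 x)) < e"
  proof (intro exI[of _ i0] allI impI)
    fix n assume n: "n \<ge> i0"
    have "integral\<^sup>L lborel (\<lambda>x. C x * h n x) - integral\<^sup>L lborel (\<lambda>x. C x * h0 x) = integral\<^sup>L lborel (\<lambda>x. C x * h n x - C x * h0 x)"
      by (intro Bochner_Integration.integral_diff[symmetric] i h)
    also have "\<bar>\<dots>\<bar> \<le> integral\<^sup>L lborel (\<lambda>x. \<bar>C x * h n x - C x * h0 x\<bar>)" by (rule integral_abs_bound)
    also have "\<dots> \<le> integral\<^sup>L lborel (\<lambda>x. d * \<bar>C x\<bar>)"
    proof (rule integral_mono)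
      show "integrable lborel (\<lambda>x. \<bar>C x * h n x - C x * h0 x\<bar>)"
        by (intro integrable_abs Bochner_Integration.integrable_diff i h)
      show "integrable lborel (\<lambda>x. d * \<bar>C x\<bar>)" using iC by (rule integrable_mult_right)
      fix x
      show "\<bar>C x * h n x - C x * h0 x\<bar> \<le> d * \<bar>C x\<bar>"
      proof (cases "x \<in> K")
        case True
        have "\<bar>C x * h n x - C x * h0 x\<bar> = \<bar>C x\<bar> * \<bar>h n x - h0 x\<bar>" by (simp add: right_diff_distrib[symmetric] abs_mult)
        also have "\<dots> \<le> \<bar>C x\<bar> * d" using i0 n True by (intro mult_left_mono) auto
        finally show ?thesis by (simp add: mult.commute)
      next
        case False then show ?thesis using C(2) by simp
      qed
    qed
    also have "\<dots> = d * I" unfolding I_def by (rule integral_mult_right_zero)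
    finally show "norm (integral\<^sup>L lborel (\<lambda>x. C x * h n x) - integral\<^sup>L lborel (\<lambda>x. C x * h0 x)) < e" using d(2) by simp
  qed
qed

lemma Fs_head_limit:
  fixes v :: "complex^'n \<Rightarrow> real"
  assumes S: "open S" "closed K" "bounded K" "K \<subseteq> S" and us: "\<And>u. u \<in> set us \<Longrightarrow> Ck_on 2 u S"
    and v: "Ck_on 2 v S" and w: "\<And>(i::nat) j. Ck_on j (w i) UNIV"
    "\<And>p q e. 0 < e \<Longrightarrow> \<exists>i0. \<forall>i\<ge>i0. \<forall>x\<in>K. \<bar>dd p (dd q (w i)) x - dd p (dd q v) x\<bar> \<le> e"
    and C: "continuous_on S C" "\<And>x. x \<notin> K \<Longrightarrow> C x = 0"
  shows "(\<lambda>i. integral\<^sup>L lborel (\<lambda>x. C x * Fs (w i # us) x)) \<longlonglongrightarrow> integral\<^sup>L lborel (\<lambda>x. C x * Fs (v # us) x)"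
proof -
  let ?P = "{\<pi>. \<pi> permutes {..<2 * Suc (length us)}}"
  let ?D = "\<lambda>\<pi> u. dd (std_frame (\<pi> 0)) (dd (mJ (std_frame (\<pi> 1))) u) :: complex^'n \<Rightarrow> real"
  define D where "D \<pi> x = - of_int (sign \<pi>) * (C x * Gpi us \<pi> x)" for \<pi> x
  have cG: "continuous_on S (Gpi us \<pi>)" for \<pi>
    using Ck_Gpi[OF S(1), of us 0 \<pi>] us by (simp add: numeral_2_eq_2)
  have cD: "continuous_on S (D \<pi>)" for \<pi> unfolding D_def by (intro continuous_intros C(1) cG)
  have D0: "D \<pi> x = 0" if "x \<notin> K" for \<pi> x using C(2)[OF that] by (simp add: D_def)
  have c2: "continuous_on S (?D \<pi> u)" if "Ck_on 2 u S" for u \<pi>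
    using Ck_cont[OF Ck_dd[OF Ck_dd[OF Ck2D[OF that]]]] .
  have wS: "Ck_on 2 (w i) S" for i using Ck_subset[OF w(1)] by blast
  have eq: "integral\<^sup>L lborel (\<lambda>x. C x * Fs (u # us) x) = (\<Sum>\<pi>\<in>?P. integral\<^sup>L lborel (\<lambda>x. D \<pi> x * ?D \<pi> u x))" if "Ck_on 2 u S" for u
  proof -
    have "integral\<^sup>L lborel (\<lambda>x. C x * Fs (u # us) x) = integral\<^sup>L lborel (\<lambda>x. \<Sum>\<pi>\<in>?P. D \<pi> x * ?D \<pi> u x)"
      unfolding Fs_def list.map asum_reta_Cons sum_distrib_left D_def
      by (intro Bochner_Integration.integral_cong refl sum.cong) (simp add: reta_def mult_ac)
    also have "\<dots> = (\<Sum>\<pi>\<in>?P. integral\<^sup>L lborel (\<lambda>x. D \<pi> x * ?D \<pi> u x))"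
    proof (rule Bochner_Integration.integral_sum)
      fix \<pi>
      show "integrable lborel (\<lambda>x. D \<pi> x * ?D \<pi> u x)"
        by (rule supp_integrable(1)[OF S continuous_on_mult[OF cD c2[OF that]]]) (use D0 in simp)
    qed
    finally show ?thesis .
  qed
  show ?thesis unfolding eq[OF wS] eq[OF v]
    by (intro tendsto_sum int_uniform_limit[OF S cD D0 c2[OF wS] c2[OF v]] w(2))
qed

text \<open>The identity holds for smooth \<open>v\<^sub>i\<close> and both sides are continuous in each of them for local
  \<open>C\<^sup>2\<close> convergence; the induction replaces them one at a time by smooth approximations. The
  list \<open>ss\<close> holds those already replaced.\<close>
theorem ibp:
  fixes f g :: "complex^'n \<Rightarrow> real"
  assumes S: "open S" "compact K" "K \<subseteq> S" and f: "Ck_on 2 f S" and g: "Ck_on 2 g S"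
    and vs: "\<And>u. u \<in> set vs \<Longrightarrow> Ck_on 2 u S" and l: "Suc (length vs) = CARD('n)"
    and z: "\<And>x. x \<notin> K \<Longrightarrow> g x = 0"
  shows "integral\<^sup>L lborel (\<lambda>x. f x * Fs (g # vs) x) = integral\<^sup>L lborel (\<lambda>x. g x * Fs (f # vs) x)"
proof -
  have K: "closed K" "bounded K" using S(2) by (auto simp: compact_imp_closed compact_imp_bounded)
  have "integral\<^sup>L lborel (\<lambda>x. f x * Fs (g # ss @ vs) x) = integral\<^sup>L lborel (\<lambda>x. g x * Fs (f # ss @ vs) x)"
    if "\<And>u j. u \<in> set ss \<Longrightarrow> Ck_on j u UNIV" "Suc (length (ss @ vs)) = CARD('n)" for ss
    using that vs
  proof (induction vs arbitrary: ss)
    case Nil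
    then show ?case using ibp_smooth[OF S(1) K S(3) f g, of ss] z by simp
  next
    case (Cons v vs)
    have ssS: "Ck_on 2 u S" if "u \<in> set ss" for u using Ck_subset[OF Cons.prems(1)[OF that]] by blast
    have mv: "Fs (h # ss @ v # vs) x = Fs (v # h # ss @ vs) x" for h x by (rule Fs_mset) simp
    \<comment> \<open>g has compact support but f does not: cut f off near K\<close>
    obtain \<kappa> L r where k: "continuous_on UNIV \<kappa>" "compact L" "L \<subseteq> S" "\<And>x. x \<notin> L \<Longrightarrow> \<kappa> x = (0::real)"
      "r > 0" "\<And>x y. x \<in> K \<Longrightarrow> y \<in> cball x r \<Longrightarrow> \<kappa> y = 1" "\<And>x. x \<in> K \<Longrightarrow> cball x r \<subseteq> S"
      using cutoff[OF S(2,1,3)] by blast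
    obtain w' where w': "\<And>(i::nat) j. Ck_on j (w' i) UNIV"
      "\<And>p q e. 0 < e \<Longrightarrow> \<exists>i0. \<forall>i\<ge>i0. \<forall>x\<in>L. \<bar>dd p (dd q (w' i)) x - dd p (dd q v) x\<bar> \<le> e"
      using smooth_approx[OF k(2) S(1) k(3) Cons.prems(3)[of v]] by auto
    have K1: "\<kappa> x = 1" if "x \<in> K" for x using k(6)[OF that, of x] k(5) by simp
    have KL: "K \<subseteq> L" using K1 k(4) by force
    have eqi': "integral\<^sup>L lborel (\<lambda>x. f x * Fs (w' i # g # ss @ vs) x) = integral\<^sup>L lborel (\<lambda>x. g x * Fs (w' i # f # ss @ vs) x)" for i
    proof -
      have "integral\<^sup>L lborel (\<lambda>x. f x * Fs (g # (ss @ [w' i]) @ vs) x) = integral\<^sup>L lborel (\<lambda>x. g x * Fs (f # (ss @ [w' i]) @ vs) x)"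
        by (rule Cons.IH) (use Cons.prems w'(1) in auto)
      moreover have "Fs (h # (ss @ [w' i]) @ vs) x = Fs (w' i # h # ss @ vs) x" for h x by (rule Fs_mset) simp
      ultimately show ?thesis by simp
    qed
    have fk: "integral\<^sup>L lborel (\<lambda>x. f x * Fs (h # g # ss @ vs) x) = integral\<^sup>L lborel (\<lambda>x. (\<kappa> x * f x) * Fs (h # g # ss @ vs) x)" for h
    proof (intro Bochner_Integration.integral_cong refl)
      fix x
      have "Fs (h # g # ss @ vs) x = Fs (g # h # ss @ vs) x" by (rule Fs_mset) simp
      then show "f x * Fs (h # g # ss @ vs) x = (\<kappa> x * f x) * Fs (h # g # ss @ vs) x"
        using Fs_zero[OF K(1), of g x] z K1[of x] by (cases "x \<in> K") auto
    qed
    have ck: "continuous_on S (\<lambda>x. \<kappa> x * f x)"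
      using continuous_on_subset[OF k(1)] Ck_cont[OF f] by (auto intro!: continuous_intros)
    have L2: "(\<lambda>i. integral\<^sup>L lborel (\<lambda>x. (\<kappa> x * f x) * Fs (w' i # g # ss @ vs) x)) \<longlonglongrightarrow> integral\<^sup>L lborel (\<lambda>x. (\<kappa> x * f x) * Fs (v # g # ss @ vs) x)"
      by (rule Fs_head_limit[OF S(1) compact_imp_closed[OF k(2)] compact_imp_bounded[OF k(2)] k(3) _ _ w' ck]) (use g ssS Cons.prems k(4) in auto)
    have gL: "g x = 0" if "x \<notin> L" for x using z KL that by blast
    have L1': "(\<lambda>i. integral\<^sup>L lborel (\<lambda>x. g x * Fs (w' i # f # ss @ vs) x)) \<longlonglongrightarrow> integral\<^sup>L lborel (\<lambda>x. g x * Fs (v # f # ss @ vs) x)"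
      by (rule Fs_head_limit[OF S(1) compact_imp_closed[OF k(2)] compact_imp_bounded[OF k(2)] k(3) _ _ w' Ck_cont[OF g]])
        (use f ssS Cons.prems gL in auto)
    show ?case unfolding mv using LIMSEQ_unique[OF L2[folded fk, unfolded eqi'] L1'] fk[of v] by simp
  qed
  from this[of "[]"] l show ?thesis by simp
qed

section \<open>Weak m-positivity against constant coefficients\<close>

text \<open>The value at \<open>A\<close> of the linear functional on Hermitian matrices given by the product with fixed
  matrices.\<close>
definition LQ :: "(complex^'n^'n) list \<Rightarrow> complex^'n^'n \<Rightarrow> real" where "LQ As A = Re (Qf (A # As))"

lemma LQ_lin: "LQ As (a *\<^sub>R A + b *\<^sub>R B) = a * LQ As A + b * LQ As B"
proof -
  have "a *\<^sub>R A + b *\<^sub>R B = smul (of_real a) A + smul (of_real b) B"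
    by (simp add: smul_def cvec_eq_iff scaleR_conv_of_real[where 'a=complex])
  then show ?thesis by (simp add: LQ_def Qf_lin)
qed

lemma LQ_scale: "LQ As (a *\<^sub>R A) = a * LQ As A"
  using LQ_lin[of As a A 0 A] by simp

text \<open>The coefficient lists \<open>B\<^sub>1, \<dots>, B\<^sub>m\<^sub>-\<^sub>1, I, \<dots>, I\<close> that
  \<open>m\<close>-subharmonicity tests against.\<close>
definition Adm :: "nat \<Rightarrow> (complex^'n^'n) list set" where
  "Adm m = {Bs @ replicate (CARD('n) - m) idm | Bs. length Bs = m - 1 \<and> set Bs \<subseteq> Gm m}"

lemma LQ_nonneg:
  fixes A :: "complex^'n^'n"
  assumes "1 \<le> m" "m \<le> CARD('n)" "As \<in> Adm m" "A \<in> Gm m" shows "0 \<le> LQ As A"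
proof -
  obtain Bs where B: "As = Bs @ replicate (CARD('n) - m) idm" "length Bs = m - 1" "set Bs \<subseteq> Gm m"
    using assms(3) unfolding Adm_def by blast
  have "0 \<le> Re (Qf ((A # Bs) @ replicate (CARD('n) - m) idm))"
    by (rule mixed_nonneg) (use assms B in auto)
  then show ?thesis unfolding LQ_def B(1) by simp
qed

lemma Adm_ctr: assumes "(As :: (complex^'n^'n) list) \<in> Adm m" "A \<in> set As" shows "ctr A = A"
  using assms unfolding Adm_def Gm_def by auto

lemma Adm_length: assumes "1 \<le> m" "m \<le> CARD('n)" "(As :: (complex^'n^'n) list) \<in> Adm m" shows "Suc (length As) = CARD('n)"
  using assms unfolding Adm_def by auto

lemma nsq_qp: "nsq = qp idm"
proof
  fix z :: "complex^'n"
  have "(\<chi> j. \<Sum>k\<in>UNIV. cnj (idm $ j $ k) * z $ k) = z"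
    by (simp add: cvec_eq_iff idm_nth if_distrib[of "\<lambda>t. t * _"] if_distrib[of cnj] cong: if_cong)
  then show "nsq z = qp idm z" by (simp add: qp_def nsq_inner)
qed

lemma Fs_Re:
  assumes "\<And>u. u \<in> set us \<Longrightarrow> Ck_on 2 u S" "open S" "z \<in> S"
  shows "Fs us z = Re (Qf (map (\<lambda>u. hess u z) us))"
proof -
  have "complex_of_real (Fs us z) = wedge2 (map (\<lambda>u. ddc u z) us) std_frame"
    unfolding Fs_def by (rule wedge_real[OF _ assms(3), symmetric]) (rule assms(1))
  also have "\<dots> = Qf (map (\<lambda>u. hess u z) us)"
    by (rule wedge_Qf[OF _ assms(2,3)]) (rule assms(1))
  finally have "complex_of_real (Fs us z) = Qf (map (\<lambda>u. hess u z) us)" .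
  then show ?thesis by (metis Re_complex_of_real)
qed

text \<open>The second-order operator with constant coefficients \<open>\<theta> \<mapsto> dd\<^sup>c\<theta> \<and>
  B\<^sub>1 \<and> \<dots> \<and> B\<^sub>n\<^sub>-\<^sub>1\<close>.\<close>
definition Lap :: "(complex^'n^'n) list \<Rightarrow> (complex^'n \<Rightarrow> real) \<Rightarrow> complex^'n \<Rightarrow> real" where
  "Lap As u = Fs (u # map qp As)"

lemma Lap_LQ:
  assumes "As \<in> Adm m" "Ck_on 2 u S" "open S" "z \<in> S" shows "Lap As u z = LQ As (hess u z)"
proof -
  have q: "map (\<lambda>u. hess u z) (map qp As) = As"
    unfolding map_map o_def by (rule map_idI) (rule hess_qp[OF Adm_ctr[OF assms(1)]])
  have "Fs (u # map qp As) z = Re (Qf (map (\<lambda>u. hess u z) (u # map qp As)))"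
    by (rule Fs_Re[OF _ assms(3,4)]) (use assms(2) qp_deriv(1) in auto)
  then show ?thesis unfolding Lap_def LQ_def list.map(2) q .
qed

text \<open>The constant coefficients of \<^const>\<open>Lap\<close>: the second derivatives of quadratic polynomials,
  evaluated at \<open>0\<close> for definiteness.\<close>
definition lc :: "(complex^'n^'n) list \<Rightarrow> (nat \<Rightarrow> nat) \<Rightarrow> real" where
  "lc As \<pi> = - (of_int (sign \<pi>) * Gpi (map qp As) \<pi> 0)"

lemma Lap_expand:
  fixes As :: "(complex^'n^'n) list"
  shows "Lap As u x = (\<Sum>\<pi> | \<pi> permutes {..<2 * Suc (length As)}.
     lc As \<pi> * dd (std_frame (\<pi> 0)) (dd (mJ (std_frame (\<pi> 1))) u) x)"
proof -
  have r: "reta (qp B) x = reta (qp B) 0" for B :: "complex^'n^'n" unfolding reta_def qp_deriv(2) ..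
  have "Gpi (map qp As) \<pi> x = Gpi (map qp As) \<pi> 0" for \<pi>
    unfolding Gpi_def by (intro prod.cong refl) (simp add: r)
  then show ?thesis
    unfolding Lap_def Fs_def list.map(2) asum_reta_Cons length_map
    by (intro sum.cong refl) (simp add: reta_def lc_def)
qed

definition tpos :: "nat \<Rightarrow> (complex^'n) set \<Rightarrow> (complex^'n \<Rightarrow> real) \<Rightarrow> bool" where
  "tpos m S u \<longleftrightarrow> (\<forall>As\<in>Adm m. \<forall>\<theta>. test_function S \<theta> \<longrightarrow> (\<forall>z. 0 \<le> \<theta> z) \<longrightarrow>
     0 \<le> integral\<^sup>L lborel (\<lambda>x. u x * Lap As \<theta> x))"

lemma test_mono: "test_function S \<theta> \<Longrightarrow> S \<subseteq> T \<Longrightarrow> test_function T \<theta>"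
  unfolding test_function_def by blast

lemma tpos_mono: "tpos m T u \<Longrightarrow> S \<subseteq> T \<Longrightarrow> tpos m S u"
  unfolding tpos_def using test_mono by blast

text \<open>The local form of \<^const>\<open>tpos\<close>, which is what gluing requires. It implies the global form
  (lemma \<open>msub_tpos\<close>).\<close>
definition msub :: "nat \<Rightarrow> (complex^'n) set \<Rightarrow> (complex^'n \<Rightarrow> real) \<Rightarrow> bool" where
  "msub m S u \<longleftrightarrow> continuous_on S u \<and> (\<forall>x\<in>S. \<exists>r>0. tpos m (ball x r) u)"

lemma msub_cont: "msub m S u \<Longrightarrow> continuous_on S u" by (simp add: msub_def)

lemma tpos_msub: assumes "open S" "continuous_on S u" "tpos m S u" shows "msub m S u"
  unfolding msub_def using assms by (meson openE tpos_mono)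

lemma test_supp:
  assumes "test_function S \<theta>"
  obtains K where "compact K" "K \<subseteq> S" "\<And>x. x \<notin> K \<Longrightarrow> \<theta> x = 0" "\<And>k. Ck_on k \<theta> UNIV"
proof (rule that[of "closure {x. \<theta> x \<noteq> 0}"])
  fix x assume "x \<notin> closure {x. \<theta> x \<noteq> 0}"
  then show "\<theta> x = 0" using closure_subset[of "{x. \<theta> x \<noteq> 0}"] by blast
qed (use assms in \<open>auto simp: test_function_def\<close>)

lemma int_perturb:
  fixes u v F :: "'a::euclidean_space \<Rightarrow> real"
  assumes T: "open T" "compact K" "K \<subseteq> T" and c: "continuous_on T u" "continuous_on T v" "continuous_on T F"
    and F: "\<And>x. x \<notin> K \<Longrightarrow> F x = 0" and e: "\<And>x. x \<in> K \<Longrightarrow> \<bar>v x - u x\<bar> \<le> e"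
    and p: "0 \<le> integral\<^sup>L lborel (\<lambda>x. v x * F x)"
  shows "- e * integral\<^sup>L lborel (\<lambda>x. \<bar>F x\<bar>) \<le> integral\<^sup>L lborel (\<lambda>x. u x * F x)"
proof -
  have i: "integrable lborel (\<lambda>x. h x * F x)" if "continuous_on T h" for h
    by (rule supp_integrable(1)[OF T(1) compact_imp_closed[OF T(2)] compact_imp_bounded[OF T(2)] T(3)])
      (use F c that in \<open>auto intro!: continuous_intros\<close>)
  have iF: "integrable lborel (\<lambda>x. \<bar>F x\<bar>)"
    by (rule supp_integrable(1)[OF T(1) compact_imp_closed[OF T(2)] compact_imp_bounded[OF T(2)] T(3)])
      (use F c in \<open>auto intro!: continuous_intros\<close>)
  have "integral\<^sup>L lborel (\<lambda>x. v x * F x) \<le> integral\<^sup>L lborel (\<lambda>x. u x * F x + e * \<bar>F x\<bar>)"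
  proof (rule integral_mono)
    show "integrable lborel (\<lambda>x. v x * F x)" "integrable lborel (\<lambda>x. u x * F x + e * \<bar>F x\<bar>)"
      using i c iF by auto
    fix x
    show "v x * F x \<le> u x * F x + e * \<bar>F x\<bar>"
    proof (cases "x \<in> K")
      case True
      have "(v x - u x) * F x \<le> \<bar>v x - u x\<bar> * \<bar>F x\<bar>" by (metis abs_ge_self abs_mult)
      also have "\<dots> \<le> e * \<bar>F x\<bar>" using e[OF True] by (intro mult_right_mono) auto
      finally show ?thesis by (simp add: algebra_simps)
    qed (simp add: F)
  qed
  also have "\<dots> = integral\<^sup>L lborel (\<lambda>x. u x * F x) + e * integral\<^sup>L lborel (\<lambda>x. \<bar>F x\<bar>)"
    using i[OF c(1)] iF by simp
  finally show ?thesis using p by simp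
qed

text \<open>Used with \<open>N\<close> an integral that does not depend on the approximation.\<close>
lemma nonneg_by_eps: assumes "\<And>e. 0 < e \<Longrightarrow> - e * N \<le> (I::real)" shows "0 \<le> I"
proof (rule ccontr)
  assume "\<not> 0 \<le> I" then have I: "I < 0" by simp
  define e where "e = - I / (2 * (\<bar>N\<bar> + 1))"
  have e: "0 < e" using I by (simp add: e_def divide_neg_pos)
  have "e * N \<le> e * (\<bar>N\<bar> + 1)" using e by (intro mult_left_mono) auto
  also have "\<dots> = - I / 2" by (simp add: e_def field_simps)
  finally show False using assms[OF e] I by simp
qed

text \<open>The mollified function satisfies the pointwise inequality, since \<^const>\<open>Lap\<close> has constant
  coefficients: at a point it is the integral of \<open>u\<close> against \<^const>\<open>Lap\<close> of a
  translated mollifier, which is a test function. A Lebesgue number of the cover by balls on which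
  \<open>u\<close> is tested makes the scale uniform on \<open>K\<close>.\<close>
lemma smoothing:
  fixes u :: "complex^'n \<Rightarrow> real"
  assumes S: "open S" and u: "msub m S u" and K: "compact K" "K \<subseteq> S" and e: "0 < e"
  obtains w T where "\<And>j. Ck_on j w UNIV" "open T" "K \<subseteq> T" "T \<subseteq> S" "\<And>z. z \<in> T \<Longrightarrow> \<bar>w z - u z\<bar> \<le> e"
    "\<And>z As. z \<in> T \<Longrightarrow> As \<in> Adm m \<Longrightarrow> 0 \<le> LQ As (hess w z)"
proof -
  have uc: "continuous_on S u" using u by (rule msub_cont)
  obtain r0 L where L: "r0 > 0" "compact L" "L \<subseteq> S" "\<And>x. x \<in> K \<Longrightarrow> cball x r0 \<subseteq> L"
    using compact_nbhd[OF K(1) S K(2)] by blast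
  obtain \<kappa> L' r where k: "continuous_on UNIV \<kappa>" "compact L'" "L' \<subseteq> S" "\<And>x. x \<notin> L' \<Longrightarrow> \<kappa> x = (0::real)"
    "r > 0" "\<And>x y. x \<in> L \<Longrightarrow> y \<in> cball x r \<Longrightarrow> \<kappa> y = 1" "\<And>x. x \<in> L \<Longrightarrow> cball x r \<subseteq> S"
    using cutoff[OF L(2) S L(3)] by blast
  obtain \<epsilon>0 where e0: "\<epsilon>0 > 0" "\<forall>\<epsilon>. 0 < \<epsilon> \<and> \<epsilon> < \<epsilon>0 \<longrightarrow> (\<forall>x\<in>L. cball x \<epsilon> \<subseteq> S \<and> \<bar>conv u (moll \<epsilon>) x - u x\<bar> \<le> e)"
    using conv_moll_uniform[OF L(2) S L(3) uc e] by blast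
  obtain \<rho> where \<rho>: "\<And>x. x \<in> S \<Longrightarrow> 0 < \<rho> x \<and> tpos m (ball x (\<rho> x)) u"
    using u unfolding msub_def by metis
  define GG where "GG = (\<lambda>x. ball x (\<rho> x)) ` S"
  have cov: "L \<subseteq> \<Union>GG" using \<rho> L(3) unfolding GG_def by force
  have op: "open G" if "G \<in> GG" for G using that unfolding GG_def by auto
  have "\<exists>r1. 0 < r1 \<and> (\<forall>x\<in>L. \<exists>G\<in>GG. ball x r1 \<subseteq> G)"
  proof (rule Heine_Borel_lemma[OF L(2) cov])
    fix e :: real assume e: "0 < e" "\<And>x. x \<in> L \<Longrightarrow> \<exists>G\<in>GG. ball x e \<subseteq> G"
    show ?thesis by (rule exI[of _ e], rule conjI, rule e(1), rule ballI, rule e(2))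
  qed (rule op)
  then obtain r1 where r1: "0 < r1 \<and> (\<forall>x\<in>L. \<exists>G\<in>GG. ball x r1 \<subseteq> G)" by (rule exE)
  define \<epsilon> where "\<epsilon> = min (\<epsilon>0 / 2) (min r (r1 / 2))"
  have ep: "0 < \<epsilon>" "\<epsilon> < \<epsilon>0" "\<epsilon> \<le> r" "\<epsilon> < r1" using e0(1) k(5) r1[THEN conjunct1] by (auto simp: \<epsilon>_def)
  define ut where "ut y = \<kappa> y * u y" for y
  have u0: "ut y = 0" if "y \<notin> L'" for y using k(4)[OF that] by (simp add: ut_def)
  have "continuous_on S ut" unfolding ut_def using uc continuous_on_subset[OF k(1)] by (auto intro!: continuous_intros)
  then have cu: "continuous_on UNIV ut"
    by (rule supp_integrable(2)[OF S compact_imp_closed[OF k(2)] compact_imp_bounded[OF k(2)] k(3)]) (rule u0)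
  have su: "csupp ut" by (rule csupp_bounded[OF compact_imp_bounded[OF k(2)]]) (rule u0)
  define w where "w = conv ut (moll \<epsilon>)"
  have sm: "Ck_on j w UNIV" for j unfolding w_def by (rule Ck_conv[OF cu su Ck_moll])
  have zq: "dd q (moll \<epsilon>) z = 0" if "z \<notin> cball 0 \<epsilon>" for z :: "complex^'n" and q
    by (rule dd_zero_off[OF closed_cball _ that]) (rule moll_zero[OF ep(1)])
  have zpq: "dd p (dd q (moll \<epsilon>)) z = 0" if "z \<notin> cball 0 \<epsilon>" for z :: "complex^'n" and p q
    by (rule dd_zero_off[OF closed_cball _ that]) (rule zq)
  have m1: "Ck_on 1 (moll \<epsilon>) UNIV" and m1q: "Ck_on 1 (dd q (moll \<epsilon>)) UNIV" for q :: "complex^'n"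
    using Ck_moll Ck_dd[OF Ck_moll] by auto
  have utu: "ut y = u y" if "x \<in> L" "y \<in> cball x \<epsilon>" for x y
    using k(6)[OF that(1), of y] that ep(3) by (simp add: ut_def)
  have close: "\<bar>w x - u x\<bar> \<le> e" if "x \<in> L" for x
  proof -
    have "w x = conv u (moll \<epsilon>) x" unfolding w_def
      by (rule conv_cong[of x \<epsilon>]) (use utu that moll_zero[OF ep(1)] in auto)
    then show ?thesis using e0(2) ep that by auto
  qed
  have pos: "0 \<le> Lap As w x" if x: "x \<in> L" and A: "As \<in> Adm m" for x As
  proof -
    let ?a = "\<lambda>\<pi>. std_frame (\<pi> (0::nat)) :: complex^'n" and ?b = "\<lambda>\<pi>. mJ (std_frame (\<pi> (1::nat))) :: complex^'n"
    let ?P = "{\<pi>. \<pi> permutes {..<2 * Suc (length As)}}"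
    obtain G where G: "G \<in> GG" "ball x r1 \<subseteq> G" using r1[THEN conjunct2, rule_format, OF x] by (rule bexE)
    then obtain y where y: "y \<in> S" "ball x r1 \<subseteq> ball y (\<rho> y)" unfolding GG_def by auto
    have cb: "cball x \<epsilon> \<subseteq> ball y (\<rho> y)" using y(2) ep(4) by (auto simp: subset_iff)
    have cbS: "cball x \<epsilon> \<subseteq> S" using e0(2) ep x by auto
    define \<theta> where "\<theta> = (\<lambda>y. moll \<epsilon> (x - y))"
    have dm: "moll \<epsilon> differentiable (at z)" "dd q (moll \<epsilon>) differentiable (at z)" for z q :: "complex^'n"
      using Ck_diff[OF m1[unfolded One_nat_def]] Ck_diff[OF m1q[unfolded One_nat_def]] by simp_all
    have t1: "dd b \<theta> = (\<lambda>y. -1 * dd b (moll \<epsilon>) (x - y))" for b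
      unfolding \<theta>_def using dd_affine(1)[OF dm(1)] by (intro HOL.ext) simp
    have t2: "dd a (dd b \<theta>) y = dd a (dd b (moll \<epsilon>)) (x - y)" for a b y
      unfolding t1 dd_cmult[OF dd_affine(2)[OF dm(2)]] dd_affine(1)[OF dm(2)] by simp
    have "test_function (ball y (\<rho> y)) \<theta>" unfolding \<theta>_def by (rule test_moll[OF ep(1) cb])
    then have p: "0 \<le> integral\<^sup>L lborel (\<lambda>y. u y * Lap As \<theta> y)"
      using \<rho>[OF y(1)] A moll_nonneg[OF ep(1)] unfolding tpos_def \<theta>_def by blast
    have d1: "dd q w = conv ut (dd q (moll \<epsilon>))" for q
      unfolding w_def by (rule HOL.ext) (rule conv_derivative(2)[OF cu su m1])
    have d2: "dd p (dd q w) x = integral\<^sup>L lborel (\<lambda>y. u y * dd p (dd q \<theta>) y)" for p q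
    proof -
      have "dd p (dd q w) x = conv ut (dd p (dd q (moll \<epsilon>))) x"
        unfolding d1 by (rule conv_derivative(2)[OF cu su m1q])
      also have "\<dots> = conv u (dd p (dd q (moll \<epsilon>))) x"
        by (rule conv_cong[of x \<epsilon>]) (use utu x zpq in auto)
      finally show ?thesis unfolding conv_def t2 .
    qed
    have ct: "continuous_on S (dd p (dd q \<theta>))" for p q
    proof -
      have "\<And>k. Ck_on k \<theta> UNIV" using test_moll[OF ep(1) cbS] by (simp add: test_function_def \<theta>_def)
      from Ck_cont[OF Ck_dd[OF Ck_dd[OF this[of "Suc (Suc 0)"]]]] show ?thesis by (rule continuous_on_subset) simp
    qed
    have ii: "integrable lborel (\<lambda>y. u y * dd p (dd q \<theta>) y)" for p q
    proof (rule supp_integrable(1)[OF S closed_cball bounded_cball cbS])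
      fix y assume "y \<notin> cball x \<epsilon>"
      then have "x - y \<notin> cball 0 \<epsilon>" by (simp add: dist_norm norm_minus_commute)
      then show "u y * dd p (dd q \<theta>) y = 0" by (simp add: t2 zpq)
    qed (intro continuous_on_mult uc ct)
    have "Lap As w x = (\<Sum>\<pi>\<in>?P. lc As \<pi> * integral\<^sup>L lborel (\<lambda>y. u y * dd (?a \<pi>) (dd (?b \<pi>) \<theta>) y))"
      unfolding Lap_expand d2 ..
    also have "\<dots> = (\<Sum>\<pi>\<in>?P. integral\<^sup>L lborel (\<lambda>y. lc As \<pi> * (u y * dd (?a \<pi>) (dd (?b \<pi>) \<theta>) y)))"
      by (intro sum.cong refl integral_mult_right_zero[symmetric])
    also have "\<dots> = integral\<^sup>L lborel (\<lambda>y. \<Sum>\<pi>\<in>?P. lc As \<pi> * (u y * dd (?a \<pi>) (dd (?b \<pi>) \<theta>) y))"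
      by (rule Bochner_Integration.integral_sum[symmetric]) (intro integrable_mult_right ii)
    also have "\<dots> = integral\<^sup>L lborel (\<lambda>y. u y * Lap As \<theta> y)"
      unfolding Lap_expand sum_distrib_left by (intro Bochner_Integration.integral_cong refl sum.cong) (simp add: mult_ac)
    finally show ?thesis using p by simp
  qed
  define T where "T = (\<Union>x\<in>K. ball x r0)"
  have TL: "T \<subseteq> L" unfolding T_def using L(4) ball_subset_cball by fastforce
  have oT: "open T" unfolding T_def by auto
  have cT: "\<bar>w z - u z\<bar> \<le> e" if "z \<in> T" for z using close TL that by blast
  show ?thesis
  proof (rule that[of w T])
    show "K \<subseteq> T" unfolding T_def using L(1) by force
    show "0 \<le> LQ As (hess w z)" if "z \<in> T" "As \<in> Adm m" for z As
      using pos[of z As] Lap_LQ[OF that(2) sm open_UNIV UNIV_I, of z] that TL by auto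
    show "T \<subseteq> S" using TL L(3) by blast
  qed (fact sm oT cT)+
qed

text \<open>Positivity against variable coefficients: for a smoothed \<open>u\<close>, integrate by parts and use the
  pointwise inequality, with the Hessians of the \<open>v\<^sub>i\<close> at each point as the constant
  matrices; then let the smoothing parameter tend to \<open>0\<close>.\<close>
lemma weak_pos:
  fixes u :: "complex^'n \<Rightarrow> real"
  assumes S: "open S" and m: "1 \<le> m" "m \<le> CARD('n)" and u: "msub m S u"
    and vs: "length vs = m - 1" "\<And>v. v \<in> set vs \<Longrightarrow> Ck_on 2 v S" "\<And>v z. v \<in> set vs \<Longrightarrow> z \<in> S \<Longrightarrow> hess v z \<in> Gm m"
    and t: "test_function S \<theta>" "\<And>z. 0 \<le> \<theta> z"
  shows "0 \<le> integral\<^sup>L lborel (\<lambda>x. u x * Fs (\<theta> # vs @ replicate (CARD('n) - m) nsq) x)"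
proof (rule nonneg_by_eps)
  fix e :: real assume e: "0 < e"
  let ?R = "replicate (CARD('n) - m) nsq" and ?F = "Fs (\<theta> # vs @ replicate (CARD('n) - m) nsq)"
  obtain K where K: "compact K" "K \<subseteq> S" "\<And>x. x \<notin> K \<Longrightarrow> \<theta> x = 0" "\<And>k. Ck_on k \<theta> UNIV"
    using test_supp[OF t(1)] by blast
  obtain w T where w: "\<And>j. Ck_on j w UNIV" "open T" "K \<subseteq> T" "T \<subseteq> S" "\<And>z. z \<in> T \<Longrightarrow> \<bar>w z - u z\<bar> \<le> e"
    "\<And>z As. z \<in> T \<Longrightarrow> As \<in> Adm m \<Longrightarrow> 0 \<le> LQ As (hess w z)"
    using smoothing[OF S u K(1,2) e] by blast
  have C2: "Ck_on 2 h S" if "h \<in> set (vs @ ?R)" for h using that vs(2) Ck_nsq by auto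
  have C2': "Ck_on 2 h S" if "\<And>j. Ck_on j h UNIV" for h using Ck_subset[OF that] by blast
  have l: "Suc (length (vs @ ?R)) = CARD('n)" using vs(1) m by simp
  have "integral\<^sup>L lborel (\<lambda>x. w x * ?F x) = integral\<^sup>L lborel (\<lambda>x. \<theta> x * Fs (w # vs @ ?R) x)"
    by (rule ibp[OF S K(1,2) C2'[OF w(1)] C2'[OF K(4)] C2 l K(3)])
  also have "\<dots> \<ge> 0"
  proof (intro integral_nonneg_AE AE_I2)
    fix z
    show "0 \<le> \<theta> z * Fs (w # vs @ ?R) z"
    proof (cases "z \<in> K")
      case True
      then have z: "z \<in> S" "z \<in> T" using K w by auto
      let ?As = "map (\<lambda>v. hess v z) vs @ replicate (CARD('n) - m) idm"
      have "?As \<in> Adm m" unfolding Adm_def using vs(1,3) z by auto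
      moreover have "Fs (w # vs @ ?R) z = Re (Qf (map (\<lambda>u. hess u z) (w # vs @ ?R)))"
        by (rule Fs_Re[OF _ S z(1)]) (use C2 C2'[OF w(1)] in auto)
      then have "Fs (w # vs @ ?R) z = LQ ?As (hess w z)" by (simp add: LQ_def hess_nsq)
      ultimately show ?thesis using w(6)[OF z(2)] t(2) by simp
    qed (simp add: K(3))
  qed
  finally have p: "0 \<le> integral\<^sup>L lborel (\<lambda>x. w x * ?F x)" .
  have cF: "continuous_on S ?F" by (rule Ck_Fs_cont[OF S]) (use C2 C2'[OF K(4)] in auto)
  show "- e * integral\<^sup>L lborel (\<lambda>x. \<bar>?F x\<bar>) \<le> integral\<^sup>L lborel (\<lambda>x. u x * ?F x)"
    by (rule int_perturb[OF S K(1,2) msub_cont[OF u] Ck_cont[OF C2'[OF w(1)]] cF _ _ p])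
      (use Fs_zero[OF compact_imp_closed[OF K(1)] K(3)] w(3,5) in auto)
qed

lemma msub_tpos:
  fixes u :: "complex^'n \<Rightarrow> real"
  assumes S: "open S" and m: "1 \<le> m" "m \<le> CARD('n)" and u: "msub m S u" shows "tpos m S u"
  unfolding tpos_def
proof (intro ballI allI impI)
  fix As :: "(complex^'n^'n) list" and \<theta> :: "complex^'n \<Rightarrow> real" assume A: "As \<in> Adm m" and t: "test_function S \<theta>" "\<forall>z. 0 \<le> \<theta> z"
  obtain Bs where B: "As = Bs @ replicate (CARD('n) - m) idm" "length Bs = m - 1" "set Bs \<subseteq> Gm m"
    using A unfolding Adm_def by blast
  have "0 \<le> integral\<^sup>L lborel (\<lambda>x. u x * Fs (\<theta> # map qp Bs @ replicate (CARD('n) - m) nsq) x)"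
  proof (rule weak_pos[OF S m u _ _ _ t(1)])
    show "hess v z \<in> Gm m" if vB: "v \<in> set (map qp Bs)" for v z
    proof -
      obtain b where b: "v = qp b" "b \<in> Gm m" using vB B(3) by auto
      then have "hess (qp b) z = b" by (intro hess_qp) (simp add: Gm_def)
      then show ?thesis using b by simp
    qed
  qed (use B t(2) qp_deriv(1) in auto)
  then show "0 \<le> integral\<^sup>L lborel (\<lambda>x. u x * Lap As \<theta> x)"
    unfolding Lap_def B(1) map_append map_replicate nsq_qp[symmetric] .
qed

lemma msub_mono: assumes "msub m T u" "S \<subseteq> T" shows "msub m S u"
  using assms continuous_on_subset unfolding msub_def by blast

lemma Lap_cont:
  assumes K: "compact K" "\<And>x. x \<notin> K \<Longrightarrow> \<theta> x = 0" "\<And>k. Ck_on k \<theta> UNIV"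
  shows "continuous_on S (Lap As \<theta>)" "x \<notin> K \<Longrightarrow> Lap As \<theta> x = 0"
proof -
  have "continuous_on UNIV (Lap As \<theta>)" unfolding Lap_def
    by (rule Ck_Fs_cont[OF open_UNIV]) (use K(3) qp_deriv(1) in auto)
  then show "continuous_on S (Lap As \<theta>)" by (rule continuous_on_subset) simp
  show "x \<notin> K \<Longrightarrow> Lap As \<theta> x = 0" unfolding Lap_def by (rule Fs_zero[OF compact_imp_closed[OF K(1)] K(2)])
qed

text \<open>The inequalities with a fixed test function are stable under uniform convergence on its support.\<close>
lemma msub_approx:
  fixes u :: "complex^'n \<Rightarrow> real"
  assumes S: "open S" and m: "1 \<le> m" "m \<le> CARD('n)" and u: "continuous_on S u"
    and a: "\<And>K e. compact K \<Longrightarrow> K \<subseteq> S \<Longrightarrow> 0 < e \<Longrightarrow> \<exists>v T. open T \<and> K \<subseteq> T \<and> T \<subseteq> S \<and> msub m T v \<and> (\<forall>z\<in>K. \<bar>v z - u z\<bar> \<le> e)"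
  shows "msub m S u"
proof (rule tpos_msub[OF S u], unfold tpos_def, intro ballI allI impI)
  fix As :: "(complex^'n^'n) list" and \<theta> :: "complex^'n \<Rightarrow> real" assume A: "As \<in> Adm m" and t: "test_function S \<theta>" "\<forall>z. 0 \<le> \<theta> z"
  obtain K where K: "compact K" "K \<subseteq> S" "\<And>x. x \<notin> K \<Longrightarrow> \<theta> x = 0" "\<And>k. Ck_on k \<theta> UNIV"
    using test_supp[OF t(1)] by blast
  show "0 \<le> integral\<^sup>L lborel (\<lambda>x. u x * Lap As \<theta> x)"
  proof (rule nonneg_by_eps)
    fix e :: real assume e: "0 < e"
    obtain v T where v: "open T" "K \<subseteq> T" "T \<subseteq> S" "msub m T v" "\<And>z. z \<in> K \<Longrightarrow> \<bar>v z - u z\<bar> \<le> e"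
      using a[OF K(1,2) e] by blast
    have tT: "test_function T \<theta>"
    proof -
      have "{x. \<theta> x \<noteq> 0} \<subseteq> K" using K(3) by blast
      then have "closure {x. \<theta> x \<noteq> 0} \<subseteq> K" by (rule closure_minimal) (rule compact_imp_closed[OF K(1)])
      then show ?thesis using t(1) v(2) unfolding test_function_def by blast
    qed
    have p: "0 \<le> integral\<^sup>L lborel (\<lambda>x. v x * Lap As \<theta> x)"
      using msub_tpos[OF v(1) m v(4)] A t(2) tT unfolding tpos_def by blast
    show "- e * integral\<^sup>L lborel (\<lambda>x. \<bar>Lap As \<theta> x\<bar>) \<le> integral\<^sup>L lborel (\<lambda>x. u x * Lap As \<theta> x)"
      by (rule int_perturb[OF v(1) K(1) v(2) continuous_on_subset[OF u v(3)] msub_cont[OF v(4)] Lap_cont(1)[OF K(1,3,4)] Lap_cont(2)[OF K(1,3,4)] v(5) p])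
  qed
qed

lemma C2_msub:
  fixes u :: "complex^'n \<Rightarrow> real"
  assumes S: "open S" and m: "1 \<le> m" "m \<le> CARD('n)" and u: "Ck_on 2 u S"
    and p: "\<And>z As. z \<in> S \<Longrightarrow> As \<in> Adm m \<Longrightarrow> 0 \<le> LQ As (hess u z)"
  shows "msub m S u"
proof (rule tpos_msub[OF S Ck_cont[OF u]], unfold tpos_def, intro ballI allI impI)
  fix As :: "(complex^'n^'n) list" and \<theta> :: "complex^'n \<Rightarrow> real" assume A: "As \<in> Adm m" and t: "test_function S \<theta>" "\<forall>z. 0 \<le> \<theta> z"
  obtain K where K: "compact K" "K \<subseteq> S" "\<And>x. x \<notin> K \<Longrightarrow> \<theta> x = 0" "\<And>k. Ck_on k \<theta> UNIV"
    using test_supp[OF t(1)] by blast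
  have "integral\<^sup>L lborel (\<lambda>x. u x * Lap As \<theta> x) = integral\<^sup>L lborel (\<lambda>x. \<theta> x * Lap As u x)"
    unfolding Lap_def
    by (rule ibp[OF S K(1,2) u Ck_subset[OF K(4)] _ _ K(3)]) (use Adm_length[OF m A] qp_deriv(1) in auto)
  also have "\<dots> \<ge> 0"
  proof (intro integral_nonneg_AE AE_I2)
    fix z
    show "0 \<le> \<theta> z * Lap As u z"
    proof (cases "z \<in> K")
      case True
      then have "z \<in> S" using K(2) by blast
      then show ?thesis using Lap_LQ[OF A u S] p A t(2) by simp
    qed (simp add: K(3))
  qed
  finally show "0 \<le> integral\<^sup>L lborel (\<lambda>x. u x * Lap As \<theta> x)" .
qed

lemma msub_add_pos:
  fixes u v :: "complex^'n \<Rightarrow> real"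
  assumes S: "open S" and m: "1 \<le> m" "m \<le> CARD('n)" and u: "msub m S u" and v: "msub m S v" and c: "0 \<le> c"
  shows "msub m S (\<lambda>x. u x + c * v x)"
proof (rule tpos_msub[OF S], goal_cases)
  case 1 show ?case using msub_cont[OF u] msub_cont[OF v] by (auto intro!: continuous_intros)
next
  case 2 show ?case unfolding tpos_def
  proof (intro ballI allI impI)
    fix As :: "(complex^'n^'n) list" and \<theta> :: "complex^'n \<Rightarrow> real" assume A: "As \<in> Adm m" and t: "test_function S \<theta>" "\<forall>z. 0 \<le> \<theta> z"
    obtain K where K: "compact K" "K \<subseteq> S" "\<And>x. x \<notin> K \<Longrightarrow> \<theta> x = 0" "\<And>k. Ck_on k \<theta> UNIV"
      using test_supp[OF t(1)] by blast
    have i: "integrable lborel (\<lambda>x. h x * Lap As \<theta> x)" if "continuous_on S h" for h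
    proof (rule supp_integrable(1)[OF S compact_imp_closed[OF K(1)] compact_imp_bounded[OF K(1)] K(2)])
      show "continuous_on S (\<lambda>x. h x * Lap As \<theta> x)" by (intro continuous_on_mult that Lap_cont(1)[OF K(1,3,4)])
      show "x \<notin> K \<Longrightarrow> h x * Lap As \<theta> x = 0" for x using Lap_cont(2)[OF K(1,3,4)] by simp
    qed
    have "integral\<^sup>L lborel (\<lambda>x. (u x + c * v x) * Lap As \<theta> x) = integral\<^sup>L lborel (\<lambda>x. u x * Lap As \<theta> x + c * (v x * Lap As \<theta> x))"
      by (intro Bochner_Integration.integral_cong refl) (simp add: algebra_simps)
    also have "\<dots> = integral\<^sup>L lborel (\<lambda>x. u x * Lap As \<theta> x) + c * integral\<^sup>L lborel (\<lambda>x. v x * Lap As \<theta> x)"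
      using i[OF msub_cont[OF u]] i[OF msub_cont[OF v]] by simp
    also have "\<dots> \<ge> 0" using msub_tpos[OF S m u] msub_tpos[OF S m v] A t c unfolding tpos_def by simp
    finally show "0 \<le> integral\<^sup>L lborel (\<lambda>x. (u x + c * v x) * Lap As \<theta> x)" .
  qed
qed

section \<open>The sub-mean value inequality\<close>

lemma pos_sq_deriv: "((\<lambda>s::real. (max 0 s)\<^sup>2) has_real_derivative 2 * max 0 s) (at s)"
proof -
  consider "s > 0" | "s < 0" | "s = 0" by linarith
  then show ?thesis
  proof cases
    case 1
    have "((\<lambda>s::real. s\<^sup>2) has_real_derivative 2 * max 0 s) (at s)" using 1 by (auto intro!: derivative_eq_intros)
    then show ?thesis by (rule has_field_derivative_transform_within_open[of _ _ _ "{0<..}"]) (use 1 in auto)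
  next
    case 2
    have "((\<lambda>s::real. 0) has_real_derivative 2 * max 0 s) (at s)" using 2 by simp
    then show ?thesis by (rule has_field_derivative_transform_within_open[of _ _ _ "{..<0}"]) (use 2 in auto)
  next
    case 3
    have "((\<lambda>h::real. (max 0 h)\<^sup>2 / h) \<longlongrightarrow> 0) (at 0)"
    proof (rule Lim_null_comparison)
      show "\<forall>\<^sub>F h in at (0::real). norm ((max 0 h)\<^sup>2 / h) \<le> \<bar>h\<bar>"
      proof (intro always_eventually allI)
        fix h :: real
        show "norm ((max 0 h)\<^sup>2 / h) \<le> \<bar>h\<bar>" by (cases "h > 0") (auto simp: power2_eq_square max_def)
      qed
      show "((\<lambda>h::real. \<bar>h\<bar>) \<longlongrightarrow> 0) (at 0)" by (intro tendsto_rabs_zero tendsto_ident_at)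
    qed
    then show ?thesis unfolding DERIV_def 3 by simp
  qed
qed

text \<open>A continuous approximation of the indicator of the positive axis, with primitive \<open>rampi\<close> of class
  \<open>C\<^sup>1\<close>; with argument \<open>1 - \<bar>y\<bar>\<^sup>2\<close> it approximates the indicator
  of the unit ball.\<close>
definition ramp :: "real \<Rightarrow> real \<Rightarrow> real" where "ramp \<delta> s = (max 0 s - max 0 (s - \<delta>)) / \<delta>"
definition rampi :: "real \<Rightarrow> real \<Rightarrow> real" where "rampi \<delta> s = ((max 0 s)\<^sup>2 - (max 0 (s - \<delta>))\<^sup>2) / (2 * \<delta>)"

lemma rampi_deriv: assumes "0 < \<delta>" shows "(rampi \<delta> has_real_derivative ramp \<delta> s) (at s)"
proof -
  have "((\<lambda>s. (max 0 (s - \<delta>))\<^sup>2) has_real_derivative 2 * max 0 (s - \<delta>) * 1) (at s)"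
    by (rule DERIV_chain2[OF pos_sq_deriv]) (auto intro!: derivative_eq_intros)
  then have "((\<lambda>s. ((max 0 s)\<^sup>2 - (max 0 (s - \<delta>))\<^sup>2) / (2 * \<delta>)) has_real_derivative (2 * max 0 s - 2 * max 0 (s - \<delta>) * 1) / (2 * \<delta>)) (at s)"
    by (intro DERIV_cdivide DERIV_diff pos_sq_deriv)
  moreover have "(2 * max 0 s - 2 * max 0 (s - \<delta>) * 1) / (2 * \<delta>) = ramp \<delta> s" using assms by (simp add: ramp_def field_simps)
  ultimately show ?thesis unfolding rampi_def[abs_def] by simp
qed

lemma ramp_bounds:
  assumes "0 < \<delta>" shows "0 \<le> ramp \<delta> s" "ramp \<delta> s \<le> 1" "s \<le> 0 \<Longrightarrow> ramp \<delta> s = 0" "\<delta> \<le> s \<Longrightarrow> ramp \<delta> s = 1"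
    "0 \<le> rampi \<delta> s" "s \<le> 0 \<Longrightarrow> rampi \<delta> s = 0"
  using assms by (auto simp: ramp_def rampi_def max_def field_simps intro!: power_mono)

lemma ramp_cont: "continuous_on S f \<Longrightarrow> continuous_on S (\<lambda>y. ramp \<delta> (f y))"
  unfolding ramp_def divide_inverse by (intro continuous_intros)

lemma dd_scale:
  assumes "f differentiable (at (a + t *\<^sub>R x))"
  shows "dd v (\<lambda>y. f (a + t *\<^sub>R y)) x = t * dd v f (a + t *\<^sub>R x)" "(\<lambda>y. f (a + t *\<^sub>R y)) differentiable (at x)"
proof -
  have "((\<lambda>y. a + t *\<^sub>R y) has_derivative (\<lambda>v. t *\<^sub>R v)) (at x)" by (auto intro!: derivative_eq_intros)
  from has_derivative_compose[OF this has_derivative_dd[OF assms]]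
  have h: "((\<lambda>y. f (a + t *\<^sub>R y)) has_derivative (\<lambda>v. dd (t *\<^sub>R v) f (a + t *\<^sub>R x))) (at x)" .
  then show "(\<lambda>y. f (a + t *\<^sub>R y)) differentiable (at x)" by (rule differentiableI)
  show "dd v (\<lambda>y. f (a + t *\<^sub>R y)) x = t * dd v f (a + t *\<^sub>R x)"
    using dd_eq[OF h, of v] dd_dir_lin[OF assms, of t v 0 0] by simp
qed

lemma cball_unit_cbox: "norm y \<le> 1 \<Longrightarrow> y \<in> cbox (- One) (One :: 'a::euclidean_space)"
  using Basis_le_norm[of _ y] by (force simp: mem_box abs_le_iff inner_minus_left)

text \<open>The derivative in \<open>t\<close> of the weighted mean \<open>\<integral> G(y) w(a + t y) dy\<close> is
  \<open>\<integral> G(y) \<nabla>w(a + t y) \<cdot> y dy\<close>. Here \<open>G(y) y\<close> is \<open>-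
  1/2\<close> times the gradient of the nonnegative function \<open>J\<close> with support in the unit ball, so
  an integration by parts gives \<open>t/2 \<integral> J(y) \<Delta>w(a + t y) dy \<ge> 0\<close>, and the mean
  increases from \<open>t = 0\<close> to \<open>t = r\<close>.\<close>
lemma submean_weight:
  fixes w :: "'a::euclidean_space \<Rightarrow> real"
  assumes w: "Ck_on 2 w UNIV" and r: "0 \<le> r" and d: "0 < \<delta>"
    and p: "\<And>z. z \<in> cball a r \<Longrightarrow> 0 \<le> (\<Sum>b\<in>Basis. dd b (dd b w) z)"
  shows "w a * integral\<^sup>L lborel (\<lambda>y::'a. ramp \<delta> (1 - y \<bullet> y)) \<le> integral\<^sup>L lborel (\<lambda>y. ramp \<delta> (1 - y \<bullet> y) * w (a + r *\<^sub>R y))"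
proof -
  let ?C = "cbox (- One) (One :: 'a)"
  define G where "G y = ramp \<delta> (1 - y \<bullet> y)" for y :: 'a
  define J where "J y = rampi \<delta> (1 - y \<bullet> y)" for y :: 'a
  have n1: "1 - y \<bullet> y \<le> 0" if "1 \<le> norm y" for y :: 'a
    using that power_mono[of 1 "norm y" 2] by (simp add: power2_norm_eq_inner[symmetric])
  have G0: "G y = 0" if "y \<notin> ?C" for y unfolding G_def
    by (rule ramp_bounds(3)[OF d n1]) (use cball_unit_cbox[of y] that in linarith)
  have J0: "J y = 0" if "y \<notin> cball 0 1" for y unfolding J_def by (rule ramp_bounds(6)[OF d n1]) (use that in auto)
  have cG: "continuous_on UNIV G" unfolding G_def by (intro ramp_cont continuous_intros)
  have w2: "Ck_on (Suc (Suc 0)) w UNIV" by (rule Ck2D[OF w])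
  have dw: "w differentiable (at x)" "dd b w differentiable (at x)" for x b
    using Ck_diff[OF w2] Ck_diff[OF Ck_dd[OF w2]] by auto
  have cw: "continuous_on UNIV w" "continuous_on UNIV (dd b w)" "continuous_on UNIV (dd c (dd b w))" for b c
    using Ck_cont[OF w2] Ck_cont[OF Ck_dd[OF w2]] Ck_cont[OF Ck_dd[OF Ck_dd[OF w2]]] by auto
  have cA: "continuous_on UNIV (\<lambda>y. h (a + t *\<^sub>R y))" if "continuous_on UNIV h" for h :: "'a \<Rightarrow> real" and t
    by (rule continuous_on_compose2[OF that]) (auto intro!: continuous_intros)
  define fx where "fx t y = G y * (\<Sum>b\<in>Basis. (y \<bullet> b) * dd b w (a + t *\<^sub>R y))" for t y
  have dJ: "dd b J y = -2 * (y \<bullet> b) * G y" "J differentiable (at y)" for b y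
  proof -
    have s: "(\<lambda>y::'a. -1 * (y \<bullet> y)) differentiable (at y)" "(\<lambda>y::'a. y \<bullet> y) differentiable (at y)" for y :: 'a
      using Ck_diff[OF Ck_inner_self[of "Suc 0" UNIV]] Ck_diff[OF Ck_cmult[OF open_UNIV Ck_inner_self[of "Suc 0" UNIV]]] by auto
    have s1: "(\<lambda>y::'a. 1 + -1 * (y \<bullet> y)) differentiable (at y)" using s(1) by (intro differentiable_add) auto
    have e: "dd b (\<lambda>y. 1 + -1 * (y \<bullet> y)) y = - (2 * (y \<bullet> b))"
      using dd_add[of "\<lambda>_. 1" y "\<lambda>y. -1 * (y \<bullet> y)" b] s dd_cmult[OF s(2), of b "-1" y] dd_inner_self[of b] by simp
    have "((rampi \<delta>) has_real_derivative ramp \<delta> (1 - y \<bullet> y)) (at (1 + -1 * (y \<bullet> y)))" using rampi_deriv[OF d, of "1 - y \<bullet> y"] by simp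
    from dd_compose(1)[OF s1 this, of b] dd_compose(2)[OF s1 this]
    have "dd b J y = ramp \<delta> (1 - y \<bullet> y) * dd b (\<lambda>y. 1 + -1 * (y \<bullet> y)) y" "J differentiable (at y)"
      unfolding J_def[abs_def] by simp_all
    then show "dd b J y = -2 * (y \<bullet> b) * G y" "J differentiable (at y)"
      unfolding e G_def by simp_all
  qed
  have J1: "Ck_on 1 J UNIV" unfolding One_nat_def Ck_Suc using dJ cG by (auto intro!: continuous_intros)
  have W1: "Ck_on 1 (\<lambda>y. dd b w (a + t *\<^sub>R y)) UNIV" for b t
    unfolding One_nat_def Ck_Suc using dd_scale[OF dw(2)] cA[OF cw(3)] by (auto intro!: continuous_intros)
  note ip = int_by_parts[OF open_UNIV closed_cball[of 0 1] bounded_cball[of 0 1] subset_UNIV W1 J1 J0]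
  have step: "integral ?C (fx t) \<ge> 0" if t: "0 \<le> t" "t \<le> r" for t
  proof -
    have cf: "continuous_on UNIV (fx t)" unfolding fx_def by (intro continuous_intros cG cA cw)
    have "integral ?C (fx t) = integral\<^sup>L lborel (fx t)"
      by (rule cc_int(2)[symmetric, OF continuous_on_subset[OF cf subset_UNIV]]) (simp add: fx_def G0)
    also have "\<dots> = integral\<^sup>L lborel (\<lambda>y. \<Sum>b\<in>Basis. - (1/2) * (dd b w (a + t *\<^sub>R y) * dd b J y))"
      by (intro Bochner_Integration.integral_cong refl) (simp add: fx_def dJ sum_distrib_left mult_ac)
    also have "\<dots> = (\<Sum>b\<in>Basis. - (1/2) * integral\<^sup>L lborel (\<lambda>y. dd b w (a + t *\<^sub>R y) * dd b J y))"
      using ip(2)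
      by (subst Bochner_Integration.integral_sum) auto
    also have "\<dots> = (\<Sum>b\<in>Basis. (1/2) * integral\<^sup>L lborel (\<lambda>y. t * dd b (dd b w) (a + t *\<^sub>R y) * J y))"
      using ip(1) dd_scale(1)[OF dw(2)] by simp
    also have "\<dots> = integral\<^sup>L lborel (\<lambda>y. \<Sum>b\<in>Basis. (1/2) * (t * dd b (dd b w) (a + t *\<^sub>R y) * J y))"
      using ip(3) dd_scale(1)[OF dw(2)]
      by (subst Bochner_Integration.integral_sum) auto
    also have "\<dots> \<ge> 0"
    proof (intro integral_nonneg_AE AE_I2)
      fix y
      have e: "(\<Sum>b\<in>Basis. (1/2) * (t * dd b (dd b w) (a + t *\<^sub>R y) * J y)) = (1/2) * t * J y * (\<Sum>b\<in>Basis. dd b (dd b w) (a + t *\<^sub>R y))"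
        unfolding sum_distrib_left by (intro sum.cong refl) (simp add: mult_ac)
      show "0 \<le> (\<Sum>b\<in>Basis. (1/2) * (t * dd b (dd b w) (a + t *\<^sub>R y) * J y))"
      proof (cases "y \<in> cball 0 1")
        case True
        have "norm (t *\<^sub>R y) \<le> r * 1" using t True unfolding norm_scaleR by (intro mult_mono) auto
        then have "a + t *\<^sub>R y \<in> cball a r" by (simp add: dist_norm)
        then show ?thesis unfolding e using p t ramp_bounds(5)[OF d] by (intro mult_nonneg_nonneg) (auto simp: J_def)
      qed (simp add: J0)
    qed
    finally show ?thesis .
  qed
  define m where "m t = integral ?C (\<lambda>y. G y * w (a + t *\<^sub>R y))" for t
  have md: "(m has_real_derivative integral ?C (fx t)) (at t)" for t
  proof -
    have "((\<lambda>t. integral ?C (\<lambda>y. G y * w (a + t *\<^sub>R y))) has_field_derivative integral ?C (fx t)) (at t within UNIV)"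
    proof (rule leibniz_rule_field_derivative)
      fix t y
      have "dd y w (a + t *\<^sub>R y) = (\<Sum>b\<in>Basis. (y \<bullet> b) * dd b w (a + t *\<^sub>R y))"
      proof -
        have l: "linear (\<lambda>v. dd v w (a + t *\<^sub>R y))"
          using has_derivative_dd[OF dw(1)] has_derivative_linear by blast
        have "dd y w (a + t *\<^sub>R y) = dd (\<Sum>b\<in>Basis. (y \<bullet> b) *\<^sub>R b) w (a + t *\<^sub>R y)" by (simp add: euclidean_representation)
        then show ?thesis using linear_sum[OF l, of "\<lambda>b. (y \<bullet> b) *\<^sub>R b" Basis] linear_scale[OF l] by simp
      qed
      then show "((\<lambda>t. G y * w (a + t *\<^sub>R y)) has_field_derivative fx t y) (at t within UNIV)"
        unfolding fx_def using DERIV_cmult[OF line_derivative[OF dw(1), where x=a and t=t and v=y], of "G y"] by simp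
    next
      fix t show "(\<lambda>y. G y * w (a + t *\<^sub>R y)) integrable_on ?C"
        by (rule integrable_continuous) (use continuous_on_mult[OF cG cA[OF cw(1)]] continuous_on_subset in blast)
    next
      have c1: "continuous_on (UNIV \<times> ?C) (\<lambda>z. h (a + fst z *\<^sub>R snd z))" if "continuous_on UNIV h" for h :: "'a \<Rightarrow> real"
        by (rule continuous_on_compose2[OF that]) (auto intro!: continuous_intros)
      have c2: "continuous_on (UNIV \<times> ?C) (\<lambda>z :: real \<times> 'a. G (snd z))"
        by (rule continuous_on_compose2[OF cG]) (auto intro!: continuous_intros)
      show "continuous_on (UNIV \<times> ?C) (\<lambda>(t, y). fx t y)"
        unfolding fx_def case_prod_beta by (intro continuous_intros c1 c2 cw)
    qed auto
    then show ?thesis by (simp add: m_def[abs_def])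
  qed
  have mm: "m 0 \<le> m r"
    by (rule DERIV_nonneg_imp_nondecreasing[OF r]) (use md step in blast)
  have me: "m t = integral\<^sup>L lborel (\<lambda>y. G y * w (a + t *\<^sub>R y))" for t
    unfolding m_def by (rule cc_int(2)[symmetric, OF continuous_on_subset[OF continuous_on_mult[OF cG cA[OF cw(1)]] subset_UNIV]]) (simp add: G0)
  have "m 0 = w a * integral\<^sup>L lborel G" unfolding me by (simp add: mult.commute)
  with mm me[of r] show ?thesis unfolding G_def[abs_def] by simp
qed

lemma lborel_scale:
  fixes f :: "'a::euclidean_space \<Rightarrow> real"
  assumes "f \<in> borel_measurable borel" "0 < r"
  shows "integral\<^sup>L lborel f = r ^ DIM('a) * integral\<^sup>L lborel (\<lambda>y. f (a + r *\<^sub>R y))"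
proof -
  have "integral\<^sup>L lborel f = integral\<^sup>L (density (distr lborel borel (\<lambda>x. a + r *\<^sub>R x)) (\<lambda>_. ennreal (\<bar>r\<bar> ^ DIM('a)))) f"
    using lborel_affine[of r a] assms(2) by simp
  also have "\<dots> = r ^ DIM('a) * integral\<^sup>L (distr lborel borel (\<lambda>x. a + r *\<^sub>R x)) f"
    using assms by (subst integral_density) auto
  also have "integral\<^sup>L (distr lborel borel (\<lambda>x. a + r *\<^sub>R x)) f = integral\<^sup>L lborel (\<lambda>y. f (a + r *\<^sub>R y))"
    using assms by (intro integral_distr) auto
  finally show ?thesis .
qed

lemma indicator_times_measurable:
  fixes h :: "'a::euclidean_space \<Rightarrow> real"
  shows "h \<in> borel_measurable borel \<Longrightarrow> A \<in> sets borel \<Longrightarrow> (\<lambda>x. indicator A x * h x) \<in> borel_measurable borel"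
  by (intro borel_measurable_times borel_measurable_indicator) auto

text \<open>The limit of \<open>submean_weight\<close> as the weight tends to the indicator of the ball.\<close>
lemma submean:
  fixes w :: "'a::euclidean_space \<Rightarrow> real"
  assumes w: "Ck_on 2 w UNIV" and r: "0 < r"
    and p: "\<And>z. z \<in> cball a r \<Longrightarrow> 0 \<le> (\<Sum>b\<in>Basis. dd b (dd b w) z)"
  shows "w a * measure lborel (cball a r) \<le> integral\<^sup>L lborel (\<lambda>x. indicator (cball a r) x * w x)"
proof -
  let ?\<delta> = "\<lambda>k::nat. 1 / (real k + 1)"
  have cw: "continuous_on UNIV w" by (rule Ck_cont[OF w])
  have cA: "continuous_on UNIV (\<lambda>y. w (a + r *\<^sub>R y))"
    by (rule continuous_on_compose2[OF cw]) (auto intro!: continuous_intros)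
  have lim: "(\<lambda>k. integral\<^sup>L lborel (\<lambda>y. ramp (?\<delta> k) (1 - y \<bullet> y) * h y)) \<longlonglongrightarrow> integral\<^sup>L lborel (\<lambda>y. indicator (ball 0 1) y * h y)"
    if h: "continuous_on UNIV h" for h :: "'a \<Rightarrow> real"
  proof (rule integral_dominated_convergence)
    have i: "integrable lborel (\<lambda>y. indicator (cball 0 1) y *\<^sub>R \<bar>h y\<bar>)"
      by (rule borel_integrable_compact) (use h continuous_on_subset in \<open>auto intro!: continuous_intros\<close>)
    show "integrable lborel (\<lambda>y. indicator (cball 0 1) y *\<^sub>R \<bar>h y\<bar>)" by (rule i)
    have hm: "h \<in> borel_measurable borel" using h by (rule borel_measurable_continuous_onI)
    show "(\<lambda>y. indicator (ball 0 1) y * h y) \<in> borel_measurable lborel" using indicator_times_measurable[OF hm, of "ball 0 1"] by simp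
    show "(\<lambda>y. ramp (?\<delta> k) (1 - y \<bullet> y) * h y) \<in> borel_measurable lborel" for k
      by (simp, rule borel_measurable_continuous_onI) (intro continuous_intros ramp_cont h)
    show "AE y in lborel. (\<lambda>k. ramp (?\<delta> k) (1 - y \<bullet> y) * h y) \<longlonglongrightarrow> indicator (ball 0 1) y * h y"
    proof (rule AE_I2)
      fix y :: 'a
      show "(\<lambda>k. ramp (?\<delta> k) (1 - y \<bullet> y) * h y) \<longlonglongrightarrow> indicator (ball 0 1) y * h y"
      proof (cases "norm y < 1")
        case True
        then have s: "0 < 1 - y \<bullet> y" by (simp add: power2_norm_eq_inner[symmetric] abs_square_less_1)
        have "?\<delta> \<longlonglongrightarrow> 0" using LIMSEQ_inverse_real_of_nat by (simp add: inverse_eq_divide add.commute)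
        then have "eventually (\<lambda>k. ?\<delta> k < 1 - y \<bullet> y) sequentially" using s by (rule order_tendstoD(2))
        then have "eventually (\<lambda>k. ramp (?\<delta> k) (1 - y \<bullet> y) * h y = indicator (ball 0 1) y * h y) sequentially"
          by eventually_elim (use True in \<open>simp add: ramp_bounds(4)\<close>)
        then show ?thesis by (rule tendsto_eventually)
      next
        case False
        then have "1 - y \<bullet> y \<le> 0" using power_mono[of 1 "norm y" 2] by (simp add: power2_norm_eq_inner[symmetric])
        then have "ramp (?\<delta> k) (1 - y \<bullet> y) = 0" for k by (intro ramp_bounds(3)) auto
        then show ?thesis using False by simp
      qed
    qed
    show "AE y in lborel. norm (ramp (?\<delta> k) (1 - y \<bullet> y) * h y) \<le> indicator (cball 0 1) y *\<^sub>R \<bar>h y\<bar>" for k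
    proof (rule AE_I2)
      fix y :: 'a
      show "norm (ramp (?\<delta> k) (1 - y \<bullet> y) * h y) \<le> indicator (cball 0 1) y *\<^sub>R \<bar>h y\<bar>"
      proof (cases "norm y \<le> 1")
        case True
        have "\<bar>ramp (?\<delta> k) (1 - y \<bullet> y)\<bar> \<le> 1" using ramp_bounds(1,2)[of "?\<delta> k"] by (simp add: abs_le_iff add.commute)
        then have "\<bar>ramp (?\<delta> k) (1 - y \<bullet> y)\<bar> * \<bar>h y\<bar> \<le> 1 * \<bar>h y\<bar>" by (rule mult_right_mono) simp
        then show ?thesis using True by (simp add: abs_mult)
      next
        case False
        then have "1 - y \<bullet> y \<le> 0" using power_mono[of 1 "norm y" 2] by (simp add: power2_norm_eq_inner[symmetric])
        then have "ramp (?\<delta> k) (1 - y \<bullet> y) = 0" by (intro ramp_bounds(3)) auto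
        then show ?thesis by simp
      qed
    qed
  qed
  have le: "w a * integral\<^sup>L lborel (\<lambda>y::'a. ramp (?\<delta> k) (1 - y \<bullet> y) * 1) \<le> integral\<^sup>L lborel (\<lambda>y. ramp (?\<delta> k) (1 - y \<bullet> y) * w (a + r *\<^sub>R y))" for k
    using submean_weight[OF w less_imp_le[OF r] _ p, of "?\<delta> k"] by simp
  have L: "w a * integral\<^sup>L lborel (\<lambda>y::'a. indicator (ball 0 1) y * 1) \<le> integral\<^sup>L lborel (\<lambda>y. indicator (ball 0 1) y * w (a + r *\<^sub>R y))"
    by (rule LIMSEQ_le[OF tendsto_mult_left[OF lim] lim[OF cA]]) (use le in \<open>auto intro!: continuous_intros\<close>)
  have nul: "integral\<^sup>L lborel (\<lambda>x. indicator (cball a r) x * h x) = integral\<^sup>L lborel (\<lambda>x. indicator (ball a r) x * h x)"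
    if h: "h \<in> borel_measurable borel" for h :: "'a \<Rightarrow> real"
  proof (rule integral_cong_AE)
    have "sphere a r \<in> null_sets (completion lborel)" using negligible_sphere negligible_iff_null_sets by blast
    then have "sphere a r \<in> null_sets lborel" by (subst (asm) null_sets_completion_iff) auto
    then have "AE x in lborel. x \<notin> sphere a r" by (rule AE_not_in)
    then show "AE x in lborel. indicator (cball a r) x * h x = indicator (ball a r) x * h x"
      by eventually_elim (auto simp: indicator_def)
  qed (use indicator_times_measurable[OF h, of "ball a r"] indicator_times_measurable[OF h, of "cball a r"] in auto)
  have sc: "integral\<^sup>L lborel (\<lambda>x. indicator (ball a r) x * h x) = r ^ DIM('a) * integral\<^sup>L lborel (\<lambda>y. indicator (ball 0 1) y * h (a + r *\<^sub>R y))"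
    if h: "h \<in> borel_measurable borel" for h :: "'a \<Rightarrow> real"
  proof -
    have "a + r *\<^sub>R y \<in> ball a r \<longleftrightarrow> y \<in> ball 0 1" for y using r by (simp add: dist_norm)
    then have e: "indicator (ball a r) (a + r *\<^sub>R y) = (indicator (ball 0 1) y :: real)" for y by (simp add: indicator_def)
    show ?thesis using lborel_scale[OF _ r, of "\<lambda>x. indicator (ball a r) x * h x" a] indicator_times_measurable[OF h, of "ball a r"] unfolding e by simp
  qed
  have wm: "w \<in> borel_measurable borel" using cw by (rule borel_measurable_continuous_onI)
  have "w a * measure lborel (cball a r) = w a * integral\<^sup>L lborel (\<lambda>x. indicator (cball a r) x * 1)" by simp
  also have "\<dots> = r ^ DIM('a) * (w a * integral\<^sup>L lborel (\<lambda>y::'a. indicator (ball 0 1) y * 1))"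
    by (subst nul, simp, subst sc, simp) simp
  also have "\<dots> \<le> r ^ DIM('a) * integral\<^sup>L lborel (\<lambda>y. indicator (ball 0 1) y * w (a + r *\<^sub>R y))"
    using r by (intro mult_left_mono L) simp
  also have "\<dots> = integral\<^sup>L lborel (\<lambda>x. indicator (cball a r) x * w x)" unfolding nul[OF wm] sc[OF wm] ..
  finally show ?thesis .
qed

section \<open>Maxima, suprema and translates\<close>

lemma hm_lin: "hm (\<lambda>p q. a * H p q + b * G p q) = a *\<^sub>R hm H + b *\<^sub>R hm G"
  by (simp add: hm_def cvec_eq_iff scaleR_conv_of_real[where 'a=complex] field_simps)

lemma hess_lin:
  assumes "Ck_on 2 u S" "Ck_on 2 v S" "open S" "z \<in> S"
  shows "hess (\<lambda>x. a * u x + b * v x) z = a *\<^sub>R hess u z + b *\<^sub>R hess v z"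
proof -
  note u = Ck2D[OF assms(1)] and v = Ck2D[OF assms(2)]
  have L: "dd p (\<lambda>x. a * f x + b * g x) x = a * dd p f x + b * dd p g x" if "f differentiable (at x)" "g differentiable (at x)" for p f g x
  proof -
    have "(\<lambda>x. a * f x) differentiable (at x)" "(\<lambda>x. b * g x) differentiable (at x)" using that by (auto intro!: differentiable_mult)
    from dd_add[OF this, of p] show ?thesis using dd_cmult[OF that(1), of p a] dd_cmult[OF that(2), of p b] by simp
  qed
  have d1: "dd q (\<lambda>x. a * u x + b * v x) x = a * dd q u x + b * dd q v x" if "x \<in> S" for q x
    by (rule L[OF Ck_diff[OF u that] Ck_diff[OF v that]])
  have "dd p (dd q (\<lambda>x. a * u x + b * v x)) z = a * dd p (dd q u) z + b * dd p (dd q v) z" for p q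
  proof -
    have "dd p (dd q (\<lambda>x. a * u x + b * v x)) z = dd p (\<lambda>x. a * dd q u x + b * dd q v x) z"
      by (rule dd_cong_open[OF assms(3,4) d1])
    also have "\<dots> = a * dd p (dd q u) z + b * dd p (dd q v) z"
      by (rule L[OF Ck_diff[OF Ck_dd[OF u] assms(4)] Ck_diff[OF Ck_dd[OF v] assms(4)]])
    finally show ?thesis .
  qed
  then show ?thesis unfolding hess_def by (simp add: hm_lin)
qed

text \<open>The vector \<open>(\<partial>u / \<partial>z\<^sub>j)\<close>.\<close>
definition gvec :: "(complex^'n \<Rightarrow> real) \<Rightarrow> complex^'n \<Rightarrow> complex^'n" where
  "gvec u z = (\<chi> j. (of_real (dd (axis j 1) u z) - \<i> * of_real (dd (axis j \<i>) u z)) / 2)"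
definition rk1 :: "complex^'n \<Rightarrow> complex^'n^'n" where "rk1 w = (\<chi> j k. w $ j * cnj (w $ k))"

lemma hm_rk1: "hm (\<lambda>p q. dd p u z * dd q u z) = rk1 (gvec u z)"
  by (simp add: hm_def rk1_def gvec_def cvec_eq_iff algebra_simps)

lemma hess_comp:
  assumes S: "open S" "z \<in> S" and g: "Ck_on 2 g S" "g ` S \<subseteq> I"
    and F: "\<And>t. t \<in> I \<Longrightarrow> (F0 has_real_derivative F1 t) (at t)" "\<And>t. t \<in> I \<Longrightarrow> (F1 has_real_derivative F2 t) (at t)"
  shows "hess (\<lambda>x. F0 (g x)) z = F1 (g z) *\<^sub>R hess g z + F2 (g z) *\<^sub>R rk1 (gvec g z)"
proof -
  note g2 = Ck2D[OF g(1)]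
  have gI: "g x \<in> I" if "x \<in> S" for x using g(2) that by blast
  have d1: "dd q (\<lambda>x. F0 (g x)) x = F1 (g x) * dd q g x" if "x \<in> S" for q x
    by (rule dd_compose(1)[OF Ck_diff[OF g2 that] F(1)[OF gI[OF that]]])
  note c = dd_compose[OF Ck_diff[OF g2 S(2)] F(2)[OF gI[OF S(2)]]]
  have "dd p (dd q (\<lambda>x. F0 (g x))) z = F1 (g z) * dd p (dd q g) z + F2 (g z) * (dd p g z * dd q g z)" for p q
  proof -
    have "dd p (dd q (\<lambda>x. F0 (g x))) z = dd p (\<lambda>x. F1 (g x) * dd q g x) z"
      by (rule dd_cong_open[OF S d1])
    also have "\<dots> = F1 (g z) * dd p (dd q g) z + dd p (\<lambda>x. F1 (g x)) z * dd q g z"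
      by (rule dd_mult[OF c(2) Ck_diff[OF Ck_dd[OF g2] S(2)]])
    finally show ?thesis unfolding c(1) by (simp add: mult.assoc)
  qed
  then show ?thesis unfolding hess_def hm_rk1[symmetric] by (simp add: hm_lin)
qed

lemma LQ_rk1: assumes "1 \<le> m" "m \<le> CARD('n)" "As \<in> Adm m" shows "0 \<le> LQ As (rk1 (w :: complex^'n))"
  unfolding rk1_def by (rule LQ_nonneg[OF assms rank1_Gm[OF assms(2)]])

lemma Ck2_comp:
  assumes "open S" "Ck_on 2 g S" "g ` S \<subseteq> I" "continuous_on I F2"
    and F: "\<And>t. t \<in> I \<Longrightarrow> (F0 has_real_derivative F1 t) (at t)" "\<And>t. t \<in> I \<Longrightarrow> (F1 has_real_derivative F2 t) (at t)"
  shows "Ck_on 2 (\<lambda>x. F0 (g x)) S"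
proof -
  have "Ck_on 2 (\<lambda>x. ([F0, F1, F2] ! 0) (g x)) S"
  proof (rule Ck_comp[OF assms(1,3), where F = "\<lambda>j. [F0, F1, F2] ! j"])
    show "((\<lambda>t. ([F0, F1, F2] ! j) t) has_real_derivative ([F0, F1, F2] ! Suc j) t) (at t)" if "j < 2" "t \<in> I" for j t
      using that F less_2_cases[OF that(1)] by auto
    show "continuous_on I ([F0, F1, F2] ! 2)" using assms(4) by simp
  qed (rule assms(2))
  then show ?thesis by simp
qed

text \<open>A smooth convex approximation of the absolute value with slope at most \<open>1\<close>.\<close>
definition rab :: "real \<Rightarrow> real \<Rightarrow> real" where "rab e t = sqrt (t\<^sup>2 + e\<^sup>2)"
lemma rab_pos: "0 < e \<Longrightarrow> 0 < rab e t" unfolding rab_def by (simp add: add_nonneg_pos)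
lemma rab_sq: "(rab e t)\<^sup>2 = t\<^sup>2 + e\<^sup>2" unfolding rab_def by simp
lemma rab_bounds: assumes "0 < e" shows "\<bar>t\<bar> \<le> rab e t" "rab e t \<le> \<bar>t\<bar> + e"
proof -
  show "\<bar>t\<bar> \<le> rab e t" unfolding rab_def by (rule real_le_rsqrt) simp
  show "rab e t \<le> \<bar>t\<bar> + e" unfolding rab_def by (rule real_le_lsqrt) (use assms in \<open>auto simp: power2_sum\<close>)
qed
lemma rab_deriv:
  assumes "0 < e" shows "(rab e has_real_derivative t / rab e t) (at t)"
    "((\<lambda>t. t / rab e t) has_real_derivative e\<^sup>2 / (rab e t) ^ 3) (at t)"
proof -
  have p: "0 < t\<^sup>2 + e\<^sup>2" using assms by (simp add: add_nonneg_pos)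
  have "((\<lambda>t. sqrt (t\<^sup>2 + e\<^sup>2)) has_real_derivative (2 * t) * (inverse (sqrt (t\<^sup>2 + e\<^sup>2)) / 2)) (at t)"
    using p by (auto intro!: derivative_eq_intros)
  then show d: "(rab e has_real_derivative t / rab e t) (at t)"
    unfolding rab_def[abs_def] by (simp add: field_simps)
  have r: "rab e t \<noteq> 0" using rab_pos[OF assms] by (metis less_irrefl)
  have "((\<lambda>t. t / rab e t) has_real_derivative (1 * rab e t - t * (t / rab e t)) / (rab e t * rab e t)) (at t)"
    by (rule DERIV_divide[OF DERIV_ident d r])
  moreover have "(1 * rab e t - t * (t / rab e t)) / (rab e t * rab e t) = e\<^sup>2 / (rab e t) ^ 3"
  proof -
    have "(1 * rab e t - t * (t / rab e t)) / (rab e t * rab e t) = ((rab e t)\<^sup>2 - t\<^sup>2) / (rab e t) ^ 3"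
      using r by (simp add: field_simps power2_eq_square power3_eq_cube)
    then show ?thesis by (simp add: rab_sq)
  qed
  ultimately show "((\<lambda>t. t / rab e t) has_real_derivative e\<^sup>2 / (rab e t) ^ 3) (at t)" by simp
qed

text \<open>With \<open>s\<close> the regularised absolute value, \<open>(w\<^sub>1 + w\<^sub>2 + s(w\<^sub>1 -
  w\<^sub>2)) / 2\<close> approximates the maximum of two smoothings. Its Hessian is a combination of those of
  \<open>w\<^sub>1\<close> and \<open>w\<^sub>2\<close> with the nonnegative weights \<open>(1 \<plusminus>
  s\<^sup>\<prime>) / 2\<close>, plus a nonnegative rank-one term from the convexity of \<open>s\<close>.\<close>
lemma msub_max:
  fixes u1 u2 :: "complex^'n \<Rightarrow> real"
  assumes S: "open S" and m: "1 \<le> m" "m \<le> CARD('n)" and u1: "msub m S u1" and u2: "msub m S u2"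
  shows "msub m S (\<lambda>x. max (u1 x) (u2 x))"
proof (rule msub_approx[OF S m])
  show "continuous_on S (\<lambda>x. max (u1 x) (u2 x))" using msub_cont[OF u1] msub_cont[OF u2] by (intro continuous_intros)
  fix K :: "(complex^'n) set" and e0 :: real assume K: "compact K" "K \<subseteq> S" and "0 < e0"
  define e where "e = e0 / 3"
  have e: "0 < e" using \<open>0 < e0\<close> by (simp add: e_def)
  obtain w1 T1 where w1: "\<And>j. Ck_on j w1 UNIV" "open T1" "K \<subseteq> T1" "T1 \<subseteq> S" "\<And>z. z \<in> T1 \<Longrightarrow> \<bar>w1 z - u1 z\<bar> \<le> e"
    "\<And>z As. z \<in> T1 \<Longrightarrow> As \<in> Adm m \<Longrightarrow> 0 \<le> LQ As (hess w1 z)" using smoothing[OF S u1 K e] by blast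
  obtain w2 T2 where w2: "\<And>j. Ck_on j w2 UNIV" "open T2" "K \<subseteq> T2" "T2 \<subseteq> S" "\<And>z. z \<in> T2 \<Longrightarrow> \<bar>w2 z - u2 z\<bar> \<le> e"
    "\<And>z As. z \<in> T2 \<Longrightarrow> As \<in> Adm m \<Longrightarrow> 0 \<le> LQ As (hess w2 z)" using smoothing[OF S u2 K e] by blast
  define d where "d x = 1 * w1 x + (-1) * w2 x" for x
  define p where "p x = (1/2) * w1 x + (1/2) * w2 x" for x
  define w where "w x = 1 * p x + (1/2) * rab e (d x)" for x
  define T where "T = T1 \<inter> T2"
  have T: "open T" "K \<subseteq> T" "T \<subseteq> S" using w1 w2 by (auto simp: T_def)
  have d2: "Ck_on 2 d UNIV" unfolding d_def by (intro Ck_add Ck_cmult open_UNIV w1 w2)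
  have p2: "Ck_on 2 p UNIV" unfolding p_def by (intro Ck_add Ck_cmult open_UNIV w1 w2)
  have cont: "continuous_on UNIV (\<lambda>t. e\<^sup>2 / (rab e t) ^ 3)"
    unfolding rab_def by (intro continuous_intros) (use e in \<open>auto simp: add_nonneg_pos sum_power2_eq_zero_iff\<close>)
  have r2: "Ck_on 2 (\<lambda>x. rab e (d x)) UNIV"
    by (rule Ck2_comp[OF open_UNIV d2 subset_UNIV cont rab_deriv(1)[OF e] rab_deriv(2)[OF e]])
  have w2': "Ck_on 2 w UNIV" unfolding w_def by (intro Ck_add Ck_cmult open_UNIV p2 r2)
  have "msub m T w"
  proof (rule C2_msub[OF T(1) m Ck_subset[OF w2' subset_UNIV]])
    fix z and As :: "(complex^'n^'n) list" assume z: "z \<in> T" and A: "As \<in> Adm m"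
    define s where "s = d z / rab e (d z)"
    define q where "q = e\<^sup>2 / (rab e (d z)) ^ 3"
    have hw: "hess w z = 1 *\<^sub>R hess p z + (1/2) *\<^sub>R hess (\<lambda>x. rab e (d x)) z"
      unfolding w_def[abs_def] by (rule hess_lin[OF p2 r2 open_UNIV UNIV_I])
    have hp: "hess p z = (1/2) *\<^sub>R hess w1 z + (1/2) *\<^sub>R hess w2 z"
      unfolding p_def[abs_def] by (rule hess_lin[OF w1(1) w2(1) open_UNIV UNIV_I])
    have hd: "hess d z = 1 *\<^sub>R hess w1 z + (-1) *\<^sub>R hess w2 z"
      unfolding d_def[abs_def] by (rule hess_lin[OF w1(1) w2(1) open_UNIV UNIV_I])
    have hr: "hess (\<lambda>x. rab e (d x)) z = s *\<^sub>R hess d z + q *\<^sub>R rk1 (gvec d z)"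
      unfolding s_def q_def by (rule hess_comp[OF open_UNIV UNIV_I d2 subset_UNIV rab_deriv(1)[OF e] rab_deriv(2)[OF e]])
    have E: "LQ As (hess w z) = ((1 + s) * LQ As (hess w1 z) + (1 - s) * LQ As (hess w2 z) + q * LQ As (rk1 (gvec d z))) / 2"
      unfolding hw LQ_lin hp hr hd by (simp add: field_simps)
    have sb: "\<bar>s\<bar> \<le> 1" using rab_bounds(1)[OF e, of "d z"] rab_pos[OF e, of "d z"] by (simp add: s_def abs_divide)
    have "0 \<le> (1 + s) * LQ As (hess w1 z)" by (rule mult_nonneg_nonneg) (use sb w1(6) A z in \<open>auto simp: T_def abs_le_iff\<close>)
    moreover have "0 \<le> (1 - s) * LQ As (hess w2 z)" by (rule mult_nonneg_nonneg) (use sb w2(6) A z in \<open>auto simp: T_def abs_le_iff\<close>)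
    moreover have "0 \<le> q * LQ As (rk1 (gvec d z))"
      using rab_pos[OF e, of "d z"] LQ_rk1[OF m A] unfolding q_def by (intro mult_nonneg_nonneg divide_nonneg_nonneg) auto
    ultimately show "0 \<le> LQ As (hess w z)" unfolding E by simp
  qed
  moreover have "\<bar>w z - max (u1 z) (u2 z)\<bar> \<le> e0" if z: "z \<in> K" for z
  proof -
    have a: "\<bar>w1 z - u1 z\<bar> \<le> e" "\<bar>w2 z - u2 z\<bar> \<le> e" using z w1(3,5) w2(3,5) by auto
    have "2 * w z = w1 z + w2 z + rab e (w1 z - w2 z)" by (simp add: w_def p_def d_def)
    moreover have "\<bar>w1 z - w2 z\<bar> \<le> rab e (w1 z - w2 z)" "rab e (w1 z - w2 z) \<le> \<bar>w1 z - w2 z\<bar> + e" using rab_bounds[OF e] by auto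
    moreover have "2 * max (u1 z) (u2 z) = u1 z + u2 z + \<bar>u1 z - u2 z\<bar>" by (simp add: max_def)
    moreover have "\<bar>w1 z - w2 z\<bar> \<le> \<bar>u1 z - u2 z\<bar> + 2 * e" "\<bar>u1 z - u2 z\<bar> \<le> \<bar>w1 z - w2 z\<bar> + 2 * e" using a by linarith+
    moreover have "w1 z \<le> u1 z + e" "u1 z \<le> w1 z + e" "w2 z \<le> u2 z + e" "u2 z \<le> w2 z + e" using a by linarith+
    ultimately have "w z - max (u1 z) (u2 z) \<le> 3 * e" "max (u1 z) (u2 z) - w z \<le> 3 * e" using e by linarith+
    then show ?thesis by (simp add: e_def abs_le_iff)
  qed
  ultimately show "\<exists>v T. open T \<and> K \<subseteq> T \<and> T \<subseteq> S \<and> msub m T v \<and> (\<forall>z\<in>K. \<bar>v z - max (u1 z) (u2 z)\<bar> \<le> e0)"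
    using T by (intro exI[of _ w] exI[of _ T]) simp
qed

lemma msub_local:
  assumes "continuous_on S u" "\<And>x. x \<in> S \<Longrightarrow> \<exists>r>0. msub m (ball x r) u" shows "msub m S u"
  unfolding msub_def
proof (intro conjI ballI assms(1))
  fix x assume "x \<in> S"
  then obtain r where r: "0 < r" "msub m (ball x r) u" using assms(2) by blast
  then have "x \<in> ball x r" by simp
  with r(2) show "\<exists>r>0. tpos m (ball x r) u" unfolding msub_def by blast
qed

lemma msub_cong:
  fixes u v :: "complex^'n \<Rightarrow> real"
  assumes S: "open S" and m: "1 \<le> m" "m \<le> CARD('n)" and e: "\<And>x. x \<in> S \<Longrightarrow> u x = v x" and u: "msub m S u" shows "msub m S v"
proof (rule msub_approx[OF S m])
  show "continuous_on S v" using msub_cont[OF u] e by (simp cong: continuous_on_cong)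
  fix K :: "(complex^'n) set" and d :: real assume K: "compact K" "K \<subseteq> S" "0 < d"
  then have "\<forall>z\<in>K. \<bar>u z - v z\<bar> \<le> d" using e by (simp add: subset_iff)
  then show "\<exists>w T. open T \<and> K \<subseteq> T \<and> T \<subseteq> S \<and> msub m T w \<and> (\<forall>z\<in>K. \<bar>w z - v z\<bar> \<le> d)"
    using u S K by (intro exI[of _ u] exI[of _ S]) simp
qed

text \<open>A version of Dini's theorem: a compact set is covered by finitely many of the open sets where a member of the
  family exceeds \<open>u - e\<close>, and the maximum of these members is uniformly close to \<open>u\<close>.\<close>
lemma msub_sup:
  fixes u :: "complex^'n \<Rightarrow> real"
  assumes S: "open S" and m: "1 \<le> m" "m \<le> CARD('n)" and u: "continuous_on S u"
    and ne: "g0 \<in> \<G>" and G: "\<And>g. g \<in> \<G> \<Longrightarrow> msub m S g" "\<And>f g. f \<in> \<G> \<Longrightarrow> g \<in> \<G> \<Longrightarrow> (\<lambda>x. max (f x) (g x)) \<in> \<G>"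
    and le: "\<And>g x. g \<in> \<G> \<Longrightarrow> x \<in> S \<Longrightarrow> g x \<le> u x" and ap: "\<And>x e. x \<in> S \<Longrightarrow> 0 < e \<Longrightarrow> \<exists>g\<in>\<G>. u x - e < g x"
  shows "msub m S u"
proof (rule msub_approx[OF S m u])
  fix K :: "(complex^'n) set" and e :: real assume K: "compact K" "K \<subseteq> S" and e: "0 < e"
  have o: "open {x\<in>S. u x - e < g x}" if "g \<in> \<G>" for g
  proof -
    have "continuous_on S (\<lambda>x. g x - u x)" using u msub_cont[OF G(1)[OF that]] by (intro continuous_intros)
    from continuous_open_preimage[OF this S open_greaterThan[of "- e"]]
    have "open (S \<inter> (\<lambda>x. g x - u x) -` {- e<..})" .
    moreover have "S \<inter> (\<lambda>x. g x - u x) -` {- e<..} = {x\<in>S. u x - e < g x}" by auto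
    ultimately show ?thesis by simp
  qed
  have cov: "K \<subseteq> (\<Union>g\<in>\<G>. {x\<in>S. u x - e < g x})" using ap[OF _ e] K(2) by blast
  obtain C where C: "C \<subseteq> \<G>" "finite C" "K \<subseteq> (\<Union>g\<in>C. {x\<in>S. u x - e < g x})"
    using compactE_image[OF K(1) o cov] by blast
  have "\<exists>g\<in>\<G>. \<forall>c\<in>C. \<forall>x. c x \<le> g x" using C(2,1)
  proof (induction rule: finite_induct)
    case empty then show ?case using ne by blast
  next
    case (insert c C)
    then obtain g where g: "g \<in> \<G>" "\<forall>c\<in>C. \<forall>x. c x \<le> g x" by blast
    have "(\<lambda>x. max (c x) (g x)) \<in> \<G>" using insert.prems g by (intro G(2)) auto
    then show ?case using g(2) by (intro bexI[of _ "\<lambda>x. max (c x) (g x)"]) (auto simp: le_max_iff_disj)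
  qed
  then obtain g where g: "g \<in> \<G>" "\<forall>c\<in>C. \<forall>x. c x \<le> g x" by blast
  have "\<bar>g z - u z\<bar> \<le> e" if zK: "z \<in> K" for z
  proof -
    obtain c where "c \<in> C" "u z - e < c z" using C(3) zK by blast
    then have "u z - e < g z" using g(2) by (meson less_le_trans)
    moreover have "g z \<le> u z" using le[OF g(1)] zK K(2) by blast
    ultimately show ?thesis by simp
  qed
  then show "\<exists>v T. open T \<and> K \<subseteq> T \<and> T \<subseteq> S \<and> msub m T v \<and> (\<forall>z\<in>K. \<bar>v z - u z\<bar> \<le> e)"
    using G(1)[OF g(1)] S K(2) by (intro exI[of _ g] exI[of _ S]) simp
qed

lemma Lap_shift:
  assumes "\<And>k. Ck_on k \<theta> UNIV" shows "Lap As (\<lambda>y. \<theta> (y + c)) x = Lap As \<theta> (x + c)"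
proof -
  have d: "\<theta> differentiable (at y)" "dd b \<theta> differentiable (at y)" for y b
    using Ck_diff[OF assms[of "Suc 0"]] Ck_diff[OF Ck_dd[OF assms[of "Suc (Suc 0)"]]] by auto
  have 1: "dd b (\<lambda>y. \<theta> (y + c)) = (\<lambda>y. dd b \<theta> (y + c))" for b using dd_shift(1)[OF d(1)] by (intro HOL.ext)
  have "dd a (dd b (\<lambda>y. \<theta> (y + c))) x = dd a (dd b \<theta>) (x + c)" for a b unfolding 1 by (rule dd_shift(1)[OF d(2)])
  then show ?thesis unfolding Lap_expand by simp
qed

lemma msub_translate:
  fixes u :: "complex^'n \<Rightarrow> real"
  assumes S: "open S" and m: "1 \<le> m" "m \<le> CARD('n)" and u: "msub m S u"
  shows "msub m {z. z + c \<in> S} (\<lambda>z. u (z + c))"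
proof -
  let ?S = "{z. z + c \<in> S}"
  have oS: "open ?S"
  proof -
    have "open ((\<lambda>z. z + c) -` S)" by (intro open_vimage S continuous_intros)
    then show ?thesis by (simp add: vimage_def)
  qed
  show ?thesis
  proof (rule tpos_msub[OF oS])
    show "continuous_on ?S (\<lambda>z. u (z + c))"
      by (rule continuous_on_compose2[OF msub_cont[OF u]]) (auto intro!: continuous_intros)
    show "tpos m ?S (\<lambda>z. u (z + c))" unfolding tpos_def
    proof (intro ballI allI impI)
      fix As :: "(complex^'n^'n) list" and \<theta> :: "complex^'n \<Rightarrow> real"
      assume A: "As \<in> Adm m" and t: "test_function ?S \<theta>" "\<forall>z. 0 \<le> \<theta> z"
      obtain K where K: "compact K" "K \<subseteq> ?S" "\<And>x. x \<notin> K \<Longrightarrow> \<theta> x = 0" "\<And>k. Ck_on k \<theta> UNIV"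
        using test_supp[OF t(1)] by blast
      let ?K = "(\<lambda>z. z + c) ` K"
      define \<eta> where "\<eta> y = \<theta> (y + - c)" for y
      have \<eta>: "\<And>k. Ck_on k \<eta> UNIV" unfolding \<eta>_def by (rule Ck_shift[OF K(4)])
      have cK: "compact ?K" by (intro compact_continuous_image K continuous_intros)
      have z: "\<eta> x = 0" if "x \<notin> ?K" for x
      proof -
        have "x + - c \<notin> K" using that by (metis (no_types) image_eqI add.assoc add.left_inverse add_0_right)
        then show ?thesis unfolding \<eta>_def by (rule K(3))
      qed
      have KS: "?K \<subseteq> S" using K(2) by auto
      have sub: "closure {x. \<eta> x \<noteq> 0} \<subseteq> ?K" by (rule closure_minimal) (use z compact_imp_closed[OF cK] in auto)
      have "compact (closure {x. \<eta> x \<noteq> 0})" using compact_Int_closed[OF cK, of "closure {x. \<eta> x \<noteq> 0}"] sub by (simp add: Int_absorb1)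
      then have "test_function S \<eta>" unfolding test_function_def using \<eta> sub KS by blast
      then have p: "0 \<le> integral\<^sup>L lborel (\<lambda>x. u x * Lap As \<eta> x)"
        using msub_tpos[OF S m u] A t(2) unfolding tpos_def \<eta>_def by blast
      have cont: "continuous_on UNIV (\<lambda>x. u x * Lap As \<eta> x)"
      proof (rule supp_integrable(2)[OF S compact_imp_closed[OF cK] compact_imp_bounded[OF cK] KS])
        show "continuous_on S (\<lambda>x. u x * Lap As \<eta> x)" by (intro continuous_on_mult msub_cont[OF u] Lap_cont(1)[OF cK z \<eta>])
        show "x \<notin> ?K \<Longrightarrow> u x * Lap As \<eta> x = 0" for x using Lap_cont(2)[OF cK z \<eta>] by simp
      qed
      have "integral\<^sup>L lborel (\<lambda>x. u x * Lap As \<eta> x) = integral\<^sup>L lborel (\<lambda>x. u (c + x) * Lap As \<eta> (c + x))"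
        by (rule lborel_int_shift[symmetric]) (rule borel_measurable_continuous_onI[OF cont])
      also have "\<dots> = integral\<^sup>L lborel (\<lambda>x. u (x + c) * Lap As \<theta> x)"
      proof (intro Bochner_Integration.integral_cong refl)
        fix x
        have "Lap As \<eta> (c + x) = Lap As \<theta> (c + x + - c)" unfolding \<eta>_def[abs_def] by (rule Lap_shift[OF K(4)])
        then show "u (c + x) * Lap As \<eta> (c + x) = u (x + c) * Lap As \<theta> x" by (simp add: add.commute)
      qed
      finally show "0 \<le> integral\<^sup>L lborel (\<lambda>x. u (x + c) * Lap As \<theta> x)" using p by simp
    qed
  qed
qed

section \<open>Equivalence with m-subharmonicity\<close>

lemma sum_Basis_vec:
  fixes f :: "complex^'n \<Rightarrow> real"
  shows "(\<Sum>b\<in>Basis. f b) = (\<Sum>j\<in>UNIV. f (axis j 1) + f (axis j \<i>))"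
proof -
  have inj: "inj_on (\<lambda>(i, u). axis i u :: complex^'n) (UNIV \<times> {1, \<i>})"
    by (auto simp: inj_on_def axis_eq_axis)
  have B: "(Basis :: (complex^'n) set) = (\<lambda>(i, u). axis i u) ` (UNIV \<times> {1, \<i>})"
    unfolding Basis_vec_def Basis_complex_def by force
  have "(\<Sum>b\<in>Basis. f b) = (\<Sum>(i, u)\<in>UNIV \<times> {1, \<i>}. f (axis i u))"
    unfolding B sum.reindex[OF inj] by (intro sum.cong) auto
  also have "\<dots> = (\<Sum>i\<in>UNIV. \<Sum>u\<in>{1, \<i>}. f (axis i u))" by (rule sum.cartesian_product[symmetric])
  finally show ?thesis by (simp add: complex_eq_iff)
qed

lemma Re_nonneg_of_scaled:
  assumes "of_nat N * (Q::complex) = T * of_real c" "0 \<le> Re Q" "0 < c" shows "0 \<le> Re T"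
proof -
  have "real N * Re Q = Re T * c" using arg_cong[OF assms(1), of Re] by simp
  moreover have "0 \<le> real N * Re Q" using assms(2) by simp
  ultimately have "0 \<le> Re T * c" by (rule subst)
  then show ?thesis using assms(3) by (simp add: zero_le_mult_iff)
qed

text \<open>Testing against identity matrices only.\<close>
lemma laplace_pos:
  fixes w :: "complex^'n \<Rightarrow> real"
  assumes m: "1 \<le> m" "m \<le> CARD('n)" and w: "\<And>As. As \<in> Adm m \<Longrightarrow> 0 \<le> LQ As (hess w z)"
  shows "0 \<le> (\<Sum>b\<in>Basis. dd b (dd b w) z)"
proof -
  let ?A = "replicate (m - 1) idm @ replicate (CARD('n) - m) idm :: (complex^'n^'n) list"
  have A: "?A = replicate (CARD('n) - 1) idm" using m by (simp add: replicate_add[symmetric])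
  have "?A \<in> Adm m" unfolding Adm_def using idm_Gm[OF m(2)] by (auto simp del: replicate_append_same)
  from w[OF this] have q: "0 \<le> Re (Qf (hess w z # replicate (CARD('n) - 1) idm))" unfolding LQ_def A .
  obtain c where c: "0 < c" "Qf (replicate CARD('n) (idm :: complex^'n^'n)) = of_real c" using Qf_idm_pos by blast
  have "of_nat CARD('n) * Qf (hess w z # replicate (CARD('n) - 1) idm) = (\<Sum>j\<in>UNIV. hess w z $ j $ j) * of_real c"
    using Qf_trace[of "hess w z"] c(2) by simp
  from Re_nonneg_of_scaled[OF this q c(1)] have "0 \<le> Re (\<Sum>j\<in>UNIV. hess w z $ j $ j)" .
  moreover have "Re (\<Sum>j\<in>UNIV. hess w z $ j $ j) = (\<Sum>b\<in>Basis. dd b (dd b w) z) / 4"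
    unfolding sum_Basis_vec sum_divide_distrib by (simp add: hess_def hm_def)
  ultimately show ?thesis by simp
qed

lemma cball_integrable:
  fixes u :: "'a::euclidean_space \<Rightarrow> real"
  assumes "continuous_on (cball a r) u" shows "integrable lborel (\<lambda>x. indicator (cball a r) x * u x)"
  using borel_integrable_compact[OF compact_cball assms] by simp

lemma msub_submean:
  fixes u :: "complex^'n \<Rightarrow> real"
  assumes S: "open S" and m: "1 \<le> m" "m \<le> CARD('n)" and u: "msub m S u" and r: "0 < r" "cball a r \<subseteq> S"
  shows "u a * measure lborel (cball a r) \<le> integral\<^sup>L lborel (\<lambda>x. indicator (cball a r) x * u x)"
proof -
  let ?V = "measure lborel (cball a r)" and ?I = "\<lambda>f. integral\<^sup>L lborel (\<lambda>x. indicator (cball a r) x * f x :: real)"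
  have cu: "continuous_on (cball a r) u" using continuous_on_subset[OF msub_cont[OF u] r(2)] .
  have "0 \<le> ?I u - u a * ?V"
  proof (rule nonneg_by_eps)
    fix e :: real assume e: "0 < e"
    obtain w T where w: "\<And>j. Ck_on j w UNIV" "open T" "cball a r \<subseteq> T" "T \<subseteq> S" "\<And>z. z \<in> T \<Longrightarrow> \<bar>w z - u z\<bar> \<le> e"
      "\<And>z As. z \<in> T \<Longrightarrow> As \<in> Adm m \<Longrightarrow> 0 \<le> LQ As (hess w z)"
      using smoothing[OF S u compact_cball r(2) e] by blast
    have a: "a \<in> T" using w(3) r(1) by auto
    have 1: "w a * ?V \<le> ?I w"
      by (rule submean[OF w(1) r(1)]) (use laplace_pos[OF m] w(3,6) in blast)
    have 2: "?I w \<le> integral\<^sup>L lborel (\<lambda>x. indicator (cball a r) x * u x + e * indicator (cball a r) x)"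
    proof (rule integral_mono)
      show "integrable lborel (\<lambda>x. indicator (cball a r) x * w x)"
        by (rule cball_integrable) (use Ck_cont[OF w(1)] continuous_on_subset in blast)
      show "integrable lborel (\<lambda>x. indicator (cball a r) x * u x + e * indicator (cball a r) x)"
        using cball_integrable[OF cu] cball_integrable[OF continuous_on_const, of a r e] by (simp add: mult.commute)
      show "indicator (cball a r) x * w x \<le> indicator (cball a r) x * u x + e * indicator (cball a r) x" for x
        using w(5)[of x] w(3) by (auto simp: indicator_def abs_le_iff)
    qed
    have 3: "integral\<^sup>L lborel (\<lambda>x. indicator (cball a r) x * u x + e * indicator (cball a r) x) = ?I u + e * ?V"
      using cball_integrable[OF cu] cball_integrable[OF continuous_on_const, of a r e] by (subst Bochner_Integration.integral_add) (auto simp: mult.commute)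
    have "(u a - e) * ?V \<le> w a * ?V" using w(5)[OF a] by (intro mult_right_mono) (auto simp: abs_le_iff)
    then show "- e * (2 * ?V) \<le> ?I u - u a * ?V" using 1 2 3 by (simp add: algebra_simps)
  qed
  then show ?thesis by simp
qed

text \<open>For real continuous functions the two nonnegative integrals in the definition are those of the positive and
  negative parts, and their difference is the Bochner integral.\<close>
lemma subharmonic_onI:
  fixes u :: "'a::euclidean_space \<Rightarrow> real"
  assumes S: "open S" and U: "\<And>x. x \<in> S \<Longrightarrow> U x = ereal (u x)" and c: "continuous_on S u"
    and sm: "\<And>a r. 0 < r \<Longrightarrow> cball a r \<subseteq> S \<Longrightarrow> u a * measure lborel (cball a r) \<le> integral\<^sup>L lborel (\<lambda>x. indicator (cball a r) x * u x)"
  shows "subharmonic_on S U"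
  unfolding subharmonic_on_def
proof (intro conjI ballI allI impI)
  show "U x \<noteq> \<infinity>" if "x \<in> S" for x using U[OF that] by simp
  show "\<exists>x\<in>C. U x \<noteq> - \<infinity>" if CS: "C \<in> components S" for C
  proof -
    obtain x where x: "x \<in> C" using in_components_nonempty[OF CS] by blast
    then have "x \<in> S" using in_components_subset[OF CS] by blast
    then have "U x \<noteq> - \<infinity>" by (simp add: U)
    with x show ?thesis by blast
  qed
  show "\<forall>\<^sub>F y in at x within S. U y < c" if x: "x \<in> S" and cx: "U x < c" for x c
  proof -
    have "\<exists>t. u x < t \<and> ereal t \<le> c"
      using cx unfolding U[OF x] by (cases c) (auto intro: exI[of _ "u x + 1"])
    then obtain t where t: "u x < t" "ereal t \<le> c" by blast
    have "(u \<longlongrightarrow> u x) (at x within S)" using c x by (simp add: continuous_on_def)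
    then have "\<forall>\<^sub>F y in at x within S. u y < t" using t(1) by (rule order_tendstoD(2))
    then show ?thesis unfolding eventually_at_filter
    proof (rule eventually_mono)
      fix y assume y: "y \<noteq> x \<longrightarrow> y \<in> S \<longrightarrow> u y < t"
      show "y \<noteq> x \<longrightarrow> y \<in> S \<longrightarrow> U y < c"
      proof (intro impI)
        assume "y \<noteq> x" and yS: "y \<in> S"
        then have "ereal (u y) < ereal t" using y by simp
        then show "U y < c" unfolding U[OF yS] using t(2) by (rule less_le_trans)
      qed
    qed
  qed
  fix a r assume ar: "0 < r \<and> cball a r \<subseteq> S"
  have i: "integrable lborel (\<lambda>x. indicator (cball a r) x * u x)"
    by (rule cball_integrable) (use ar continuous_on_subset[OF c] in blast)
  let ?f = "\<lambda>x. indicator (cball a r) x * u x"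
  have N: "(\<integral>\<^sup>+x\<in>cball a r. e2ennreal (V x) \<partial>lborel) = ennreal (integral\<^sup>L lborel (\<lambda>x. max 0 (s * ?f x)))"
    if V: "\<And>x. x \<in> S \<Longrightarrow> V x = ereal (s * u x)" for V and s :: real
  proof -
    have "(\<integral>\<^sup>+x\<in>cball a r. e2ennreal (V x) \<partial>lborel) = (\<integral>\<^sup>+x. ennreal (max 0 (s * ?f x)) \<partial>lborel)"
    proof (intro nn_integral_cong)
      fix x
      show "e2ennreal (V x) * indicator (cball a r) x = ennreal (max 0 (s * ?f x))"
      proof (cases "x \<in> cball a r")
        case True
        then have "V x = ereal (s * u x)" using V ar by blast
        then show ?thesis using True by (simp add: e2ennreal_ereal max_def ennreal_neg)
      qed simp
    qed
    also have "\<dots> = ennreal (integral\<^sup>L lborel (\<lambda>x. max 0 (s * ?f x)))"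
      by (rule nn_integral_eq_integral) (use i in auto)
    finally show ?thesis .
  qed
  have P: "enn2ereal (ennreal (integral\<^sup>L lborel (\<lambda>x. max 0 (s * ?f x)))) = ereal (integral\<^sup>L lborel (\<lambda>x. max 0 (s * ?f x)))" for s :: real
    by (rule enn2ereal_ennreal) (intro integral_nonneg_AE AE_I2, simp)
  have "integral\<^sup>L lborel (\<lambda>x. max 0 (1 * ?f x)) - integral\<^sup>L lborel (\<lambda>x. max 0 ((-1) * ?f x)) = integral\<^sup>L lborel (\<lambda>x. max 0 (1 * ?f x) - max 0 ((-1) * ?f x))"
    using i by (intro Bochner_Integration.integral_diff[symmetric]) auto
  also have "\<dots> = integral\<^sup>L lborel ?f" by (intro Bochner_Integration.integral_cong refl) (simp add: max_def)
  finally have D: "integral\<^sup>L lborel (\<lambda>x. max 0 (1 * ?f x)) - integral\<^sup>L lborel (\<lambda>x. max 0 ((-1) * ?f x)) = integral\<^sup>L lborel ?f" .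
  have n1: "(\<integral>\<^sup>+x\<in>cball a r. e2ennreal (U x) \<partial>lborel) = ennreal (integral\<^sup>L lborel (\<lambda>x. max 0 (1 * ?f x)))"
    by (rule N) (simp add: U)
  have n2: "(\<integral>\<^sup>+x\<in>cball a r. e2ennreal (- U x) \<partial>lborel) = ennreal (integral\<^sup>L lborel (\<lambda>x. max 0 ((-1) * ?f x)))"
    by (rule N) (simp add: U)
  have "a \<in> S" using ar by auto
  then have "U a * ereal (measure lborel (cball a r)) = ereal (u a * measure lborel (cball a r))" by (simp add: U)
  also have "\<dots> \<le> ereal (integral\<^sup>L lborel ?f)" using sm ar by simp
  also have "\<dots> = enn2ereal (\<integral>\<^sup>+x\<in>cball a r. e2ennreal (U x) \<partial>lborel) - enn2ereal (\<integral>\<^sup>+x\<in>cball a r. e2ennreal (- U x) \<partial>lborel)"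
    unfolding n1 n2 P D[symmetric] by simp
  finally show "U a * ereal (measure lborel (cball a r)) \<le> enn2ereal (\<integral>\<^sup>+x\<in>cball a r. e2ennreal (U x) \<partial>lborel) - enn2ereal (\<integral>\<^sup>+x\<in>cball a r. e2ennreal (- U x) \<partial>lborel)" .
qed

lemma hessian_form_sig:
  fixes v :: "complex^'n \<Rightarrow> real"
  assumes "Ck_on 2 v S" "open S" "z \<in> S" "k \<le> CARD('n)"
  shows "top_coeff (hessian_form k v z) = of_real (sig k (hess v z))"
proof -
  let ?L = "replicate k v @ replicate (CARD('n) - k) nsq"
  have C: "Ck_on 2 u S" if "u \<in> set ?L" for u using that assms(1) Ck_nsq by (auto split: if_splits)
  have e: "top_coeff (hessian_form k v z) = wedge2 (map (\<lambda>u. ddc u z) ?L) std_frame"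
    unfolding top_coeff_def hessian_form_def kaehler_nsq by simp
  have q: "wedge2 (map (\<lambda>u. ddc u z) ?L) std_frame = Qf (replicate k (hess v z) @ replicate (CARD('n) - k) idm)"
    using wedge_Qf[OF C assms(2,3), of ?L] by (simp add: hess_nsq)
  have "wedge2 (map (\<lambda>u. ddc u z) ?L) std_frame = of_real (Fs ?L z)"
    unfolding Fs_def by (rule wedge_real[OF C assms(3)])
  then show ?thesis unfolding e sig_def q[symmetric] by simp
qed

lemma C2_msh_iff:
  fixes v :: "complex^'n \<Rightarrow> real"
  assumes "Ck_on 2 v S" "open S" "m \<le> CARD('n)"
  shows "C2_msh m S v \<longleftrightarrow> (\<forall>z\<in>S. hess v z \<in> Gm m)"
proof -
  have z0: "top_coeff (\<lambda>_. 0) = 0" by (simp add: top_coeff_def)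
  have "top_ge (hessian_form k v z) (\<lambda>_. 0) \<longleftrightarrow> 0 \<le> sig k (hess v z)" if "z \<in> S" "k \<in> {1..m}" for z k
    unfolding top_ge_def z0 using hessian_form_sig[OF assms(1,2) that(1), of k] that(2) assms(3) by simp
  then show ?thesis using assms(1) ctr_hess[OF assms(1,2)] unfolding C2_msh_def Gm_def by auto
qed

lemma weakly_positive_iff:
  fixes u :: "complex^'n \<Rightarrow> real"
  assumes S: "open S" and m: "1 \<le> m" and vs: "length vs = m - 1" "\<And>v. v \<in> set vs \<Longrightarrow> Ck_on 2 v S"
    and U: "\<And>x. x \<in> S \<Longrightarrow> U x = ereal (u x)"
  shows "weakly_positive S U vs \<longleftrightarrow> (\<forall>\<theta>. test_function S \<theta> \<and> (\<forall>z. 0 \<le> \<theta> z) \<longrightarrow>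
      0 \<le> integral\<^sup>L lborel (\<lambda>x. u x * Fs (\<theta> # vs @ replicate (CARD('n) - m) nsq) x))"
proof -
  let ?R = "replicate (CARD('n) - m) nsq"
  have "(LINT z:S|lborel. real_of_ereal (U z) *\<^sub>R top_coeff (wedge2 (ddc \<theta> z # map (\<lambda>v. ddc v z) vs
          @ replicate (CARD('n) - Suc (length vs)) (kaehler z)))) = of_real (integral\<^sup>L lborel (\<lambda>x. u x * Fs (\<theta> # vs @ ?R) x))"
    if t: "test_function S \<theta>" for \<theta>
  proof -
    obtain K where K: "compact K" "K \<subseteq> S" "\<And>x. x \<notin> K \<Longrightarrow> \<theta> x = 0" "\<And>k. Ck_on k \<theta> UNIV"
      using test_supp[OF t] by blast
    have C: "Ck_on 2 h S" if "h \<in> set (\<theta> # vs @ ?R)" for h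
      using that vs(2) Ck_nsq Ck_subset[OF K(4) subset_UNIV] by (auto split: if_splits)
    have l: "CARD('n) - Suc (length vs) = CARD('n) - m" using vs(1) m by simp
    have "(LINT z:S|lborel. real_of_ereal (U z) *\<^sub>R top_coeff (wedge2 (ddc \<theta> z # map (\<lambda>v. ddc v z) vs
          @ replicate (CARD('n) - Suc (length vs)) (kaehler z)))) = integral\<^sup>L lborel (\<lambda>x. complex_of_real (u x * Fs (\<theta> # vs @ ?R) x))"
      unfolding set_lebesgue_integral_def
    proof (intro Bochner_Integration.integral_cong refl)
      fix z
      show "indicat_real S z *\<^sub>R (real_of_ereal (U z) *\<^sub>R top_coeff (wedge2 (ddc \<theta> z # map (\<lambda>v. ddc v z) vs
          @ replicate (CARD('n) - Suc (length vs)) (kaehler z)))) = complex_of_real (u z * Fs (\<theta> # vs @ ?R) z)"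
      proof (cases "z \<in> S")
        case True
        have "wedge2 (map (\<lambda>u. ddc u z) (\<theta> # vs @ ?R)) std_frame = of_real (Fs (\<theta> # vs @ ?R) z)"
          unfolding Fs_def by (rule wedge_real[OF C True])
        then have "top_coeff (wedge2 (ddc \<theta> z # map (\<lambda>v. ddc v z) vs @ replicate (CARD('n) - Suc (length vs)) (kaehler z))) = of_real (Fs (\<theta> # vs @ ?R) z)"
          unfolding top_coeff_def l kaehler_nsq by simp
        then show ?thesis using True by (simp add: U scaleR_conv_of_real)
      next
        case False
        then have zK: "z \<notin> K" using K(2) by blast
        have "Fs (\<theta> # vs @ ?R) z = 0" by (rule Fs_zero[OF compact_imp_closed[OF K(1)] _ zK]) (rule K(3))
        then show ?thesis using False by simp
      qed
    qed
    also have "\<dots> = of_real (integral\<^sup>L lborel (\<lambda>x. u x * Fs (\<theta> # vs @ ?R) x))" by (rule integral_complex_of_real)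
    finally show ?thesis .
  qed
  then show ?thesis unfolding weakly_positive_def by simp
qed

text \<open>Testing against constant coefficients suffices.\<close>
theorem msub_SH:
  fixes u :: "complex^'n \<Rightarrow> real"
  assumes S: "open S" and m: "1 \<le> m" "m \<le> CARD('n)" and u: "msub m S u" and U: "\<And>x. x \<in> S \<Longrightarrow> U x = ereal (u x)"
  shows "U \<in> SH m S"
proof -
  have "weakly_positive S U vs" if vs: "length vs = m - 1" "\<forall>v\<in>set vs. C2_msh m S v" for vs
  proof -
    have C: "Ck_on 2 v S" if "v \<in> set vs" for v using vs(2) that unfolding C2_msh_def by blast
    have H: "hess v z \<in> Gm m" if "v \<in> set vs" "z \<in> S" for v z using C2_msh_iff[OF C[OF that(1)] S m(2)] vs(2) that by blast
    show ?thesis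
    proof (rule weakly_positive_iff[OF S m(1) vs(1), THEN iffD2])
      show "\<forall>\<theta>. test_function S \<theta> \<and> (\<forall>z. 0 \<le> \<theta> z) \<longrightarrow>
        0 \<le> integral\<^sup>L lborel (\<lambda>x. u x * Fs (\<theta> # vs @ replicate (CARD('n) - m) nsq) x)"
        by (intro allI impI, rule weak_pos[OF S m u vs(1)]) (use C H in auto)
    qed (use C U in auto)
  qed
  moreover have "subharmonic_on S U"
    by (rule subharmonic_onI[OF S U msub_cont[OF u] msub_submean[OF S m u]])
  ultimately show ?thesis unfolding SH_def by blast
qed

text \<open>Constant matrices in the cone are the Hessians of \<open>m\<close>-subharmonic quadratic polynomials.\<close>
theorem SH_msub:
  fixes u :: "complex^'n \<Rightarrow> real"
  assumes S: "open S" and m: "1 \<le> m" "m \<le> CARD('n)" and u: "continuous_on S u" "(\<lambda>x. ereal (u x)) \<in> SH m S"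
  shows "msub m S u"
proof (rule tpos_msub[OF S u(1)], unfold tpos_def, intro ballI allI impI)
  fix As :: "(complex^'n^'n) list" and \<theta> :: "complex^'n \<Rightarrow> real"
  assume A: "As \<in> Adm m" and t: "test_function S \<theta>" "\<forall>z. 0 \<le> \<theta> z"
  obtain Bs where B: "As = Bs @ replicate (CARD('n) - m) idm" "length Bs = m - 1" "set Bs \<subseteq> Gm m"
    using A unfolding Adm_def by blast
  have C: "Ck_on 2 v S" if "v \<in> set (map qp Bs)" for v using that qp_deriv(1) by auto
  have "C2_msh m S v" if vB: "v \<in> set (map qp Bs)" for v
  proof -
    obtain b where b: "v = qp b" "b \<in> Gm m" using vB B(3) by auto
    then have "hess (qp b) z = b" for z by (intro hess_qp) (simp add: Gm_def)
    then show ?thesis using C2_msh_iff[OF C[OF vB] S m(2)] b by simp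
  qed
  then have "weakly_positive S (\<lambda>x. ereal (u x)) (map qp Bs)" using u(2) B(2) unfolding SH_def by auto
  then have "0 \<le> integral\<^sup>L lborel (\<lambda>x. u x * Fs (\<theta> # map qp Bs @ replicate (CARD('n) - m) nsq) x)"
    using t by (subst (asm) weakly_positive_iff[OF S m(1) _ C refl]) (use B(2) in auto)
  then show "0 \<le> integral\<^sup>L lborel (\<lambda>x. u x * Lap As \<theta> x)"
    unfolding Lap_def B(1) map_append map_replicate nsq_qp[symmetric] .
qed

section \<open>The maximum principle\<close>

text \<open>At a maximum point of largest norm, a ball around it contains points of strictly larger norm, near which the
  function is smaller by a fixed amount; this contradicts the sub-mean value inequality.\<close>
lemma max_principle:
  fixes f :: "'a::euclidean_space \<Rightarrow> real"
  assumes S: "open S" "bounded S" and c: "continuous_on (closure S) f" and b: "\<And>z. z \<in> frontier S \<Longrightarrow> f z \<le> 0"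
    and sm: "\<And>a r. 0 < r \<Longrightarrow> cball a r \<subseteq> S \<Longrightarrow> f a * measure lborel (cball a r) \<le> integral\<^sup>L lborel (\<lambda>x. indicator (cball a r) x * f x)"
    and z: "z \<in> closure S"
  shows "f z \<le> 0"
proof (rule ccontr)
  assume "\<not> f z \<le> 0"
  then have z0: "0 < f z" by simp
  have cS: "compact (closure S)" using S(2) by (simp add: compact_closure)
  obtain y where y: "y \<in> closure S" "\<And>x. x \<in> closure S \<Longrightarrow> f x \<le> f y"
    using continuous_attains_sup[OF cS _ c] z by force
  define M where "M = {x \<in> closure S. f x = f y}"
  have fy: "0 < f y" using y(2)[OF z] z0 by simp
  have "closed M" unfolding M_def by (rule continuous_closed_preimage_constant[OF c closed_closure])
  then have "compact (closure S \<inter> M)" by (rule compact_Int_closed[OF cS])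
  moreover have "closure S \<inter> M = M" unfolding M_def by blast
  ultimately have cM: "compact M" by (rule back_subst[of compact])
  have "M \<noteq> {}" using y(1) unfolding M_def by blast
  from continuous_attains_sup[OF cM this continuous_on_norm_id]
  obtain p where p: "p \<in> M" "\<And>x. x \<in> M \<Longrightarrow> norm x \<le> norm p" by blast
  have pS: "p \<in> S"
  proof (rule ccontr)
    assume "p \<notin> S"
    then have "p \<in> frontier S" using p(1) S(1) unfolding M_def frontier_def by (simp add: interior_open)
    then show False using b[of p] p(1) fy unfolding M_def by simp
  qed
  obtain r where r: "0 < r" "cball p r \<subseteq> S" using S(1) pS open_contains_cball by blast
  obtain u :: 'a where u: "norm u = 1" "0 \<le> p \<bullet> u"
  proof -
    obtain e :: 'a where e: "e \<in> Basis" using nonempty_Basis by blast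
    show ?thesis
    proof (cases "0 \<le> p \<bullet> e")
      case True then show ?thesis using that[of e] e by simp
    next
      case False then show ?thesis using that[of "- e"] e by simp
    qed
  qed
  define q where "q = p + (r / 2) *\<^sub>R u"
  have qn: "norm p < norm q"
  proof -
    have uu: "u \<bullet> u = 1" using u(1) by (simp add: norm_eq_1)
    have "q \<bullet> q = p \<bullet> p + r * (p \<bullet> u) + r\<^sup>2 / 4"
      unfolding q_def by (simp add: inner_simps inner_commute uu power2_eq_square algebra_simps)
    moreover have "0 \<le> r * (p \<bullet> u)" "0 < r\<^sup>2 / 4" using r(1) u(2) by simp_all
    ultimately have "p \<bullet> p < q \<bullet> q" by linarith
    then show ?thesis by (simp add: norm_lt)
  qed
  have qd: "dist p q = r / 2" using u(1) r(1) by (simp add: q_def dist_norm)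
  have qS: "q \<in> S" using r qd by (auto simp: subset_iff)
  then have qcl: "q \<in> closure S" using closure_subset by blast
  have "q \<notin> M" using p(2)[of q] qn by auto
  then have fq: "f q < f y" using y(2)[OF qcl] qcl unfolding M_def by force
  define c0 where "c0 = (f y - f q) / 2"
  have c2: "2 * c0 = f y - f q" by (simp add: c0_def)
  then have c0: "0 < c0" using fq by simp
  have "continuous_on S f" using continuous_on_subset[OF c closure_subset] .
  then have "isCont f q" using S(1) qS continuous_on_eq_continuous_at by blast
  then obtain d where d: "0 < d" "\<And>x. dist x q < d \<Longrightarrow> dist (f x) (f q) < c0" using c0 unfolding continuous_at_eps_delta by blast
  define s where "s = min d (r / 2)"
  have s: "0 < s" using d(1) r(1) by (simp add: s_def)
  have B: "x \<in> cball p r" "f x \<le> f y - c0" if x: "x \<in> ball q s" for x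
  proof -
    have "dist p x \<le> dist p q + dist q x" by (rule dist_triangle)
    then show "x \<in> cball p r" using x qd by (simp add: s_def)
    have "dist (f x) (f q) < c0" using x by (intro d(2)) (simp add: s_def dist_commute)
    then show "f x \<le> f y - c0" using c2 unfolding dist_real_def by linarith
  qed
  have if1: "integrable lborel (\<lambda>x. indicator (cball p r) x * f x)"
    by (rule cball_integrable) (use r(2) closure_subset continuous_on_subset[OF c] in blast)
  have if2: "integrable lborel (\<lambda>x. f y * indicator (cball p r) x)" using cball_integrable[OF continuous_on_const, of p r "f y"] by (simp add: mult.commute)
  have if3: "integrable lborel (\<lambda>x. c0 * indicator (ball q s) x :: real)"
    by (intro integrable_mult_right integrable_real_indicator) (use emeasure_lborel_ball_finite[of q s] in \<open>simp_all add: less_top\<close>)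
  have "integral\<^sup>L lborel (\<lambda>x. indicator (cball p r) x * f x) \<le> integral\<^sup>L lborel (\<lambda>x. f y * indicator (cball p r) x - c0 * indicator (ball q s) x)"
  proof (rule integral_mono[OF if1 Bochner_Integration.integrable_diff[OF if2 if3]])
    fix x
    show "indicator (cball p r) x * f x \<le> f y * indicator (cball p r) x - c0 * indicator (ball q s) x"
    proof (cases "x \<in> ball q s")
      case True then show ?thesis using B[OF True] by (simp del: mem_cball mem_ball)
    next
      case F: False
      show ?thesis
      proof (cases "x \<in> cball p r")
        case True
        then have "x \<in> closure S" using r(2) closure_subset by blast
        then show ?thesis using F True y(2) by (simp del: mem_cball mem_ball)
      qed (use F in \<open>simp del: mem_cball mem_ball\<close>)
    qed
  qed
  also have "\<dots> = f y * measure lborel (cball p r) - c0 * measure lborel (ball q s)"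
    using if2 if3 by (subst Bochner_Integration.integral_diff) auto
  also have "\<dots> < f y * measure lborel (cball p r)" using c0 content_ball_pos[OF s, of q] by simp
  finally show False using sm[OF r] p(1) unfolding M_def by simp
qed

section \<open>Barriers at boundary points\<close>

text \<open>Subadditivity of \<open>t\<^sup>\<alpha>\<close>: for \<open>0 \<le> t \<le> 1\<close> one has \<open>t \<le>
  t\<^sup>\<alpha>\<close>, applied to the proportions of \<open>x\<close> and \<open>y - x\<close> in
  \<open>y\<close>.\<close>
lemma powr_subadd:
  fixes a b :: real
  assumes "0 \<le> a" "0 \<le> b" "0 < \<alpha>" "\<alpha> \<le> 1" shows "\<bar>a powr \<alpha> - b powr \<alpha>\<bar> \<le> \<bar>a - b\<bar> powr \<alpha>"
proof -
  have L: "y powr \<alpha> \<le> x powr \<alpha> + (y - x) powr \<alpha>" if xy: "0 \<le> x" "x \<le> y" for x y :: real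
  proof (cases "y = 0")
    case False
    then have y: "0 < y" using xy by simp
    have P: "t / y \<le> (t / y) powr \<alpha>" if t: "0 \<le> t" "t \<le> y" for t
    proof -
      have "(t / y) powr 1 \<le> (t / y) powr \<alpha>" by (rule powr_mono') (use t y assms in auto)
      then show ?thesis using t y by simp
    qed
    have D: "t powr \<alpha> = (t / y) powr \<alpha> * y powr \<alpha>" if "0 \<le> t" for t
      using y that by (simp add: powr_mult[symmetric])
    have "y powr \<alpha> = (x / y + (y - x) / y) * y powr \<alpha>" using y by (simp add: add_divide_distrib[symmetric])
    also have "\<dots> \<le> ((x / y) powr \<alpha> + ((y - x) / y) powr \<alpha>) * y powr \<alpha>"
      by (intro mult_right_mono add_mono P) (use xy in auto)
    also have "\<dots> = x powr \<alpha> + (y - x) powr \<alpha>" using D[of x] D[of "y - x"] xy by (simp add: distrib_right)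
    finally show ?thesis .
  qed (use xy in simp)
  have M: "x powr \<alpha> \<le> y powr \<alpha>" if "0 \<le> x" "x \<le> y" for x y :: real using that assms(3) by (intro powr_mono2) auto
  show ?thesis
  proof (cases "a \<le> b")
    case True
    have "\<bar>a powr \<alpha> - b powr \<alpha>\<bar> = b powr \<alpha> - a powr \<alpha>" using M[OF assms(1) True] by simp
    moreover have "\<bar>a - b\<bar> = b - a" using True by simp
    ultimately show ?thesis using L[OF assms(1) True] by simp
  next
    case False
    then have ba: "b \<le> a" by simp
    have "\<bar>a powr \<alpha> - b powr \<alpha>\<bar> = a powr \<alpha> - b powr \<alpha>" using M[OF assms(2) ba] by simp
    moreover have "\<bar>a - b\<bar> = a - b" using ba by simp
    ultimately show ?thesis using L[OF assms(2) ba] by simp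
  qed
qed

lemma holder_continuous:
  fixes f :: "'a::real_normed_vector \<Rightarrow> real"
  assumes "0 < \<alpha>" "\<And>x y. x \<in> A \<Longrightarrow> y \<in> A \<Longrightarrow> \<bar>f x - f y\<bar> \<le> C * norm (x - y) powr \<alpha>" shows "continuous_on A f"
  unfolding continuous_on_def
proof
  fix x assume x: "x \<in> A"
  have "((\<lambda>y. C * norm (y - x) powr \<alpha>) \<longlongrightarrow> C * 0) (at x within A)"
  proof (rule tendsto_mult_left)
    have "((\<lambda>y. norm (y - x)) \<longlongrightarrow> norm (x - x)) (at x within A)" by (intro tendsto_intros)
    then have n: "((\<lambda>y. norm (y - x)) \<longlongrightarrow> 0) (at x within A)" by simp
    show "((\<lambda>y. norm (y - x) powr \<alpha>) \<longlongrightarrow> 0) (at x within A)"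
      using tendsto_powr'[OF n tendsto_const[of \<alpha>]] assms(1) by simp
  qed
  then have l: "((\<lambda>y. C * norm (y - x) powr \<alpha>) \<longlongrightarrow> 0) (at x within A)" by simp
  have "((\<lambda>y. f y - f x) \<longlongrightarrow> 0) (at x within A)"
    by (rule Lim_null_comparison[OF _ l]) (use assms(2)[OF _ x] in \<open>auto simp: eventually_at_filter\<close>)
  then show "(f \<longlongrightarrow> f x) (at x within A)" by (simp add: LIM_zero_iff)
qed

text \<open>Since the set may fail to be convex, two cases are distinguished: close points are joined by a segment in a
  compact neighbourhood where the gradient is bounded, and for distant points the bound on \<open>\<rho>\<close>
  is enough.\<close>
lemma C1_lipschitz:
  fixes \<rho> :: "'a::euclidean_space \<Rightarrow> real"
  assumes U: "open U" and C: "compact C" "C \<subseteq> U" and \<rho>: "Ck_on 1 \<rho> U"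
  obtains L where "0 \<le> L" "\<And>x y. x \<in> C \<Longrightarrow> y \<in> C \<Longrightarrow> \<bar>\<rho> x - \<rho> y\<bar> \<le> L * norm (x - y)"
proof -
  obtain r K where K: "r > 0" "compact K" "K \<subseteq> U" "\<And>x. x \<in> C \<Longrightarrow> cball x r \<subseteq> K"
    using compact_nbhd[OF C(1) U C(2)] by blast
  note \<rho>1 = \<rho>[unfolded One_nat_def]
  have bd: "\<exists>B. \<forall>z\<in>K. \<bar>h z\<bar> \<le> B" if h: "continuous_on U h" for h :: "'a \<Rightarrow> real"
  proof -
    have "compact (h ` K)" by (intro compact_continuous_image K(2) continuous_on_subset[OF h K(3)])
    then have "bounded (h ` K)" by (rule compact_imp_bounded)
    then show ?thesis unfolding bounded_iff by auto
  qed
  have "\<forall>b. \<exists>B. \<forall>z\<in>K. \<bar>dd b \<rho> z\<bar> \<le> B" using bd[OF Ck_cont[OF Ck_dd[OF \<rho>1]]] by blast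
  then obtain B where B: "\<And>b z. z \<in> K \<Longrightarrow> \<bar>dd b \<rho> z\<bar> \<le> B b" by metis
  obtain B0 where B0: "\<And>z. z \<in> K \<Longrightarrow> \<bar>\<rho> z\<bar> \<le> B0" using bd[OF Ck_cont[OF \<rho>1]] by blast
  define S where "S = (\<Sum>b\<in>Basis. \<bar>B b\<bar>)"
  have S0: "0 \<le> S" unfolding S_def by (intro sum_nonneg) simp
  have near: "\<bar>dd v \<rho> z\<bar> \<le> S * norm v" if z: "z \<in> K" for v z
  proof -
    have df: "\<rho> differentiable (at z)" using Ck_diff[OF \<rho>1] z K(3) by blast
    have l: "linear (\<lambda>v. dd v \<rho> z)" using has_derivative_dd[OF df] has_derivative_linear by blast
    have "dd v \<rho> z = dd (\<Sum>b\<in>Basis. (v \<bullet> b) *\<^sub>R b) \<rho> z" by (simp add: euclidean_representation)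
    also have "\<dots> = (\<Sum>b\<in>Basis. (v \<bullet> b) * dd b \<rho> z)"
      using linear_sum[OF l, of "\<lambda>b. (v \<bullet> b) *\<^sub>R b" Basis] linear_scale[OF l] by simp
    also have "\<bar>\<dots>\<bar> \<le> (\<Sum>b\<in>Basis. norm v * \<bar>B b\<bar>)"
    proof (rule order_trans[OF sum_abs], rule sum_mono)
      fix b :: 'a assume b: "b \<in> Basis"
      have "\<bar>dd b \<rho> z\<bar> \<le> \<bar>B b\<bar>" using B[OF z, of b] by linarith
      then show "\<bar>v \<bullet> b * dd b \<rho> z\<bar> \<le> norm v * \<bar>B b\<bar>" unfolding abs_mult using Basis_le_norm[OF b, of v] by (intro mult_mono) auto
    qed
    also have "\<dots> = S * norm v" unfolding S_def sum_distrib_right by (simp add: mult.commute)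
    finally show ?thesis .
  qed
  define L where "L = S + 2 * \<bar>B0\<bar> / r"
  have L0: "0 \<le> L" using S0 K(1) by (simp add: L_def)
  show ?thesis
  proof (rule that[OF L0])
    fix x y assume x: "x \<in> C" and y: "y \<in> C"
    show "\<bar>\<rho> x - \<rho> y\<bar> \<le> L * norm (x - y)"
    proof (cases "norm (x - y) \<le> r")
      case True
      have seg: "x + t *\<^sub>R (y - x) \<in> K" if t: "0 \<le> t" "t \<le> 1" for t
      proof -
        have "norm (t *\<^sub>R (y - x)) \<le> 1 * norm (y - x)" unfolding norm_scaleR using t by (intro mult_right_mono) auto
        then have "x + t *\<^sub>R (y - x) \<in> cball x r" using True by (simp add: dist_norm norm_minus_commute)
        then show ?thesis using K(4)[OF x] by blast
      qed
      have "\<exists>t>0. t < 1 \<and> \<rho> (x + 1 *\<^sub>R (y - x)) - \<rho> (x + 0 *\<^sub>R (y - x)) = (1 - 0) * dd (y - x) \<rho> (x + t *\<^sub>R (y - x))"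
      proof (rule MVT2)
        fix t :: real assume "0 \<le> t" "t \<le> 1"
        then have "x + t *\<^sub>R (y - x) \<in> U" using seg K(3) by blast
        from line_derivative[OF Ck_diff[OF \<rho>1 this]]
        show "((\<lambda>t. \<rho> (x + t *\<^sub>R (y - x))) has_real_derivative dd (y - x) \<rho> (x + t *\<^sub>R (y - x))) (at t)" .
      qed simp
      then obtain t where t: "0 < t" "t < 1" "\<rho> y - \<rho> x = dd (y - x) \<rho> (x + t *\<^sub>R (y - x))" by auto
      have "\<bar>\<rho> x - \<rho> y\<bar> = \<bar>dd (y - x) \<rho> (x + t *\<^sub>R (y - x))\<bar>" unfolding t(3)[symmetric] by simp
      also have "\<dots> \<le> S * norm (y - x)" by (rule near) (use seg t in simp)
      also have "\<dots> \<le> L * norm (y - x)" using K(1) by (intro mult_right_mono) (auto simp: L_def)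
      finally show ?thesis by (simp add: norm_minus_commute)
    next
      case False
      have "x \<in> K" "y \<in> K" using K(4)[OF x] K(4)[OF y] K(1) by auto
      then have "\<bar>\<rho> x - \<rho> y\<bar> \<le> 2 * \<bar>B0\<bar>" using B0[of x] B0[of y] by linarith
      also have "\<dots> = (2 * \<bar>B0\<bar> / r) * r" using K(1) by simp
      also have "\<dots> \<le> L * norm (x - y)" using False S0 K(1) by (intro mult_mono) (auto simp: L_def)
      finally show ?thesis .
    qed
  qed
qed

text \<open>By compactness the quantities \<open>sig k\<close> of the Hessians are bounded on the closure, and the
  hypothesis bounds them below, so \<open>Gm_shift\<close> applies with one \<open>\<delta>\<close>.\<close>
lemma pseudoconvex_shift:
  fixes \<Omega> :: "(complex^'n) set"
  assumes m: "1 \<le> m" "m \<le> CARD('n)" and bd: "bounded \<Omega>" and pc: "strongly_m_pseudoconvex m \<Omega>"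
  obtains \<rho> U \<delta> where "open U" "closure \<Omega> \<subseteq> U" "Ck_on 2 \<rho> U" "\<And>z. z \<in> \<Omega> \<Longrightarrow> \<rho> z < 0" "\<And>z. z \<in> frontier \<Omega> \<Longrightarrow> \<rho> z = 0"
    "0 < \<delta>" "\<And>z. z \<in> closure \<Omega> \<Longrightarrow> hess \<rho> z - \<delta> *\<^sub>R idm \<in> Gm m"
proof -
  obtain \<rho> \<sigma> where \<rho>: "defining_function \<Omega> \<rho>" "\<sigma> > 0" "\<And>k z. k \<in> {1..m} \<Longrightarrow> z \<in> closure \<Omega> \<Longrightarrow>
    top_ge (hessian_form k \<rho> z) (\<lambda>v. of_real \<sigma> * wedge2 (replicate CARD('n) (kaehler z)) v)"
    using pc unfolding strongly_m_pseudoconvex_def by blast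
  obtain U where U: "open U" "closure \<Omega> \<subseteq> U" "Ck_on 2 \<rho> U" using \<rho>(1) unfolding defining_function_def by blast
  obtain c where c: "0 < c" "Qf (replicate CARD('n) (idm :: complex^'n^'n)) = of_real c" using Qf_idm_pos by blast
  have lo: "\<sigma> * c \<le> sig k (hess \<rho> z)" if k: "k \<in> {1..m}" and z: "z \<in> closure \<Omega>" for k z
  proof -
    have zU: "z \<in> U" using z U(2) by blast
    have kC: "k \<le> CARD('n)" using k m(2) by simp
    have "wedge2 (replicate CARD('n) (kaehler z)) std_frame = top_coeff (hessian_form 0 \<rho> z)"
      unfolding top_coeff_def hessian_form_def by simp
    also have "\<dots> = of_real c" unfolding hessian_form_sig[OF U(3,1) zU le0] sig_def by (simp add: c(2))
    finally have "of_real (sig k (hess \<rho> z)) - of_real \<sigma> * complex_of_real c \<in> \<real>\<^sub>\<ge>\<^sub>0"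
      using \<rho>(3)[OF k z] unfolding top_ge_def hessian_form_sig[OF U(3,1) zU kC] unfolding top_coeff_def by simp
    then have "complex_of_real (sig k (hess \<rho> z) - \<sigma> * c) \<in> \<real>\<^sub>\<ge>\<^sub>0" by simp
    then show ?thesis unfolding nonneg_Reals_of_real_iff by simp
  qed
  have cC: "compact (closure \<Omega>)" using bd by (simp add: compact_closure)
  have "\<exists>B. \<forall>z\<in>closure \<Omega>. \<bar>sig k (hess \<rho> z)\<bar> \<le> B" for k
  proof -
    let ?L = "replicate k \<rho> @ replicate (CARD('n) - k) nsq"
    have C: "Ck_on 2 u U" if "u \<in> set ?L" for u using that U(3) Ck_nsq by (auto split: if_splits)
    have "compact (Fs ?L ` closure \<Omega>)"
      by (intro compact_continuous_image cC continuous_on_subset[OF Ck_Fs_cont[OF U(1) C] U(2)])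
    then have "bounded (Fs ?L ` closure \<Omega>)" by (rule compact_imp_bounded)
    then obtain B where B: "\<And>z. z \<in> closure \<Omega> \<Longrightarrow> \<bar>Fs ?L z\<bar> \<le> B" unfolding bounded_iff by auto
    have "sig k (hess \<rho> z) = Fs ?L z" if "z \<in> closure \<Omega>" for z
      using Fs_Re[OF C U(1), of ?L z] that U(2) by (auto simp: sig_def hess_nsq)
    then show ?thesis using B by (intro exI[of _ B]) simp
  qed
  then obtain B where B: "\<And>k z. z \<in> closure \<Omega> \<Longrightarrow> \<bar>sig k (hess \<rho> z)\<bar> \<le> B k" by metis
  define M where "M = (\<Sum>k\<le>m. \<bar>B k\<bar>)"
  have M0: "0 \<le> M" unfolding M_def by (intro sum_nonneg) simp
  have hi: "\<bar>sig k (hess \<rho> z)\<bar> \<le> M" if "z \<in> closure \<Omega>" "k \<le> m" for k z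
  proof -
    have "\<bar>sig k (hess \<rho> z)\<bar> \<le> \<bar>B k\<bar>" using B[OF that(1), of k] by linarith
    also have "\<dots> \<le> M" unfolding M_def by (rule member_le_sum) (use that in auto)
    finally show ?thesis .
  qed
  define \<delta> where "\<delta> = min 1 (\<sigma> * c / (2 ^ m * M + 1))"
  have P: "0 < 2 ^ m * M + 1" using M0 by (intro add_nonneg_pos) auto
  have d: "0 < \<delta>" "\<delta> \<le> 1" using P \<rho>(2) c(1) by (auto simp: \<delta>_def)
  have "\<delta> * (2 ^ m * M) \<le> \<delta> * (2 ^ m * M + 1)" using d by (intro mult_left_mono) auto
  also have "\<dots> \<le> (\<sigma> * c / (2 ^ m * M + 1)) * (2 ^ m * M + 1)" using P by (intro mult_right_mono) (auto simp: \<delta>_def)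
  also have "\<dots> = \<sigma> * c" using P by simp
  finally have d3: "\<delta> * (2 ^ m * M) \<le> \<sigma> * c" .
  have "hess \<rho> z - \<delta> *\<^sub>R idm \<in> Gm m" if z: "z \<in> closure \<Omega>" for z
  proof (rule Gm_shift[OF _ _ _ d d3 m(2)])
    show "ctr (hess \<rho> z) = hess \<rho> z" using ctr_hess[OF U(3,1)] z U(2) by blast
  qed (use lo[OF _ z] hi[OF z] in auto)
  then show ?thesis using that[OF U _ _ d(1)] \<rho>(1) unfolding defining_function_def by blast
qed

lemma hess_shift:
  assumes "\<And>k. Ck_on k u UNIV" shows "hess (\<lambda>y. u (y + c)) z = hess u (z + c)"
proof -
  have d: "u differentiable (at y)" "dd b u differentiable (at y)" for y b
    using Ck_diff[OF assms[of "Suc 0"]] Ck_diff[OF Ck_dd[OF assms[of "Suc (Suc 0)"]]] by auto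
  have 1: "dd b (\<lambda>y. u (y + c)) = (\<lambda>y. dd b u (y + c))" for b using dd_shift(1)[OF d(1)] by (intro HOL.ext)
  have "dd a (dd b (\<lambda>y. u (y + c))) z = dd a (dd b u) (z + c)" for a b unfolding 1 by (rule dd_shift(1)[OF d(2)])
  then show ?thesis unfolding hess_def by simp
qed

lemma neg_powr_deriv:
  fixes t :: real assumes "t < 0"
  shows "((\<lambda>t. c * (- t) powr a) has_real_derivative - c * a * (- t) powr (a - 1)) (at t)"
proof -
  have "((\<lambda>t. (- t) powr a) has_real_derivative (a * (- t) powr (a - 1)) * (- 1)) (at t)"
    by (rule DERIV_chain2[OF has_real_derivative_powr]) (use assms in \<open>auto intro!: derivative_eq_intros\<close>)
  from DERIV_cmult[OF this, of c] show ?thesis by (simp add: mult_ac)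
qed

text \<open>With \<open>g\<close> as below, \<open>b = -(-g)\<^sup>\<alpha>\<close>. The normalisation \<open>\<rho> /
  \<delta> - \<bar>z - \<xi>\<bar>\<^sup>2\<close> makes its Hessian \<open>1 / \<delta>\<close> times a matrix
  in the cone. The Hoelder bound follows from the Lipschitz bound of \<open>g\<close> and the subadditivity of
  \<open>t\<^sup>\<alpha>\<close>.\<close>
lemma barrier_family:
  fixes \<Omega> :: "(complex^'n) set"
  assumes m: "1 \<le> m" "m \<le> CARD('n)" and O: "open \<Omega>" and bd: "bounded \<Omega>" and pc: "strongly_m_pseudoconvex m \<Omega>"
    and \<alpha>: "0 < \<alpha>" "\<alpha> \<le> 1"
  obtains b C where "0 \<le> C" "\<And>\<xi>. \<xi> \<in> closure \<Omega> \<Longrightarrow> msub m \<Omega> (b \<xi>)"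
    "\<And>\<xi> z z'. \<xi> \<in> closure \<Omega> \<Longrightarrow> z \<in> closure \<Omega> \<Longrightarrow> z' \<in> closure \<Omega> \<Longrightarrow> \<bar>b \<xi> z - b \<xi> z'\<bar> \<le> C * norm (z - z') powr \<alpha>"
    "\<And>\<xi> z. z \<in> frontier \<Omega> \<Longrightarrow> b \<xi> z = - (norm (z - \<xi>) powr (2 * \<alpha>))"
proof -
  obtain U \<rho> \<delta> where U: "open U" "closure \<Omega> \<subseteq> U" "Ck_on 2 \<rho> U" and neg: "\<And>z. z \<in> \<Omega> \<Longrightarrow> \<rho> z < 0" and zero: "\<And>z. z \<in> frontier \<Omega> \<Longrightarrow> \<rho> z = 0"
    and d: "0 < \<delta>" "\<And>z. z \<in> closure \<Omega> \<Longrightarrow> hess \<rho> z - \<delta> *\<^sub>R idm \<in> Gm m"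
    by (rule pseudoconvex_shift[OF m bd pc], rule that)
  have cC: "compact (closure \<Omega>)" using bd by (simp add: compact_closure)
  have "Ck_on 1 \<rho> U" using U(3) by (rule Ck_le) simp
  then obtain L where L: "0 \<le> L" "\<And>x y. x \<in> closure \<Omega> \<Longrightarrow> y \<in> closure \<Omega> \<Longrightarrow> \<bar>\<rho> x - \<rho> y\<bar> \<le> L * norm (x - y)"
    using C1_lipschitz[OF U(1) cC U(2)] by blast
  obtain R where R: "\<And>z. z \<in> closure \<Omega> \<Longrightarrow> norm z \<le> R" using compact_imp_bounded[OF cC] unfolding bounded_iff by blast
  define g where "g \<xi> z = (1 / \<delta>) * \<rho> z + (-1) * nsq (z + - \<xi>)" for \<xi> z
  define b where "b \<xi> z = (-1) * (- g \<xi> z) powr \<alpha>" for \<xi> z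
  define C0 where "C0 = L / \<delta> + 4 * \<bar>R\<bar>"
  have C00: "0 \<le> C0" using L(1) d(1) by (simp add: C0_def)
  have nn: "nsq (z + - \<xi>) = (norm (z - \<xi>))\<^sup>2" for z \<xi> :: "complex^'n" by (simp add: nsq_def)
  have \<Omega>cl: "z \<in> \<Omega> \<or> z \<in> frontier \<Omega>" if "z \<in> closure \<Omega>" for z using that O by (auto simp: frontier_def interior_open)
  have rho0: "\<rho> z \<le> 0" if "z \<in> closure \<Omega>" for z using \<Omega>cl[OF that] neg zero by fastforce
  have gneg: "g \<xi> z \<le> 0" if "z \<in> closure \<Omega>" for \<xi> z
  proof -
    have "(1 / \<delta>) * \<rho> z \<le> 0" using rho0[OF that] d(1) by (simp add: mult_nonneg_nonpos divide_nonpos_pos)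
    then show ?thesis unfolding g_def nn using zero_le_power2[of "norm (z - \<xi>)"] by linarith
  qed
  have gneg': "g \<xi> z < 0" if "z \<in> \<Omega>" for \<xi> z
  proof -
    have "(1 / \<delta>) * \<rho> z < 0" using neg[OF that] d(1) by (simp add: divide_neg_pos)
    then show ?thesis unfolding g_def nn using zero_le_power2[of "norm (z - \<xi>)"] by linarith
  qed
  have glip: "\<bar>g \<xi> z - g \<xi> z'\<bar> \<le> C0 * norm (z - z')" if xz: "\<xi> \<in> closure \<Omega>" "z \<in> closure \<Omega>" "z' \<in> closure \<Omega>" for \<xi> z z'
  proof -
    have e1: "\<bar>(1 / \<delta>) * \<rho> z - (1 / \<delta>) * \<rho> z'\<bar> \<le> (L / \<delta>) * norm (z - z')"
    proof -
      have "\<bar>(1 / \<delta>) * \<rho> z - (1 / \<delta>) * \<rho> z'\<bar> = (1 / \<delta>) * \<bar>\<rho> z - \<rho> z'\<bar>"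
        unfolding right_diff_distrib[symmetric] abs_mult using d(1) by simp
      also have "\<dots> \<le> (1 / \<delta>) * (L * norm (z - z'))" using d(1) by (intro mult_left_mono L(2) xz) auto
      finally show ?thesis by simp
    qed
    have e2: "\<bar>(norm (z - \<xi>))\<^sup>2 - (norm (z' - \<xi>))\<^sup>2\<bar> \<le> 4 * \<bar>R\<bar> * norm (z - z')"
    proof -
      have n: "norm (y - \<xi>) \<le> 2 * \<bar>R\<bar>" if "y \<in> closure \<Omega>" for y
        using norm_triangle_ineq4[of y \<xi>] R[OF that] R[OF xz(1)] by linarith
      have "\<bar>(norm (z - \<xi>))\<^sup>2 - (norm (z' - \<xi>))\<^sup>2\<bar> = \<bar>norm (z - \<xi>) - norm (z' - \<xi>)\<bar> * \<bar>norm (z - \<xi>) + norm (z' - \<xi>)\<bar>"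
        unfolding abs_mult[symmetric] by (simp add: power2_eq_square algebra_simps)
      also have "\<dots> \<le> norm (z - z') * (4 * \<bar>R\<bar>)"
      proof (rule mult_mono)
        show "\<bar>norm (z - \<xi>) - norm (z' - \<xi>)\<bar> \<le> norm (z - z')" using norm_triangle_ineq3[of "z - \<xi>" "z' - \<xi>"] by simp
        have "0 \<le> norm (z - \<xi>) + norm (z' - \<xi>)" by simp
        then show "\<bar>norm (z - \<xi>) + norm (z' - \<xi>)\<bar> \<le> 4 * \<bar>R\<bar>" using n[OF xz(2)] n[OF xz(3)] by linarith
      qed auto
      finally show ?thesis by (simp add: mult.commute)
    qed
    have "\<bar>g \<xi> z - g \<xi> z'\<bar> \<le> \<bar>(1 / \<delta>) * \<rho> z - (1 / \<delta>) * \<rho> z'\<bar> + \<bar>(norm (z - \<xi>))\<^sup>2 - (norm (z' - \<xi>))\<^sup>2\<bar>"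
      unfolding g_def nn by linarith
    also have "\<dots> \<le> C0 * norm (z - z')" using e1 e2 by (simp add: C0_def distrib_right)
    finally show ?thesis .
  qed
  show ?thesis
  proof (rule that[of "C0 powr \<alpha>" b])
    show "0 \<le> C0 powr \<alpha>" by simp
    show "\<bar>b \<xi> z - b \<xi> z'\<bar> \<le> C0 powr \<alpha> * norm (z - z') powr \<alpha>" if xz: "\<xi> \<in> closure \<Omega>" "z \<in> closure \<Omega>" "z' \<in> closure \<Omega>" for \<xi> z z'
    proof -
      have "\<bar>b \<xi> z - b \<xi> z'\<bar> = \<bar>(- g \<xi> z) powr \<alpha> - (- g \<xi> z') powr \<alpha>\<bar>" unfolding b_def by simp
      also have "\<dots> \<le> \<bar>- g \<xi> z - - g \<xi> z'\<bar> powr \<alpha>" by (rule powr_subadd) (use gneg xz \<alpha> in auto)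
      also have "\<dots> = \<bar>g \<xi> z - g \<xi> z'\<bar> powr \<alpha>" by (simp add: abs_minus_commute)
      also have "\<dots> \<le> (C0 * norm (z - z')) powr \<alpha>" using glip[OF xz] \<alpha> by (intro powr_mono2) auto
      also have "\<dots> = C0 powr \<alpha> * norm (z - z') powr \<alpha>" using C00 by (simp add: powr_mult)
      finally show ?thesis .
    qed
    show "b \<xi> z = - (norm (z - \<xi>) powr (2 * \<alpha>))" if "z \<in> frontier \<Omega>" for \<xi> z
    proof -
      have "- g \<xi> z = (norm (z - \<xi>))\<^sup>2" unfolding g_def nn zero[OF that] by simp
      moreover have "(norm (z - \<xi>))\<^sup>2 powr \<alpha> = norm (z - \<xi>) powr (2 * \<alpha>)"
        by (cases "z = \<xi>") (simp_all add: powr_powr[symmetric] powr_numeral)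
      ultimately show ?thesis unfolding b_def by simp
    qed
    show "msub m \<Omega> (b \<xi>)" if "\<xi> \<in> closure \<Omega>" for \<xi>
    proof -
      have \<rho>2: "Ck_on 2 \<rho> \<Omega>" using Ck_subset[OF U(3)] U(2) closure_subset by blast
      have s2: "Ck_on k (\<lambda>z. nsq (z + - \<xi>)) S" for k S by (rule Ck_subset[OF Ck_shift[OF Ck_nsq] subset_UNIV])
      have g2: "Ck_on 2 (g \<xi>) \<Omega>" unfolding g_def by (intro Ck_add Ck_cmult O \<rho>2 s2)
      have gI: "g \<xi> ` \<Omega> \<subseteq> {..<0}" using gneg' by auto
      define F1 where "F1 t = \<alpha> * (- t) powr (\<alpha> - 1)" for t :: real
      define F2 where "F2 t = - \<alpha> * (\<alpha> - 1) * (- t) powr (\<alpha> - 1 - 1)" for t :: real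
      have D1: "((\<lambda>t. (-1) * (- t) powr \<alpha>) has_real_derivative F1 t) (at t)" if "t \<in> {..<0}" for t
        using neg_powr_deriv[of t "-1" \<alpha>] that by (simp add: F1_def)
      have D2: "(F1 has_real_derivative F2 t) (at t)" if "t \<in> {..<0}" for t
        using neg_powr_deriv[of t \<alpha> "\<alpha> - 1"] that by (simp add: F1_def[abs_def] F2_def)
      have cF2: "continuous_on {..<0} F2" unfolding F2_def by (intro continuous_intros) auto
      show ?thesis
      proof (rule C2_msub[OF O m])
        show "Ck_on 2 (b \<xi>) \<Omega>" unfolding b_def[abs_def] by (rule Ck2_comp[OF O g2 gI cF2 D1 D2])
        fix z and As :: "(complex^'n^'n) list" assume z: "z \<in> \<Omega>" and A: "As \<in> Adm m"
        have hb: "hess (b \<xi>) z = F1 (g \<xi> z) *\<^sub>R hess (g \<xi>) z + F2 (g \<xi> z) *\<^sub>R rk1 (gvec (g \<xi>) z)"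
          unfolding b_def[abs_def] by (rule hess_comp[OF O z g2 gI D1 D2])
        have hg: "hess (g \<xi>) z = (1 / \<delta>) *\<^sub>R hess \<rho> z + (-1) *\<^sub>R hess (\<lambda>z. nsq (z + - \<xi>)) z"
          unfolding g_def[abs_def] by (rule hess_lin[OF \<rho>2 s2 O z])
        have hs: "hess (\<lambda>z. nsq (z + - \<xi>)) z = idm" using hess_shift[OF Ck_nsq, of "- \<xi>" z] hess_nsq by simp
        have "0 \<le> LQ As (1 *\<^sub>R hess \<rho> z + (- \<delta>) *\<^sub>R idm)"
          using LQ_nonneg[OF m A d(2)[of z]] z closure_subset by auto
        then have p: "0 \<le> LQ As (hess \<rho> z) - \<delta> * LQ As idm" unfolding LQ_lin by simp
        have "LQ As (hess (g \<xi>) z) = (1 / \<delta>) * (LQ As (hess \<rho> z) - \<delta> * LQ As idm)"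
          unfolding hg hs LQ_lin using d(1) by (simp add: field_simps)
        then have q: "0 \<le> LQ As (hess (g \<xi>) z)" using p d(1) by simp
        have al2: "0 \<le> - \<alpha> * (\<alpha> - 1)" using \<alpha> mult_nonneg_nonneg[of \<alpha> "1 - \<alpha>"] by (simp add: algebra_simps)
        have f: "0 \<le> F1 (g \<xi> z)" "0 \<le> F2 (g \<xi> z)"
          unfolding F1_def F2_def by (rule mult_nonneg_nonneg[OF less_imp_le[OF \<alpha>(1)]], simp, rule mult_nonneg_nonneg[OF al2], simp)
        show "0 \<le> LQ As (hess (b \<xi>) z)"
          unfolding hb LQ_lin by (intro add_nonneg_nonneg mult_nonneg_nonneg f q LQ_rk1[OF m A])
      qed
    qed
  qed
qed

section \<open>The envelope\<close>

lemma msub_const: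
  assumes "open S" "1 \<le> m" "m \<le> CARD('n)" shows "msub m S (\<lambda>_ :: complex^'n. c)"
proof (rule C2_msub[OF assms Ck_const])
  fix z :: "complex^'n" and As :: "(complex^'n^'n) list"
  have "hess (\<lambda>_ :: complex^'n. c) z = 0" by (simp add: hess_def hm_def cvec_eq_iff)
  then show "0 \<le> LQ As (hess (\<lambda>_. c) z)" using LQ_scale[of As 0 0] by simp
qed

theorem theorem3p7:
  fixes \<Omega> :: "(complex^'n) set" and \<phi> :: "complex^'n \<Rightarrow> real" and m :: nat and \<alpha> :: real
  assumes "1 < m" and "m < CARD('n)"
    and "open \<Omega>" and "connected \<Omega>" and "\<Omega> \<noteq> {}" and "bounded \<Omega>"
    and "strongly_m_pseudoconvex m \<Omega>"
    and "0 < \<alpha>" and "\<alpha> \<le> 1 / 2"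
    and "\<phi> \<in> Lip (2 * \<alpha>) (closure \<Omega>)"
  shows "envelope m \<Omega> \<phi> \<in> SH m \<Omega> \<and>
         (\<forall>z\<in>closure \<Omega>. \<bar>envelope m \<Omega> \<phi> z\<bar> \<noteq> \<infinity>) \<and>
         (\<lambda>z. real_of_ereal (envelope m \<Omega> \<phi> z)) \<in> Lip \<alpha> (closure \<Omega>)"
proof -
  have m: "1 \<le> m" "m \<le> CARD('n)" using assms(1,2) by auto
  note O = assms(3) and bd = assms(6)
  have al: "0 < \<alpha>" "\<alpha> \<le> 1" using assms(8,9) by auto
  let ?cl = "closure \<Omega>"
  have Ocl: "z \<in> ?cl" if "z \<in> \<Omega>" for z using that closure_subset by blast
  have fcl: "z \<in> ?cl" if "z \<in> frontier \<Omega>" for z using that by (simp add: frontier_def)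
  have cC: "compact ?cl" using bd by (simp add: compact_closure)
  obtain M where M: "0 \<le> M" "\<And>z w. z \<in> ?cl \<Longrightarrow> w \<in> ?cl \<Longrightarrow> \<bar>\<phi> z - \<phi> w\<bar> \<le> M * norm (z - w) powr (2 * \<alpha>)"
  proof -
    let ?I = "{(z, w). z \<in> ?cl \<and> w \<in> ?cl \<and> z \<noteq> w}" and ?q = "\<lambda>(z, w). ennreal (\<bar>\<phi> z - \<phi> w\<bar> / norm (z - w) powr (2 * \<alpha>))"
    have "lip_norm (2 * \<alpha>) ?cl \<phi> < \<infinity>" using assms(10) unfolding Lip_def by blast
    moreover have "(SUP p\<in>?I. ?q p) \<le> lip_norm (2 * \<alpha>) ?cl \<phi>" unfolding lip_norm_def by simp
    ultimately have f: "(SUP p\<in>?I. ?q p) < \<infinity>" by (rule le_less_trans[rotated])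
    define M where "M = enn2real (SUP p\<in>?I. ?q p)"
    have eM: "ennreal M = (SUP p\<in>?I. ?q p)" unfolding M_def using f by (simp add: less_top)
    show ?thesis
    proof (rule that[of M])
      show M0: "0 \<le> M" unfolding M_def by simp
      show "\<bar>\<phi> z - \<phi> w\<bar> \<le> M * norm (z - w) powr (2 * \<alpha>)" if zw: "z \<in> ?cl" "w \<in> ?cl" for z w
      proof (cases "z = w")
        case False
        have "?q (z, w) \<le> ennreal M" unfolding eM by (rule SUP_upper) (use zw False in auto)
        then have "\<bar>\<phi> z - \<phi> w\<bar> / norm (z - w) powr (2 * \<alpha>) \<le> M" using M0 by (simp add: ennreal_le_iff)
        moreover have "0 < norm (z - w) powr (2 * \<alpha>)" using False by simp
        ultimately show ?thesis by (simp add: pos_divide_le_eq)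
      qed (use M0 in simp)
    qed
  qed
  obtain C b where b: "0 \<le> C" "\<And>\<xi>. \<xi> \<in> ?cl \<Longrightarrow> msub m \<Omega> (b \<xi>)"
    "\<And>\<xi> z z'. \<xi> \<in> ?cl \<Longrightarrow> z \<in> ?cl \<Longrightarrow> z' \<in> ?cl \<Longrightarrow> \<bar>b \<xi> z - b \<xi> z'\<bar> \<le> C * norm (z - z') powr \<alpha>"
    "\<And>\<xi> z. z \<in> frontier \<Omega> \<Longrightarrow> b \<xi> z = - (norm (z - \<xi>) powr (2 * \<alpha>))"
    by (rule barrier_family[OF m O bd assms(7) al], rule that)
  have bself: "b \<xi> \<xi> = 0" if "\<xi> \<in> frontier \<Omega>" for \<xi> using b(4)[OF that, of \<xi>] by simp
  define C1 where "C1 = M * C"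
  have C10: "0 \<le> C1" using M(1) b(1) by (simp add: C1_def)
  have Mb: "\<bar>M * b \<xi> z - M * b \<xi> z'\<bar> \<le> C1 * norm (z - z') powr \<alpha>" if x: "\<xi> \<in> ?cl" "z \<in> ?cl" "z' \<in> ?cl" for \<xi> z z'
  proof -
    have "\<bar>M * b \<xi> z - M * b \<xi> z'\<bar> = M * \<bar>b \<xi> z - b \<xi> z'\<bar>" unfolding right_diff_distrib[symmetric] abs_mult using M(1) by simp
    also have "\<dots> \<le> M * (C * norm (z - z') powr \<alpha>)" by (intro mult_left_mono b(3) x M(1))
    finally show ?thesis by (simp add: C1_def mult.assoc)
  qed
  have bc: "continuous_on ?cl (b \<xi>)" if "\<xi> \<in> ?cl" for \<xi> by (rule holder_continuous[OF al(1)]) (rule b(3)[OF that])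
  \<comment> \<open>The competitors, in terms of weak positivity against constant coefficients.\<close>
  define FF where "FF = {v. msub m \<Omega> v \<and> continuous_on ?cl v \<and> (\<forall>x\<in>frontier \<Omega>. v x \<le> \<phi> x)}"
  have FFD: "msub m \<Omega> v" "continuous_on ?cl v" "\<And>x. x \<in> frontier \<Omega> \<Longrightarrow> v x \<le> \<phi> x" if "v \<in> FF" for v
    using that unfolding FF_def by auto
  have FFmax: "(\<lambda>x. max (v x) (w x)) \<in> FF" if vw: "v \<in> FF" "w \<in> FF" for v w
    unfolding FF_def using msub_max[OF O m FFD(1)[OF vw(1)] FFD(1)[OF vw(2)]] FFD(2,3)[OF vw(1)] FFD(2,3)[OF vw(2)]
    by (auto intro!: continuous_intros)
  \<comment> \<open>Lower barriers: competitors that attain \<open>\<phi>\<close> at \<open>\<xi>\<close>. Their reflections are upper bounds for all competitors.\<close>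
  define vv where "vv \<xi> z = \<phi> \<xi> + M * b \<xi> z" for \<xi> z
  have vvF: "vv \<xi> \<in> FF" if x: "\<xi> \<in> frontier \<Omega>" for \<xi>
  proof -
    have "msub m \<Omega> (vv \<xi>)" unfolding vv_def[abs_def]
      by (rule msub_add_pos[OF O m msub_const[OF O m] b(2)[OF fcl[OF x]] M(1)])
    moreover have "continuous_on ?cl (vv \<xi>)" unfolding vv_def[abs_def] by (intro continuous_intros bc fcl x)
    moreover have "vv \<xi> z \<le> \<phi> z" if z: "z \<in> frontier \<Omega>" for z
      using M(2)[OF fcl[OF z] fcl[OF x]] b(4)[OF z, of \<xi>] unfolding vv_def by (simp add: abs_le_iff)
    ultimately show ?thesis unfolding FF_def by blast
  qed
  have UB: "v z \<le> \<phi> \<xi> - M * b \<xi> z" if v: "v \<in> FF" and x: "\<xi> \<in> frontier \<Omega>" and z: "z \<in> ?cl" for v \<xi> z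
  proof -
    let ?f = "\<lambda>z. (v z + M * b \<xi> z) + 1 * (- \<phi> \<xi>)"
    have ms: "msub m \<Omega> ?f"
      by (rule msub_add_pos[OF O m msub_add_pos[OF O m FFD(1)[OF v] b(2)[OF fcl[OF x]] M(1)] msub_const[OF O m]]) simp
    have "?f z \<le> 0"
    proof (rule max_principle[OF O bd _ _ _ z])
      show "continuous_on ?cl ?f" by (intro continuous_intros FFD(2)[OF v] bc fcl x)
      show "?f y \<le> 0" if y: "y \<in> frontier \<Omega>" for y
        using M(2)[OF fcl[OF y] fcl[OF x]] b(4)[OF y, of \<xi>] FFD(3)[OF v y] by (simp add: abs_le_iff)
    qed (rule msub_submean[OF O m ms])
    then show ?thesis by simp
  qed
  have "\<Omega> \<noteq> UNIV" using bd not_bounded_UNIV by metis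
  then have "frontier \<Omega> \<noteq> {}" using frontier_not_empty[OF assms(5)] by blast
  then obtain \<xi>0 where x0: "\<xi>0 \<in> frontier \<Omega>" by blast
  define H where "H z = (SUP v\<in>FF. v z)" for z
  have bddF: "bdd_above ((\<lambda>v. v z) ` FF)" if "z \<in> ?cl" for z
    by (rule bdd_aboveI2[where M = "\<phi> \<xi>0 - M * b \<xi>0 z"]) (rule UB[OF _ x0 that])
  have leH: "v z \<le> H z" if "v \<in> FF" "z \<in> ?cl" for v z unfolding H_def by (rule cSUP_upper[OF that(1) bddF[OF that(2)]])
  have Hle: "H z \<le> c" if "\<And>v. v \<in> FF \<Longrightarrow> v z \<le> c" for z c unfolding H_def by (rule cSUP_least) (use vvF[OF x0] that in auto)
  have Hap: "\<exists>v\<in>FF. H z - e < v z" if "z \<in> ?cl" "0 < e" for z e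
  proof (rule ccontr)
    assume "\<not> ?thesis"
    then have "H z \<le> H z - e" by (intro Hle) force
    then show False using that(2) by simp
  qed

  \<comment> \<open>The supremum of the lower barriers is a competitor that attains \<open>\<phi>\<close> on the whole boundary.\<close>
  define V where "V z = (SUP \<xi>\<in>frontier \<Omega>. vv \<xi> z)" for z
  have bddV: "bdd_above ((\<lambda>\<xi>. vv \<xi> z) ` frontier \<Omega>)" if "z \<in> ?cl" for z
    by (rule bdd_aboveI2[where M = "\<phi> \<xi>0 - M * b \<xi>0 z"]) (rule UB[OF vvF x0 that])
  have leV: "vv \<xi> z \<le> V z" if "\<xi> \<in> frontier \<Omega>" "z \<in> ?cl" for \<xi> z unfolding V_def by (rule cSUP_upper[OF that(1) bddV[OF that(2)]])
  have Vle: "V z \<le> c" if "\<And>\<xi>. \<xi> \<in> frontier \<Omega> \<Longrightarrow> vv \<xi> z \<le> c" for z c unfolding V_def by (rule cSUP_least) (use x0 that in auto)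
  have VH: "V z \<le> V z' + C1 * norm (z - z') powr \<alpha>" if z: "z \<in> ?cl" "z' \<in> ?cl" for z z'
  proof (rule Vle)
    fix \<xi> assume x: "\<xi> \<in> frontier \<Omega>"
    have "vv \<xi> z \<le> vv \<xi> z' + C1 * norm (z - z') powr \<alpha>" unfolding vv_def using Mb[OF fcl[OF x] z] by (simp add: abs_le_iff)
    then show "vv \<xi> z \<le> V z' + C1 * norm (z - z') powr \<alpha>" using leV[OF x z(2)] by linarith
  qed
  have VH': "\<bar>V z - V z'\<bar> \<le> C1 * norm (z - z') powr \<alpha>" if z: "z \<in> ?cl" "z' \<in> ?cl" for z z'
    using VH[OF z] VH[OF z(2,1)] by (simp add: abs_le_iff norm_minus_commute)
  have Vc: "continuous_on ?cl V" by (rule holder_continuous[OF al(1) VH'])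
  have Vfr: "V z = \<phi> z" if z: "z \<in> frontier \<Omega>" for z
  proof (rule antisym)
    show "V z \<le> \<phi> z" by (rule Vle) (rule FFD(3)[OF vvF z])
    show "\<phi> z \<le> V z" using leV[OF z fcl[OF z]] bself[OF z] by (simp add: vv_def)
  qed
  have Vm: "msub m \<Omega> V"
  proof (rule msub_sup[OF O m continuous_on_subset[OF Vc closure_subset], where \<G> = "{g \<in> FF. \<forall>z\<in>?cl. g z \<le> V z}" and ?g0.0 = "vv \<xi>0"])
    show "vv \<xi>0 \<in> {g \<in> FF. \<forall>z\<in>?cl. g z \<le> V z}" using vvF leV x0 by blast
    show "msub m \<Omega> g" if "g \<in> {g \<in> FF. \<forall>z\<in>?cl. g z \<le> V z}" for g using FFD(1) that by blast
    show "(\<lambda>x. max (f x) (g x)) \<in> {g \<in> FF. \<forall>z\<in>?cl. g z \<le> V z}"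
      if "f \<in> {g \<in> FF. \<forall>z\<in>?cl. g z \<le> V z}" "g \<in> {g \<in> FF. \<forall>z\<in>?cl. g z \<le> V z}" for f g using that FFmax by simp
    show "g x \<le> V x" if "g \<in> {g \<in> FF. \<forall>z\<in>?cl. g z \<le> V z}" "x \<in> \<Omega>" for g x using that Ocl by blast
    show "\<exists>g\<in>{g \<in> FF. \<forall>z\<in>?cl. g z \<le> V z}. V x - e < g x" if xe: "x \<in> \<Omega>" "0 < e" for x e
    proof (rule ccontr)
      assume n: "\<not> ?thesis"
      have "V x \<le> V x - e"
      proof (rule Vle)
        fix \<xi> assume "\<xi> \<in> frontier \<Omega>"
        then have "vv \<xi> \<in> {g \<in> FF. \<forall>z\<in>?cl. g z \<le> V z}" using vvF leV by blast
        then show "vv \<xi> x \<le> V x - e" using n by force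
      qed
      then show False using xe(2) by simp
    qed
  qed
  have VF: "V \<in> FF" unfolding FF_def using Vm Vc Vfr by simp
  \<comment> \<open>Walsh's translation argument.\<close>
  have key: "v (z + \<tau>) - c \<le> H z"
    if v: "v \<in> FF" and z: "z \<in> ?cl" "z + \<tau> \<in> ?cl" and c: "C1 * norm \<tau> powr \<alpha> < c" for v z \<tau> c
  proof -
    define A where "A = {y \<in> ?cl. y + \<tau> \<in> ?cl}"
    define w where "w y = (if y \<in> A then max (v (y + \<tau>) + - c) (V y) else V y)" for y
    have cnt: "continuous_on UNIV (\<lambda>y. y + \<tau>)" by (intro continuous_intros)
    have vA: "continuous_on A (\<lambda>y. v (y + \<tau>))"
      by (rule continuous_on_compose2[OF FFD(2)[OF v]]) (auto simp: A_def intro!: continuous_intros)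
    have VA: "continuous_on A V" by (rule continuous_on_subset[OF Vc]) (auto simp: A_def)
    \<comment> \<open>The strict inequality makes \<open>w = V\<close> near the points where the translate stops being defined, so that gluing is local.\<close>
    have small: "v (y + \<tau>) - c < V y" if y: "y \<in> ?cl" "y + \<tau> \<in> frontier \<Omega>" for y
    proof -
      have "v (y + \<tau>) \<le> V (y + \<tau>)" using FFD(3)[OF v y(2)] Vfr[OF y(2)] by simp
      also have "\<dots> \<le> V y + C1 * norm \<tau> powr \<alpha>" using VH[OF fcl[OF y(2)] y(1)] by simp
      finally show ?thesis using c by linarith
    qed
    have "w \<in> FF" unfolding FF_def mem_Collect_eq
    proof (intro conjI ballI)
      have clA: "closed A"
      proof -
        have "closed ((\<lambda>y. y + \<tau>) -` ?cl)" by (intro closed_vimage closed_closure continuous_intros)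
        then have "closed (?cl \<inter> (\<lambda>y. y + \<tau>) -` ?cl)" by (intro closed_Int closed_closure)
        moreover have "?cl \<inter> (\<lambda>y. y + \<tau>) -` ?cl = A" by (auto simp: A_def)
        ultimately show ?thesis by simp
      qed
      define B where "B = ?cl \<inter> (\<lambda>y. y + \<tau>) -` (- \<Omega>)"
      have clB: "closed B" unfolding B_def using O by (intro closed_Int closed_closure closed_vimage continuous_intros) auto
      have AB: "A \<union> B = ?cl" using Ocl by (auto simp: A_def B_def)
      have "continuous_on (A \<union> B) w" unfolding w_def
      proof (rule continuous_on_cases[OF clA clB])
        show "continuous_on A (\<lambda>y. max (v (y + \<tau>) + - c) (V y))" by (intro continuous_intros vA VA)
        show "continuous_on B V" by (rule continuous_on_subset[OF Vc]) (auto simp: B_def)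
        show "\<forall>x. x \<in> A \<and> x \<notin> A \<or> x \<in> B \<and> x \<in> A \<longrightarrow> max (v (x + \<tau>) + - c) (V x) = V x"
        proof (intro allI impI)
          fix x assume "x \<in> A \<and> x \<notin> A \<or> x \<in> B \<and> x \<in> A"
          then have "x \<in> ?cl" "x + \<tau> \<in> frontier \<Omega>" using O by (auto simp: A_def B_def frontier_def interior_open)
          from small[OF this] show "max (v (x + \<tau>) + - c) (V x) = V x" by simp
        qed
      qed
      then show wc: "continuous_on ?cl w" unfolding AB .
      show "msub m \<Omega> w"
      proof (rule msub_local[OF continuous_on_subset[OF wc closure_subset]])
        fix x assume x: "x \<in> \<Omega>"
        obtain r0 where r0: "0 < r0" "ball x r0 \<subseteq> \<Omega>" using O x open_contains_ball by blast
        have Vb: "msub m (ball x r) V" if "r \<le> r0" for r by (rule msub_mono[OF Vm]) (use r0(2) that in \<open>auto simp: subset_iff\<close>)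
        have loc: "\<exists>r>0. msub m (ball x r) w" if d: "0 < d" "\<And>y. y \<in> ball x d \<Longrightarrow> y \<in> A \<Longrightarrow> v (y + \<tau>) - c \<le> V y" for d
        proof (intro exI[of _ "min d r0"] conjI)
          show "0 < min d r0" using d r0 by simp
          show "msub m (ball x (min d r0)) w"
            by (rule msub_cong[OF open_ball m _ Vb]) (use d(2) in \<open>auto simp: w_def\<close>)
        qed
        consider "x + \<tau> \<in> \<Omega>" | "x + \<tau> \<notin> ?cl" | "x + \<tau> \<in> frontier \<Omega>" using O by (auto simp: frontier_def interior_open)
        then show "\<exists>r>0. msub m (ball x r) w"
        proof cases
          case 1
          have "open ((\<lambda>y. y + \<tau>) -` \<Omega>)" by (intro open_vimage O continuous_intros)
          moreover have "x \<in> (\<lambda>y. y + \<tau>) -` \<Omega>" using 1 by simp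
          ultimately obtain r1 where r1: "0 < r1" "ball x r1 \<subseteq> (\<lambda>y. y + \<tau>) -` \<Omega>" using open_contains_ball by blast
          let ?B = "ball x (min r0 r1)"
          have sub: "?B \<subseteq> {y. y + \<tau> \<in> \<Omega>}" "?B \<subseteq> \<Omega>" using r1(2) r0(2) by (auto simp: subset_iff)
          have t: "msub m ?B (\<lambda>y. v (y + \<tau>))" by (rule msub_mono[OF msub_translate[OF O m FFD(1)[OF v]] sub(1)])
          have t2: "msub m ?B (\<lambda>y. v (y + \<tau>) + 1 * (- c))" by (rule msub_add_pos[OF open_ball m t msub_const[OF open_ball m]]) simp
          have t3: "msub m ?B (\<lambda>y. max (v (y + \<tau>) + 1 * (- c)) (V y))" by (rule msub_max[OF open_ball m t2 Vb]) simp
          have "msub m ?B w"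
          proof (rule msub_cong[OF open_ball m _ t3])
            fix y assume "y \<in> ?B"
            then have "y \<in> A" using sub Ocl unfolding A_def by blast
            then show "max (v (y + \<tau>) + 1 * (- c)) (V y) = w y" by (simp add: w_def)
          qed
          then show ?thesis using r0(1) r1(1) by (intro exI[of _ "min r0 r1"]) simp
        next
          case 2
          have "open ((\<lambda>y. y + \<tau>) -` (- ?cl))" by (intro open_vimage continuous_intros) auto
          moreover have "x \<in> (\<lambda>y. y + \<tau>) -` (- ?cl)" using 2 by simp
          ultimately obtain r1 where r1: "0 < r1" "ball x r1 \<subseteq> (\<lambda>y. y + \<tau>) -` (- ?cl)" using open_contains_ball by blast
          show ?thesis by (rule loc[OF r1(1)]) (use r1(2) in \<open>auto simp: A_def\<close>)
        next
          case 3
          have xA: "x \<in> A" using Ocl[OF x] fcl[OF 3] by (simp add: A_def)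
          have "continuous_on A (\<lambda>y. v (y + \<tau>) - c - V y)" by (intro continuous_intros vA VA)
          then have "((\<lambda>y. v (y + \<tau>) - c - V y) \<longlongrightarrow> v (x + \<tau>) - c - V x) (at x within A)" using xA by (simp add: continuous_on_def)
          moreover have "v (x + \<tau>) - c - V x < 0" using small[OF Ocl[OF x] 3] by simp
          ultimately have "\<forall>\<^sub>F y in at x within A. v (y + \<tau>) - c - V y < 0" by (rule order_tendstoD(2))
          then obtain d where d: "0 < d" "\<forall>y\<in>A. y \<noteq> x \<and> dist y x < d \<longrightarrow> v (y + \<tau>) - c - V y < 0" unfolding eventually_at by blast
          show ?thesis
          proof (rule loc[OF d(1)])
            fix y assume y: "y \<in> ball x d" "y \<in> A"
            show "v (y + \<tau>) - c \<le> V y"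
            proof (cases "y = x")
              case True then show ?thesis using small[OF Ocl[OF x] 3] by simp
            next
              case False
              then have "v (y + \<tau>) - c - V y < 0" using d(2) y by (simp add: dist_commute)
              then show ?thesis by simp
            qed
          qed
        qed
      qed
      fix x assume x: "x \<in> frontier \<Omega>"
      have "v (x + \<tau>) + - c \<le> \<phi> x" if xA: "x \<in> A"
      proof -
        have xt: "x + \<tau> \<in> ?cl" using xA by (simp add: A_def)
        have "v (x + \<tau>) \<le> \<phi> x - M * b x (x + \<tau>)" by (rule UB[OF v x xt])
        moreover have "- (M * b x (x + \<tau>)) \<le> C1 * norm \<tau> powr \<alpha>"
          using Mb[OF fcl[OF x] fcl[OF x] xt] bself[OF x] by (simp add: abs_le_iff)
        ultimately show ?thesis using c by linarith
      qed
      then show "w x \<le> \<phi> x" using Vfr[OF x] by (simp add: w_def)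
    qed
    then have "w z \<le> H z" by (rule leH[OF _ z(1)])
    moreover have "z \<in> A" using z by (simp add: A_def)
    ultimately show ?thesis by (simp add: w_def)
  qed
  have HH: "H z' \<le> H z + C1 * norm (z' - z) powr \<alpha>" if z: "z \<in> ?cl" "z' \<in> ?cl" for z z'
  proof (rule Hle)
    fix v assume v: "v \<in> FF"
    show "v z' \<le> H z + C1 * norm (z' - z) powr \<alpha>"
    proof (rule field_le_epsilon)
      fix e :: real assume "0 < e"
      then show "v z' \<le> H z + C1 * norm (z' - z) powr \<alpha> + e"
        using key[OF v z(1), of "z' - z" "C1 * norm (z' - z) powr \<alpha> + e"] z(2) by simp
    qed
  qed
  have HH': "\<bar>H z - H z'\<bar> \<le> C1 * norm (z - z') powr \<alpha>" if z: "z \<in> ?cl" "z' \<in> ?cl" for z z'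
    using HH[OF z] HH[OF z(2,1)] by (simp add: abs_le_iff norm_minus_commute)
  have Hc: "continuous_on ?cl H" by (rule holder_continuous[OF al(1) HH'])
  have Hm: "msub m \<Omega> H"
  proof (rule msub_sup[OF O m continuous_on_subset[OF Hc closure_subset] VF])
    show "msub m \<Omega> g" if "g \<in> FF" for g by (rule FFD(1)[OF that])
    show "(\<lambda>x. max (f x) (g x)) \<in> FF" if "f \<in> FF" "g \<in> FF" for f g by (rule FFmax[OF that])
    show "g x \<le> H x" if "g \<in> FF" "x \<in> \<Omega>" for g x by (rule leH[OF that(1) Ocl[OF that(2)]])
    show "\<exists>g\<in>FF. H x - e < g x" if "x \<in> \<Omega>" "0 < e" for x e by (rule Hap[OF Ocl[OF that(1)] that(2)])
  qed

  have cls: "{v. (\<lambda>x. ereal (v x)) \<in> SH m \<Omega> \<and> continuous_on ?cl v \<and> (\<forall>x\<in>frontier \<Omega>. v x \<le> \<phi> x)} = FF"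
    unfolding FF_def using SH_msub[OF O m] msub_SH[OF O m _ refl] continuous_on_subset[OF _ closure_subset] by blast
  have env: "envelope m \<Omega> \<phi> z = ereal (H z)" if z: "z \<in> ?cl" for z
  proof -
    let ?E = "SUP v\<in>FF. ereal (v z)"
    have "?E \<le> ereal (H z)" by (rule SUP_least) (use leH z in simp)
    moreover have "ereal (V z) \<le> ?E" by (rule SUP_upper[OF VF])
    ultimately have "\<bar>?E\<bar> \<noteq> \<infinity>" by auto
    from ereal_SUP[OF this] show ?thesis unfolding envelope_def cls H_def by simp
  qed
  have "envelope m \<Omega> \<phi> \<in> SH m \<Omega>" by (rule msub_SH[OF O m Hm env]) (rule Ocl)
  moreover have "\<forall>z\<in>?cl. \<bar>envelope m \<Omega> \<phi> z\<bar> \<noteq> \<infinity>" using env by simp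
  moreover have "(\<lambda>z. real_of_ereal (envelope m \<Omega> \<phi> z)) \<in> Lip \<alpha> ?cl"
  proof -
    let ?h = "\<lambda>z. real_of_ereal (envelope m \<Omega> \<phi> z)"
    have hH: "?h z = H z" if "z \<in> ?cl" for z using env[OF that] by simp
    have "continuous_on ?cl ?h" using Hc by (rule continuous_on_eq) (simp add: hH)
    moreover have "lip_norm \<alpha> ?cl ?h < \<infinity>"
    proof -
      have "bounded (H ` ?cl)" by (intro compact_imp_bounded compact_continuous_image cC Hc)
      then obtain B where B: "\<And>z. z \<in> ?cl \<Longrightarrow> \<bar>H z\<bar> \<le> B" unfolding bounded_iff by auto
      have "(SUP z\<in>?cl. ennreal \<bar>?h z\<bar>) \<le> ennreal B"
        by (rule SUP_least) (use B hH in \<open>auto intro!: ennreal_leI\<close>)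
      moreover have "(SUP (z, w)\<in>{(z, w). z \<in> ?cl \<and> w \<in> ?cl \<and> z \<noteq> w}. ennreal (\<bar>?h z - ?h w\<bar> / norm (z - w) powr \<alpha>)) \<le> ennreal C1"
      proof (rule SUP_least)
        fix p assume "p \<in> {(z, w). z \<in> ?cl \<and> w \<in> ?cl \<and> z \<noteq> w}"
        then obtain z w where p: "p = (z, w)" "z \<in> ?cl" "w \<in> ?cl" "z \<noteq> w" by auto
        have "0 < norm (z - w) powr \<alpha>" using p(4) by simp
        then have "\<bar>?h z - ?h w\<bar> / norm (z - w) powr \<alpha> \<le> C1" using HH'[OF p(2,3)] hH p(2,3) by (simp add: pos_divide_le_eq)
        then show "(case p of (z, w) \<Rightarrow> ennreal (\<bar>?h z - ?h w\<bar> / norm (z - w) powr \<alpha>)) \<le> ennreal C1"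
          unfolding p(1) by (simp add: ennreal_leI)
      qed
      ultimately have "lip_norm \<alpha> ?cl ?h \<le> ennreal B + ennreal C1" unfolding lip_norm_def by (rule add_mono)
      also have "\<dots> < \<infinity>" by simp
      finally show ?thesis .
    qed
    ultimately show ?thesis unfolding Lip_def by blast
  qed
  ultimately show ?thesis by blast
qed

end
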